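(* Let $A$ be a locally finite positively graded elementary algebra over a field $\Bbbk$ with $A_0=\bigoplus_{i=1}^r\Bbbk e_i$, satisfying the standing hypotheses. (i) The classes $[Ae_1],\ldots,[Ae_r]$ form a basis of $K_0(\operatorname{per}A)$ as a $\mathbb Z[x,x^{-1}]$-module. (ii) The pairing $$\langle P,Q\rangle=\sum_{n\in\mathbb Z}\Bigl(\sum_{i\in\mathbb Z}(-1)^i\dim_\Bbbk\operatorname{Hom}_{\operatorname{per}A}(P,Q\langle-n\rangle[i])\Bigr)x^n\qquad(P,Q\in\operatorname{per}A)$$ descends to a sesquilinear form on $K_0(\operatorname{per}A)$ whose Gram matrix in the basis $[Ae_1],\ldots,[Ae_r]$ is $C_A(x)$, that is, $\langle[Ae_i],[Ae_j]\rangle=C_A(x)_{ij}$.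
   Context: All algebras are associative and unital; $\Bbbk$ is an arbitrary field. A locally finite positively graded elementary algebra is a graded algebra $A=\bigoplus_{n\ge0}A_n$ with $\dim_\Bbbk A_n<\infty$ for all $n$ and $A_0=\bigoplus_{i=1}^r\Bbbk e_i$ for primitive orthogonal idempotents $e_1,\ldots,e_r$. Put $J=A_{>0}$. The vertex simples are the graded left modules $S_j=Ae_j/Je_j$. Shifts: $M\langle m\rangle_n=M_{n-m}$. A graded module is of graded type $\mathrm{FP}_\infty$ if it has a projective resolution by finitely generated graded projectives in every homological degree. The matrix Hilbert series $C_A(x)\in M_r(\mathbb Z[[x]])$ has entries $C_A(x)_{ij}=\sum_{n\ge0}\dim_\Bbbk(e_iA_ne_j)x^n$. Standing hypotheses on $A$: every $S_j$ is of graded type $\mathrm{FP}_\infty$, and $C_A(x)\in M_r(\mathbb Q(x))$. $\operatorname{per}A$ is the homotopy category of bounded complexes of finitely generated graded projective left $A$-modules (with degree-preserving maps), a triangulated category with translation $[1]$, on which the grading shift $\langle1\rangle$ acts. $K_0(\operatorname{per}A)$ is its Grothendieck group as a triangulated category, made a $\mathbb Z[x,x^{-1}]$-module by $x[P]=[P\langle1\rangle]$. The pairing takes values in $\mathbb Z((x))$. Sesquilinear means biadditive with $\langle xu,v\rangle=x^{-1}\langle u,v\rangle$ and $\langle u,xv\rangle=x\langle u,v\rangle$. *)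

theory Defs
  imports
    "HOL-Library.Poly_Mapping"
    "HOL-Computational_Algebra.Formal_Laurent_Series"
    "HOL-Computational_Algebra.Polynomial_FPS"
    "HOL-Algebra.Generated_Groups"
    "HOL-Algebra.Module"
    "HOL-Algebra.AbelCoset"
begin

section \<open>Bases, dimensions and quotients\<close>

definition univ_ring :: "'a::{ring,monoid_mult} ring" where
  "univ_ring = \<lparr>carrier = UNIV, mult = (*), one = 1, zero = 0, add = (+)\<rparr>"

definition basis_on ::
  "('c, 'x) ring_scheme \<Rightarrow> ('c, 'v, 'y) module_scheme \<Rightarrow> 'i set \<Rightarrow> ('i \<Rightarrow> 'v) \<Rightarrow> bool" where
  "basis_on R M I b \<longleftrightarrow> finite I \<and> b \<in> I \<rightarrow> carrier M \<and>
     (\<forall>v\<in>carrier M. \<exists>!c. c \<in> I \<rightarrow>\<^sub>E carrier R \<and> v = (\<Oplus>\<^bsub>M\<^esub>i\<in>I. c i \<odot>\<^bsub>M\<^esub> b i))"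

definition fin_dim :: "('k::field, 'v, 'y) module_scheme \<Rightarrow> bool" where
  "fin_dim V \<longleftrightarrow> (\<exists>(d::nat) b. basis_on univ_ring V {..<d} b)"

definition kdim :: "('k::field, 'v, 'y) module_scheme \<Rightarrow> nat" where
  "kdim V = (THE d. \<exists>b. basis_on univ_ring V {..<d} b)"

definition quot_module :: "('c, 'v, 'y) module_scheme \<Rightarrow> 'v set \<Rightarrow> ('c, 'v set) module" where
  "quot_module M N = \<lparr>carrier = a_rcosets\<^bsub>M\<^esub> N, mult = undefined, one = undefined,
     zero = N, add = set_add M,
     smult = (\<lambda>c C. \<Union>v\<in>C. N +>\<^bsub>M\<^esub> (c \<odot>\<^bsub>M\<^esub> v))\<rparr>"


section \<open>Graded algebras\<close>

text \<open>The sort \<open>{ring,monoid_mult}\<close> is that of unital rings; unlike \<open>ring_1\<close> it does not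
  exclude the zero ring.\<close>

definition graded_algebra ::
  "('k::field \<Rightarrow> 'a \<Rightarrow> 'a::{ring,monoid_mult}) \<Rightarrow> (nat \<Rightarrow> 'a set) \<Rightarrow> bool" where
  "graded_algebra scl A \<longleftrightarrow>
     vector_space scl \<and>
     (\<forall>c a b. scl c (a * b) = scl c a * b \<and> scl c (a * b) = a * scl c b) \<and>
     (\<forall>n. Modules.module.subspace scl (A n)) \<and>
     (\<forall>a. \<exists>!c. (\<forall>n. c n \<in> A n) \<and> finite {n. c n \<noteq> 0} \<and> a = (\<Sum>n | c n \<noteq> 0. c n)) \<and>
     1 \<in> A 0 \<and> (\<forall>m n. \<forall>a\<in>A m. \<forall>b\<in>A n. a * b \<in> A (m + n))"

definition locally_finite ::
  "('k::field \<Rightarrow> 'a \<Rightarrow> 'a::{ring,monoid_mult}) \<Rightarrow> (nat \<Rightarrow> 'a set) \<Rightarrow> bool" where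
  "locally_finite scl A \<longleftrightarrow> (\<forall>n. \<exists>B. finite B \<and> A n = Modules.module.span scl B)"

definition primitive_idempotent :: "'a::{ring,monoid_mult} \<Rightarrow> bool" where
  "primitive_idempotent e \<longleftrightarrow> e \<noteq> 0 \<and> e * e = e \<and>
     (\<forall>f g. f * f = f \<and> g * g = g \<and> f * g = 0 \<and> g * f = 0 \<and> e = f + g \<longrightarrow> f = 0 \<or> g = 0)"

definition elementary_algebra ::
  "('k::field \<Rightarrow> 'a \<Rightarrow> 'a::{ring,monoid_mult}) \<Rightarrow> (nat \<Rightarrow> 'a set) \<Rightarrow> nat \<Rightarrow> (nat \<Rightarrow> 'a) \<Rightarrow> bool"
  where
  "elementary_algebra scl A r e \<longleftrightarrow> graded_algebra scl A \<and> locally_finite scl A \<and>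
     (\<forall>i\<in>{1..r}. primitive_idempotent (e i)) \<and>
     (\<forall>i\<in>{1..r}. \<forall>j\<in>{1..r}. i \<noteq> j \<longrightarrow> e i * e j = 0) \<and>
     A 0 = {\<Sum>i\<in>{1..r}. scl (c i) (e i) | c. True} \<and>
     (\<forall>c. (\<Sum>i\<in>{1..r}. scl (c i) (e i)) = 0 \<longrightarrow> (\<forall>i\<in>{1..r}. c i = 0))"

definition positive_part :: "(nat \<Rightarrow> 'a::{ring,monoid_mult} set) \<Rightarrow> 'a set" where
  "positive_part A = {\<Sum>n\<in>F. c n | F c. finite F \<and> 0 \<notin> F \<and> (\<forall>n\<in>F. c n \<in> A n)}"

definition hilbert_matrix ::
  "('k::field \<Rightarrow> 'a \<Rightarrow> 'a::{ring,monoid_mult}) \<Rightarrow> (nat \<Rightarrow> 'a set) \<Rightarrow> (nat \<Rightarrow> 'a) \<Rightarrow>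
   nat \<Rightarrow> nat \<Rightarrow> int fps" where
  "hilbert_matrix scl A e i j =
     Abs_fps (\<lambda>n. int (vector_space.dim scl {e i * a * e j | a. a \<in> A n}))"

definition rational_series :: "int fps \<Rightarrow> bool" where
  "rational_series F \<longleftrightarrow> (\<exists>p q :: rat poly. q \<noteq> 0 \<and>
     fps_to_fls (Abs_fps (\<lambda>n. of_int (fps_nth F n))) =
       fps_to_fls (fps_of_poly p) / fps_to_fls (fps_of_poly q))"


section \<open>Graded left modules\<close>

text \<open>A \<open>\<int>\<close>-graded left module over the ring \<open>'a\<close>; the fields \<open>mult\<close> and \<open>one\<close> inherited from
  the record of rings are irrelevant.\<close>

record ('a, 'm) gmodule = "('a, 'm) module" +
  gr :: "int \<Rightarrow> 'm set"

definition graded_module ::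
  "(nat \<Rightarrow> 'a::{ring,monoid_mult} set) \<Rightarrow> ('a, 'm) gmodule \<Rightarrow> bool" where
  "graded_module A M \<longleftrightarrow>
     abelian_group M \<and>
     (\<forall>a. \<forall>v\<in>carrier M. a \<odot>\<^bsub>M\<^esub> v \<in> carrier M) \<and>
     (\<forall>a b. \<forall>v\<in>carrier M. (a + b) \<odot>\<^bsub>M\<^esub> v = a \<odot>\<^bsub>M\<^esub> v \<oplus>\<^bsub>M\<^esub> b \<odot>\<^bsub>M\<^esub> v) \<and>
     (\<forall>a. \<forall>v\<in>carrier M. \<forall>w\<in>carrier M.
        a \<odot>\<^bsub>M\<^esub> (v \<oplus>\<^bsub>M\<^esub> w) = a \<odot>\<^bsub>M\<^esub> v \<oplus>\<^bsub>M\<^esub> a \<odot>\<^bsub>M\<^esub> w) \<and>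
     (\<forall>a b. \<forall>v\<in>carrier M. (a * b) \<odot>\<^bsub>M\<^esub> v = a \<odot>\<^bsub>M\<^esub> (b \<odot>\<^bsub>M\<^esub> v)) \<and>
     (\<forall>v\<in>carrier M. 1 \<odot>\<^bsub>M\<^esub> v = v) \<and>
     (\<forall>n. subgroup (gr M n) (add_monoid M)) \<and>
     (\<forall>m n. \<forall>a\<in>A m. \<forall>v\<in>gr M n. a \<odot>\<^bsub>M\<^esub> v \<in> gr M (int m + n)) \<and>
     (\<forall>v\<in>carrier M. \<exists>!c. (\<forall>n. c n \<in> gr M n) \<and> finite {n. c n \<noteq> \<zero>\<^bsub>M\<^esub>} \<and>
        v = (\<Oplus>\<^bsub>M\<^esub>n\<in>{n. c n \<noteq> \<zero>\<^bsub>M\<^esub>}. c n))"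

text \<open>Maps between modules are taken extensional, so that equality of maps is equality on the
  carrier.\<close>

definition gr_hom :: "('a, 'm) gmodule \<Rightarrow> ('a, 'n) gmodule \<Rightarrow> ('m \<Rightarrow> 'n) set" where
  "gr_hom M N = {f \<in> carrier M \<rightarrow>\<^sub>E carrier N.
     (\<forall>v\<in>carrier M. \<forall>w\<in>carrier M. f (v \<oplus>\<^bsub>M\<^esub> w) = f v \<oplus>\<^bsub>N\<^esub> f w) \<and>
     (\<forall>a. \<forall>v\<in>carrier M. f (a \<odot>\<^bsub>M\<^esub> v) = a \<odot>\<^bsub>N\<^esub> f v) \<and>
     (\<forall>n. f ` gr M n \<subseteq> gr N n)}"

definition gr_shift :: "int \<Rightarrow> ('a, 'm) gmodule \<Rightarrow> ('a, 'm) gmodule" where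
  "gr_shift m M = M\<lparr>gr := (\<lambda>n. gr M (n - m))\<rparr>"

definition zero_gmodule :: "('a, 'm) gmodule \<Rightarrow> ('a, 'm) gmodule" where
  "zero_gmodule M = M\<lparr>carrier := {\<zero>\<^bsub>M\<^esub>}, gr := (\<lambda>_. {\<zero>\<^bsub>M\<^esub>})\<rparr>"

definition dsum_gmodule :: "('a, 'm) gmodule \<Rightarrow> ('a, 'n) gmodule \<Rightarrow> ('a, 'm \<times> 'n) gmodule" where
  "dsum_gmodule M N = \<lparr>carrier = carrier M \<times> carrier N, mult = undefined, one = undefined,
     zero = (\<zero>\<^bsub>M\<^esub>, \<zero>\<^bsub>N\<^esub>),
     add = (\<lambda>(v, w) (v', w'). (v \<oplus>\<^bsub>M\<^esub> v', w \<oplus>\<^bsub>N\<^esub> w')),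
     smult = (\<lambda>a (v, w). (a \<odot>\<^bsub>M\<^esub> v, a \<odot>\<^bsub>N\<^esub> w)),
     gr = (\<lambda>n. gr M n \<times> gr N n)\<rparr>"

definition quot_gmodule :: "('a, 'm) gmodule \<Rightarrow> 'm set \<Rightarrow> ('a, 'm set) gmodule" where
  "quot_gmodule M N =
     module.extend (quot_module M N) (gmodule.fields (\<lambda>n. (\<lambda>v. N +>\<^bsub>M\<^esub> v) ` gr M n))"

text \<open>Finitely generated modules are taken with carrier inside the type \<open>nat \<Rightarrow> 'a\<close>. Every finitely
  generated module is a quotient of some \<open>A\<^sup>n\<close>, hence (choosing representatives) isomorphic to
  one of this kind, so the categories below are equivalent to the ones without size restriction.\<close>

type_synonym 'a univ_gmodule = "('a, nat \<Rightarrow> 'a) gmodule"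

definition fin_gen :: "('a, 'm) gmodule \<Rightarrow> bool" where
  "fin_gen M \<longleftrightarrow> (\<exists>S. finite S \<and> S \<subseteq> carrier M \<and>
     (\<forall>v\<in>carrier M. \<exists>c. v = (\<Oplus>\<^bsub>M\<^esub>s\<in>S. c s \<odot>\<^bsub>M\<^esub> s)))"

text \<open>Projectivity as the lifting property. For a finitely generated module it suffices to test it
  on modules carried by \<open>nat \<Rightarrow> 'a\<close>: these include the finitely generated graded free modules, so a
  finitely generated module with this property is a direct summand of a graded free one.\<close>

definition gr_projective ::
  "(nat \<Rightarrow> 'a::{ring,monoid_mult} set) \<Rightarrow> 'a univ_gmodule \<Rightarrow> bool" where
  "gr_projective A P \<longleftrightarrow> graded_module A P \<and>
     (\<forall>(M :: 'a univ_gmodule) (N :: 'a univ_gmodule).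
        graded_module A M \<longrightarrow> graded_module A N \<longrightarrow>
        (\<forall>g\<in>gr_hom M N. \<forall>f\<in>gr_hom P N. g ` carrier M = carrier N \<longrightarrow>
           (\<exists>h\<in>gr_hom P M. \<forall>v\<in>carrier P. g (h v) = f v)))"

definition fg_gr_projective ::
  "(nat \<Rightarrow> 'a::{ring,monoid_mult} set) \<Rightarrow> 'a univ_gmodule \<Rightarrow> bool" where
  "fg_gr_projective A P \<longleftrightarrow> gr_projective A P \<and> fin_gen P"

definition FP_infinity ::
  "(nat \<Rightarrow> 'a::{ring,monoid_mult} set) \<Rightarrow> ('a, 'm) gmodule \<Rightarrow> bool" where
  "FP_infinity A M \<longleftrightarrow> graded_module A M \<and>
     (\<exists>(P :: nat \<Rightarrow> 'a univ_gmodule) d \<epsilon>.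
        (\<forall>n. fg_gr_projective A (P n)) \<and>
        \<epsilon> \<in> gr_hom (P 0) M \<and> \<epsilon> ` carrier (P 0) = carrier M \<and>
        (\<forall>n. d n \<in> gr_hom (P (Suc n)) (P n)) \<and>
        d 0 ` carrier (P 1) = {v \<in> carrier (P 0). \<epsilon> v = \<zero>\<^bsub>M\<^esub>} \<and>
        (\<forall>n. d (Suc n) ` carrier (P (Suc (Suc n))) =
               {v \<in> carrier (P (Suc n)). d n v = \<zero>\<^bsub>P n\<^esub>}))"

text \<open>\<open>Ax\<close>, with \<open>a \<in> A\<close> placed in the type \<open>nat \<Rightarrow> 'a\<close> as \<open>(a, 0, 0, \<dots>)\<close>.\<close>

definition univ_in :: "'a::zero \<Rightarrow> nat \<Rightarrow> 'a" where
  "univ_in a = (\<lambda>n. if n = 0 then a else 0)"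

definition left_ideal_gmodule ::
  "(nat \<Rightarrow> 'a::{ring,monoid_mult} set) \<Rightarrow> 'a \<Rightarrow> 'a univ_gmodule" where
  "left_ideal_gmodule A x = \<lparr>carrier = univ_in ` {a * x | a. True}, mult = undefined,
     one = undefined, zero = (\<lambda>_. 0), add = (\<lambda>v w n. v n + w n), smult = (\<lambda>a v n. a * v n),
     gr = (\<lambda>n. if 0 \<le> n then univ_in ` {a * x | a. a \<in> A (nat n)} else {\<lambda>_. 0})\<rparr>"

definition vertex_simple ::
  "(nat \<Rightarrow> 'a::{ring,monoid_mult} set) \<Rightarrow> 'a \<Rightarrow> ('a, (nat \<Rightarrow> 'a) set) gmodule" where
  "vertex_simple A x =
     quot_gmodule (left_ideal_gmodule A x) (univ_in ` {a * x | a. a \<in> positive_part A})"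


section \<open>Complexes and the homotopy category\<close>

record ('a, 'm) gcomplex =
  obj :: "int \<Rightarrow> ('a, 'm) gmodule"
  dif :: "int \<Rightarrow> 'm \<Rightarrow> 'm"

type_synonym 'a univ_gcomplex = "('a, nat \<Rightarrow> 'a) gcomplex"

definition is_complex :: "('a, 'm) gcomplex \<Rightarrow> bool" where
  "is_complex X \<longleftrightarrow> (\<forall>i. dif X i \<in> gr_hom (obj X i) (obj X (i + 1)) \<and>
     (\<forall>v\<in>carrier (obj X i). dif X (i + 1) (dif X i v) = \<zero>\<^bsub>obj X (i + 2)\<^esub>))"

definition per :: "(nat \<Rightarrow> 'a::{ring,monoid_mult} set) \<Rightarrow> 'a univ_gcomplex set" where
  "per A = {X. is_complex X \<and> (\<forall>i. fg_gr_projective A (obj X i)) \<and>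
     (\<exists>N. \<forall>i. N < \<bar>i\<bar> \<longrightarrow> carrier (obj X i) = {\<zero>\<^bsub>obj X i\<^esub>})}"

definition stalk :: "('a, 'm) gmodule \<Rightarrow> ('a, 'm) gcomplex" where
  "stalk M = (let X = (\<lambda>i::int. if i = 0 then M else zero_gmodule M) in
     \<lparr>obj = X, dif = (\<lambda>i. \<lambda>v\<in>carrier (X i). \<zero>\<^bsub>M\<^esub>)\<rparr>)"

definition cpx_shift :: "int \<Rightarrow> ('a, 'm) gcomplex \<Rightarrow> ('a, 'm) gcomplex" where
  "cpx_shift m X = \<lparr>obj = (\<lambda>i. gr_shift m (obj X i)), dif = dif X\<rparr>"

text \<open>\<open>X[k]\<close>: the differential carries the sign \<open>(-1)\<^sup>k\<close>.\<close>

definition translate :: "int \<Rightarrow> ('a, 'm) gcomplex \<Rightarrow> ('a, 'm) gcomplex" where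
  "translate k X = \<lparr>obj = (\<lambda>i. obj X (i + k)),
     dif = (\<lambda>i. \<lambda>v\<in>carrier (obj X (i + k)).
       if even k then dif X (i + k) v else \<ominus>\<^bsub>obj X (i + k + 1)\<^esub> dif X (i + k) v)\<rparr>"

definition chain_maps :: "('a, 'm) gcomplex \<Rightarrow> ('a, 'n) gcomplex \<Rightarrow> (int \<Rightarrow> 'm \<Rightarrow> 'n) set" where
  "chain_maps X Y = {f. \<forall>i. f i \<in> gr_hom (obj X i) (obj Y i) \<and>
     (\<forall>v\<in>carrier (obj X i). f (i + 1) (dif X i v) = dif Y i (f i v))}"

definition homotopic ::
  "('a, 'm) gcomplex \<Rightarrow> ('a, 'n) gcomplex \<Rightarrow> (int \<Rightarrow> 'm \<Rightarrow> 'n) \<Rightarrow> (int \<Rightarrow> 'm \<Rightarrow> 'n) \<Rightarrow> bool" where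
  "homotopic X Y f g \<longleftrightarrow> (\<exists>h. (\<forall>i. h i \<in> gr_hom (obj X i) (obj Y (i - 1))) \<and>
     (\<forall>i. \<forall>v\<in>carrier (obj X i).
        f i v = g i v \<oplus>\<^bsub>obj Y i\<^esub> (dif Y (i - 1) (h i v) \<oplus>\<^bsub>obj Y i\<^esub> h (i + 1) (dif X i v))))"

definition zero_map :: "('a, 'm) gcomplex \<Rightarrow> ('a, 'n) gcomplex \<Rightarrow> int \<Rightarrow> 'm \<Rightarrow> 'n" where
  "zero_map X Y = (\<lambda>i. \<lambda>v\<in>carrier (obj X i). \<zero>\<^bsub>obj Y i\<^esub>)"

definition id_map :: "('a, 'm) gcomplex \<Rightarrow> int \<Rightarrow> 'm \<Rightarrow> 'm" where
  "id_map X = (\<lambda>i. \<lambda>v\<in>carrier (obj X i). v)"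

definition comp_map ::
  "('a, 'm) gcomplex \<Rightarrow> (int \<Rightarrow> 'n \<Rightarrow> 'p) \<Rightarrow> (int \<Rightarrow> 'm \<Rightarrow> 'n) \<Rightarrow> int \<Rightarrow> 'm \<Rightarrow> 'p" where
  "comp_map X g f = (\<lambda>i. compose (carrier (obj X i)) (g i) (f i))"

definition translate_map :: "int \<Rightarrow> (int \<Rightarrow> 'm \<Rightarrow> 'n) \<Rightarrow> int \<Rightarrow> 'm \<Rightarrow> 'n" where
  "translate_map k f = (\<lambda>i. f (i + k))"

definition homotopy_equiv ::
  "('a, 'm) gcomplex \<Rightarrow> ('a, 'n) gcomplex \<Rightarrow> (int \<Rightarrow> 'm \<Rightarrow> 'n) \<Rightarrow> bool" where
  "homotopy_equiv X Y f \<longleftrightarrow> f \<in> chain_maps X Y \<and> (\<exists>g\<in>chain_maps Y X.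
     homotopic X X (comp_map X g f) (id_map X) \<and> homotopic Y Y (comp_map Y f g) (id_map Y))"

text \<open>The base field acts on an \<open>A\<close>-module through \<open>c \<mapsto> c1 \<in> A\<close>.\<close>

definition chain_map_space ::
  "('k \<Rightarrow> 'a \<Rightarrow> 'a::{ring,monoid_mult}) \<Rightarrow> ('a, 'm) gcomplex \<Rightarrow> ('a, 'n) gcomplex \<Rightarrow>
   ('k, int \<Rightarrow> 'm \<Rightarrow> 'n) module" where
  "chain_map_space scl X Y = \<lparr>carrier = chain_maps X Y, mult = undefined, one = undefined,
     zero = zero_map X Y,
     add = (\<lambda>f g i. \<lambda>v\<in>carrier (obj X i). f i v \<oplus>\<^bsub>obj Y i\<^esub> g i v),
     smult = (\<lambda>c f i. \<lambda>v\<in>carrier (obj X i). scl c 1 \<odot>\<^bsub>obj Y i\<^esub> f i v)\<rparr>"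

definition Hom_per ::
  "('k \<Rightarrow> 'a \<Rightarrow> 'a::{ring,monoid_mult}) \<Rightarrow> ('a, 'm) gcomplex \<Rightarrow> ('a, 'n) gcomplex \<Rightarrow>
   ('k, (int \<Rightarrow> 'm \<Rightarrow> 'n) set) module" where
  "Hom_per scl X Y = quot_module (chain_map_space scl X Y)
     {f \<in> chain_maps X Y. homotopic X Y f (zero_map X Y)}"

definition cone ::
  "('a, 'm) gcomplex \<Rightarrow> ('a, 'n) gcomplex \<Rightarrow> (int \<Rightarrow> 'm \<Rightarrow> 'n) \<Rightarrow> ('a, 'm \<times> 'n) gcomplex" where
  "cone X Y u = (let Z = (\<lambda>i. dsum_gmodule (obj X (i + 1)) (obj Y i)) in
     \<lparr>obj = Z,
      dif = (\<lambda>i. \<lambda>(v, w)\<in>carrier (Z i).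
        (\<ominus>\<^bsub>obj X (i + 2)\<^esub> dif X (i + 1) v, u (i + 1) v \<oplus>\<^bsub>obj Y (i + 1)\<^esub> dif Y i w))\<rparr>)"

definition cone_in ::
  "('a, 'm) gcomplex \<Rightarrow> ('a, 'n) gcomplex \<Rightarrow> int \<Rightarrow> 'n \<Rightarrow> 'm \<times> 'n" where
  "cone_in X Y = (\<lambda>i. \<lambda>w\<in>carrier (obj Y i). (\<zero>\<^bsub>obj X (i + 1)\<^esub>, w))"

definition cone_out ::
  "('a, 'm) gcomplex \<Rightarrow> ('a, 'n) gcomplex \<Rightarrow> int \<Rightarrow> 'm \<times> 'n \<Rightarrow> 'm" where
  "cone_out X Y = (\<lambda>i. \<lambda>(v, w)\<in>carrier (dsum_gmodule (obj X (i + 1)) (obj Y i)). v)"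

text \<open>Distinguished triangles \<open>X \<rightarrow> Y \<rightarrow> Z \<rightarrow> X[1]\<close>: those isomorphic, in the homotopy category, to
  \<open>X' \<rightarrow> Y' \<rightarrow> cone u \<rightarrow> X'[1]\<close> for some \<open>u : X' \<rightarrow> Y'\<close>. Morphisms are given by representing chain
  maps.\<close>

definition distinguished_triangle ::
  "(nat \<Rightarrow> 'a::{ring,monoid_mult} set) \<Rightarrow>
   'a univ_gcomplex \<Rightarrow> 'a univ_gcomplex \<Rightarrow> 'a univ_gcomplex \<Rightarrow>
   (int \<Rightarrow> (nat \<Rightarrow> 'a) \<Rightarrow> nat \<Rightarrow> 'a) \<Rightarrow> (int \<Rightarrow> (nat \<Rightarrow> 'a) \<Rightarrow> nat \<Rightarrow> 'a) \<Rightarrow>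
   (int \<Rightarrow> (nat \<Rightarrow> 'a) \<Rightarrow> nat \<Rightarrow> 'a) \<Rightarrow> bool" where
  "distinguished_triangle A X Y Z f g h \<longleftrightarrow>
     X \<in> per A \<and> Y \<in> per A \<and> Z \<in> per A \<and>
     f \<in> chain_maps X Y \<and> g \<in> chain_maps Y Z \<and> h \<in> chain_maps Z (translate 1 X) \<and>
     (\<exists>X'\<in>per A. \<exists>Y'\<in>per A. \<exists>u\<in>chain_maps X' Y'. \<exists>\<alpha> \<beta> \<gamma>.
        homotopy_equiv X X' \<alpha> \<and> homotopy_equiv Y Y' \<beta> \<and> homotopy_equiv Z (cone X' Y' u) \<gamma> \<and>
        homotopic X Y' (comp_map X u \<alpha>) (comp_map X \<beta> f) \<and>
        homotopic Y (cone X' Y' u) (comp_map Y (cone_in X' Y') \<beta>) (comp_map Y \<gamma> g) \<and>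
        homotopic Z (translate 1 X') (comp_map Z (cone_out X' Y') \<gamma>)
          (comp_map Z (translate_map 1 \<alpha>) h))"


section \<open>The Grothendieck group\<close>

text \<open>\<open>\<int>[x, x\<^sup>-\<^sup>1]\<close> is the group ring \<open>int \<Rightarrow>\<^sub>0 int\<close> with the convolution product.\<close>

abbreviation laurent_ring :: "(int \<Rightarrow>\<^sub>0 int) ring" where
  "laurent_ring \<equiv> univ_ring"

definition laurent_x :: "int \<Rightarrow>\<^sub>0 int" where
  "laurent_x = Poly_Mapping.single 1 1"

text \<open>The free abelian group on the objects of \<open>per A\<close>, on which \<open>x\<close> acts by \<open>P \<mapsto> P\<langle>1\<rangle>\<close>.\<close>

definition free_per ::
  "(nat \<Rightarrow> 'a::{ring,monoid_mult} set) \<Rightarrow> (int \<Rightarrow>\<^sub>0 int, 'a univ_gcomplex \<Rightarrow>\<^sub>0 int) module" where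
  "free_per A = \<lparr>carrier = {g. Poly_Mapping.keys g \<subseteq> per A}, mult = undefined, one = undefined,
     zero = 0, add = (+),
     smult = (\<lambda>p g. \<Sum>m\<in>Poly_Mapping.keys p. \<Sum>X\<in>Poly_Mapping.keys g.
       Poly_Mapping.single (cpx_shift m X)
         (Poly_Mapping.lookup p m * Poly_Mapping.lookup g X))\<rparr>"

definition triangle_relations ::
  "(nat \<Rightarrow> 'a::{ring,monoid_mult} set) \<Rightarrow> ('a univ_gcomplex \<Rightarrow>\<^sub>0 int) set" where
  "triangle_relations A = generate (add_monoid (free_per A))
     {Poly_Mapping.single Y 1 - Poly_Mapping.single X 1 - Poly_Mapping.single Z 1 | X Y Z.
        \<exists>f g h. distinguished_triangle A X Y Z f g h}"

definition K0 ::
  "(nat \<Rightarrow> 'a::{ring,monoid_mult} set) \<Rightarrow>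
   (int \<Rightarrow>\<^sub>0 int, ('a univ_gcomplex \<Rightarrow>\<^sub>0 int) set) module" where
  "K0 A = quot_module (free_per A) (triangle_relations A)"

definition K0_class ::
  "(nat \<Rightarrow> 'a::{ring,monoid_mult} set) \<Rightarrow> 'a univ_gcomplex \<Rightarrow> ('a univ_gcomplex \<Rightarrow>\<^sub>0 int) set" where
  "K0_class A X = triangle_relations A +>\<^bsub>free_per A\<^esub> Poly_Mapping.single X 1"


section \<open>The pairing\<close>

definition pairing_dim ::
  "('k::field \<Rightarrow> 'a \<Rightarrow> 'a::{ring,monoid_mult}) \<Rightarrow> 'a univ_gcomplex \<Rightarrow> 'a univ_gcomplex \<Rightarrow>
   int \<Rightarrow> int \<Rightarrow> nat" where
  "pairing_dim scl P Q n i = kdim (Hom_per scl P (translate i (cpx_shift (- n) Q)))"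

definition pairing_coeff ::
  "('k::field \<Rightarrow> 'a \<Rightarrow> 'a::{ring,monoid_mult}) \<Rightarrow> 'a univ_gcomplex \<Rightarrow> 'a univ_gcomplex \<Rightarrow>
   int \<Rightarrow> int" where
  "pairing_coeff scl P Q n =
     (\<Sum>i | pairing_dim scl P Q n i \<noteq> 0. (- 1) ^ nat \<bar>i\<bar> * int (pairing_dim scl P Q n i))"

definition pairing ::
  "('k::field \<Rightarrow> 'a \<Rightarrow> 'a::{ring,monoid_mult}) \<Rightarrow> 'a univ_gcomplex \<Rightarrow> 'a univ_gcomplex \<Rightarrow>
   int fls" where
  "pairing scl P Q = Abs_fls (pairing_coeff scl P Q)"

text \<open>All dimensions, all sums over \<open>i\<close>, and the principal part of the resulting series are
  finite.\<close>

definition pairing_welldefined ::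
  "('k::field \<Rightarrow> 'a \<Rightarrow> 'a::{ring,monoid_mult}) \<Rightarrow> 'a univ_gcomplex \<Rightarrow> 'a univ_gcomplex \<Rightarrow> bool"
  where
  "pairing_welldefined scl P Q \<longleftrightarrow>
     (\<forall>n i. fin_dim (Hom_per scl P (translate i (cpx_shift (- n) Q)))) \<and>
     (\<forall>n. finite {i. pairing_dim scl P Q n i \<noteq> 0}) \<and>
     (\<exists>N. \<forall>n<N. pairing_coeff scl P Q n = 0)"

definition sesquilinear ::
  "(int \<Rightarrow>\<^sub>0 int, 'v) module \<Rightarrow> ('v \<Rightarrow> 'v \<Rightarrow> int fls) \<Rightarrow> bool" where
  "sesquilinear V B \<longleftrightarrow>
     (\<forall>u\<in>carrier V. \<forall>v\<in>carrier V. \<forall>w\<in>carrier V.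
        B (u \<oplus>\<^bsub>V\<^esub> v) w = B u w + B v w \<and> B u (v \<oplus>\<^bsub>V\<^esub> w) = B u v + B u w) \<and>
     (\<forall>u\<in>carrier V. \<forall>v\<in>carrier V.
        B (laurent_x \<odot>\<^bsub>V\<^esub> u) v = fls_X_inv * B u v \<and>
        B u (laurent_x \<odot>\<^bsub>V\<^esub> v) = fls_X * B u v)"

end

theory Submission
  imports Defs "HOL-Library.Function_Algebras"
begin

text \<open>Every finitely generated graded projective is a finite direct sum of shifts of the modules
  \<open>Ae\<^sub>i\<close> (\<open>projective_iso_gfree\<close>): in a smallest generating family, a relation
  whose coefficient at some generator is a unit would make that generator superfluous, and since
  \<open>A\<^sub>0\<close> is a product of copies of the field, every nonzero coefficient of degree zero is a unit
  on its summand; so all coefficients of relations have positive degree, and splitting the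
  presentation rules such relations out degree by degree. A bounded complex is an
  iterated extension of its terms by brutal truncation (\<open>truncation\<close>), and degreewise split
  extensions give cones, hence relations in \<open>K\<^sub>0\<close> (\<open>split_rel\<close>). Therefore the classes
  \<open>[Ae\<^sub>i]\<close> generate \<open>K\<^sub>0\<close> over the Laurent polynomials (\<open>spanned_all\<close>).

  For the pairing, the maps between the terms of \<open>P\<close> and the terms of \<open>Q[i]\<close> form finite-dimensional
  spaces, vanishing for almost all \<open>i\<close>: a graded map is determined by its values on finitely many
  homogeneous generators, and all graded pieces are finite-dimensional. Cocycles and coboundaries
  in this complex of maps are the chain maps and the null-homotopic maps, so the alternating sum of
  the dimensions of \<open>Hom(P, Q[i])\<close> equals the alternating sum of the dimensions of the spaces of
  all graded maps (\<open>euler_eq\<close>). The latter does not see the differentials, and the terms of a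
  cone are direct sums; together with homotopy invariance this gives additivity on distinguished
  triangles in both arguments (\<open>euler_triangle\<close>). Generators of \<open>P\<close> have bounded degrees and \<open>Q\<close>
  is bounded below, which bounds the principal part of the series (\<open>pairing_lower\<close>).

  Finally \<open>Hom(Ae\<^sub>i, Ae\<^sub>j\<langle>-n\<rangle>) = e\<^sub>iA\<^sub>ne\<^sub>j\<close> (\<open>gdim_stalk\<close>), which is the
  Gram matrix. Its constant term is the identity matrix, because
  \<open>A\<^sub>0\<close> is spanned by the \<open>e\<^sub>i\<close>. Pairing a nontrivial relation between the \<open>[Ae\<^sub>i]\<close> with the
  \<open>[Ae\<^sub>j]\<close> and reading off the coefficient of lowest degree gives a contradiction, so the
  generators are linearly independent (\<open>comb_independent\<close>).\<close>

section \<open>Finite-dimensional spaces with explicit carriers\<close>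

lemma univ_ring_simps [simp]:
  "carrier univ_ring = UNIV" "mult univ_ring = (*)" "one univ_ring = 1"
  "zero univ_ring = 0" "add univ_ring = (+)"
  by (simp_all add: univ_ring_def)

lemma cring_univ_ring: "cring (univ_ring :: 'c::comm_ring_1 ring)"
proof (rule cringI)
  show "abelian_group (univ_ring :: 'c ring)"
  proof (rule abelian_groupI)
    fix x :: 'c
    show "\<exists>y\<in>carrier univ_ring. y \<oplus>\<^bsub>univ_ring\<^esub> x = \<zero>\<^bsub>univ_ring\<^esub>"
      by (rule bexI[of _ "- x"]) auto
  qed (auto simp: algebra_simps)
  show "comm_monoid (univ_ring :: 'c ring)"
    by (rule comm_monoidI) (auto simp: algebra_simps)
qed (auto simp: algebra_simps)

text \<open>The spaces of homomorphisms are proper subsets of types of functions or of cosets, so that they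
  are treated as modules with carrier over the record \<open>univ_ring\<close>; the dimension theory of
  \<open>vector_space\<close> enters only through coordinates.\<close>

abbreviation kspace :: "('k::field, 'v, 'x) module_scheme \<Rightarrow> bool" where
  "kspace V \<equiv> Module.module univ_ring V"

lemma kspaceI:
  fixes V :: "('k::field, 'v, 'x) module_scheme" (structure)
  assumes "abelian_group V"
    and "\<And>c x. x \<in> carrier V \<Longrightarrow> c \<odot> x \<in> carrier V"
    and "\<And>a b x. x \<in> carrier V \<Longrightarrow> (a + b) \<odot> x = a \<odot> x \<oplus> b \<odot> x"
    and "\<And>c x y. x \<in> carrier V \<Longrightarrow> y \<in> carrier V \<Longrightarrow> c \<odot> (x \<oplus> y) = c \<odot> x \<oplus> c \<odot> y"
    and "\<And>a b x. x \<in> carrier V \<Longrightarrow> (a * b) \<odot> x = a \<odot> (b \<odot> x)"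
    and "\<And>x. x \<in> carrier V \<Longrightarrow> 1 \<odot> x = x"
  shows "kspace V"
  by (rule moduleI) (use assms cring_univ_ring in auto)

definition lin :: "('k, 'v, 'x) module_scheme \<Rightarrow> ('k, 'w, 'y) module_scheme \<Rightarrow> ('v \<Rightarrow> 'w) \<Rightarrow> bool" where
  "lin V W f \<longleftrightarrow> f \<in> carrier V \<rightarrow> carrier W \<and>
     (\<forall>x\<in>carrier V. \<forall>y\<in>carrier V. f (x \<oplus>\<^bsub>V\<^esub> y) = f x \<oplus>\<^bsub>W\<^esub> f y) \<and>
     (\<forall>c. \<forall>x\<in>carrier V. f (c \<odot>\<^bsub>V\<^esub> x) = c \<odot>\<^bsub>W\<^esub> f x)"

lemma linI:
  assumes "\<And>x. x \<in> carrier V \<Longrightarrow> f x \<in> carrier W"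
    and "\<And>x y. x \<in> carrier V \<Longrightarrow> y \<in> carrier V \<Longrightarrow> f (x \<oplus>\<^bsub>V\<^esub> y) = f x \<oplus>\<^bsub>W\<^esub> f y"
    and "\<And>c x. x \<in> carrier V \<Longrightarrow> f (c \<odot>\<^bsub>V\<^esub> x) = c \<odot>\<^bsub>W\<^esub> f x"
  shows "lin V W f"
  using assms by (auto simp: lin_def)

lemma
  assumes "lin V W f" "x \<in> carrier V"
  shows lin_closed: "f x \<in> carrier W"
    and lin_add: "y \<in> carrier V \<Longrightarrow> f (x \<oplus>\<^bsub>V\<^esub> y) = f x \<oplus>\<^bsub>W\<^esub> f y"
    and lin_smult: "f (c \<odot>\<^bsub>V\<^esub> x) = c \<odot>\<^bsub>W\<^esub> f x"
  using assms by (auto simp: lin_def)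

lemma lin_zero:
  assumes "lin V W f" "abelian_group V" "abelian_group W"
  shows "f \<zero>\<^bsub>V\<^esub> = \<zero>\<^bsub>W\<^esub>"
proof -
  interpret V: abelian_group V by fact
  interpret W: abelian_group W by fact
  have "f \<zero>\<^bsub>V\<^esub> \<oplus>\<^bsub>W\<^esub> f \<zero>\<^bsub>V\<^esub> = f \<zero>\<^bsub>V\<^esub>"
    using lin_add[OF assms(1), of "\<zero>\<^bsub>V\<^esub>" "\<zero>\<^bsub>V\<^esub>"] by simp
  then show ?thesis
    using lin_closed[OF assms(1), of "\<zero>\<^bsub>V\<^esub>"] by (metis V.zero_closed W.add.r_cancel_one)
qed

lemma lin_comp: "lin U V f \<Longrightarrow> lin V W g \<Longrightarrow> lin U W (\<lambda>x. g (f x))"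
  by (auto simp: lin_def Pi_iff)

lemma lin_inv:
  assumes "lin V W f" "bij_betw f (carrier V) (carrier W)" "kspace V"
  shows "lin W V (inv_into (carrier V) f)"
proof (rule linI)
  let ?g = "inv_into (carrier V) f"
  interpret V: Module.module univ_ring V by fact
  have g: "?g y \<in> carrier V" "f (?g y) = y" if "y \<in> carrier W" for y
    using that assms(2) by (auto simp: bij_betw_def inv_into_into f_inv_into_f)
  have inj: "x = y" if "f x = f y" "x \<in> carrier V" "y \<in> carrier V" for x y
    using that assms(2) by (auto simp: bij_betw_def inj_on_def)
  fix x y c assume x: "x \<in> carrier W"
  show "?g x \<in> carrier V" using g x by simp
  have cl: "y \<oplus>\<^bsub>W\<^esub> z \<in> carrier W" if "y \<in> carrier W" "z \<in> carrier W" for y z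
    using g[OF that(1)] g[OF that(2)] lin_add[OF assms(1), of "?g y" "?g z"]
      lin_closed[OF assms(1), of "?g y \<oplus>\<^bsub>V\<^esub> ?g z"] by simp
  have cl2: "c \<odot>\<^bsub>W\<^esub> y \<in> carrier W" if "y \<in> carrier W" for y c
    using g[OF that] lin_smult[OF assms(1), of "?g y" c]
      lin_closed[OF assms(1), of "c \<odot>\<^bsub>V\<^esub> ?g y"] by simp
  show "?g (c \<odot>\<^bsub>W\<^esub> x) = c \<odot>\<^bsub>V\<^esub> ?g x"
    by (rule inj) (use g x cl2 assms(1) in \<open>auto simp: lin_smult\<close>)
  assume y: "y \<in> carrier W"
  show "?g (x \<oplus>\<^bsub>W\<^esub> y) = ?g x \<oplus>\<^bsub>V\<^esub> ?g y"
    by (rule inj) (use g x y cl assms(1) in \<open>auto simp: lin_add\<close>)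
qed

text \<open>The passage from subspaces in the sense of \<open>vector_space\<close> to modules with carrier.\<close>

definition sub_space :: "('k \<Rightarrow> 'v \<Rightarrow> 'v) \<Rightarrow> 'v::ab_group_add set \<Rightarrow> ('k, 'v) module" where
  "sub_space scl S = \<lparr>carrier = S, mult = undefined, one = undefined, zero = 0, add = (+),
     smult = scl\<rparr>"

lemma sub_space_simps [simp]:
  "carrier (sub_space scl S) = S" "zero (sub_space scl S) = 0" "add (sub_space scl S) = (+)"
  "smult (sub_space scl S) = scl"
  by (simp_all add: sub_space_def)

lemma kspace_sub_space:
  assumes "vector_space scl" "Modules.module.subspace scl S"
  shows "kspace (sub_space scl S)"
proof -
  interpret vector_space scl by fact
  note S = assms(2)
  have "abelian_group (sub_space scl S)"
  proof (rule abelian_groupI)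
    fix x assume "x \<in> carrier (sub_space scl S)"
    then show "\<exists>y\<in>carrier (sub_space scl S). y \<oplus>\<^bsub>sub_space scl S\<^esub> x = \<zero>\<^bsub>sub_space scl S\<^esub>"
      by (intro bexI[of _ "- x"]) (auto simp: subspace_neg[OF S])
  qed (auto simp: subspace_add[OF S] subspace_0[OF S] add.assoc add.commute)
  then show ?thesis
    by (rule kspaceI) (auto simp: subspace_scale[OF S] scale_left_distrib scale_right_distrib)
qed

definition fun_scale :: "'k::field \<Rightarrow> (nat \<Rightarrow> 'k) \<Rightarrow> nat \<Rightarrow> 'k" where
  "fun_scale c f = (\<lambda>i. c * f i)"

definition coord_space :: "nat \<Rightarrow> ('k::field, nat \<Rightarrow> 'k) module" where
  "coord_space d = sub_space fun_scale {f. \<forall>i\<ge>d. f i = 0}"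

lemma coord_space_simps [simp]:
  "carrier (coord_space d) = {f. \<forall>i\<ge>d. f i = 0}" "zero (coord_space d) = 0"
  "add (coord_space d) = (+)" "smult (coord_space d) = fun_scale"
  by (simp_all add: coord_space_def)

interpretation fs: vector_space fun_scale
  by unfold_locales (auto simp: fun_scale_def fun_eq_iff algebra_simps)

lemma subspace_coord: "fs.subspace {f. \<forall>i\<ge>d. f i = 0}"
  by (rule fs.subspaceI) (auto simp: fun_scale_def)

lemma kspace_coord: "kspace (coord_space d)"
  unfolding coord_space_def by (intro kspace_sub_space subspace_coord fs.vector_space_axioms)

text \<open>Dimension as the existence of linear coordinates. This is equivalent to the existence of a basis
  indexed by \<open>{..<d}\<close> (\<open>basis_on_imp_has_dim\<close>, \<open>has_dim_imp_basis_on\<close>), and it passes along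
  isomorphisms without mentioning finite sums in the carrier.\<close>

definition has_dim :: "('k::field, 'v, 'x) module_scheme \<Rightarrow> nat \<Rightarrow> bool" where
  "has_dim V d \<longleftrightarrow> kspace V \<and> (\<exists>T. lin V (coord_space d) T \<and> bij_betw T (carrier V) (carrier (coord_space d)))"

lemma has_dim_kspace: "has_dim V d \<Longrightarrow> kspace V"
  by (simp add: has_dim_def)

lemma kspace_ab: "kspace V \<Longrightarrow> abelian_group V"
  by (simp add: Module.module_def)

lemma has_dim_iso:
  assumes "kspace V" "lin V W f" "bij_betw f (carrier V) (carrier W)" "has_dim W d"
  shows "has_dim V d"
proof -
  obtain T where T: "lin W (coord_space d) T" "bij_betw T (carrier W) (carrier (coord_space d))"
    using assms(4) by (auto simp: has_dim_def)
  have "bij_betw (T \<circ> f) (carrier V) (carrier (coord_space d))"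
    using assms(3) T(2) by (rule bij_betw_trans)
  moreover have "lin V (coord_space d) (T \<circ> f)"
    using lin_comp[OF assms(2) T(1)] by (simp add: comp_def)
  ultimately show ?thesis using assms(1) by (auto simp: has_dim_def)
qed

lemma has_dim_iso':
  assumes "kspace V" "lin V W f" "bij_betw f (carrier V) (carrier W)" "has_dim V d" "kspace W"
  shows "has_dim W d"
  by (rule has_dim_iso[OF assms(5) lin_inv[OF assms(2,3,1)] bij_betw_inv_into[OF assms(3)] assms(4)])

lemma sum_fun_apply: "(\<Sum>i\<in>I. f i) x = (\<Sum>i\<in>I. f i x)" for f :: "'i \<Rightarrow> 'x \<Rightarrow> 'y::comm_monoid_add"
  by (induction I rule: infinite_finite_induct) auto

text \<open>Coordinates with respect to a basis contained in the subspace.\<close>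

lemma has_dim_sub_space:
  assumes "vector_space scl" "Modules.module.subspace scl S" "finite G" "S \<subseteq> Modules.module.span scl G"
  shows "has_dim (sub_space scl S) (vector_space.dim scl S)"
proof -
  interpret vector_space scl by fact
  let ?d = "dim S"
  obtain B where B: "B \<subseteq> S" "independent B" "S \<subseteq> span B" "card B = ?d"
    by (rule basis_exists[of S])
  have finB: "finite B"
    using independent_span_bound[OF assms(3) B(2)] B(1) assms(4) by blast
  obtain h where h: "bij_betw h {0..<?d} B"
    using ex_bij_betw_nat_finite[OF finB] B(4) by auto
  let ?F = "\<lambda>f. \<Sum>i\<in>{0..<?d}. scl (f i) (h i)"
  have eqF: "?F f = (\<Sum>b\<in>B. scl (f (inv_into {0..<?d} h b)) b)" for f
    by (subst sum.reindex_bij_betw[OF h, symmetric])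
      (use h in \<open>auto intro!: sum.cong simp: bij_betw_def\<close>)
  have hS: "h i \<in> S" if "i < ?d" for i
    using h B(1) that by (auto simp: bij_betw_def)
  have lin: "lin (coord_space ?d) (sub_space scl S) ?F"
    by (rule linI) (auto simp: fun_scale_def scale_left_distrib sum.distrib scale_sum_right
        intro!: subspace_sum subspace_scale assms(2) hS)
  have bij: "bij_betw ?F (carrier (coord_space ?d)) (carrier (sub_space scl S))"
    unfolding bij_betw_def
  proof
    show "inj_on ?F (carrier (coord_space ?d))"
    proof (rule inj_onI)
      fix f g assume f: "f \<in> carrier (coord_space ?d)" and g: "g \<in> carrier (coord_space ?d)"
        and eq: "?F f = ?F g"
      have "(\<Sum>b\<in>B. scl (f (inv_into {0..<?d} h b) - g (inv_into {0..<?d} h b)) b) = 0"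
        using eq unfolding eqF by (simp add: scale_left_diff_distrib sum_subtractf)
      then have z: "f (inv_into {0..<?d} h b) - g (inv_into {0..<?d} h b) = 0" if "b \<in> B" for b
        using independentD[OF B(2) finB order_refl _ that, of "\<lambda>b. f (inv_into {0..<?d} h b) - g (inv_into {0..<?d} h b)"] by simp
      show "f = g"
      proof
        fix i show "f i = g i"
        proof (cases "i < ?d")
          case True
          then have "h i \<in> B" "inv_into {0..<?d} h (h i) = i"
            using h by (auto simp: bij_betw_def)
          then show ?thesis using z[of "h i"] by simp
        next
          case False then show ?thesis using f g by auto
        qed
      qed
    qed
    show "?F ` carrier (coord_space ?d) = carrier (sub_space scl S)"
    proof
      show "?F ` carrier (coord_space ?d) \<subseteq> carrier (sub_space scl S)"
        using lin by (auto simp: lin_def)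
      show "carrier (sub_space scl S) \<subseteq> ?F ` carrier (coord_space ?d)"
      proof
        fix v assume "v \<in> carrier (sub_space scl S)"
        then have "v \<in> span B" using B(3) by auto
        then obtain u where u: "v = (\<Sum>b\<in>B. scl (u b) b)"
          using span_finite[OF finB] by auto
        let ?f = "\<lambda>i. if i < ?d then u (h i) else 0"
        have "?F ?f = (\<Sum>i\<in>{0..<?d}. scl (u (h i)) (h i))" by (intro sum.cong) auto
        also have "\<dots> = v" unfolding u by (rule sum.reindex_bij_betw[OF h])
        finally show "v \<in> ?F ` carrier (coord_space ?d)"
          by (intro image_eqI[of _ _ ?f]) auto
      qed
    qed
  qed
  show ?thesis
    by (rule has_dim_iso'[OF kspace_coord lin bij _ kspace_sub_space[OF assms(1,2)]])
      (auto simp: has_dim_def kspace_coord intro!: exI[of _ "\<lambda>x. x"] linI bij_betwI')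
qed

definition unit_vec :: "nat \<Rightarrow> nat \<Rightarrow> 'k::field" where
  "unit_vec j = (\<lambda>i. if i = j then 1 else 0)"

lemma coord_expand:
  assumes "\<forall>i\<ge>d. f i = 0"
  shows "f = (\<Sum>j<d. fun_scale (f j) (unit_vec j))"
proof
  fix i
  have "(\<Sum>j<d. fun_scale (f j) (unit_vec j)) i = (\<Sum>j<d. if i = j then f j else 0)"
    by (simp add: sum_fun_apply fun_scale_def unit_vec_def if_distrib[of "\<lambda>x. _ * x"] cong: if_cong)
  also have "\<dots> = f i" using assms by (simp add: not_less)
  finally show "f i = (\<Sum>j<d. fun_scale (f j) (unit_vec j)) i" by simp
qed

lemma coord_span: "{f. \<forall>i\<ge>d. f i = 0} \<subseteq> fs.span (unit_vec ` {..<d})"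
proof
  fix f :: "nat \<Rightarrow> 'a" assume "f \<in> {f. \<forall>i\<ge>d. f i = 0}"
  then have "f = (\<Sum>j<d. fun_scale (f j) (unit_vec j))" by (intro coord_expand) auto
  also have "\<dots> \<in> fs.span (unit_vec ` {..<d})"
    by (intro fs.span_sum fs.span_scale fs.span_base) auto
  finally show "f \<in> fs.span (unit_vec ` {..<d})" .
qed

lemma has_dim_sub_coord:
  assumes "fs.subspace S" "S \<subseteq> {f. \<forall>i\<ge>d. f i = 0}"
  shows "has_dim (sub_space fun_scale S) (fs.dim S)"
  by (rule has_dim_sub_space[of _ _ "unit_vec ` {..<d}"])
    (use assms coord_span[of d] in \<open>auto intro: fs.vector_space_axioms\<close>)

text \<open>A linear map between coordinate spaces extends to all sequences by truncation, which
  makes the dimension theory of \<open>vector_space\<close> applicable to it.\<close>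

lemma has_dim_le:
  fixes V :: "('k::field, 'v, 'x) module_scheme"
  assumes "has_dim V d" "has_dim V e"
  shows "d \<le> e"
proof -
  obtain T where T: "lin V (coord_space d) T" "bij_betw T (carrier V) (carrier (coord_space d))"
    using assms(1) by (auto simp: has_dim_def)
  obtain U where U: "lin V (coord_space e) U" "bij_betw U (carrier V) (carrier (coord_space e))"
    using assms(2) by (auto simp: has_dim_def)
  have V: "kspace V" using assms(1) by (rule has_dim_kspace)
  let ?g = "\<lambda>x. T (inv_into (carrier V) U x)"
  have g: "lin (coord_space e) (coord_space d) ?g"
    by (rule lin_comp[OF lin_inv[OF U V] T(1)])
  have gim: "?g ` carrier (coord_space e) = carrier (coord_space d)"
    using bij_betw_trans[OF bij_betw_inv_into[OF U(2)] T(2)] by (simp add: bij_betw_def comp_def)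
  let ?tr = "\<lambda>f i. if i < e then f i else (0::'k)"
  have lin: "Vector_Spaces.linear fun_scale fun_scale (\<lambda>f. ?g (?tr f))"
  proof (rule Vector_Spaces.linear_iff[THEN iffD2], intro conjI allI)
    fix x y :: "nat \<Rightarrow> 'k" and c
    have "?tr (x + y) = ?tr x + ?tr y" by auto
    then show "?g (?tr (x + y)) = ?g (?tr x) + ?g (?tr y)"
      using lin_add[OF g, of "?tr x" "?tr y"] by simp
    have "?tr (fun_scale c x) = fun_scale c (?tr x)" by (auto simp: fun_scale_def)
    then show "?g (?tr (fun_scale c x)) = fun_scale c (?g (?tr x))"
      using lin_smult[OF g, of "?tr x" c] by simp
  qed (auto intro: fs.vector_space_axioms)
  interpret L: Vector_Spaces.linear fun_scale fun_scale "\<lambda>f. ?g (?tr f)" by (rule lin)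
  have ind: "fs.independent (unit_vec ` {..<d} :: (nat \<Rightarrow> 'k) set)"
  proof (rule fs.independent_if_scalars_zero)
    fix f :: "(nat \<Rightarrow> 'k) \<Rightarrow> 'k" and x :: "nat \<Rightarrow> 'k"
    assume s: "(\<Sum>x\<in>unit_vec ` {..<d}. fun_scale (f x) x) = 0" and "x \<in> unit_vec ` {..<d}"
    then obtain j where j: "j < d" "x = unit_vec j" by auto
    have inj: "inj_on (unit_vec :: nat \<Rightarrow> nat \<Rightarrow> 'k) {..<d}"
      by (auto simp: inj_on_def unit_vec_def fun_eq_iff split: if_splits)
    have "0 = (\<Sum>i<d. fun_scale (f (unit_vec i)) (unit_vec i)) j"
      using s by (simp add: sum.reindex[OF inj])
    also have "\<dots> = (\<Sum>i<d. if i = j then f (unit_vec i) else 0)"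
      by (simp add: sum_fun_apply fun_scale_def unit_vec_def if_distrib[of "\<lambda>x. _ * x"] eq_commute cong: if_cong)
    also have "\<dots> = f x" using j by simp
    finally show "f x = 0" by simp
  qed simp
  have "unit_vec ` {..<d} \<subseteq> fs.span ((\<lambda>f. ?g (?tr f)) ` (unit_vec ` {..<e}))"
  proof
    fix x :: "nat \<Rightarrow> 'k" assume "x \<in> unit_vec ` {..<d}"
    then have "x \<in> carrier (coord_space d)" by (auto simp: unit_vec_def)
    then obtain y where y: "y \<in> carrier (coord_space e)" "x = ?g y" using gim by blast
    have "?tr y = y" using y(1) by (auto simp: fun_eq_iff)
    then have "x = ?g (?tr y)" using y by simp
    moreover have "y \<in> fs.span (unit_vec ` {..<e})" using y(1) coord_span[of e] by auto
    ultimately show "x \<in> fs.span ((\<lambda>f. ?g (?tr f)) ` (unit_vec ` {..<e}))"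
      unfolding L.span_image by (intro image_eqI)
  qed
  from fs.independent_span_bound[OF _ ind this]
  have "card (unit_vec ` {..<d} :: (nat \<Rightarrow> 'k) set) \<le> card ((\<lambda>f. ?g (?tr f)) ` (unit_vec ` {..<e}))"
    by auto
  also have "\<dots> \<le> card (unit_vec ` {..<e} :: (nat \<Rightarrow> 'k) set)" by (rule card_image_le) simp
  also have "\<dots> \<le> e" using card_image_le[of "{..<e}" unit_vec] by simp
  also have "card (unit_vec ` {..<d} :: (nat \<Rightarrow> 'k) set) = d"
    by (subst card_image) (auto simp: inj_on_def unit_vec_def fun_eq_iff split: if_splits)
  finally show ?thesis .
qed

lemma has_dim_unique: "has_dim V d \<Longrightarrow> has_dim V e \<Longrightarrow> d = e"
  by (simp add: has_dim_le le_antisym)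

text \<open>Closure under scalars and sums makes sense over any ring of scalars; the relations that define
  the Grothendieck group are such a subset over the Laurent polynomials.\<close>

definition ksubspace :: "('k, 'v, 'x) module_scheme \<Rightarrow> 'v set \<Rightarrow> bool" where
  "ksubspace V U \<longleftrightarrow> U \<subseteq> carrier V \<and> \<zero>\<^bsub>V\<^esub> \<in> U \<and> (\<forall>x\<in>U. \<forall>y\<in>U. x \<oplus>\<^bsub>V\<^esub> y \<in> U) \<and>
     (\<forall>c. \<forall>x\<in>U. c \<odot>\<^bsub>V\<^esub> x \<in> U)"

lemma smult_minus_one:
  fixes V :: "('c::comm_ring_1, 'v, 'x) module_scheme"
  assumes "Module.module univ_ring V" "x \<in> carrier V"
  shows "(- 1) \<odot>\<^bsub>V\<^esub> x = \<ominus>\<^bsub>V\<^esub> x"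
proof -
  interpret V: Module.module univ_ring V by fact
  have "(- 1) \<odot>\<^bsub>V\<^esub> x \<oplus>\<^bsub>V\<^esub> 1 \<odot>\<^bsub>V\<^esub> x = \<zero>\<^bsub>V\<^esub>"
    using V.smult_l_distr[of "- 1" 1 x] V.smult_l_null[of x] assms(2) by simp
  then show ?thesis using assms(2) V.smult_closed[of "-1" x] V.smult_one[of x]
    by (metis V.minus_equality UNIV_I univ_ring_simps(1,3))
qed

lemma ksubspace_neg:
  fixes V :: "('c::comm_ring_1, 'v, 'x) module_scheme"
  assumes "Module.module univ_ring V" "ksubspace V U" "x \<in> U"
  shows "\<ominus>\<^bsub>V\<^esub> x \<in> U"
  using smult_minus_one[OF assms(1), of x] assms(2,3) unfolding ksubspace_def by (metis subsetD)

lemma ksubspace_subgroup: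
  fixes V :: "('c::comm_ring_1, 'v, 'x) module_scheme"
  assumes "Module.module univ_ring V" "ksubspace V U"
  shows "subgroup U (add_monoid V)"
proof
  fix x assume "x \<in> U"
  then show "inv\<^bsub>add_monoid V\<^esub> x \<in> U"
    using ksubspace_neg[OF assms] by (simp add: a_inv_def)
qed (use assms(2) in \<open>auto simp: ksubspace_def\<close>)

lemma kspace_restrict:
  fixes V :: "('k::field, 'v, 'x) module_scheme"
  assumes "kspace V" "ksubspace V U"
  shows "kspace (V\<lparr>carrier := U\<rparr>)"
proof -
  interpret V: Module.module univ_ring V by fact
  have U: "x \<in> carrier V" if "x \<in> U" for x using that assms(2) by (auto simp: ksubspace_def)
  have "abelian_group (V\<lparr>carrier := U\<rparr>)"
  proof (rule abelian_groupI)
    fix x assume "x \<in> carrier (V\<lparr>carrier := U\<rparr>)"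
    then show "\<exists>y\<in>carrier (V\<lparr>carrier := U\<rparr>). y \<oplus>\<^bsub>V\<lparr>carrier := U\<rparr>\<^esub> x = \<zero>\<^bsub>V\<lparr>carrier := U\<rparr>\<^esub>"
      using ksubspace_neg[OF assms] U by (intro bexI[of _ "\<ominus>\<^bsub>V\<^esub> x"]) (auto simp: V.l_neg)
  qed (use assms(2) U in \<open>auto simp: ksubspace_def V.a_assoc intro: V.a_comm\<close>)
  then show ?thesis
    by (rule kspaceI) (use assms(2) U V.smult_l_distr V.smult_r_distr V.smult_assoc1 V.smult_one in
        \<open>auto simp: ksubspace_def\<close>)
qed

lemma has_dim_inj:
  assumes "kspace V" "lin V W f" "inj_on f (carrier V)" "has_dim W d"
  shows "\<exists>e. has_dim V e"
proof -
  obtain T where T: "lin W (coord_space d) T" "bij_betw T (carrier W) (carrier (coord_space d))"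
    using assms(4) by (auto simp: has_dim_def)
  let ?g = "\<lambda>x. T (f x)"
  have g: "lin V (coord_space d) ?g" by (rule lin_comp[OF assms(2) T(1)])
  let ?S = "?g ` carrier V"
  interpret V: Module.module univ_ring V by fact
  have z: "?g \<zero>\<^bsub>V\<^esub> = 0"
    using lin_zero[OF g V.abelian_group_axioms kspace_ab[OF kspace_coord]] by simp
  have "fs.subspace ?S"
  proof (rule fs.subspaceI)
    show "0 \<in> ?S" using z by (metis V.zero_closed image_eqI)
    fix c x assume "x \<in> ?S"
    then obtain v where v: "v \<in> carrier V" "x = ?g v" by auto
    then show "fun_scale c x \<in> ?S" using lin_smult[OF g v(1), of c]
      by (intro image_eqI[of _ _ "c \<odot>\<^bsub>V\<^esub> v"]) auto
    fix y assume "y \<in> ?S"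
    then obtain w where w: "w \<in> carrier V" "y = ?g w" by auto
    then show "x + y \<in> ?S" using v lin_add[OF g v(1), of w]
      by (intro image_eqI[of _ _ "v \<oplus>\<^bsub>V\<^esub> w"]) auto
  qed
  moreover have "?S \<subseteq> {f. \<forall>i\<ge>d. f i = 0}" using g by (auto simp: lin_def)
  ultimately have "has_dim (sub_space fun_scale ?S) (fs.dim ?S)" by (rule has_dim_sub_coord)
  moreover have "lin V (sub_space fun_scale ?S) ?g"
    using g by (auto simp: lin_def)
  moreover have "bij_betw ?g (carrier V) (carrier (sub_space fun_scale ?S))"
    using comp_inj_on[OF assms(3), of T] T(2) assms(2) inj_on_subset[of T "carrier W" "f ` carrier V"]
    by (auto simp: bij_betw_def comp_def lin_def)
  ultimately show ?thesis using has_dim_iso[OF assms(1)] by blast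
qed

definition lker :: "('k, 'v, 'x) module_scheme \<Rightarrow> ('k, 'w, 'y) module_scheme \<Rightarrow> ('v \<Rightarrow> 'w) \<Rightarrow> 'v set" where
  "lker V W f = {x \<in> carrier V. f x = \<zero>\<^bsub>W\<^esub>}"

lemma ksubspace_lker:
  assumes "kspace V" "kspace W" "lin V W f"
  shows "ksubspace V (lker V W f)"
proof -
  interpret V: Module.module univ_ring V by fact
  interpret W: Module.module univ_ring W by fact
  have "f \<zero>\<^bsub>V\<^esub> = \<zero>\<^bsub>W\<^esub>" using lin_zero[OF assms(3) V.abelian_group_axioms W.abelian_group_axioms] .
  then show ?thesis
    using lin_add[OF assms(3)] lin_smult[OF assms(3)] W.smult_r_null
    by (auto simp: ksubspace_def lker_def)
qed

text \<open>Extend a basis of \<open>S\<close> to one of the coordinate space; the added vectors span \<open>C\<close>.\<close>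

lemma coord_complement:
  fixes S :: "(nat \<Rightarrow> 'k::field) set"
  assumes "fs.subspace S" "S \<subseteq> carrier (coord_space d)"
  obtains C where "fs.subspace C" "C \<subseteq> carrier (coord_space d)" "S \<inter> C = {0}"
    "\<And>x. x \<in> carrier (coord_space d) \<Longrightarrow> \<exists>s\<in>S. \<exists>c\<in>C. x = s + c" "fs.dim S + fs.dim C = d"
proof -
  let ?K = "carrier (coord_space d) :: (nat \<Rightarrow> 'k) set"
  obtain B where B: "B \<subseteq> S" "fs.independent B" "S \<subseteq> fs.span B"
    by (rule fs.basis_exists[of S])
  have BK: "B \<subseteq> ?K" using B(1) assms(2) by (rule order_trans)
  obtain B' where B': "B \<subseteq> B'" "B' \<subseteq> ?K" "fs.independent B'" "?K \<subseteq> fs.span B'"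
    by (rule fs.maximal_independent_subset_extend[OF BK B(2)])
  have fin: "finite B'"
    using fs.independent_span_bound[OF finite_imageI[OF finite_lessThan] B'(3) order_trans[OF B'(2)[unfolded coord_space_simps] coord_span[of d]]]
    by (rule conjunct1)
  let ?C = "fs.span (B' - B)"
  have sub: "fs.subspace ?K" unfolding coord_space_simps by (rule subspace_coord)
  have sp: "fs.span B' = ?K" by (rule fs.span_subspace[OF B'(2,4) sub])
  have spB: "fs.span B = S" by (rule fs.span_subspace[OF B(1,3) assms(1)])
  have iC: "fs.independent (B' - B)" by (rule fs.independent_mono[OF B'(3)]) auto
  have c1: "fs.dim S = card B" using fs.dim_span_eq_card_independent[OF B(2)] spB by simp
  have c2: "fs.dim ?C = card (B' - B)" by (rule fs.dim_span_eq_card_independent[OF iC])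
  have c3: "fs.dim ?K = card B'" using fs.dim_span_eq_card_independent[OF B'(3)] sp by simp
  have "has_dim (coord_space d :: ('k, _) module) (fs.dim ?K)"
    using has_dim_sub_coord[OF sub, of d] by (simp add: coord_space_def)
  moreover have "has_dim (coord_space d :: ('k, _) module) d"
    by (auto simp: has_dim_def kspace_coord intro!: exI[of _ "\<lambda>x. x"] linI bij_betwI')
  ultimately have dK: "fs.dim ?K = d" by (rule has_dim_unique)
  have "S \<inter> ?C = {0}"
  proof
    show "{0} \<subseteq> S \<inter> ?C" using fs.subspace_0[OF assms(1)] fs.span_zero by auto
    show "S \<inter> ?C \<subseteq> {0}"
    proof
      fix x assume x: "x \<in> S \<inter> ?C"
      have finB: "finite B" using fin B'(1) finite_subset by blast
      obtain u where u: "x = (\<Sum>b\<in>B. fun_scale (u b) b)"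
        using x spB fs.span_finite[OF finB] by auto
      obtain w where w: "x = (\<Sum>b\<in>B' - B. fun_scale (w b) b)"
        using x fs.span_finite[of "B' - B"] fin by auto
      let ?z = "\<lambda>b. if b \<in> B then u b else - w b"
      have "(\<Sum>b\<in>B'. fun_scale (?z b) b) = (\<Sum>b\<in>B. fun_scale (?z b) b) + (\<Sum>b\<in>B' - B. fun_scale (?z b) b)"
        using sum.subset_diff[OF B'(1) fin, of "\<lambda>b. fun_scale (?z b) b"] by (simp add: add.commute)
      also have "(\<Sum>b\<in>B. fun_scale (?z b) b) = x" using u by simp
      also have "(\<Sum>b\<in>B' - B. fun_scale (?z b) b) = - x"
        by (simp add: w sum_negf)
      finally have z: "(\<Sum>b\<in>B'. fun_scale (?z b) b) = 0" by (simp only: right_minus)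
      have "u b = 0" if "b \<in> B" for b
        using fs.independentD[OF B'(3) fin order_refl z subsetD[OF B'(1) that]] that by simp
      then have "x = (\<Sum>b\<in>B. 0)" unfolding u by (intro sum.cong) auto
      then show "x \<in> {0}" by simp
    qed
  qed
  moreover have "\<exists>s\<in>S. \<exists>c\<in>?C. x = s + c" if "x \<in> ?K" for x
  proof -
    have "B \<union> (B' - B) = B'" using B'(1) by auto
    then have "fs.span B' = {x + y |x y. x \<in> fs.span B \<and> y \<in> fs.span (B' - B)}"
      using fs.span_Un[of B "B' - B"] by simp
    then have "x \<in> {x + y |x y. x \<in> S \<and> y \<in> ?C}"
      unfolding spB sp using that by simp
    then show ?thesis by blast
  qed
  moreover have "card B + card (B' - B) = card B'"
    using card_Diff_subset[OF finite_subset[OF B'(1) fin] B'(1)] card_mono[OF fin B'(1)] by simp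
  then have "fs.dim S + fs.dim ?C = d"
    unfolding c1 c2 using c3 dK by simp
  moreover have "?C \<subseteq> ?K"
    unfolding sp[symmetric] by (rule fs.span_mono) (rule Diff_subset)
  ultimately show thesis by (intro that[of ?C] fs.subspace_span)
qed

text \<open>In coordinates of \<open>V\<close>, a complement of the kernel is mapped isomorphically onto \<open>W\<close>.\<close>

lemma rank_nullity:
  assumes "has_dim V d" "kspace W" "lin V W f" "f ` carrier V = carrier W"
  obtains a b where "has_dim (V\<lparr>carrier := lker V W f\<rparr>) a" "has_dim W b" "a + b = d"
proof -
  obtain T where T: "lin V (coord_space d) T" "bij_betw T (carrier V) (carrier (coord_space d))"
    using assms(1) by (auto simp: has_dim_def)
  have V: "kspace V" using assms(1) by (rule has_dim_kspace)
  interpret V: Module.module univ_ring V by fact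
  interpret W: Module.module univ_ring W by fact
  let ?g = "inv_into (carrier V) T"
  have g: "lin (coord_space d) V ?g" by (rule lin_inv[OF T V])
  have Tg: "T (?g x) = x" if "x \<in> carrier (coord_space d)" for x
    using that T(2) by (simp add: bij_betw_def f_inv_into_f)
  have gT: "?g (T v) = v" if "v \<in> carrier V" for v
    using that T(2) by (simp add: bij_betw_def)
  let ?N = "lker V W f"
  have N: "ksubspace V ?N" by (rule ksubspace_lker[OF V assms(2,3)])
  let ?S = "T ` ?N"
  have TN: "lin (V\<lparr>carrier := ?N\<rparr>) (coord_space d) T"
    using T(1) N by (auto simp: lin_def ksubspace_def subset_iff)
  have T0: "T \<zero>\<^bsub>V\<^esub> = 0"
    using lin_zero[OF T(1) V.abelian_group_axioms kspace_ab[OF kspace_coord]] by simp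
  have S: "fs.subspace ?S"
  proof (rule fs.subspaceI)
    show "0 \<in> ?S" using T0 N by (metis image_eqI ksubspace_def)
    fix c x assume "x \<in> ?S"
    then obtain v where v: "v \<in> ?N" "x = T v" by auto
    have vV: "v \<in> carrier V" using v N by (auto simp: ksubspace_def)
    show "fun_scale c x \<in> ?S" using lin_smult[OF T(1) vV, of c] v N
      by (intro image_eqI[of _ _ "c \<odot>\<^bsub>V\<^esub> v"]) (auto simp: ksubspace_def)
    fix y assume "y \<in> ?S"
    then obtain w where w: "w \<in> ?N" "y = T w" by auto
    have wV: "w \<in> carrier V" using w N by (auto simp: ksubspace_def)
    show "x + y \<in> ?S" using v w N lin_add[OF T(1) vV wV]
      by (intro image_eqI[of _ _ "v \<oplus>\<^bsub>V\<^esub> w"]) (auto simp: ksubspace_def)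
  qed
  have SK: "?S \<subseteq> carrier (coord_space d)" using T(1) by (auto simp: lin_def lker_def)
  obtain C where C: "fs.subspace C" "C \<subseteq> carrier (coord_space d)" "?S \<inter> C = {0}"
    "\<And>x. x \<in> carrier (coord_space d) \<Longrightarrow> \<exists>s\<in>?S. \<exists>c\<in>C. x = s + c" "fs.dim ?S + fs.dim C = d"
    using coord_complement[OF S SK] by metis
  have dS: "has_dim (sub_space fun_scale ?S) (fs.dim ?S)"
    using has_dim_sub_coord[OF S, of d] SK by simp
  have 1: "has_dim (V\<lparr>carrier := ?N\<rparr>) (fs.dim ?S)"
  proof (rule has_dim_iso[OF kspace_restrict[OF V N] _ _ dS])
    show "lin (V\<lparr>carrier := ?N\<rparr>) (sub_space fun_scale ?S) T" using TN by (auto simp: lin_def)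
    show "bij_betw T (carrier (V\<lparr>carrier := ?N\<rparr>)) (carrier (sub_space fun_scale ?S))"
      using T(2) by (auto simp: bij_betw_def lker_def intro: inj_on_subset)
  qed
  have dC: "has_dim (sub_space fun_scale C) (fs.dim C)"
    using has_dim_sub_coord[OF C(1), of d] C(2) by simp
  have gK: "?g x \<in> carrier V" if "x \<in> carrier (coord_space d)" for x
    using lin_closed[OF g that] .
  have 2: "has_dim W (fs.dim C)"
  proof (rule has_dim_iso'[OF has_dim_kspace[OF dC] _ _ dC assms(2)])
    show "lin (sub_space fun_scale C) W (\<lambda>x. f (?g x))"
      using lin_comp[OF g assms(3)] C(2) by (auto simp: lin_def subset_iff)
    show "bij_betw (\<lambda>x. f (?g x)) (carrier (sub_space fun_scale C)) (carrier W)"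
      unfolding bij_betw_def
    proof
      show "inj_on (\<lambda>x. f (?g x)) (carrier (sub_space fun_scale C))"
      proof (rule inj_onI)
        fix x y assume x: "x \<in> carrier (sub_space fun_scale C)" and y: "y \<in> carrier (sub_space fun_scale C)"
          and eq: "f (?g x) = f (?g y)"
        have xy: "x \<in> carrier (coord_space d)" "y \<in> carrier (coord_space d)" using x y C(2) by auto
        have xyC: "x - y \<in> C" using x y fs.subspace_diff[OF C(1)] by auto
        have xyK: "x - y \<in> carrier (coord_space d)" using xy by auto
        have "f (?g (x - y)) \<oplus>\<^bsub>W\<^esub> f (?g y) = f (?g x)"
          using lin_add[OF lin_comp[OF g assms(3)] xyK xy(2)] by simp
        then have "f (?g (x - y)) = \<zero>\<^bsub>W\<^esub>"
          unfolding eq using lin_closed[OF lin_comp[OF g assms(3)] xyK] lin_closed[OF lin_comp[OF g assms(3)] xy(2)]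
          by (simp only: W.add.r_cancel_one)
        then have "?g (x - y) \<in> ?N" using gK[OF xyK] by (simp add: lker_def)
        then have "x - y \<in> ?S" by (rule image_eqI[where f = T and x = "?g (x - y)", OF Tg[OF xyK, symmetric]])
        then have "x - y \<in> {0}" unfolding C(3)[symmetric] using xyC by (rule IntI)
        then show "x = y" by simp
      qed
      show "(\<lambda>x. f (?g x)) ` carrier (sub_space fun_scale C) = carrier W"
      proof
        show "(\<lambda>x. f (?g x)) ` carrier (sub_space fun_scale C) \<subseteq> carrier W"
          using C(2) lin_closed[OF lin_comp[OF g assms(3)]] by auto
        show "carrier W \<subseteq> (\<lambda>x. f (?g x)) ` carrier (sub_space fun_scale C)"
        proof
          fix w assume "w \<in> carrier W"
          then obtain v where v: "v \<in> carrier V" "w = f v" using assms(4) by auto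
          then obtain s c where sc: "s \<in> ?S" "c \<in> C" "T v = s + c"
            using C(4)[of "T v"] lin_closed[OF T(1), of v] by auto
          obtain n where n: "n \<in> ?N" "s = T n" using sc(1) by auto
          have nV: "n \<in> carrier V" "f n = \<zero>\<^bsub>W\<^esub>" using n by (auto simp: lker_def)
          have cK: "c \<in> carrier (coord_space d)" using C(2) sc(2) by auto
          have "v = ?g (T v)" using gT v by simp
          also have "\<dots> = ?g s \<oplus>\<^bsub>V\<^esub> ?g c" unfolding sc(3)
            using lin_add[OF g _ cK, of s] SK sc(1) by auto
          also have "?g s = n" using gT nV n by simp
          finally have "w = f (?g c)" using v(2) lin_add[OF assms(3) nV(1) gK[OF cK]] nV(2)
            lin_closed[OF assms(3) gK[OF cK]] by simp
          then show "w \<in> (\<lambda>x. f (?g x)) ` carrier (sub_space fun_scale C)" using sc(2) by auto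
        qed
      qed
    qed
  qed
  show thesis using that[OF 1 2 C(5)] .
qed

lemma (in abelian_group) minus_zero_right: "x \<in> carrier G \<Longrightarrow> x \<ominus> \<zero> = x"
  using add.inv_one by (simp add: minus_eq)

lemma (in abelian_group) minus_eq_zero_iff:
  assumes "x \<in> carrier G" "y \<in> carrier G"
  shows "x \<ominus> y = \<zero> \<longleftrightarrow> x = y"
proof
  assume z: "x \<ominus> y = \<zero>"
  have "x = x \<ominus> y \<oplus> y" using assms by (simp add: minus_eq a_assoc l_neg)
  then show "x = y" unfolding z using assms by simp
qed (use assms in \<open>simp add: minus_eq r_neg\<close>)

lemma has_dim_coord: "has_dim (coord_space d) d"
  by (auto simp: has_dim_def kspace_coord intro!: exI[of _ "\<lambda>x. x"] linI bij_betwI')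

lemma has_dim_trivial:
  assumes "kspace V" "carrier V = {\<zero>\<^bsub>V\<^esub>}"
  shows "has_dim V 0"
proof -
  interpret V: Module.module univ_ring V by fact
  have "lin V (coord_space 0) (\<lambda>_. 0)"
    using assms(2) by (auto simp: lin_def fun_scale_def)
  moreover have "bij_betw (\<lambda>_. 0) (carrier V) (carrier (coord_space 0))"
    using assms(2) by (auto simp: bij_betw_def)
  ultimately show ?thesis using assms(1) by (auto simp: has_dim_def)
qed

definition prod_space ::
  "('k, 'v, 'x) module_scheme \<Rightarrow> ('k, 'w, 'y) module_scheme \<Rightarrow> ('k, 'v \<times> 'w) module" where
  "prod_space V W = \<lparr>carrier = carrier V \<times> carrier W, mult = undefined, one = undefined,
     zero = (\<zero>\<^bsub>V\<^esub>, \<zero>\<^bsub>W\<^esub>), add = (\<lambda>p q. (fst p \<oplus>\<^bsub>V\<^esub> fst q, snd p \<oplus>\<^bsub>W\<^esub> snd q)),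
     smult = (\<lambda>c p. (c \<odot>\<^bsub>V\<^esub> fst p, c \<odot>\<^bsub>W\<^esub> snd p))\<rparr>"

lemma prod_space_simps [simp]:
  "carrier (prod_space V W) = carrier V \<times> carrier W" "zero (prod_space V W) = (\<zero>\<^bsub>V\<^esub>, \<zero>\<^bsub>W\<^esub>)"
  "add (prod_space V W) = (\<lambda>p q. (fst p \<oplus>\<^bsub>V\<^esub> fst q, snd p \<oplus>\<^bsub>W\<^esub> snd q))"
  "smult (prod_space V W) = (\<lambda>c p. (c \<odot>\<^bsub>V\<^esub> fst p, c \<odot>\<^bsub>W\<^esub> snd p))"
  by (simp_all add: prod_space_def)

lemma kspace_prod:
  assumes "kspace V" "kspace W"
  shows "kspace (prod_space V W)"
proof -
  interpret V: Module.module univ_ring V by fact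
  interpret W: Module.module univ_ring W by fact
  have "abelian_group (prod_space V W)"
  proof (rule abelian_groupI)
    fix p assume "p \<in> carrier (prod_space V W)"
    then show "\<exists>q\<in>carrier (prod_space V W). q \<oplus>\<^bsub>prod_space V W\<^esub> p = \<zero>\<^bsub>prod_space V W\<^esub>"
      by (intro bexI[of _ "(\<ominus>\<^bsub>V\<^esub> fst p, \<ominus>\<^bsub>W\<^esub> snd p)"]) (auto simp: V.l_neg W.l_neg)
  qed (auto simp: V.a_assoc W.a_assoc intro: V.a_comm W.a_comm)
  then show ?thesis
    by (rule kspaceI) (use V.smult_l_distr V.smult_r_distr V.smult_assoc1 V.smult_one
      W.smult_l_distr W.smult_r_distr W.smult_assoc1 W.smult_one in auto)
qed

lemma has_dim_prod:
  fixes V :: "('k::field, 'v, 'x) module_scheme" and W :: "('k, 'w, 'y) module_scheme"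
  assumes "has_dim V a" "has_dim W b"
  shows "has_dim (prod_space V W) (a + b)"
proof -
  obtain T where T: "lin V (coord_space a) T" "bij_betw T (carrier V) (carrier (coord_space a))"
    using assms(1) by (auto simp: has_dim_def)
  obtain U where U: "lin W (coord_space b) U" "bij_betw U (carrier W) (carrier (coord_space b))"
    using assms(2) by (auto simp: has_dim_def)
  let ?C = "\<lambda>p i. if i < a then T (fst p) i else U (snd p) (i - a)"
  have V: "kspace V" and W: "kspace W" using assms by (auto dest: has_dim_kspace)
  interpret V: Module.module univ_ring V by fact
  interpret W: Module.module univ_ring W by fact
  have T1: "T v i = 0" if "v \<in> carrier V" "a \<le> i" for v i
    using lin_closed[OF T(1) that(1)] that(2) by simp
  have U1: "U w i = 0" if "w \<in> carrier W" "b \<le> i" for w i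
    using lin_closed[OF U(1) that(1)] that(2) by simp
  have lin: "lin (prod_space V W) (coord_space (a + b)) ?C"
    using lin_add[OF T(1)] lin_add[OF U(1)] lin_smult[OF T(1)] lin_smult[OF U(1)]
    by (intro linI) (auto simp: U1 fun_eq_iff fun_scale_def)
  have bij: "bij_betw ?C (carrier (prod_space V W)) (carrier (coord_space (a + b)))"
    unfolding bij_betw_def
  proof
    show "inj_on ?C (carrier (prod_space V W))"
    proof (rule inj_onI)
      fix p q assume p: "p \<in> carrier (prod_space V W)" and q: "q \<in> carrier (prod_space V W)"
        and eq: "?C p = ?C q"
      have 1: "T (fst p) i = T (fst q) i" for i
        using fun_cong[OF eq, of i] T1[of "fst p" i] T1[of "fst q" i] p q by (cases "i < a") auto
      have 2: "U (snd p) i = U (snd q) i" for i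
        using fun_cong[OF eq, of "i + a"] by auto
      have "fst p = fst q"
        by (rule inj_onD[OF bij_betw_imp_inj_on[OF T(2)]]) (use 1 p q in auto)
      moreover have "snd p = snd q"
        by (rule inj_onD[OF bij_betw_imp_inj_on[OF U(2)]]) (use 2 p q in auto)
      ultimately
      show "p = q" by (simp add: prod_eq_iff)
    qed
    show "?C ` carrier (prod_space V W) = carrier (coord_space (a + b))"
    proof
      show "?C ` carrier (prod_space V W) \<subseteq> carrier (coord_space (a + b))"
        using lin by (auto simp: lin_def)
      show "carrier (coord_space (a + b)) \<subseteq> ?C ` carrier (prod_space V W)"
      proof
        fix f :: "nat \<Rightarrow> 'k" assume f: "f \<in> carrier (coord_space (a + b))"
        have "(\<lambda>i. if i < a then f i else 0) \<in> T ` carrier V"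
          using T(2) by (auto simp: bij_betw_def)
        then obtain v where v: "v \<in> carrier V" "(\<lambda>i. if i < a then f i else 0) = T v" by auto
        have "(\<lambda>i. f (i + a)) \<in> U ` carrier W"
          using U(2) f by (auto simp: bij_betw_def)
        then obtain w where w: "w \<in> carrier W" "(\<lambda>i. f (i + a)) = U w" by auto
        have "f i = ?C (v, w) i" for i
          using fun_cong[OF v(2), of i] fun_cong[OF w(2), of "i - a"] by (cases "i < a") auto
        then have "f = ?C (v, w)" by (rule ext)
        then show "f \<in> ?C ` carrier (prod_space V W)" using v w by (intro image_eqI) auto
      qed
    qed
  qed
  show ?thesis by (rule has_dim_iso[OF kspace_prod[OF V W] lin bij has_dim_coord])
qed

lemma ksubspace_image:
  assumes "kspace V" "kspace W" "lin V W f"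
  shows "ksubspace W (f ` carrier V)"
proof -
  interpret V: Module.module univ_ring V by fact
  have "f \<zero>\<^bsub>V\<^esub> = \<zero>\<^bsub>W\<^esub>" using lin_zero[OF assms(3)] assms by (auto intro: kspace_ab)
  then show ?thesis
    using lin_add[OF assms(3), symmetric] lin_smult[OF assms(3), symmetric] lin_closed[OF assms(3)]
    by (auto simp: ksubspace_def intro: image_eqI[OF _ V.zero_closed])
qed

lemma has_dim_image:
  assumes "has_dim V d" "kspace W" "lin V W f"
  obtains a b where "has_dim (V\<lparr>carrier := lker V W f\<rparr>) a" "has_dim (W\<lparr>carrier := f ` carrier V\<rparr>) b"
    "a + b = d"
proof -
  let ?W = "W\<lparr>carrier := f ` carrier V\<rparr>"
  have "lin V ?W f" using assms(3) by (auto simp: lin_def)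
  moreover have "kspace ?W"
    by (rule kspace_restrict[OF assms(2) ksubspace_image[OF has_dim_kspace[OF assms(1)] assms(2,3)]])
  moreover have "lker V ?W f = lker V W f" by (simp add: lker_def)
  ultimately show thesis using rank_nullity[OF assms(1), of ?W f] that by auto
qed

definition fd_subspace :: "('k::field, 'v, 'x) module_scheme \<Rightarrow> 'v set \<Rightarrow> bool" where
  "fd_subspace V U \<longleftrightarrow> ksubspace V U \<and> (\<exists>d. has_dim (V\<lparr>carrier := U\<rparr>) d)"

lemma fd_subspace_zero: "kspace V \<Longrightarrow> fd_subspace V {\<zero>\<^bsub>V\<^esub>}"
proof -
  assume V: "kspace V"
  interpret V: Module.module univ_ring V by fact
  have "ksubspace V {\<zero>\<^bsub>V\<^esub>}" using V.smult_r_null by (auto simp: ksubspace_def)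
  then show ?thesis using has_dim_trivial[OF kspace_restrict[OF V]] by (auto simp: fd_subspace_def)
qed

lemma fd_subspace_sum:
  assumes "kspace V" "fd_subspace V U" "fd_subspace V U'"
  shows "fd_subspace V {x \<oplus>\<^bsub>V\<^esub> y |x y. x \<in> U \<and> y \<in> U'}"
proof -
  interpret V: Module.module univ_ring V by fact
  let ?P = "prod_space (V\<lparr>carrier := U\<rparr>) (V\<lparr>carrier := U'\<rparr>)"
  obtain a b where ab: "has_dim (V\<lparr>carrier := U\<rparr>) a" "has_dim (V\<lparr>carrier := U'\<rparr>) b"
    using assms(2,3) by (auto simp: fd_subspace_def)
  have P: "has_dim ?P (a + b)" by (rule has_dim_prod[OF ab])
  have sub: "x \<in> carrier V" if "x \<in> U \<or> x \<in> U'" for x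
    using that assms(2,3) by (auto simp: fd_subspace_def ksubspace_def)
  have lin: "lin ?P V (\<lambda>p. fst p \<oplus>\<^bsub>V\<^esub> snd p)"
    by (rule linI) (auto simp: sub V.a_ac V.smult_r_distr)
  have im: "(\<lambda>p. fst p \<oplus>\<^bsub>V\<^esub> snd p) ` carrier ?P = {x \<oplus>\<^bsub>V\<^esub> y |x y. x \<in> U \<and> y \<in> U'}"
    by (simp add: set_eq_iff image_iff) blast
  obtain d where "has_dim (V\<lparr>carrier := (\<lambda>p. fst p \<oplus>\<^bsub>V\<^esub> snd p) ` carrier ?P\<rparr>) d"
    using has_dim_image[OF P assms(1) lin] by blast
  then show ?thesis
    using ksubspace_image[OF has_dim_kspace[OF P] assms(1) lin] unfolding fd_subspace_def im by blast
qed

text \<open>Together the maps embed the space into a coordinate space.\<close>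

lemma has_dim_separating:
  assumes "kspace V" "finite F"
    and "\<And>t. t \<in> F \<Longrightarrow> lin V (W t) (g t)" "\<And>t. t \<in> F \<Longrightarrow> \<exists>d. has_dim (W t) d"
    and "\<And>v. v \<in> carrier V \<Longrightarrow> (\<And>t. t \<in> F \<Longrightarrow> g t v = \<zero>\<^bsub>W t\<^esub>) \<Longrightarrow> v = \<zero>\<^bsub>V\<^esub>"
  shows "\<exists>d. has_dim V d"
proof -
  interpret V: Module.module univ_ring V by fact
  have "\<exists>D G. lin V (coord_space D) G \<and> (\<forall>v\<in>carrier V. G v = 0 \<longrightarrow> (\<forall>t\<in>F. g t v = \<zero>\<^bsub>W t\<^esub>))"
    using assms(2-4)
  proof (induction F rule: finite_induct)
    case empty
    show ?case
      by (intro exI[of _ 0] exI[of _ "\<lambda>_. 0"]) (auto simp: lin_def fun_scale_def)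
  next
    case (insert t F)
    have "\<exists>D G. lin V (coord_space D) G \<and> (\<forall>v\<in>carrier V. G v = 0 \<longrightarrow> (\<forall>t\<in>F. g t v = \<zero>\<^bsub>W t\<^esub>))"
      by (rule insert.IH) (use insert.prems in auto)
    then obtain D G where G0: "lin V (coord_space D) G \<and> (\<forall>v\<in>carrier V. G v = 0 \<longrightarrow> (\<forall>t\<in>F. g t v = \<zero>\<^bsub>W t\<^esub>))"
      by (elim exE)
    note G = conjunct1[OF G0] mp[OF bspec[OF conjunct2[OF G0]]]
    obtain e where e: "has_dim (W t) e" using insert.prems by auto
    have gt: "lin V (W t) (g t)" using insert.prems by auto
    obtain T where T: "lin (prod_space (coord_space D) (W t)) (coord_space (D + e)) T"
      "bij_betw T (carrier (prod_space (coord_space D) (W t))) (carrier (coord_space (D + e)))"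
      using has_dim_prod[OF has_dim_coord e] by (auto simp: has_dim_def)
    let ?H = "\<lambda>v. (G v, g t v)"
    have H: "lin V (prod_space (coord_space D) (W t)) ?H"
      using G(1) gt by (auto simp: lin_def)
    have TH: "lin V (coord_space (D + e)) (\<lambda>v. T (?H v))" by (rule lin_comp[OF H T(1)])
    have K: "kspace (prod_space (coord_space D) (W t))"
      by (rule kspace_prod[OF kspace_coord has_dim_kspace[OF e]])
    interpret K: Module.module univ_ring "prod_space (coord_space D) (W t)" by fact
    have T0: "T \<zero>\<^bsub>prod_space (coord_space D) (W t)\<^esub> = 0"
      using lin_zero[OF T(1) kspace_ab[OF K] kspace_ab[OF kspace_coord]] by simp
    have "?H v = \<zero>\<^bsub>prod_space (coord_space D) (W t)\<^esub>" if "v \<in> carrier V" "T (?H v) = 0" for v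
      by (rule inj_onD[OF bij_betw_imp_inj_on[OF T(2)] trans[OF that(2) T0[symmetric]]
            lin_closed[OF H that(1)] K.zero_closed])
    then have "\<forall>s\<in>insert t F. g s v = \<zero>\<^bsub>W s\<^esub>" if "v \<in> carrier V" "T (?H v) = 0" for v
      using G(2)[of v] that by auto
    then show ?case using TH by blast
  qed
  then obtain D G where G: "lin V (coord_space D) G" "\<And>v. v \<in> carrier V \<Longrightarrow> G v = 0 \<Longrightarrow> v = \<zero>\<^bsub>V\<^esub>"
    using assms(5) by meson
  have "inj_on G (carrier V)"
  proof (rule inj_onI)
    fix x y assume x: "x \<in> carrier V" and y: "y \<in> carrier V" and eq: "G x = G y"
    have "G (x \<ominus>\<^bsub>V\<^esub> y) \<oplus>\<^bsub>coord_space D\<^esub> G y = G x"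
      using lin_add[OF G(1), of "x \<ominus>\<^bsub>V\<^esub> y" y] x y by (simp add: V.minus_eq V.a_assoc V.l_neg)
    then have "G (x \<ominus>\<^bsub>V\<^esub> y) = 0" unfolding eq by simp
    then have "x \<ominus>\<^bsub>V\<^esub> y = \<zero>\<^bsub>V\<^esub>" using G(2) x y by simp
    then show "x = y" using x y by (simp add: V.minus_eq_zero_iff)
  qed
  then show ?thesis using has_dim_inj[OF assms(1) G(1) _ has_dim_coord] by blast
qed

subsection \<open>Bases\<close>

lemma lin_finsum_smult:
  assumes "kspace V" "kspace W" "lin V W T" "finite I" "\<And>i. i \<in> I \<Longrightarrow> b i \<in> carrier V"
  shows "T (\<Oplus>\<^bsub>V\<^esub>i\<in>I. c i \<odot>\<^bsub>V\<^esub> b i) = (\<Oplus>\<^bsub>W\<^esub>i\<in>I. c i \<odot>\<^bsub>W\<^esub> T (b i))"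
proof -
  interpret V: Module.module univ_ring V by fact
  interpret W: Module.module univ_ring W by fact
  have "T \<zero>\<^bsub>V\<^esub> = \<zero>\<^bsub>W\<^esub>" using lin_zero[OF assms(3) V.abelian_group_axioms W.abelian_group_axioms] .
  with assms(4,5) show ?thesis
  proof (induction I rule: finite_induct)
    case (insert i I)
    have "(\<lambda>i. c i \<odot>\<^bsub>V\<^esub> b i) \<in> I \<rightarrow> carrier V" "(\<lambda>i. c i \<odot>\<^bsub>W\<^esub> T (b i)) \<in> I \<rightarrow> carrier W"
      using insert.prems lin_closed[OF assms(3)] by auto
    moreover have "T (b i) \<in> carrier W" using insert.prems lin_closed[OF assms(3)] by auto
    ultimately show ?case
      using insert by (simp add: lin_add[OF assms(3)] lin_smult[OF assms(3)])
  qed simp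
qed

lemma coord_finsum:
  fixes f :: "'i \<Rightarrow> nat \<Rightarrow> 'k::field"
  assumes "finite I" "\<And>i. i \<in> I \<Longrightarrow> f i \<in> carrier (coord_space d)"
  shows "(\<Oplus>\<^bsub>coord_space d\<^esub>i\<in>I. f i) = (\<Sum>i\<in>I. f i)"
  using assms
proof (induction I rule: finite_induct)
  interpret W: Module.module univ_ring "coord_space d :: ('k, _) module" by (rule kspace_coord)
  case (insert i I)
  then have "f \<in> I \<rightarrow> carrier (coord_space d)" "f i \<in> carrier (coord_space d)" by auto
  then show ?case using insert W.M.finsum_insert[OF insert.hyps, of f] by simp
qed (simp add: finsum_def finprod_def)

lemma basis_on_imp_has_dim:
  assumes "kspace V" "basis_on univ_ring V {..<d} b"
  shows "has_dim V d"
proof -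
  interpret V: Module.module univ_ring V by fact
  have b: "b i \<in> carrier V" if "i < d" for i using assms(2) that by (auto simp: basis_on_def)
  have ex: "\<exists>!c. c \<in> {..<d} \<rightarrow>\<^sub>E UNIV \<and> v = (\<Oplus>\<^bsub>V\<^esub>i\<in>{..<d}. c i \<odot>\<^bsub>V\<^esub> b i)" if "v \<in> carrier V" for v
    using assms(2) that by (auto simp: basis_on_def)
  let ?F = "\<lambda>c. \<Oplus>\<^bsub>V\<^esub>i\<in>{..<d}. c i \<odot>\<^bsub>V\<^esub> b i"
  have cl: "(\<lambda>i. c i \<odot>\<^bsub>V\<^esub> b i) \<in> {..<d} \<rightarrow> carrier V" for c using b by auto
  have lin: "lin (coord_space d) V ?F"
  proof (rule linI)
    show "?F x \<in> carrier V" for x by (rule V.finsum_closed[OF cl])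
    show "?F (x \<oplus>\<^bsub>coord_space d\<^esub> y) = ?F x \<oplus>\<^bsub>V\<^esub> ?F y" for x y
      unfolding V.finsum_addf[OF cl cl, symmetric]
      by (rule V.finsum_cong') (use b V.smult_l_distr in auto)
    show "?F (c \<odot>\<^bsub>coord_space d\<^esub> x) = c \<odot>\<^bsub>V\<^esub> ?F x" for c x
    proof -
      have "c \<odot>\<^bsub>V\<^esub> ?F x = (\<Oplus>\<^bsub>V\<^esub>i\<in>{..<d}. c \<odot>\<^bsub>V\<^esub> (x i \<odot>\<^bsub>V\<^esub> b i))"
        by (rule V.finsum_smult_ldistr) (use cl in auto)
      also have "\<dots> = ?F (c \<odot>\<^bsub>coord_space d\<^esub> x)"
        by (rule V.finsum_cong') (use b V.smult_assoc1 in \<open>auto simp: fun_scale_def\<close>)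
      finally show ?thesis by simp
    qed
  qed
  have "bij_betw ?F (carrier (coord_space d)) (carrier V)"
    unfolding bij_betw_def
  proof
    show "inj_on ?F (carrier (coord_space d))"
    proof (rule inj_onI)
      fix x y :: "nat \<Rightarrow> 'a" assume x: "x \<in> carrier (coord_space d)" and y: "y \<in> carrier (coord_space d)"
        and eq: "?F x = ?F y"
      have r: "?F z = ?F (restrict z {..<d})" for z
        by (rule V.finsum_cong') (use b in auto)
      have "restrict x {..<d} = restrict y {..<d}"
        using ex[OF V.finsum_closed[OF cl[of x]]] r[of x] r[of y] eq by auto
      then have "x i = y i" if "i < d" for i using that by (metis lessThan_iff restrict_apply')
      then show "x = y" using x y by (auto simp: fun_eq_iff) (metis not_less)
    qed
    show "?F ` carrier (coord_space d) = carrier V"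
    proof
      show "?F ` carrier (coord_space d) \<subseteq> carrier V" using V.finsum_closed[OF cl] by auto
      show "carrier V \<subseteq> ?F ` carrier (coord_space d)"
      proof
        fix v assume "v \<in> carrier V"
        then obtain c where c: "v = ?F c" using ex by blast
        have "?F c = ?F (\<lambda>i. if i < d then c i else 0)"
          by (rule V.finsum_cong') (use b in auto)
        then show "v \<in> ?F ` carrier (coord_space d)" unfolding c by (intro image_eqI) auto
      qed
    qed
  qed
  then show ?thesis by (rule has_dim_iso'[OF kspace_coord lin _ has_dim_coord assms(1)])
qed

lemma has_dim_imp_basis_on:
  assumes "has_dim V d"
  obtains b where "basis_on univ_ring V {..<d} b"
proof -
  have V: "kspace V" using assms by (rule has_dim_kspace)
  interpret V: Module.module univ_ring V by fact
  obtain T where T: "lin V (coord_space d) T" "bij_betw T (carrier V) (carrier (coord_space d))"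
    using assms by (auto simp: has_dim_def)
  let ?b = "\<lambda>i. inv_into (carrier V) T (unit_vec i)"
  have u: "unit_vec i \<in> carrier (coord_space d)" if "i < d" for i
    using that by (auto simp: unit_vec_def)
  have b: "?b i \<in> carrier V" "T (?b i) = unit_vec i" if "i < d" for i
    using inv_into_into[of "unit_vec i" T "carrier V"] f_inv_into_f[of "unit_vec i" T "carrier V"]
      T(2) u[OF that] unfolding bij_betw_def by (simp_all del: coord_space_simps)
  have TF: "T (\<Oplus>\<^bsub>V\<^esub>i\<in>{..<d}. c i \<odot>\<^bsub>V\<^esub> ?b i) = (\<lambda>i. if i < d then c i else 0)" for c
  proof -
    have "T (\<Oplus>\<^bsub>V\<^esub>i\<in>{..<d}. c i \<odot>\<^bsub>V\<^esub> ?b i) = (\<Oplus>\<^bsub>coord_space d\<^esub>i\<in>{..<d}. fun_scale (c i) (T (?b i)))"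
      using lin_finsum_smult[OF V kspace_coord T(1), of "{..<d}" ?b c] b by simp
    also have "\<dots> = (\<Sum>i<d. fun_scale (c i) (T (?b i)))"
      by (rule coord_finsum) (use u in \<open>auto simp: b(2) fun_scale_def\<close>)
    also have "\<dots> = (\<Sum>i<d. fun_scale (c i) (unit_vec i))"
      by (rule sum.cong) (auto simp: b(2))
    also have "\<dots> = (\<Sum>i<d. fun_scale ((\<lambda>i. if i < d then c i else 0) i) (unit_vec i))"
      by (rule sum.cong) auto
    also have "\<dots> = (\<lambda>i. if i < d then c i else 0)"
      by (rule coord_expand[symmetric]) auto
    finally show ?thesis .
  qed
  have cl: "(\<lambda>i. c i \<odot>\<^bsub>V\<^esub> ?b i) \<in> {..<d} \<rightarrow> carrier V" for c using b by auto
  have "basis_on univ_ring V {..<d} ?b"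
    unfolding basis_on_def
  proof (intro conjI ballI)
    show "?b \<in> {..<d} \<rightarrow> carrier V" using b by auto
    fix v assume v: "v \<in> carrier V"
    show "\<exists>!c. c \<in> {..<d} \<rightarrow>\<^sub>E carrier univ_ring \<and> v = (\<Oplus>\<^bsub>V\<^esub>i\<in>{..<d}. c i \<odot>\<^bsub>V\<^esub> ?b i)"
    proof (rule ex1I[of _ "restrict (T v) {..<d}"], intro conjI)
      have "T v i = 0" if "\<not> i < d" for i using lin_closed[OF T(1) v] that by auto
      then have "T (\<Oplus>\<^bsub>V\<^esub>i\<in>{..<d}. restrict (T v) {..<d} i \<odot>\<^bsub>V\<^esub> ?b i) = T v"
        unfolding TF by (auto simp: fun_eq_iff)
      then show "v = (\<Oplus>\<^bsub>V\<^esub>i\<in>{..<d}. restrict (T v) {..<d} i \<odot>\<^bsub>V\<^esub> ?b i)"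
        by (intro inj_onD[OF bij_betw_imp_inj_on[OF T(2)] sym v V.finsum_closed[OF cl]])
      fix c
      assume c: "c \<in> {..<d} \<rightarrow>\<^sub>E carrier univ_ring \<and> v = (\<Oplus>\<^bsub>V\<^esub>i\<in>{..<d}. c i \<odot>\<^bsub>V\<^esub> ?b i)"
      then have "T v = (\<lambda>i. if i < d then c i else 0)" using TF by simp
      then show "c = restrict (T v) {..<d}" using c by (auto simp: fun_eq_iff PiE_def extensional_def)
    qed auto
  qed simp
  then show thesis by (rule that)
qed

lemma has_dim_fin_dim: "has_dim V d \<Longrightarrow> fin_dim V"
  unfolding fin_dim_def by (meson has_dim_imp_basis_on)

lemma has_dim_kdim: "has_dim V d \<Longrightarrow> kdim V = d"
  unfolding kdim_def
  by (rule the_equality)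
    (meson has_dim_imp_basis_on, meson basis_on_imp_has_dim has_dim_kspace has_dim_unique)

subsection \<open>Quotients\<close>

text \<open>Quotients are needed twice: for morphisms modulo homotopy, over the field, and for the
  Grothendieck group, over the Laurent polynomials.\<close>

locale submod =
  fixes V :: "('c::comm_ring_1, 'v, 'x) module_scheme" and N :: "'v set"
  assumes M: "Module.module univ_ring V" and N: "ksubspace V N"
begin

sublocale V: Module.module univ_ring V by (rule M)

sublocale S: abelian_subgroup N V
  by (rule abelian_subgroupI3) (simp_all add: additive_subgroup_def ksubspace_subgroup[OF M N] V.abelian_group_axioms)

abbreviation "Q \<equiv> quot_module V N"

lemma Q_simps: "carrier Q = (\<lambda>v. N +>\<^bsub>V\<^esub> v) ` carrier V" "zero Q = N"
  by (auto simp: quot_module_def A_RCOSETS_def')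

lemma Q_add: "v \<in> carrier V \<Longrightarrow> w \<in> carrier V \<Longrightarrow> (N +>\<^bsub>V\<^esub> v) \<oplus>\<^bsub>Q\<^esub> (N +>\<^bsub>V\<^esub> w) = N +>\<^bsub>V\<^esub> (v \<oplus>\<^bsub>V\<^esub> w)"
  by (simp add: quot_module_def S.a_rcos_sum)

lemma coset_eq_iff:
  assumes "v \<in> carrier V" "w \<in> carrier V"
  shows "N +>\<^bsub>V\<^esub> v = N +>\<^bsub>V\<^esub> w \<longleftrightarrow> v \<ominus>\<^bsub>V\<^esub> w \<in> N"
proof
  assume "N +>\<^bsub>V\<^esub> v = N +>\<^bsub>V\<^esub> w"
  then have "v \<in> N +>\<^bsub>V\<^esub> w" using S.a_rcos_self[OF assms(1)] by simp
  then obtain h where h: "h \<in> N" "v = h \<oplus>\<^bsub>V\<^esub> w" unfolding a_r_coset_def' by auto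
  have hV: "h \<in> carrier V" using h(1) S.a_subset by auto
  have "v \<ominus>\<^bsub>V\<^esub> w = h" unfolding h(2) using hV assms(2) by (simp add: V.minus_eq V.a_assoc V.r_neg)
  then show "v \<ominus>\<^bsub>V\<^esub> w \<in> N" using h(1) by simp
next
  assume n: "v \<ominus>\<^bsub>V\<^esub> w \<in> N"
  have "v = (v \<ominus>\<^bsub>V\<^esub> w) \<oplus>\<^bsub>V\<^esub> w" using assms by (simp add: V.minus_eq V.a_assoc V.l_neg)
  then have "v \<in> N +>\<^bsub>V\<^esub> w" unfolding a_r_coset_def' using n by auto
  then show "N +>\<^bsub>V\<^esub> v = N +>\<^bsub>V\<^esub> w"
    using V.a_repr_independence[OF _ assms(2) S.a_subgroup] by simp
qed

lemma coset_zero: "N +>\<^bsub>V\<^esub> \<zero>\<^bsub>V\<^esub> = N"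
  by (simp add: S.a_subset)

lemma coset_eq_N_iff: "v \<in> carrier V \<Longrightarrow> N +>\<^bsub>V\<^esub> v = N \<longleftrightarrow> v \<in> N"
  using coset_eq_iff[of v "\<zero>\<^bsub>V\<^esub>"] by (simp add: coset_zero V.minus_zero_right)

text \<open>The defining union runs over all representatives, which give the same coset because \<open>N\<close> is closed
  under scalars.\<close>

lemma Q_smult:
  assumes "v \<in> carrier V"
  shows "c \<odot>\<^bsub>Q\<^esub> (N +>\<^bsub>V\<^esub> v) = N +>\<^bsub>V\<^esub> (c \<odot>\<^bsub>V\<^esub> v)"
proof -
  have "N +>\<^bsub>V\<^esub> (c \<odot>\<^bsub>V\<^esub> w) = N +>\<^bsub>V\<^esub> (c \<odot>\<^bsub>V\<^esub> v)" if w: "w \<in> N +>\<^bsub>V\<^esub> v" for w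
  proof -
    obtain h where h: "h \<in> N" "w = h \<oplus>\<^bsub>V\<^esub> v" using w unfolding a_r_coset_def' by auto
    have hV: "h \<in> carrier V" using h(1) S.a_subset by auto
    have ch: "c \<odot>\<^bsub>V\<^esub> h \<in> N" using N h(1) by (simp add: ksubspace_def)
    have "c \<odot>\<^bsub>V\<^esub> w \<ominus>\<^bsub>V\<^esub> c \<odot>\<^bsub>V\<^esub> v = c \<odot>\<^bsub>V\<^esub> h"
      unfolding h(2) using hV assms V.smult_r_distr[of c h v] V.smult_closed[of c h] V.smult_closed[of c v]
      by (simp add: V.minus_eq V.a_assoc V.r_neg)
    then show ?thesis using coset_eq_iff[of "c \<odot>\<^bsub>V\<^esub> w" "c \<odot>\<^bsub>V\<^esub> v"] ch hV assms h(2)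
      V.smult_closed by simp
  qed
  then have "(\<Union>w\<in>N +>\<^bsub>V\<^esub> v. N +>\<^bsub>V\<^esub> (c \<odot>\<^bsub>V\<^esub> w)) = (\<Union>w\<in>N +>\<^bsub>V\<^esub> v. N +>\<^bsub>V\<^esub> (c \<odot>\<^bsub>V\<^esub> v))"
    by (rule SUP_cong[OF refl])
  also have "\<dots> = N +>\<^bsub>V\<^esub> (c \<odot>\<^bsub>V\<^esub> v)"
    using S.a_rcos_self[OF assms] by (metis UN_constant empty_iff)
  finally show ?thesis by (simp add: quot_module_def)
qed

lemma Q_module: "Module.module univ_ring Q"
proof (rule moduleI)
  show "cring (univ_ring :: 'c ring)" by (rule cring_univ_ring)
  show "abelian_group Q"
  proof (rule abelian_groupI)
    show "\<zero>\<^bsub>Q\<^esub> \<in> carrier Q"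
      unfolding Q_simps
      by (rule image_eqI[where f = "\<lambda>v. N +>\<^bsub>V\<^esub> v" and x = "\<zero>\<^bsub>V\<^esub>", OF coset_zero[symmetric] V.zero_closed])
    fix x y z assume x: "x \<in> carrier Q"
    then obtain u where u: "u \<in> carrier V" "x = N +>\<^bsub>V\<^esub> u" by (auto simp: Q_simps)
    show "\<zero>\<^bsub>Q\<^esub> \<oplus>\<^bsub>Q\<^esub> x = x"
      using Q_add[OF V.zero_closed u(1)] u by (simp add: Q_simps coset_zero)
    show "\<exists>y\<in>carrier Q. y \<oplus>\<^bsub>Q\<^esub> x = \<zero>\<^bsub>Q\<^esub>"
    proof (rule bexI)
      show "(N +>\<^bsub>V\<^esub> (\<ominus>\<^bsub>V\<^esub> u)) \<oplus>\<^bsub>Q\<^esub> x = \<zero>\<^bsub>Q\<^esub>"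
        using Q_add[OF V.a_inv_closed[OF u(1)] u(1)] u by (simp add: Q_simps(2) coset_zero V.l_neg)
      show "N +>\<^bsub>V\<^esub> (\<ominus>\<^bsub>V\<^esub> u) \<in> carrier Q"
        unfolding Q_simps(1) by (rule imageI) (rule V.a_inv_closed[OF u(1)])
    qed
    assume y: "y \<in> carrier Q"
    then obtain v where v: "v \<in> carrier V" "y = N +>\<^bsub>V\<^esub> v" by (auto simp: Q_simps)
    have "N +>\<^bsub>V\<^esub> (u \<oplus>\<^bsub>V\<^esub> v) \<in> carrier Q"
      unfolding Q_simps(1) by (rule imageI) (rule V.a_closed[OF u(1) v(1)])
    then show "x \<oplus>\<^bsub>Q\<^esub> y \<in> carrier Q" using u v by (simp add: Q_add)
    show "x \<oplus>\<^bsub>Q\<^esub> y = y \<oplus>\<^bsub>Q\<^esub> x" using u v by (simp add: Q_add V.a_comm)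
    assume z: "z \<in> carrier Q"
    then obtain w where w: "w \<in> carrier V" "z = N +>\<^bsub>V\<^esub> w" by (auto simp: Q_simps)
    show "x \<oplus>\<^bsub>Q\<^esub> y \<oplus>\<^bsub>Q\<^esub> z = x \<oplus>\<^bsub>Q\<^esub> (y \<oplus>\<^bsub>Q\<^esub> z)" using u v w by (simp add: Q_add V.a_assoc)
  qed
  fix a b :: 'c and x y assume "x \<in> carrier Q"
  then obtain u where u: "u \<in> carrier V" "x = N +>\<^bsub>V\<^esub> u" by (auto simp: Q_simps)
  have cu: "c \<odot>\<^bsub>V\<^esub> u \<in> carrier V" for c using V.smult_closed[of c u] u by simp
  have "N +>\<^bsub>V\<^esub> (a \<odot>\<^bsub>V\<^esub> u) \<in> carrier Q"
    unfolding Q_simps(1) by (rule imageI) (rule cu)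
  then show "a \<odot>\<^bsub>Q\<^esub> x \<in> carrier Q" using u by (simp add: Q_smult)
  show "(a \<oplus>\<^bsub>univ_ring\<^esub> b) \<odot>\<^bsub>Q\<^esub> x = a \<odot>\<^bsub>Q\<^esub> x \<oplus>\<^bsub>Q\<^esub> b \<odot>\<^bsub>Q\<^esub> x"
    using u cu V.smult_l_distr[of a b u] by (simp add: Q_smult Q_add)
  show "(a \<otimes>\<^bsub>univ_ring\<^esub> b) \<odot>\<^bsub>Q\<^esub> x = a \<odot>\<^bsub>Q\<^esub> (b \<odot>\<^bsub>Q\<^esub> x)"
    using u cu V.smult_assoc1[of a b u] by (simp add: Q_smult)
  show "\<one>\<^bsub>univ_ring\<^esub> \<odot>\<^bsub>Q\<^esub> x = x" using u V.smult_one[of u] by (simp add: Q_smult)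
  assume "y \<in> carrier Q"
  then obtain v where v: "v \<in> carrier V" "y = N +>\<^bsub>V\<^esub> v" by (auto simp: Q_simps)
  have cv: "a \<odot>\<^bsub>V\<^esub> v \<in> carrier V" using V.smult_closed[of a v] v by simp
  show "a \<odot>\<^bsub>Q\<^esub> (x \<oplus>\<^bsub>Q\<^esub> y) = a \<odot>\<^bsub>Q\<^esub> x \<oplus>\<^bsub>Q\<^esub> a \<odot>\<^bsub>Q\<^esub> y"
    using u v cu cv V.smult_r_distr[of a u v] by (simp add: Q_smult Q_add)
qed

end

lemma has_dim_quot:
  fixes V :: "('k::field, 'v, 'x) module_scheme"
  assumes "has_dim V d" "ksubspace V N"
  obtains a b where "has_dim (V\<lparr>carrier := N\<rparr>) a" "has_dim (quot_module V N) b" "a + b = d"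
proof -
  have V: "kspace V" by (rule has_dim_kspace[OF assms(1)])
  have S: "submod V N" by (rule submod.intro[OF V assms(2)])
  let ?p = "\<lambda>v. N +>\<^bsub>V\<^esub> v" and ?Q = "quot_module V N"
  note car = submod.Q_simps(1)[OF S]
  have lin: "lin V ?Q ?p"
  proof (rule linI)
    show "?p x \<in> carrier ?Q" if "x \<in> carrier V" for x unfolding car by (rule imageI) (rule that)
  qed (simp_all add: submod.Q_add[OF S] submod.Q_smult[OF S])
  have kerN: "lker V ?Q ?p = N"
  proof (rule equalityI; rule subsetI)
    show "v \<in> lker V ?Q ?p" if "v \<in> N" for v
    proof -
      have "v \<in> carrier V" using assms(2) that by (auto simp: ksubspace_def)
      then show ?thesis using that by (simp add: lker_def submod.Q_simps(2)[OF S] submod.coset_eq_N_iff[OF S])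
    qed
    show "v \<in> N" if "v \<in> lker V ?Q ?p" for v
      using that submod.coset_eq_N_iff[OF S, of v] by (auto simp: lker_def submod.Q_simps(2)[OF S])
  qed
  show thesis
    by (rule rank_nullity[OF assms(1) submod.Q_module[OF S] lin car[symmetric]])
      (rule that, simp_all add: kerN)
qed

text \<open>Keeps the index set \<open>{1..r}\<close> of the idempotents from being rewritten to \<open>{Suc 0..r}\<close>.\<close>

declare One_nat_def [simp del]

section \<open>Graded modules\<close>

locale gmod =
  fixes A :: "nat \<Rightarrow> 'a::{ring,monoid_mult} set" and M :: "('a, 'm) gmodule" (structure)
  assumes gm: "graded_module A M"
begin

sublocale abelian_group M using gm by (simp add: graded_module_def)

lemma sm_closed [simp]: "v \<in> carrier M \<Longrightarrow> a \<odot> v \<in> carrier M"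
  using gm by (simp add: graded_module_def)

lemma sm_l: "v \<in> carrier M \<Longrightarrow> (a + b) \<odot> v = a \<odot> v \<oplus> b \<odot> v"
  using gm by (simp add: graded_module_def)

lemma sm_r: "v \<in> carrier M \<Longrightarrow> w \<in> carrier M \<Longrightarrow> a \<odot> (v \<oplus> w) = a \<odot> v \<oplus> a \<odot> w"
  using gm by (simp add: graded_module_def)

lemma sm_assoc: "v \<in> carrier M \<Longrightarrow> (a * b) \<odot> v = a \<odot> (b \<odot> v)"
  using gm by (simp add: graded_module_def)

lemma sm_one [simp]: "v \<in> carrier M \<Longrightarrow> 1 \<odot> v = v"
  using gm by (simp add: graded_module_def)

lemma gr_subgroup: "subgroup (gr M n) (add_monoid M)"
  using gm by (simp add: graded_module_def)

lemma gr_carrier: "v \<in> gr M n \<Longrightarrow> v \<in> carrier M"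
  using subgroup.subset[OF gr_subgroup[of n]] by auto

lemma gr_zero [simp]: "\<zero> \<in> gr M n"
  using subgroup.one_closed[OF gr_subgroup[of n]] by simp

lemma gr_add: "v \<in> gr M n \<Longrightarrow> w \<in> gr M n \<Longrightarrow> v \<oplus> w \<in> gr M n"
  using subgroup.m_closed[OF gr_subgroup[of n]] by simp

lemma gr_neg: "v \<in> gr M n \<Longrightarrow> \<ominus> v \<in> gr M n"
  using subgroup.m_inv_closed[OF gr_subgroup[of n]] by (simp add: a_inv_def)

lemma gr_sm: "a \<in> A m \<Longrightarrow> v \<in> gr M n \<Longrightarrow> a \<odot> v \<in> gr M (int m + n)"
  using gm by (simp add: graded_module_def)

lemma gr_decomp: "v \<in> carrier M \<Longrightarrow> \<exists>!c. (\<forall>n. c n \<in> gr M n) \<and> finite {n. c n \<noteq> \<zero>} \<and>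
    v = (\<Oplus>n\<in>{n. c n \<noteq> \<zero>}. c n)"
  using gm by (simp add: graded_module_def)

lemma sm_zero_l [simp]: "v \<in> carrier M \<Longrightarrow> 0 \<odot> v = \<zero>"
  using sm_l[of v 0 0] by (metis add.r_cancel_one add_0 sm_closed)

lemma sm_zero_r [simp]: "a \<odot> \<zero> = \<zero>"
  using sm_r[of \<zero> \<zero> a] by (metis add.r_cancel_one l_zero sm_closed zero_closed)

lemma sm_neg_l: "v \<in> carrier M \<Longrightarrow> (- a) \<odot> v = \<ominus> (a \<odot> v)"
  using sm_l[of v "- a" a] by (simp add: minus_equality)

lemma sm_neg_r: "v \<in> carrier M \<Longrightarrow> a \<odot> (\<ominus> v) = \<ominus> (a \<odot> v)"
  using sm_r[of "\<ominus> v" v a] by (simp add: minus_equality l_neg)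

lemma sm_finsum: "finite I \<Longrightarrow> (\<And>k. k \<in> I \<Longrightarrow> x k \<in> carrier M) \<Longrightarrow>
    a \<odot> (\<Oplus>k\<in>I. x k) = (\<Oplus>k\<in>I. a \<odot> x k)"
proof (induction I rule: finite_induct)
  case (insert k I)
  then have "x \<in> I \<rightarrow> carrier M" "(\<lambda>k. a \<odot> x k) \<in> I \<rightarrow> carrier M" by auto
  then show ?case using insert by (simp add: sm_r)
qed simp

lemma sm_sum: "finite I \<Longrightarrow> v \<in> carrier M \<Longrightarrow> (\<Sum>k\<in>I. a k) \<odot> v = (\<Oplus>k\<in>I. a k \<odot> v)"
proof (induction I rule: finite_induct)
  case (insert k I)
  then have "(\<lambda>k. a k \<odot> v) \<in> I \<rightarrow> carrier M" by auto
  then show ?case using insert by (simp add: sm_l)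
qed simp

lemma finsum_mem:
  assumes "finite I" "\<And>k. k \<in> I \<Longrightarrow> x k \<in> U" "\<zero> \<in> U" "\<And>v w. v \<in> U \<Longrightarrow> w \<in> U \<Longrightarrow> v \<oplus> w \<in> U"
    "U \<subseteq> carrier M"
  shows "(\<Oplus>k\<in>I. x k) \<in> U"
  using assms(1,2)
proof (induction I rule: finite_induct)
  case (insert k I)
  then have "x \<in> I \<rightarrow> carrier M" "x k \<in> carrier M" using assms(5) by auto
  then show ?case using insert assms(4) by simp
qed (simp add: assms(3))

lemma finsum_support:
  assumes "finite F" "{n. c n \<noteq> \<zero>} \<subseteq> F" "\<And>n. c n \<in> carrier M"
  shows "(\<Oplus>n\<in>{n. c n \<noteq> \<zero>}. c n) = (\<Oplus>n\<in>F. c n)"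
  by (rule add.finprod_mono_neutral_cong_left[OF assms(1,2)]) (use assms(3) in auto)

text \<open>The homogeneous components of an element.\<close>

definition gcomp :: "'m \<Rightarrow> int \<Rightarrow> 'm" where
  "gcomp v = (THE c. (\<forall>n. c n \<in> gr M n) \<and> finite {n. c n \<noteq> \<zero>} \<and> v = (\<Oplus>n\<in>{n. c n \<noteq> \<zero>}. c n))"

lemma gcomp_ex:
  assumes "v \<in> carrier M"
  shows "(\<forall>n. gcomp v n \<in> gr M n) \<and> finite {n. gcomp v n \<noteq> \<zero>} \<and>
    v = (\<Oplus>n\<in>{n. gcomp v n \<noteq> \<zero>}. gcomp v n)"
  unfolding gcomp_def by (rule theI'[OF gr_decomp[OF assms]])

lemma gcomp_gr: "v \<in> carrier M \<Longrightarrow> gcomp v n \<in> gr M n"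
  using gcomp_ex by blast

lemma gcomp_carrier [simp]: "v \<in> carrier M \<Longrightarrow> gcomp v n \<in> carrier M"
  using gcomp_gr gr_carrier by blast

lemma gcomp_finite: "v \<in> carrier M \<Longrightarrow> finite {n. gcomp v n \<noteq> \<zero>}"
  using gcomp_ex by blast

lemma gcomp_sum: "v \<in> carrier M \<Longrightarrow> v = (\<Oplus>n\<in>{n. gcomp v n \<noteq> \<zero>}. gcomp v n)"
  using gcomp_ex by blast

lemma gcomp_unique:
  assumes c: "\<And>n. c n \<in> gr M n" and "finite F" "\<And>n. n \<notin> F \<Longrightarrow> c n = \<zero>" "v = (\<Oplus>n\<in>F. c n)"
  shows "gcomp v = c"
proof -
  have cc: "c n \<in> carrier M" for n using c gr_carrier by blast
  have sub: "{n. c n \<noteq> \<zero>} \<subseteq> F" using assms(3) by blast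
  have v: "v \<in> carrier M" unfolding assms(4) by (rule finsum_closed) (use cc in auto)
  have "(\<forall>n. c n \<in> gr M n) \<and> finite {n. c n \<noteq> \<zero>} \<and> v = (\<Oplus>n\<in>{n. c n \<noteq> \<zero>}. c n)"
    using c finite_subset[OF sub assms(2)] finsum_support[OF assms(2) sub cc] assms(4) by simp
  then show ?thesis unfolding gcomp_def by (rule the1_equality[OF gr_decomp[OF v]])
qed

lemma gcomp_homog:
  assumes "v \<in> gr M n" shows "gcomp v = (\<lambda>m. if m = n then v else \<zero>)"
proof (rule gcomp_unique[of _ "{n}"])
  show "v = (\<Oplus>m\<in>{n}. if m = n then v else \<zero>)"
    using gr_carrier[OF assms] by (subst finsum_insert) auto
qed (use assms in auto)

lemma gcomp_add:
  assumes "v \<in> carrier M" "w \<in> carrier M"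
  shows "gcomp (v \<oplus> w) = (\<lambda>n. gcomp v n \<oplus> gcomp w n)"
proof (rule gcomp_unique)
  let ?F = "{n. gcomp v n \<noteq> \<zero>} \<union> {n. gcomp w n \<noteq> \<zero>}"
  show fin: "finite ?F" using assms gcomp_finite by simp
  have "v = (\<Oplus>n\<in>?F. gcomp v n)" "w = (\<Oplus>n\<in>?F. gcomp w n)"
    using finsum_support[OF fin, of "gcomp v"] finsum_support[OF fin, of "gcomp w"]
      gcomp_sum[OF assms(1)] gcomp_sum[OF assms(2)] assms by auto
  then show "v \<oplus> w = (\<Oplus>n\<in>?F. gcomp v n \<oplus> gcomp w n)"
    using finsum_addf[of "gcomp v" ?F "gcomp w"] assms by simp
qed (use assms gcomp_gr gr_add in auto)

lemma gcomp_zero: "gcomp \<zero> = (\<lambda>_. \<zero>)"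
  using gcomp_homog[of \<zero> 0] by auto

lemma gcomp_finsum:
  assumes "finite I" "\<And>k. k \<in> I \<Longrightarrow> x k \<in> carrier M"
  shows "gcomp (\<Oplus>k\<in>I. x k) n = (\<Oplus>k\<in>I. gcomp (x k) n)"
  using assms
proof (induction I rule: finite_induct)
  case (insert k I)
  then have *: "x \<in> I \<rightarrow> carrier M" "(\<lambda>k. gcomp (x k) n) \<in> I \<rightarrow> carrier M" by auto
  then show ?case using insert gcomp_add[OF _ finsum_closed[OF *(1)], of "x k"] by simp
qed (simp add: gcomp_zero)

end

lemma gr_homI:
  assumes "f \<in> carrier M \<rightarrow>\<^sub>E carrier N"
    and "\<And>v w. v \<in> carrier M \<Longrightarrow> w \<in> carrier M \<Longrightarrow> f (v \<oplus>\<^bsub>M\<^esub> w) = f v \<oplus>\<^bsub>N\<^esub> f w"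
    and "\<And>a v. v \<in> carrier M \<Longrightarrow> f (a \<odot>\<^bsub>M\<^esub> v) = a \<odot>\<^bsub>N\<^esub> f v"
    and "\<And>n v. v \<in> gr M n \<Longrightarrow> f v \<in> gr N n"
  shows "f \<in> gr_hom M N"
  using assms by (auto simp: gr_hom_def)

lemma
  assumes "f \<in> gr_hom M N"
  shows hom_ext: "f \<in> carrier M \<rightarrow>\<^sub>E carrier N"
    and hom_closed: "v \<in> carrier M \<Longrightarrow> f v \<in> carrier N"
    and hom_add: "v \<in> carrier M \<Longrightarrow> w \<in> carrier M \<Longrightarrow> f (v \<oplus>\<^bsub>M\<^esub> w) = f v \<oplus>\<^bsub>N\<^esub> f w"
    and hom_sm: "v \<in> carrier M \<Longrightarrow> f (a \<odot>\<^bsub>M\<^esub> v) = a \<odot>\<^bsub>N\<^esub> f v"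
    and hom_gr: "v \<in> gr M n \<Longrightarrow> f v \<in> gr N n"
  using assms by (auto simp: gr_hom_def image_subset_iff)

lemma hom_eqI:
  assumes "f \<in> gr_hom M N" "g \<in> gr_hom M N" "\<And>v. v \<in> carrier M \<Longrightarrow> f v = g v"
  shows "f = g"
  using assms(3) by (rule PiE_ext[OF hom_ext[OF assms(1)] hom_ext[OF assms(2)]])

lemma hom_zero:
  assumes "graded_module A M" "graded_module A N" "f \<in> gr_hom M N"
  shows "f \<zero>\<^bsub>M\<^esub> = \<zero>\<^bsub>N\<^esub>"
proof -
  interpret M: gmod A M by (rule gmod.intro) fact
  interpret N: gmod A N by (rule gmod.intro) fact
  show ?thesis using hom_sm[OF assms(3) M.zero_closed, of 0] hom_closed[OF assms(3) M.zero_closed] by simp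
qed

lemma hom_neg:
  assumes "graded_module A M" "graded_module A N" "f \<in> gr_hom M N" "v \<in> carrier M"
  shows "f (\<ominus>\<^bsub>M\<^esub> v) = \<ominus>\<^bsub>N\<^esub> f v"
proof -
  interpret M: gmod A M by (rule gmod.intro) fact
  interpret N: gmod A N by (rule gmod.intro) fact
  show ?thesis using hom_sm[OF assms(3,4), of "- 1"] hom_closed[OF assms(3,4)] assms(4)
    by (simp add: M.sm_neg_l N.sm_neg_l)
qed

lemma hom_minus:
  assumes "graded_module A M" "graded_module A N" "f \<in> gr_hom M N" "v \<in> carrier M" "w \<in> carrier M"
  shows "f (v \<ominus>\<^bsub>M\<^esub> w) = f v \<ominus>\<^bsub>N\<^esub> f w"
proof -
  interpret M: gmod A M by (rule gmod.intro) fact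
  interpret N: gmod A N by (rule gmod.intro) fact
  show ?thesis using assms(4,5) hom_add[OF assms(3), of v "\<ominus>\<^bsub>M\<^esub> w"] hom_neg[OF assms(1-3), of w]
    by (simp add: M.minus_eq N.minus_eq)
qed

lemma hom_finsum:
  assumes "graded_module A M" "graded_module A N" "f \<in> gr_hom M N"
    "finite I" "\<And>k. k \<in> I \<Longrightarrow> x k \<in> carrier M"
  shows "f (\<Oplus>\<^bsub>M\<^esub>k\<in>I. x k) = (\<Oplus>\<^bsub>N\<^esub>k\<in>I. f (x k))"
proof -
  interpret M: gmod A M by (rule gmod.intro) fact
  interpret N: gmod A N by (rule gmod.intro) fact
  show ?thesis using assms(4,5)
  proof (induction I rule: finite_induct)
    case empty show ?case using hom_zero[OF assms(1-3)] by simp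
  next
    case (insert k I)
    then have *: "x \<in> I \<rightarrow> carrier M" "(\<lambda>k. f (x k)) \<in> I \<rightarrow> carrier N" "f (x k) \<in> carrier N"
      using hom_closed[OF assms(3)] by auto
    then show ?case using insert hom_add[OF assms(3) _ M.finsum_closed[OF *(1)], of "x k"] by simp
  qed
qed

lemma hom_gcomp:
  assumes "graded_module A M" "graded_module A N" "f \<in> gr_hom M N" "v \<in> carrier M"
  shows "gmod.gcomp N (f v) n = f (gmod.gcomp M v n)"
proof -
  interpret M: gmod A M by (rule gmod.intro) fact
  interpret N: gmod A N by (rule gmod.intro) fact
  let ?F = "{n. M.gcomp v n \<noteq> \<zero>\<^bsub>M\<^esub>}"
  have "N.gcomp (f v) = (\<lambda>n. f (M.gcomp v n))"
  proof (rule N.gcomp_unique[of _ ?F])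
    show "f v = (\<Oplus>\<^bsub>N\<^esub>n\<in>?F. f (M.gcomp v n))"
      using hom_finsum[OF assms(1-3) M.gcomp_finite[OF assms(4)], of "M.gcomp v"]
        M.gcomp_sum[OF assms(4)] assms(4) by simp
  qed (use hom_gr[OF assms(3) M.gcomp_gr[OF assms(4)]] M.gcomp_finite[OF assms(4)] hom_zero[OF assms(1-3)] in auto)
  then show ?thesis by simp
qed

lemma hom_comp:
  assumes "graded_module A L" "f \<in> gr_hom L M" "g \<in> gr_hom M N"
  shows "compose (carrier L) g f \<in> gr_hom L N"
proof (rule gr_homI)
  interpret L: gmod A L by (rule gmod.intro) fact
  show "compose (carrier L) g f \<in> carrier L \<rightarrow>\<^sub>E carrier N"
    using hom_closed[OF assms(2)] hom_closed[OF assms(3)] by (auto simp: compose_def)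
  show "compose (carrier L) g f v \<in> gr N n" if "v \<in> gr L n" for n v
    using hom_gr[OF assms(3) hom_gr[OF assms(2) that]] L.gr_carrier[OF that] by (simp add: compose_eq)
qed (use hom_closed[OF assms(2)] gmod.sm_closed[OF gmod.intro[OF assms(1)]]
    abelian_groupE(1)[OF assms(1)[unfolded graded_module_def, THEN conjunct1]]
    in \<open>simp_all add: compose_eq hom_add[OF assms(2)] hom_add[OF assms(3)] hom_sm[OF assms(2)] hom_sm[OF assms(3)]\<close>)

text \<open>The inverse of a bijective graded homomorphism is graded because homomorphisms commute
  with taking components.\<close>

lemma hom_inv:
  assumes "graded_module A M" "graded_module A N" "f \<in> gr_hom M N" "bij_betw f (carrier M) (carrier N)"
  defines "g \<equiv> restrict (inv_into (carrier M) f) (carrier N)"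
  shows "g \<in> gr_hom N M" "\<And>v. v \<in> carrier M \<Longrightarrow> g (f v) = v" "\<And>w. w \<in> carrier N \<Longrightarrow> f (g w) = w"
proof -
  interpret M: gmod A M by (rule gmod.intro) fact
  interpret N: gmod A N by (rule gmod.intro) fact
  have inj: "inj_on f (carrier M)" and im: "f ` carrier M = carrier N" using assms(4) by (auto simp: bij_betw_def)
  show gf: "g (f v) = v" if "v \<in> carrier M" for v
    using that inj hom_closed[OF assms(3)] by (simp add: g_def)
  show fg: "f (g w) = w" if "w \<in> carrier N" for w
    using that im by (simp add: g_def f_inv_into_f)
  have gc: "g w \<in> carrier M" if "w \<in> carrier N" for w
    using that im inv_into_into[of w f "carrier M"] by (simp add: g_def)
  note I = inj_onD[OF inj]
  show "g \<in> gr_hom N M"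
  proof (rule gr_homI)
    show "g \<in> carrier N \<rightarrow>\<^sub>E carrier M" using gc by (auto simp: g_def)
    show "g (v \<oplus>\<^bsub>N\<^esub> w) = g v \<oplus>\<^bsub>M\<^esub> g w" if "v \<in> carrier N" "w \<in> carrier N" for v w
      by (rule I) (use that gc fg hom_add[OF assms(3)] in simp_all)
    show "g (a \<odot>\<^bsub>N\<^esub> v) = a \<odot>\<^bsub>M\<^esub> g v" if "v \<in> carrier N" for a v
      by (rule I) (use that gc fg hom_sm[OF assms(3)] in simp_all)
    fix n w assume w: "w \<in> gr N n"
    have wN: "w \<in> carrier N" by (rule N.gr_carrier[OF w])
    have "f (M.gcomp (g w) n) = f (g w)"
      using hom_gcomp[OF assms(1-3) gc[OF wN], of n] fg[OF wN] N.gcomp_homog[OF w] by simp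
    then have "M.gcomp (g w) n = g w" by (rule I) (use gc[OF wN] in simp_all)
    then show "g w \<in> gr M n" using M.gcomp_gr[OF gc[OF wN], of n] by simp
  qed
qed

section \<open>The algebra\<close>

locale galg =
  fixes scl :: "'k::field \<Rightarrow> 'a \<Rightarrow> 'a::{ring,monoid_mult}" and A :: "nat \<Rightarrow> 'a set"
    and r :: nat and e :: "nat \<Rightarrow> 'a"
  assumes elem: "elementary_algebra scl A r e"
begin

lemmas elem_conj = elem[unfolded elementary_algebra_def]

lemmas alg_conj = elem_conj[THEN conjunct1, unfolded graded_algebra_def]

sublocale vs: vector_space scl by (rule alg_conj[THEN conjunct1])

lemma scl_l: "scl c (a * b) = scl c a * b" and scl_r: "scl c (a * b) = a * scl c b"
  by (rule alg_conj[THEN conjunct2, THEN conjunct1, rule_format, THEN conjunct1],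
      rule alg_conj[THEN conjunct2, THEN conjunct1, rule_format, THEN conjunct2])

lemmas subA = alg_conj[THEN conjunct2, THEN conjunct2, THEN conjunct1, rule_format]
  and A_decomp = alg_conj[THEN conjunct2, THEN conjunct2, THEN conjunct2, THEN conjunct1, THEN spec]
  and oneA = alg_conj[THEN conjunct2, THEN conjunct2, THEN conjunct2, THEN conjunct2, THEN conjunct1]
  and multA = alg_conj[THEN conjunct2, THEN conjunct2, THEN conjunct2, THEN conjunct2, THEN conjunct2, rule_format]
  and loc_fin = elem_conj[THEN conjunct2, THEN conjunct1, unfolded locally_finite_def]
  and e_prim = elem_conj[THEN conjunct2, THEN conjunct2, THEN conjunct1, rule_format, unfolded primitive_idempotent_def]
  and e_orth = elem_conj[THEN conjunct2, THEN conjunct2, THEN conjunct2, THEN conjunct1, rule_format]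
  and A0 = elem_conj[THEN conjunct2, THEN conjunct2, THEN conjunct2, THEN conjunct2, THEN conjunct1]

lemma finA: "\<exists>B. finite B \<and> A n = vs.span B"
  by (rule loc_fin[THEN spec])

lemma e_idem: "i \<in> {1..r} \<Longrightarrow> e i * e i = e i" and e_nz: "i \<in> {1..r} \<Longrightarrow> e i \<noteq> 0"
  using e_prim[of i] by simp_all

text \<open>The expansion of \<open>a\<close> in the \<open>e\<^sub>i\<close> is diagonal for multiplication by the \<open>e\<^sub>i\<close>, from either side,
  as these are orthogonal idempotents.\<close>

lemma A0_e:
  assumes "a \<in> A 0"
  obtains c where "\<And>i. i \<in> {1..r} \<Longrightarrow> a * e i = scl (c i) (e i)" "\<And>i. i \<in> {1..r} \<Longrightarrow> e i * a = scl (c i) (e i)"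
    "a = (\<Sum>i\<in>{1..r}. scl (c i) (e i))"
proof -
  obtain c where c: "a = (\<Sum>i\<in>{1..r}. scl (c i) (e i))" using assms A0 by auto
  have "a * e i = scl (c i) (e i)" if i: "i \<in> {1..r}" for i
  proof -
    have "a * e i = (\<Sum>j\<in>{1..r}. if j = i then scl (c i) (e i) else 0)"
      unfolding c sum_distrib_right
      by (rule sum.cong) (use i e_idem e_orth in \<open>auto simp: scl_l[symmetric]\<close>)
    then show ?thesis using i by simp
  qed
  moreover have "e i * a = scl (c i) (e i)" if i: "i \<in> {1..r}" for i
  proof -
    have "e i * a = (\<Sum>j\<in>{1..r}. if j = i then scl (c i) (e i) else 0)"
      unfolding c sum_distrib_left
      by (rule sum.cong) (use i e_idem e_orth in \<open>auto simp: scl_r[symmetric]\<close>)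
    then show ?thesis using i by simp
  qed
  ultimately show thesis using c that by blast
qed

lemma sum_e: "(\<Sum>i\<in>{1..r}. e i) = 1"
proof -
  obtain c where c: "\<And>i. i \<in> {1..r} \<Longrightarrow> 1 * e i = scl (c i) (e i)" "1 = (\<Sum>i\<in>{1..r}. scl (c i) (e i))"
    using A0_e[OF oneA] by metis
  have "(\<Sum>i\<in>{1..r}. e i) = (\<Sum>i\<in>{1..r}. scl (c i) (e i))"
    by (rule sum.cong) (use c(1) in auto)
  then show ?thesis using c(2) by simp
qed

lemma eA: "i \<in> {1..r} \<Longrightarrow> e i \<in> A 0"
proof -
  assume i: "i \<in> {1..r}"
  have "(\<Sum>j\<in>{1..r}. scl (if j = i then 1 else 0) (e j)) = (\<Sum>j\<in>{1..r}. if j = i then e i else 0)"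
    by (rule sum.cong) auto
  also have "\<dots> = e i" using i by simp
  finally have *: "e i = (\<Sum>j\<in>{1..r}. scl (if j = i then 1 else 0) (e j))" by (rule sym)
  show ?thesis
    unfolding A0 by (rule CollectI, rule exI[of _ "\<lambda>j. if j = i then 1 else 0"], rule conjI[OF * TrueI])
qed

text \<open>Module degrees are integers, so the grading of the algebra is continued by zero to negative
  degrees; likewise the components \<open>part\<close> of an element below.\<close>

definition AZ :: "int \<Rightarrow> 'a set" where "AZ n = (if 0 \<le> n then A (nat n) else {0})"

lemma AZ_sub: "vs.subspace (AZ n)"
  by (simp add: AZ_def subA vs.subspace_single_0)

lemma AZ_0 [simp]: "0 \<in> AZ n" by (rule vs.subspace_0[OF AZ_sub])

lemma AZ_mult: "a \<in> AZ m \<Longrightarrow> b \<in> AZ n \<Longrightarrow> a * b \<in> AZ (m + n)"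
  using multA[of a "nat m" b "nat n"] by (auto simp: AZ_def nat_add_distrib vs.subspace_0[OF subA] split: if_splits)

lemma e_AZ: "i \<in> {1..r} \<Longrightarrow> e i \<in> AZ 0" using eA by (simp add: AZ_def)

lemma AZ_gr: "graded_module A M \<Longrightarrow> a \<in> AZ m \<Longrightarrow> v \<in> gr M n \<Longrightarrow> a \<odot>\<^bsub>M\<^esub> v \<in> gr M (m + n)"
proof -
  assume M: "graded_module A M" and a: "a \<in> AZ m" and v: "v \<in> gr M n"
  interpret M: gmod A M by (rule gmod.intro) fact
  show ?thesis using M.gr_sm[of a "nat m" v n] a v M.gr_carrier[OF v] by (auto simp: AZ_def split: if_splits)
qed

definition npart :: "'a \<Rightarrow> nat \<Rightarrow> 'a" where
  "npart a = (THE c. (\<forall>n. c n \<in> A n) \<and> finite {n. c n \<noteq> 0} \<and> a = (\<Sum>n | c n \<noteq> 0. c n))"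

lemma npart: "(\<forall>n. npart a n \<in> A n) \<and> finite {n. npart a n \<noteq> 0} \<and> a = (\<Sum>n | npart a n \<noteq> 0. npart a n)"
  unfolding npart_def by (rule theI'[OF A_decomp])

definition part :: "'a \<Rightarrow> int \<Rightarrow> 'a" where
  "part a n = (if 0 \<le> n then npart a (nat n) else 0)"

lemma part_AZ: "part a n \<in> AZ n" using npart by (simp add: part_def AZ_def)

lemma part_unique:
  assumes c: "\<And>n. c n \<in> AZ n" and "finite F" "\<And>n. n \<notin> F \<Longrightarrow> c n = 0" "a = (\<Sum>n\<in>F. c n)"
  shows "part a = c"
proof -
  let ?c = "\<lambda>n. c (int n)"
  have cneg: "c n = 0" if "n < 0" for n using c[of n] that by (simp add: AZ_def)
  have sub: "{n. ?c n \<noteq> 0} \<subseteq> nat ` F" using assms(3) by force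
  then have fin: "finite {n. ?c n \<noteq> 0}" using assms(2) by (rule finite_subset[OF _ finite_imageI])
  have "a = (\<Sum>n\<in>{n\<in>F. c n \<noteq> 0}. c n)"
    unfolding assms(4) by (rule sum.mono_neutral_right) (use assms(2) in auto)
  also have "{n\<in>F. c n \<noteq> 0} = int ` {n. ?c n \<noteq> 0}"
  proof (rule equalityI; rule subsetI)
    fix n assume n: "n \<in> {n\<in>F. c n \<noteq> 0}"
    then have "0 \<le> n" using cneg[of n] by force
    then show "n \<in> int ` {n. ?c n \<noteq> 0}" using n by (intro image_eqI[of _ _ "nat n"]) auto
  qed (use assms(3) in force)
  also have "(\<Sum>n\<in>int ` {n. ?c n \<noteq> 0}. c n) = (\<Sum>n | ?c n \<noteq> 0. ?c n)"
    by (subst sum.reindex) auto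
  finally have a: "a = (\<Sum>n | ?c n \<noteq> 0. ?c n)" .
  have cA: "?c n \<in> A n" for n using c[of "int n"] by (simp add: AZ_def)
  have "npart a = ?c" unfolding npart_def
    by (rule the1_equality[OF A_decomp]) (intro conjI allI cA fin a)
  then show ?thesis using cneg by (auto simp: part_def)
qed

lemma part_support: "{n. part a n \<noteq> 0} = int ` {n. npart a n \<noteq> 0}"
proof (rule equalityI; rule subsetI)
  fix n assume n: "n \<in> {n. part a n \<noteq> 0}"
  then have "0 \<le> n" by (simp add: part_def split: if_splits)
  then show "n \<in> int ` {n. npart a n \<noteq> 0}"
    using n by (intro image_eqI[of _ _ "nat n"]) (simp_all add: part_def)
qed (auto simp: part_def)

lemma part_finite: "finite {n. part a n \<noteq> 0}"
  unfolding part_support using npart by simp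

lemma part_sum: "a = (\<Sum>n | part a n \<noteq> 0. part a n)"
proof -
  have "(\<Sum>n | part a n \<noteq> 0. part a n) = (\<Sum>n | npart a n \<noteq> 0. npart a n)"
    unfolding part_support by (simp add: sum.reindex part_def)
  then show ?thesis using npart[of a] by simp
qed

lemma part_sum': "finite F \<Longrightarrow> {n. part a n \<noteq> 0} \<subseteq> F \<Longrightarrow> a = (\<Sum>n\<in>F. part a n)"
  by (rule trans[OF part_sum sum.mono_neutral_left]) auto

lemma part_homog: "a \<in> AZ n \<Longrightarrow> part a = (\<lambda>m. if m = n then a else 0)"
  by (rule part_unique[of _ "{n}"]) auto

text \<open>Uniqueness of components: right multiplication by a homogeneous element shifts them.\<close>

lemma part_mult_right:
  assumes "b \<in> AZ m" shows "part (a * b) n = part a (n - m) * b"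
proof -
  let ?F = "(\<lambda>n. n + m) ` {n. part a n \<noteq> 0}"
  have "part (a * b) = (\<lambda>n. part a (n - m) * b)"
  proof (rule part_unique[of _ ?F])
    show "part a (n - m) * b \<in> AZ n" for n
      using AZ_mult[OF part_AZ[of a "n - m"] assms] by simp
    show "part a (n - m) * b = 0" if "n \<notin> ?F" for n
    proof -
      have "part a (n - m) = 0" using that by (auto simp: image_iff)
      then show ?thesis by simp
    qed
    show "a * b = (\<Sum>n\<in>?F. part a (n - m) * b)"
      by (subst sum.reindex) (auto simp: inj_on_def sum_distrib_right[symmetric] part_sum[symmetric])
  qed (use part_finite in simp)
  then show ?thesis by simp
qed

lemma part_zero: "part 0 = (\<lambda>_. 0)" using part_homog[of 0 0] by auto

text \<open>A homogeneous \<open>v\<close> allows the components of \<open>a v\<close> to be read off from those of \<open>a\<close>.\<close>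

lemma gcomp_sm:
  assumes "graded_module A M" "v \<in> gr M d"
  shows "gmod.gcomp M (a \<odot>\<^bsub>M\<^esub> v) n = part a (n - d) \<odot>\<^bsub>M\<^esub> v"
proof -
  interpret M: gmod A M by (rule gmod.intro) fact
  have v: "v \<in> carrier M" by (rule M.gr_carrier[OF assms(2)])
  let ?G = "{n. part a n \<noteq> 0}"
  let ?F = "(\<lambda>n. n + d) ` ?G"
  have "M.gcomp (a \<odot>\<^bsub>M\<^esub> v) = (\<lambda>n. part a (n - d) \<odot>\<^bsub>M\<^esub> v)"
  proof (rule M.gcomp_unique[of _ ?F])
    show "part a (n - d) \<odot>\<^bsub>M\<^esub> v \<in> gr M n" for n
      using AZ_gr[OF assms(1) part_AZ[of a "n - d"] assms(2)] by simp
    show "part a (n - d) \<odot>\<^bsub>M\<^esub> v = \<zero>\<^bsub>M\<^esub>" if "n \<notin> ?F" for n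
    proof -
      have "part a (n - d) = 0" using that by (auto simp: image_iff)
      then show ?thesis using v by simp
    qed
    have "a \<odot>\<^bsub>M\<^esub> v = (\<Sum>n\<in>?G. part a n) \<odot>\<^bsub>M\<^esub> v"
      by (rule arg_cong[where f = "\<lambda>x. x \<odot>\<^bsub>M\<^esub> v", OF part_sum])
    also have "\<dots> = (\<Oplus>\<^bsub>M\<^esub>n\<in>?G. part a n \<odot>\<^bsub>M\<^esub> v)" by (rule M.sm_sum[OF part_finite v])
    also have "\<dots> = (\<Oplus>\<^bsub>M\<^esub>n\<in>?F. part a (n - d) \<odot>\<^bsub>M\<^esub> v)"
      using v by (subst M.add.finprod_reindex) (auto simp: inj_on_def)
    finally show "a \<odot>\<^bsub>M\<^esub> v = (\<Oplus>\<^bsub>M\<^esub>n\<in>?F. part a (n - d) \<odot>\<^bsub>M\<^esub> v)" .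
  qed (use part_finite in simp)
  then show ?thesis by simp
qed

end

section \<open>Finitely generated graded projectives\<close>

lemma (in gmod) lc_in_carrier: "(\<And>k. k \<in> I \<Longrightarrow> s k \<in> carrier M) \<Longrightarrow> (\<Oplus>k\<in>I. f k \<odot> s k) \<in> carrier M"
  by (rule finsum_closed) auto

lemma (in gmod) lc_add:
  assumes "\<And>k. k \<in> I \<Longrightarrow> s k \<in> carrier M"
  shows "(\<Oplus>k\<in>I. (f k + g k) \<odot> s k) = (\<Oplus>k\<in>I. f k \<odot> s k) \<oplus> (\<Oplus>k\<in>I. g k \<odot> s k)"
proof -
  have "(\<Oplus>k\<in>I. (f k + g k) \<odot> s k) = (\<Oplus>k\<in>I. f k \<odot> s k \<oplus> g k \<odot> s k)"
    by (rule finsum_cong') (use assms sm_l in auto)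
  also have "\<dots> = (\<Oplus>k\<in>I. f k \<odot> s k) \<oplus> (\<Oplus>k\<in>I. g k \<odot> s k)"
    by (rule finsum_addf) (use assms in auto)
  finally show ?thesis .
qed

lemma (in gmod) lc_sm:
  assumes "finite I" "\<And>k. k \<in> I \<Longrightarrow> s k \<in> carrier M"
  shows "(\<Oplus>k\<in>I. (a * f k) \<odot> s k) = a \<odot> (\<Oplus>k\<in>I. f k \<odot> s k)"
proof -
  have "(\<Oplus>k\<in>I. (a * f k) \<odot> s k) = (\<Oplus>k\<in>I. a \<odot> (f k \<odot> s k))"
    by (rule finsum_cong') (use assms sm_assoc in auto)
  also have "\<dots> = a \<odot> (\<Oplus>k\<in>I. f k \<odot> s k)"
    by (rule sm_finsum[symmetric]) (use assms in auto)
  finally show ?thesis .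
qed

lemma (in gmod) lc_unit:
  assumes "finite I" "k \<in> I" "\<And>k. k \<in> I \<Longrightarrow> s k \<in> carrier M"
  shows "(\<Oplus>l\<in>I. (if l = k then a else 0) \<odot> s l) = a \<odot> s k"
proof -
  have "(\<Oplus>l\<in>I. (if l = k then a else 0) \<odot> s l) = (\<Oplus>l\<in>I. if k = l then a \<odot> s l else \<zero>)"
    by (rule finsum_cong') (use assms in auto)
  also have "\<dots> = a \<odot> s k"
    by (rule add.finprod_singleton[OF assms(2,1)]) (use assms in auto)
  finally show ?thesis .
qed

lemma (in gmod) lc_split:
  assumes "finite I" "k \<in> I" "\<And>k. k \<in> I \<Longrightarrow> x k \<in> carrier M"
  shows "(\<Oplus>l\<in>I. x l) = x k \<oplus> (\<Oplus>l\<in>I - {k}. x l)"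
proof -
  have "(\<Oplus>l\<in>insert k (I - {k}). x l) = x k \<oplus> (\<Oplus>l\<in>I - {k}. x l)"
    by (rule finsum_insert) (use assms in auto)
  then show ?thesis using assms(2) by (simp add: insert_absorb)
qed

context galg
begin

lemma A0_mult_e: "a \<in> A 0 \<Longrightarrow> \<exists>c. \<forall>i\<in>{1..r}. a * e i = scl (c i) (e i)"
  by (erule A0_e) blast

text \<open>The direct sum over \<open>k \<in> I\<close> of the modules \<open>Ae\<^bsub>i k\<^esub>\<close> generated in degree \<open>d k\<close>; an element is
  the family of its coordinates, continued by zero outside \<open>I\<close>.\<close>

definition gfree :: "nat set \<Rightarrow> (nat \<Rightarrow> nat) \<Rightarrow> (nat \<Rightarrow> int) \<Rightarrow> 'a univ_gmodule" where
  "gfree I i d = \<lparr>carrier = {f. (\<forall>k\<in>I. f k * e (i k) = f k) \<and> (\<forall>k. k \<notin> I \<longrightarrow> f k = 0)},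
     mult = undefined, one = undefined, zero = (\<lambda>_. 0), add = (\<lambda>v w n. v n + w n),
     smult = (\<lambda>a v n. a * v n),
     gr = (\<lambda>n. {f. (\<forall>k\<in>I. f k * e (i k) = f k \<and> f k \<in> AZ (n - d k)) \<and> (\<forall>k. k \<notin> I \<longrightarrow> f k = 0)})\<rparr>"

lemma gfree_simps [simp]:
  "carrier (gfree I i d) = {f. (\<forall>k\<in>I. f k * e (i k) = f k) \<and> (\<forall>k. k \<notin> I \<longrightarrow> f k = 0)}"
  "zero (gfree I i d) = (\<lambda>_. 0)" "add (gfree I i d) = (\<lambda>v w n. v n + w n)"
  "smult (gfree I i d) = (\<lambda>a v n. a * v n)"
  "gr (gfree I i d) n = {f. (\<forall>k\<in>I. f k * e (i k) = f k \<and> f k \<in> AZ (n - d k)) \<and> (\<forall>k. k \<notin> I \<longrightarrow> f k = 0)}"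
  by (simp_all add: gfree_def)

lemma gfree_grD: "f \<in> gr (gfree I i d) n \<Longrightarrow> k \<in> I \<Longrightarrow> f k \<in> AZ (n - d k)"
  by simp

lemma gfree_ab: "abelian_group (gfree I i d)"
proof (rule abelian_groupI)
  fix f assume "f \<in> carrier (gfree I i d)"
  then show "\<exists>g\<in>carrier (gfree I i d). g \<oplus>\<^bsub>gfree I i d\<^esub> f = \<zero>\<^bsub>gfree I i d\<^esub>"
    by (intro bexI[of _ "\<lambda>k. - f k"]) auto
qed (auto simp: algebra_simps)

lemma gfree_finsum:
  assumes "finite F" "\<And>n. n \<in> F \<Longrightarrow> c n \<in> carrier (gfree I i d)"
  shows "(\<Oplus>\<^bsub>gfree I i d\<^esub>n\<in>F. c n) = (\<lambda>k. \<Sum>n\<in>F. c n k)"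
  using assms
proof (induction F rule: finite_induct)
  interpret G: abelian_group "gfree I i d" by (rule gfree_ab)
  case (insert n F)
  then have "c \<in> F \<rightarrow> carrier (gfree I i d)" "c n \<in> carrier (gfree I i d)" by auto
  then show ?case using insert G.finsum_insert[OF insert.hyps, of c] by simp
qed (simp add: finsum_def finprod_def)

lemma gfree_neg: "f \<in> carrier (gfree I i d) \<Longrightarrow> \<ominus>\<^bsub>gfree I i d\<^esub> f = (\<lambda>k. - f k)"
  by (rule abelian_group.minus_equality[OF gfree_ab]) auto

lemma AZ_neg: "a \<in> AZ n \<Longrightarrow> - a \<in> AZ n" and AZ_add: "a \<in> AZ n \<Longrightarrow> b \<in> AZ n \<Longrightarrow> a + b \<in> AZ n"
  and AZ_scale: "a \<in> AZ n \<Longrightarrow> scl c a \<in> AZ n"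
  by (rule vs.subspace_neg[OF AZ_sub], assumption) (rule vs.subspace_add[OF AZ_sub], assumption+,
    rule vs.subspace_scale[OF AZ_sub], assumption)

lemma graded_gfree:
  assumes fin: "finite I" and iI: "\<And>k. k \<in> I \<Longrightarrow> i k \<in> {1..r}"
  shows "graded_module A (gfree I i d)"
  unfolding graded_module_def
proof (intro conjI allI ballI)
  let ?F = "gfree I i d"
  interpret G: abelian_group ?F by (rule gfree_ab)
  show "abelian_group ?F" by (rule gfree_ab)
  show "subgroup (gr ?F n) (add_monoid ?F)" for n
  proof
    fix x assume x: "x \<in> gr ?F n"
    then have "inv\<^bsub>add_monoid ?F\<^esub> x = (\<lambda>k. - x k)"
      using gfree_neg[of x I i d] by (simp add: a_inv_def)
    then show "inv\<^bsub>add_monoid ?F\<^esub> x \<in> gr ?F n" using x AZ_neg by auto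
  qed (auto simp: AZ_add distrib_right)
  show "a \<odot>\<^bsub>?F\<^esub> v \<in> gr ?F (int m + n)" if "a \<in> A m" "v \<in> gr ?F n" for m n a v
  proof -
    have "a \<in> AZ (int m)" using that(1) by (simp add: AZ_def)
    then have "a * v k \<in> AZ (int m + n - d k)" if "k \<in> I" for k
      using AZ_mult[of a "int m" "v k" "n - d k"] \<open>v \<in> gr ?F n\<close> that by (simp add: add_diff_eq)
    then show ?thesis using that(2) by (auto simp: mult.assoc)
  qed
  fix v assume v: "v \<in> carrier ?F"
  let ?c = "\<lambda>n k. part (v k) (n - d k)"
  have cgr: "?c n \<in> gr ?F n" for n
  proof -
    have "part (v k) (n - d k) * e (i k) = part (v k) (n - d k)" if "k \<in> I" for k
      using part_mult_right[OF e_AZ[OF iI[OF that]], of "v k" "n - d k"] v that by simp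
    then show ?thesis using v part_AZ by (simp add: part_zero)
  qed
  have cun: "c = ?c" if c: "\<forall>n. c n \<in> gr ?F n" "finite {n. c n \<noteq> \<zero>\<^bsub>?F\<^esub>}"
    "v = (\<Oplus>\<^bsub>?F\<^esub>n\<in>{n. c n \<noteq> \<zero>\<^bsub>?F\<^esub>}. c n)" for c
  proof (intro ext)
    fix n k
    have vk: "v k = (\<Sum>n | c n \<noteq> \<zero>\<^bsub>?F\<^esub>. c n k)"
      by (rule fun_cong[OF trans[OF c(3) gfree_finsum[OF c(2)]]]) (use c(1) in auto)
    show "c n k = ?c n k"
    proof (cases "k \<in> I")
      case True
      let ?b = "\<lambda>m. c (m + d k) k" and ?S = "{n. c n \<noteq> \<zero>\<^bsub>?F\<^esub>}"
      have "part (v k) = ?b"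
      proof (rule part_unique[of _ "(\<lambda>n. n - d k) ` ?S"])
        show "?b m \<in> AZ m" for m using gfree_grD[OF c(1)[THEN spec, of "m + d k"] True] by simp
        show "?b m = 0" if "m \<notin> (\<lambda>n. n - d k) ` ?S" for m
        proof -
          have "m + d k \<notin> ?S" using that by (auto simp: image_iff)
          then show ?thesis by simp
        qed
        show "v k = (\<Sum>m\<in>(\<lambda>n. n - d k) ` ?S. ?b m)"
          unfolding vk by (subst sum.reindex) (auto simp: inj_on_def)
      qed (use c(2) in simp)
      then show ?thesis by simp
    next
      case False
      then have "c n k = 0" "v k = 0" using c(1)[THEN spec, of n] v by auto
      then show ?thesis by (simp add: part_zero)
    qed
  qed
  have fin': "finite {n. ?c n \<noteq> \<zero>\<^bsub>?F\<^esub>}"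
  proof (rule finite_subset)
    show "{n. ?c n \<noteq> \<zero>\<^bsub>?F\<^esub>} \<subseteq> (\<Union>k\<in>I. (\<lambda>n. n + d k) ` {n. part (v k) n \<noteq> 0})"
    proof
      fix n assume "n \<in> {n. ?c n \<noteq> \<zero>\<^bsub>?F\<^esub>}"
      then obtain k where k: "part (v k) (n - d k) \<noteq> 0" by (auto simp: fun_eq_iff)
      then have kI: "k \<in> I" using v by (cases "k \<in> I") (auto simp: part_zero)
      have "n \<in> (\<lambda>n. n + d k) ` {n. part (v k) n \<noteq> 0}"
        by (rule image_eqI[of _ _ "n - d k"]) (use k in auto)
      then show "n \<in> (\<Union>k\<in>I. (\<lambda>n. n + d k) ` {n. part (v k) n \<noteq> 0})" using kI by blast
    qed
    show "finite (\<Union>k\<in>I. (\<lambda>n. n + d k) ` {n. part (v k) n \<noteq> 0})"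
      using fin part_finite by simp
  qed
  have csum: "v = (\<Oplus>\<^bsub>?F\<^esub>n\<in>{n. ?c n \<noteq> \<zero>\<^bsub>?F\<^esub>}. ?c n)"
  proof (rule trans[OF _ gfree_finsum[OF fin', symmetric]])
    let ?S = "{n. ?c n \<noteq> \<zero>\<^bsub>?F\<^esub>}"
    show "v = (\<lambda>k. \<Sum>n\<in>?S. ?c n k)"
    proof
      fix k
      have "v k = (\<Sum>n\<in>(\<lambda>n. n - d k) ` ?S. part (v k) n)"
      proof (rule part_sum')
        show "{n. part (v k) n \<noteq> 0} \<subseteq> (\<lambda>n. n - d k) ` ?S"
        proof
          fix m assume "m \<in> {n. part (v k) n \<noteq> 0}"
          then have "?c (m + d k) k \<noteq> 0" by simp
          then have "?c (m + d k) \<noteq> \<zero>\<^bsub>?F\<^esub>"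
            unfolding gfree_simps by (rule contrapos_nn) (rule fun_cong)
          then show "m \<in> (\<lambda>n. n - d k) ` ?S" by (intro image_eqI[of _ _ "m + d k"]) auto
        qed
      qed (use fin' in simp)
      also have "\<dots> = (\<Sum>n\<in>?S. ?c n k)" by (subst sum.reindex) (auto simp: inj_on_def)
      finally show "v k = (\<Sum>n\<in>?S. ?c n k)" .
    qed
  qed (use cgr in auto)
  show "\<exists>!c. (\<forall>n. c n \<in> gr ?F n) \<and> finite {n. c n \<noteq> \<zero>\<^bsub>?F\<^esub>} \<and>
      v = (\<Oplus>\<^bsub>?F\<^esub>n\<in>{n. c n \<noteq> \<zero>\<^bsub>?F\<^esub>}. c n)"
  proof (rule ex1I)
    show "(\<forall>n. ?c n \<in> gr ?F n) \<and> finite {n. ?c n \<noteq> \<zero>\<^bsub>?F\<^esub>} \<and>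
      v = (\<Oplus>\<^bsub>?F\<^esub>n\<in>{n. ?c n \<noteq> \<zero>\<^bsub>?F\<^esub>}. ?c n)"
      by (intro conjI allI cgr fin' csum)
  next
    fix c assume "(\<forall>n. c n \<in> gr ?F n) \<and> finite {n. c n \<noteq> \<zero>\<^bsub>?F\<^esub>} \<and>
      v = (\<Oplus>\<^bsub>?F\<^esub>n\<in>{n. c n \<noteq> \<zero>\<^bsub>?F\<^esub>}. c n)"
    then show "c = ?c" by (elim conjE) (rule cun)
  qed
qed (auto simp: mult.assoc distrib_left distrib_right)

text \<open>The generator \<open>e\<^bsub>i k\<^esub>\<close> of the summand with index \<open>k\<close>.\<close>

definition gunit :: "(nat \<Rightarrow> nat) \<Rightarrow> nat \<Rightarrow> nat \<Rightarrow> 'a" where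
  "gunit i k = (\<lambda>j. if j = k then e (i k) else 0)"

lemma gunit_gr: "k \<in> I \<Longrightarrow> i k \<in> {1..r} \<Longrightarrow> gunit i k \<in> gr (gfree I i d) (d k)"
  using e_AZ[of "i k"] e_idem[of "i k"] by (auto simp: gunit_def)

lemma gunit_carrier: "k \<in> I \<Longrightarrow> i k \<in> {1..r} \<Longrightarrow> gunit i k \<in> carrier (gfree I i d)"
  using e_idem[of "i k"] by (auto simp: gunit_def)

lemma gfree_expand:
  assumes "finite I" "\<And>k. k \<in> I \<Longrightarrow> i k \<in> {1..r}" "v \<in> carrier (gfree I i d)"
  shows "v = (\<Oplus>\<^bsub>gfree I i d\<^esub>k\<in>I. v k \<odot>\<^bsub>gfree I i d\<^esub> gunit i k)"
proof (rule trans[OF _ gfree_finsum[OF assms(1), symmetric]])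
  show "v = (\<lambda>j. \<Sum>k\<in>I. (v k \<odot>\<^bsub>gfree I i d\<^esub> gunit i k) j)"
  proof
    fix j
    have "(\<Sum>k\<in>I. (v k \<odot>\<^bsub>gfree I i d\<^esub> gunit i k) j) = (\<Sum>k\<in>I. if k = j then v j else 0)"
      by (rule sum.cong) (use assms(3) in \<open>auto simp: gunit_def\<close>)
    also have "\<dots> = v j" using assms by auto
    finally show "v j = (\<Sum>k\<in>I. (v k \<odot>\<^bsub>gfree I i d\<^esub> gunit i k) j)" by simp
  qed
  show "v k \<odot>\<^bsub>gfree I i d\<^esub> gunit i k \<in> carrier (gfree I i d)" if "k \<in> I" for k
    using that assms(2)[OF that] e_idem[of "i k"] by (auto simp: gunit_def mult.assoc)
qed

lemma hom_gfree:
  assumes "finite I" "\<And>k. k \<in> I \<Longrightarrow> i k \<in> {1..r}" "graded_module A N" "f \<in> gr_hom (gfree I i d) N"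
    "v \<in> carrier (gfree I i d)"
  shows "f v = (\<Oplus>\<^bsub>N\<^esub>k\<in>I. v k \<odot>\<^bsub>N\<^esub> f (gunit i k))"
proof -
  have G: "graded_module A (gfree I i d)" by (rule graded_gfree) (use assms in auto)
  interpret G: gmod A "gfree I i d" by (rule gmod.intro) fact
  interpret N: gmod A N by (rule gmod.intro) fact
  have u: "gunit i k \<in> carrier (gfree I i d)" if "k \<in> I" for k
    by (rule gunit_carrier[where k = k and i = i, OF that assms(2)[OF that]])
  have "f v = f (\<Oplus>\<^bsub>gfree I i d\<^esub>k\<in>I. v k \<odot>\<^bsub>gfree I i d\<^esub> gunit i k)"
    by (rule arg_cong[where f = f, OF gfree_expand[OF assms(1,2,5)]])
  also have "\<dots> = (\<Oplus>\<^bsub>N\<^esub>k\<in>I. f (v k \<odot>\<^bsub>gfree I i d\<^esub> gunit i k))"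
    by (rule hom_finsum[OF G assms(3,4,1)]) (rule G.sm_closed[OF u])
  also have "\<dots> = (\<Oplus>\<^bsub>N\<^esub>k\<in>I. v k \<odot>\<^bsub>N\<^esub> f (gunit i k))"
    by (rule N.finsum_cong') (use u hom_sm[OF assms(4)] hom_closed[OF assms(4)] in auto)
  finally show ?thesis .
qed

text \<open>The homomorphism determined by images of the generators; it sends the generator with index \<open>k\<close> to
  \<open>e\<^bsub>i k\<^esub> s k\<close>.\<close>

definition ev :: "nat set \<Rightarrow> (nat \<Rightarrow> nat) \<Rightarrow> (nat \<Rightarrow> int) \<Rightarrow> ('a, 'm) gmodule \<Rightarrow> (nat \<Rightarrow> 'm) \<Rightarrow> (nat \<Rightarrow> 'a) \<Rightarrow> 'm" where
  "ev I i d M s = (\<lambda>f\<in>carrier (gfree I i d). \<Oplus>\<^bsub>M\<^esub>k\<in>I. f k \<odot>\<^bsub>M\<^esub> s k)"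

lemma ev_hom:
  assumes "finite I" "graded_module A M" "\<And>k. k \<in> I \<Longrightarrow> s k \<in> gr M (d k)"
    and iI: "\<And>k. k \<in> I \<Longrightarrow> i k \<in> {1..r}"
  shows "ev I i d M s \<in> gr_hom (gfree I i d) M"
proof -
  interpret M: gmod A M by (rule gmod.intro) fact
  interpret G: gmod A "gfree I i d" by (rule gmod.intro[OF graded_gfree]) (use assms in auto)
  have s: "s k \<in> carrier M" if "k \<in> I" for k by (rule M.gr_carrier[OF assms(3)[OF that]])
  show ?thesis
  proof (rule gr_homI)
    show "ev I i d M s \<in> carrier (gfree I i d) \<rightarrow>\<^sub>E carrier M"
      unfolding ev_def using M.lc_in_carrier[of I s] s by (simp del: gfree_simps)
    show "ev I i d M s (v \<oplus>\<^bsub>gfree I i d\<^esub> w) = ev I i d M s v \<oplus>\<^bsub>M\<^esub> ev I i d M s w"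
      if "v \<in> carrier (gfree I i d)" "w \<in> carrier (gfree I i d)" for v w
    proof -
      have vw: "v \<oplus>\<^bsub>gfree I i d\<^esub> w \<in> carrier (gfree I i d)" by (rule G.a_closed[OF that])
      have "ev I i d M s (v \<oplus>\<^bsub>gfree I i d\<^esub> w) = (\<Oplus>\<^bsub>M\<^esub>k\<in>I. (v k + w k) \<odot>\<^bsub>M\<^esub> s k)"
        unfolding ev_def restrict_apply'[OF vw] by simp
      also have "\<dots> = ev I i d M s v \<oplus>\<^bsub>M\<^esub> ev I i d M s w"
        unfolding ev_def restrict_apply'[OF that(1)] restrict_apply'[OF that(2)] by (rule M.lc_add[OF s])
      finally show ?thesis .
    qed
    show "ev I i d M s (a \<odot>\<^bsub>gfree I i d\<^esub> v) = a \<odot>\<^bsub>M\<^esub> ev I i d M s v" if "v \<in> carrier (gfree I i d)" for a v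
    proof -
      have av: "a \<odot>\<^bsub>gfree I i d\<^esub> v \<in> carrier (gfree I i d)" by (rule G.sm_closed[OF that])
      have "ev I i d M s (a \<odot>\<^bsub>gfree I i d\<^esub> v) = (\<Oplus>\<^bsub>M\<^esub>k\<in>I. (a * v k) \<odot>\<^bsub>M\<^esub> s k)"
        unfolding ev_def restrict_apply'[OF av] by simp
      also have "\<dots> = a \<odot>\<^bsub>M\<^esub> ev I i d M s v"
        unfolding ev_def restrict_apply'[OF that] by (rule M.lc_sm[OF assms(1) s])
      finally show ?thesis .
    qed
    show "ev I i d M s v \<in> gr M n" if v: "v \<in> gr (gfree I i d) n" for n v
      unfolding ev_def restrict_apply'[OF G.gr_carrier[OF v]]
    proof (rule M.finsum_mem[OF assms(1)])
      show "v k \<odot>\<^bsub>M\<^esub> s k \<in> gr M n" if "k \<in> I" for k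
        using AZ_gr[OF assms(2) _ assms(3)[OF that], of "v k" "n - d k"] v that by simp
    qed (use M.gr_add M.gr_carrier in auto)
  qed
qed

lemma ev_gunit:
  assumes "finite I" "graded_module A M" "\<And>k. k \<in> I \<Longrightarrow> s k \<in> gr M (d k)"
    and iI: "\<And>k. k \<in> I \<Longrightarrow> i k \<in> {1..r}" and k: "k \<in> I" and es: "e (i k) \<odot>\<^bsub>M\<^esub> s k = s k"
  shows "ev I i d M s (gunit i k) = s k"
proof -
  interpret M: gmod A M by (rule gmod.intro) fact
  interpret G: gmod A "gfree I i d" by (rule gmod.intro[OF graded_gfree]) (use assms in auto)
  have u: "gunit i k \<in> carrier (gfree I i d)" by (rule gunit_carrier[where k = k and i = i, OF k iI[OF k]])
  have "(\<Oplus>\<^bsub>M\<^esub>l\<in>I. (if l = k then e (i k) else 0) \<odot>\<^bsub>M\<^esub> s l) = e (i k) \<odot>\<^bsub>M\<^esub> s k"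
    by (rule M.lc_unit[OF assms(1) k]) (rule M.gr_carrier[OF assms(3)])
  then show ?thesis
    unfolding ev_def restrict_apply'[OF u] unfolding gunit_def es .
qed

text \<open>Generators that are homogeneous and fixed by one of the idempotents: exactly the data of a
  surjection from some \<open>gfree I i d\<close>.\<close>

definition gens :: "('a, 'm) gmodule \<Rightarrow> nat set \<Rightarrow> (nat \<Rightarrow> nat) \<Rightarrow> (nat \<Rightarrow> int) \<Rightarrow> (nat \<Rightarrow> 'm) \<Rightarrow> bool" where
  "gens M I i d s \<longleftrightarrow> finite I \<and>
     (\<forall>k\<in>I. i k \<in> {1..r} \<and> s k \<in> gr M (d k) \<and> e (i k) \<odot>\<^bsub>M\<^esub> s k = s k) \<and>
     (\<forall>v\<in>carrier M. \<exists>f. v = (\<Oplus>\<^bsub>M\<^esub>k\<in>I. f k \<odot>\<^bsub>M\<^esub> s k))"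

lemma gens_ev:
  assumes "graded_module A M" "gens M I i d s"
  shows "ev I i d M s ` carrier (gfree I i d) = carrier M"
proof
  interpret M: gmod A M by (rule gmod.intro) fact
  have g: "finite I" "\<And>k. k \<in> I \<Longrightarrow> i k \<in> {1..r}" "\<And>k. k \<in> I \<Longrightarrow> s k \<in> gr M (d k)"
    "\<And>k. k \<in> I \<Longrightarrow> e (i k) \<odot>\<^bsub>M\<^esub> s k = s k"
    using assms(2) by (auto simp: gens_def)
  have s: "s k \<in> carrier M" if "k \<in> I" for k by (rule M.gr_carrier[OF g(3)[OF that]])
  have ev: "ev I i d M s \<in> gr_hom (gfree I i d) M" by (rule ev_hom) (use g assms in auto)
  show "ev I i d M s ` carrier (gfree I i d) \<subseteq> carrier M"
    using hom_closed[OF ev] by (rule image_subsetI)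
  show "carrier M \<subseteq> ev I i d M s ` carrier (gfree I i d)"
  proof
    fix v assume "v \<in> carrier M"
    then obtain f where f: "v = (\<Oplus>\<^bsub>M\<^esub>k\<in>I. f k \<odot>\<^bsub>M\<^esub> s k)" using assms(2) unfolding gens_def by meson
    let ?g = "\<lambda>k. if k \<in> I then f k * e (i k) else 0"
    have gc: "?g \<in> carrier (gfree I i d)" using e_idem g(2) by (auto simp: mult.assoc)
    have "v = (\<Oplus>\<^bsub>M\<^esub>k\<in>I. ?g k \<odot>\<^bsub>M\<^esub> s k)"
      unfolding f by (rule M.finsum_cong') (use s g(4) M.sm_assoc in auto)
    then have "v = ev I i d M s ?g" unfolding ev_def restrict_apply'[OF gc] .
    then show "v \<in> ev I i d M s ` carrier (gfree I i d)" using gc by (rule image_eqI)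
  qed
qed

text \<open>Replace each generator by the finitely many elements \<open>e\<^sub>j s\<^sub>n\<close>, where \<open>s\<^sub>n\<close> runs through its
  homogeneous components; they add up to it since \<open>\<Sum>\<^sub>j e\<^sub>j = 1\<close>.\<close>

lemma fin_gen_gens:
  assumes "graded_module A M" "fin_gen M"
  obtains I i d s where "gens M I i d s"
proof -
  interpret M: gmod A M by (rule gmod.intro) fact
  obtain S where S: "finite S" "S \<subseteq> carrier M" "\<And>v. v \<in> carrier M \<Longrightarrow> \<exists>c. v = (\<Oplus>\<^bsub>M\<^esub>s\<in>S. c s \<odot>\<^bsub>M\<^esub> s)"
    using assms(2) unfolding fin_gen_def by meson
  let ?T = "SIGMA s:S. {n. M.gcomp s n \<noteq> \<zero>\<^bsub>M\<^esub>} \<times> {1..r}"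
  have finT: "finite ?T"
    by (intro finite_SigmaI S(1) finite_cartesian_product M.gcomp_finite subsetD[OF S(2)]) auto
  obtain h where h: "bij_betw h {0..<card ?T} ?T"
    using ex_bij_betw_nat_finite[OF finT] by auto
  let ?I = "{0..<card ?T}"
  let ?i = "\<lambda>k. snd (snd (h k))" and ?d = "\<lambda>k. fst (snd (h k))"
  let ?s = "\<lambda>k. e (?i k) \<odot>\<^bsub>M\<^esub> M.gcomp (fst (h k)) (?d k)"
  have hT: "fst (h k) \<in> S" "?i k \<in> {1..r}" if "k \<in> ?I" for k
    using bij_betwE[OF h, THEN bspec, OF that] by (auto simp: mem_Sigma_iff)
  have hc: "fst (h k) \<in> carrier M" if "k \<in> ?I" for k using hT(1)[OF that] S(2) by auto
  have sgr: "?s k \<in> gr M (?d k)" if "k \<in> ?I" for k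
    using AZ_gr[OF assms(1) e_AZ[OF hT(2)[OF that]] M.gcomp_gr[OF hc[OF that], of "?d k"]] by simp
  have sc: "?s k \<in> carrier M" if "k \<in> ?I" for k by (rule M.gr_carrier[OF sgr[OF that]])
  let ?lc = "\<lambda>f. \<Oplus>\<^bsub>M\<^esub>k\<in>?I. f k \<odot>\<^bsub>M\<^esub> ?s k"
  let ?U = "range ?lc"
  have lcadd: "?lc (\<lambda>k. f k + g k) = ?lc f \<oplus>\<^bsub>M\<^esub> ?lc g" for f g
    by (rule M.lc_add) (rule sc)
  have lcsm: "?lc (\<lambda>k. a * f k) = a \<odot>\<^bsub>M\<^esub> ?lc f" for a f
    by (rule M.lc_sm) (simp, rule sc)
  have U0: "\<zero>\<^bsub>M\<^esub> \<in> ?U"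
  proof (rule image_eqI[of _ _ "\<lambda>_. 0"])
    show "\<zero>\<^bsub>M\<^esub> = ?lc (\<lambda>_. 0)"
      by (rule M.add.finprod_one_eqI[symmetric]) (rule M.sm_zero_l[OF sc])
  qed simp
  have Uadd: "v \<oplus>\<^bsub>M\<^esub> w \<in> ?U" if vw: "v \<in> ?U" "w \<in> ?U" for v w
  proof -
    obtain f g where "v = ?lc f" "w = ?lc g" using vw by auto
    then have "v \<oplus>\<^bsub>M\<^esub> w = ?lc (\<lambda>k. f k + g k)" by (simp only: lcadd)
    then show ?thesis by (rule range_eqI[of _ ?lc "\<lambda>k. f k + g k"])
  qed
  have Usm: "a \<odot>\<^bsub>M\<^esub> v \<in> ?U" if v: "v \<in> ?U" for a v
  proof -
    obtain f where "v = ?lc f" using v by auto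
    then have "a \<odot>\<^bsub>M\<^esub> v = ?lc (\<lambda>k. a * f k)" by (simp only: lcsm)
    then show ?thesis by (rule range_eqI[of _ ?lc "\<lambda>k. a * f k"])
  qed
  have Uc: "?U \<subseteq> carrier M" by (rule image_subsetI, rule M.lc_in_carrier, rule sc)
  have Us: "?s k \<in> ?U" if "k \<in> ?I" for k
  proof (rule image_eqI)
    have "?lc (\<lambda>l. if l = k then 1 else 0) = 1 \<odot>\<^bsub>M\<^esub> ?s k"
      by (rule M.lc_unit) (use that sc in auto)
    then show "?s k = ?lc (\<lambda>l. if l = k then 1 else 0)" using M.sm_one[OF sc[OF that]] by (rule_tac sym) (rule trans)
  qed simp
  have Ugc: "M.gcomp s n \<in> ?U" if s: "s \<in> S" for s n
  proof (cases "M.gcomp s n = \<zero>\<^bsub>M\<^esub>")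
    case False
    have sM: "s \<in> carrier M" using s S(2) by auto
    have ej: "e j \<odot>\<^bsub>M\<^esub> M.gcomp s n \<in> ?U" if "j \<in> {1..r}" for j
    proof -
      have "(s, n, j) \<in> ?T" using s False that by auto
      then obtain k where k: "k \<in> ?I" "h k = (s, n, j)"
        using h unfolding bij_betw_def by (metis (no_types, lifting) imageE)
      show ?thesis using Us[OF k(1)] unfolding k(2) by simp
    qed
    have "M.gcomp s n = (\<Sum>j\<in>{1..r}. e j) \<odot>\<^bsub>M\<^esub> M.gcomp s n" unfolding sum_e using sM by simp
    also have "\<dots> = (\<Oplus>\<^bsub>M\<^esub>j\<in>{1..r}. e j \<odot>\<^bsub>M\<^esub> M.gcomp s n)" by (rule M.sm_sum) (use sM in auto)
    also have "\<dots> \<in> ?U" by (rule M.finsum_mem[OF _ ej U0 Uadd Uc]) simp_all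
    finally show ?thesis .
  qed (simp only: U0)
  have US: "s \<in> ?U" if s: "s \<in> S" for s
  proof -
    have sM: "s \<in> carrier M" using s S(2) by auto
    have "(\<Oplus>\<^bsub>M\<^esub>n\<in>{n. M.gcomp s n \<noteq> \<zero>\<^bsub>M\<^esub>}. M.gcomp s n) \<in> ?U"
      by (rule M.finsum_mem[OF M.gcomp_finite[OF sM] Ugc[OF s] U0 Uadd Uc])
    then show ?thesis by (subst M.gcomp_sum[OF sM])
  qed
  have "gens M ?I ?i ?d ?s"
    unfolding gens_def
  proof (intro conjI ballI)
    fix k assume k: "k \<in> ?I"
    show "?i k \<in> {1..r}" by (rule hT(2)[OF k])
    show "?s k \<in> gr M (?d k)" by (rule sgr[OF k])
    show "e (?i k) \<odot>\<^bsub>M\<^esub> ?s k = ?s k"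
      using M.sm_assoc[of "M.gcomp (fst (h k)) (?d k)" "e (?i k)" "e (?i k)"] hc[OF k] e_idem[OF hT(2)[OF k]] by simp
  next
    fix v assume "v \<in> carrier M"
    then obtain c where c: "v = (\<Oplus>\<^bsub>M\<^esub>s\<in>S. c s \<odot>\<^bsub>M\<^esub> s)" using S(3) by blast
    have "v \<in> ?U" unfolding c by (rule M.finsum_mem[OF S(1) Usm[OF US] U0 Uadd Uc])
    then show "\<exists>f. v = ?lc f" by (simp add: image_iff)
  qed simp
  then show thesis by (rule that)
qed

text \<open>Used to contradict minimality of a generating family.\<close>

lemma gens_drop:
  assumes M: "graded_module A M" and g: "gens M I i d s" and k: "k \<in> I"
    and sk: "s k = (\<Oplus>\<^bsub>M\<^esub>l\<in>I - {k}. g l \<odot>\<^bsub>M\<^esub> s l)"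
  shows "gens M (I - {k}) i d s"
proof -
  interpret M: gmod A M by (rule gmod.intro) fact
  have fin: "finite I" and sdeg: "\<And>k. k \<in> I \<Longrightarrow> s k \<in> gr M (d k)" using g by (auto simp: gens_def)
  have s: "s k \<in> carrier M" if "k \<in> I" for k by (rule M.gr_carrier[OF sdeg[OF that]])
  have "\<exists>f'. v = (\<Oplus>\<^bsub>M\<^esub>l\<in>I - {k}. f' l \<odot>\<^bsub>M\<^esub> s l)" if v: "v \<in> carrier M" for v
  proof -
    obtain f where f: "v = (\<Oplus>\<^bsub>M\<^esub>k\<in>I. f k \<odot>\<^bsub>M\<^esub> s k)" using g v unfolding gens_def by meson
    have "v = f k \<odot>\<^bsub>M\<^esub> s k \<oplus>\<^bsub>M\<^esub> (\<Oplus>\<^bsub>M\<^esub>l\<in>I - {k}. f l \<odot>\<^bsub>M\<^esub> s l)"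
      unfolding f by (rule M.lc_split[OF fin k]) (use s in auto)
    also have "f k \<odot>\<^bsub>M\<^esub> s k = (\<Oplus>\<^bsub>M\<^esub>l\<in>I - {k}. (f k * g l) \<odot>\<^bsub>M\<^esub> s l)"
      by (subst sk) (rule M.lc_sm[symmetric], use fin s in auto)
    also have "\<dots> \<oplus>\<^bsub>M\<^esub> (\<Oplus>\<^bsub>M\<^esub>l\<in>I - {k}. f l \<odot>\<^bsub>M\<^esub> s l) = (\<Oplus>\<^bsub>M\<^esub>l\<in>I - {k}. (f k * g l + f l) \<odot>\<^bsub>M\<^esub> s l)"
      by (rule M.lc_add[symmetric]) (use s in auto)
    finally show ?thesis by (rule exI[of _ "\<lambda>l. f k * g l + f l"])
  qed
  then show ?thesis using g by (auto simp: gens_def)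
qed

lemma fin_gen_gfree:
  assumes "finite I" "\<And>k. k \<in> I \<Longrightarrow> i k \<in> {1..r}"
  shows "fin_gen (gfree I i d)"
  unfolding fin_gen_def
proof (rule exI[of _ "gunit i ` I"], intro conjI ballI)
  interpret G: gmod A "gfree I i d" by (rule gmod.intro[OF graded_gfree]) (use assms in auto)
  have u: "gunit i k \<in> carrier (gfree I i d)" if "k \<in> I" for k
    by (rule gunit_carrier[where k = k and i = i, OF that assms(2)[OF that]])
  show "finite (gunit i ` I)" using assms(1) by simp
  show "gunit i ` I \<subseteq> carrier (gfree I i d)" using u by (rule image_subsetI)
  fix v assume v: "v \<in> carrier (gfree I i d)"
  have inj: "inj_on (gunit i) I"
  proof (rule inj_onI)
    fix k l assume kl: "k \<in> I" "l \<in> I" "gunit i k = gunit i l"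
    show "k = l"
    proof (rule ccontr)
      assume "k \<noteq> l"
      then have "e (i k) = 0" using fun_cong[OF kl(3), of k] by (simp add: gunit_def)
      then show False using e_nz[OF assms(2)[OF kl(1)]] by (rule notE[rotated])
    qed
  qed
  let ?c = "\<lambda>s. v (inv_into I (gunit i) s)"
  have "(\<Oplus>\<^bsub>gfree I i d\<^esub>s\<in>gunit i ` I. ?c s \<odot>\<^bsub>gfree I i d\<^esub> s) = (\<Oplus>\<^bsub>gfree I i d\<^esub>k\<in>I. ?c (gunit i k) \<odot>\<^bsub>gfree I i d\<^esub> gunit i k)"
    by (rule G.add.finprod_reindex[OF _ inj])
      (rule Pi_I, erule imageE, simp only:, rule G.sm_closed, rule u)
  also have "\<dots> = (\<Oplus>\<^bsub>gfree I i d\<^esub>k\<in>I. v k \<odot>\<^bsub>gfree I i d\<^esub> gunit i k)"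
    by (rule G.finsum_cong'[OF refl])
      (rule Pi_I, rule G.sm_closed, erule u, simp only: inv_into_f_f[OF inj])
  finally have eq: "(\<Oplus>\<^bsub>gfree I i d\<^esub>s\<in>gunit i ` I. ?c s \<odot>\<^bsub>gfree I i d\<^esub> s) =
    (\<Oplus>\<^bsub>gfree I i d\<^esub>k\<in>I. v k \<odot>\<^bsub>gfree I i d\<^esub> gunit i k)" .
  have "v = (\<Oplus>\<^bsub>gfree I i d\<^esub>k\<in>I. v k \<odot>\<^bsub>gfree I i d\<^esub> gunit i k)"
    by (rule gfree_expand) (rule assms(1), erule assms(2), rule v)
  then have "v = (\<Oplus>\<^bsub>gfree I i d\<^esub>s\<in>gunit i ` I. ?c s \<odot>\<^bsub>gfree I i d\<^esub> s)"
    unfolding eq .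
  then show "\<exists>c. v = (\<Oplus>\<^bsub>gfree I i d\<^esub>s\<in>gunit i ` I. c s \<odot>\<^bsub>gfree I i d\<^esub> s)" by (rule exI[of _ ?c])
qed

text \<open>Lift the image of each generator and keep the component of its degree.\<close>

lemma projective_gfree:
  assumes fin: "finite I" and iI: "\<And>k. k \<in> I \<Longrightarrow> i k \<in> {1..r}"
  shows "fg_gr_projective A (gfree I i d)"
  unfolding fg_gr_projective_def gr_projective_def
proof (intro conjI allI impI ballI)
  show G: "graded_module A (gfree I i d)" by (rule graded_gfree[OF assms])
  show "fin_gen (gfree I i d)" by (rule fin_gen_gfree[OF assms])
  fix M N :: "'a univ_gmodule" and g f
  assume M: "graded_module A M" and N: "graded_module A N" and g: "g \<in> gr_hom M N"
    and f: "f \<in> gr_hom (gfree I i d) N" and onto: "g ` carrier M = carrier N"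
  interpret M: gmod A M by (rule gmod.intro) fact
  interpret N: gmod A N by (rule gmod.intro) fact
  have u: "gunit i k \<in> carrier (gfree I i d)" if "k \<in> I" for k
    by (rule gunit_carrier[where k = k and i = i, OF that iI[OF that]])
  have "\<exists>t. t \<in> gr M (d k) \<and> g t = f (gunit i k)" if k: "k \<in> I" for k
  proof -
    have fu: "f (gunit i k) \<in> gr N (d k)" by (rule hom_gr[OF f gunit_gr[where k = k and i = i, OF k iI[OF k]]])
    then have "f (gunit i k) \<in> g ` carrier M" unfolding onto by (rule N.gr_carrier)
    then obtain y where y: "y \<in> carrier M" "f (gunit i k) = g y" by (rule imageE)
    have "g (M.gcomp y (d k)) = f (gunit i k)"
      using hom_gcomp[OF M N g y(1), of "d k"] N.gcomp_homog[OF fu] y(2) by simp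
    then show ?thesis using M.gcomp_gr[OF y(1), of "d k"] by blast
  qed
  then obtain t where t: "\<And>k. k \<in> I \<Longrightarrow> t k \<in> gr M (d k)" "\<And>k. k \<in> I \<Longrightarrow> g (t k) = f (gunit i k)"
    by metis
  have tc: "t k \<in> carrier M" if "k \<in> I" for k by (rule M.gr_carrier[OF t(1)[OF that]])
  show "\<exists>h\<in>gr_hom (gfree I i d) M. \<forall>v\<in>carrier (gfree I i d). g (h v) = f v"
  proof (intro bexI ballI)
    show "ev I i d M t \<in> gr_hom (gfree I i d) M" by (rule ev_hom[OF fin M t(1) iI])
    fix v assume v: "v \<in> carrier (gfree I i d)"
    have "g (ev I i d M t v) = g (\<Oplus>\<^bsub>M\<^esub>k\<in>I. v k \<odot>\<^bsub>M\<^esub> t k)"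
      unfolding ev_def restrict_apply'[OF v] ..
    also have "\<dots> = (\<Oplus>\<^bsub>N\<^esub>k\<in>I. g (v k \<odot>\<^bsub>M\<^esub> t k))"
      by (rule hom_finsum[OF M N g fin M.sm_closed[OF tc]])
    also have "\<dots> = (\<Oplus>\<^bsub>N\<^esub>k\<in>I. v k \<odot>\<^bsub>N\<^esub> f (gunit i k))"
      by (rule N.finsum_cong') (use tc hom_sm[OF g] t(2) hom_closed[OF f u] in auto)
    also have "\<dots> = f v" by (rule hom_gfree[OF fin iI N f v, symmetric])
    finally show "g (ev I i d M t v) = f v" .
  qed
qed

text \<open>Choose a generating family of minimal size. By minimality the relations between the
  generators have no coefficient of degree 0, so a section of the presentation shows, one degree
  after the other, that there are no relations.\<close>

theorem projective_iso_gfree: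
  assumes "fg_gr_projective A P"
  obtains I i d \<phi> where "finite I" "\<forall>k\<in>I. i k \<in> {1..r}" "\<phi> \<in> gr_hom (gfree I i d) P"
    "bij_betw \<phi> (carrier (gfree I i d)) (carrier P)"
proof -
  have P: "graded_module A P" and fg: "fin_gen P"
    using assms by (auto simp: fg_gr_projective_def gr_projective_def)
  interpret P: gmod A P by (rule gmod.intro) fact
  let ?gens = "\<lambda>(I, i, d, s). gens P I i d s"
  obtain I0 i0 d0 s0 where "gens P I0 i0 d0 s0" using fin_gen_gens[OF P fg] .
  then have ex: "?gens (I0, i0, d0, s0)" by simp
  obtain q where q: "?gens q" "\<And>q'. ?gens q' \<Longrightarrow> card (fst q) \<le> card (fst q')"
    using ex_has_least_nat[of ?gens "(I0, i0, d0, s0)" "\<lambda>q. card (fst q)", OF ex] by blast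
  obtain I i d s where q_eq: "q = (I, i, d, s)" by (cases q)
  have g: "gens P I i d s" using q(1) unfolding q_eq by simp
  have min: "card I \<le> card I'" if "gens P I' i d s" for I'
    using q(2)[of "(I', i, d, s)"] that unfolding q_eq by simp
  have fin: "finite I" and iI: "\<And>k. k \<in> I \<Longrightarrow> i k \<in> {1..r}" and sgr: "\<And>k. k \<in> I \<Longrightarrow> s k \<in> gr P (d k)"
    and es: "\<And>k. k \<in> I \<Longrightarrow> e (i k) \<odot>\<^bsub>P\<^esub> s k = s k"
    using g by (auto simp: gens_def)
  have sc: "s k \<in> carrier P" if "k \<in> I" for k by (rule P.gr_carrier[OF sgr[OF that]])
  let ?F = "gfree I i d"
  have G: "graded_module A ?F" by (rule graded_gfree[OF fin iI])
  interpret G: gmod A ?F by (rule gmod.intro) fact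
  let ?\<pi> = "ev I i d P s"
  have pi: "?\<pi> \<in> gr_hom ?F P" by (rule ev_hom[OF fin P sgr iI])
  have onto: "?\<pi> ` carrier ?F = carrier P" by (rule gens_ev[OF P g])
  have idP: "restrict (\<lambda>v. v) (carrier P) \<in> gr_hom P P"
    by (rule gr_homI) (auto dest: P.gr_carrier)
  obtain \<sigma> where sigma: "\<sigma> \<in> gr_hom P ?F" and ps: "\<And>v. v \<in> carrier P \<Longrightarrow> ?\<pi> (\<sigma> v) = v"
  proof -
    have "\<exists>h\<in>gr_hom P ?F. \<forall>v\<in>carrier P. ?\<pi> (h v) = restrict (\<lambda>v. v) (carrier P) v"
      using assms G P pi idP onto unfolding fg_gr_projective_def gr_projective_def by blast
    then obtain h where h: "h \<in> gr_hom P ?F" "\<And>v. v \<in> carrier P \<Longrightarrow> ?\<pi> (h v) = restrict (\<lambda>v. v) (carrier P) v"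
      by blast
    show thesis by (rule that[OF h(1)]) (use h(2) in simp)
  qed
  have u: "gunit i k \<in> carrier ?F" if "k \<in> I" for k
    by (rule gunit_carrier[where k = k and i = i, OF that iI[OF that]])
  have pu: "?\<pi> (gunit i k) = s k" if "k \<in> I" for k
    by (rule ev_gunit[where k = k and i = i and s = s, OF fin P sgr iI that es[OF that]])
  define w where "w k = gunit i k \<ominus>\<^bsub>?F\<^esub> \<sigma> (s k)" for k
  have wc: "w k \<in> carrier ?F" if "k \<in> I" for k
    unfolding w_def by (rule G.minus_closed[OF u[OF that] hom_closed[OF sigma sc[OF that]]])
  have wgr: "w k \<in> gr ?F (d k)" if "k \<in> I" for k
    unfolding w_def G.minus_eq
    by (rule G.gr_add[OF gunit_gr[where k = k and i = i, OF that iI[OF that]] G.gr_neg[OF hom_gr[OF sigma sgr[OF that]]]])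
  have wker: "?\<pi> (w k) = \<zero>\<^bsub>P\<^esub>" if "k \<in> I" for k
    unfolding w_def hom_minus[OF G P pi u[OF that] hom_closed[OF sigma sc[OF that]]] ps[OF sc[OF that]] pu[OF that]
    by (rule P.minus_eq_zero_iff[OF sc[OF that] sc[OF that], THEN iffD2]) (rule refl)
  \<comment> \<open>A relation is the same combination of the relations \<open>w k\<close>.\<close>
  have vw: "v = (\<Oplus>\<^bsub>?F\<^esub>k\<in>I. v k \<odot>\<^bsub>?F\<^esub> w k)" if v: "v \<in> carrier ?F" and z: "?\<pi> v = \<zero>\<^bsub>P\<^esub>" for v
  proof -
    let ?h = "restrict (\<lambda>v. v \<ominus>\<^bsub>?F\<^esub> \<sigma> (?\<pi> v)) (carrier ?F)"
    have h: "?h \<in> gr_hom ?F ?F"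
    proof (rule gr_homI)
      have c: "\<sigma> (?\<pi> v) \<in> carrier ?F" if "v \<in> carrier ?F" for v
        by (rule hom_closed[OF sigma hom_closed[OF pi that]])
      show "?h \<in> carrier ?F \<rightarrow>\<^sub>E carrier ?F" using c by (simp del: gfree_simps)
      fix v assume v: "v \<in> carrier ?F"
      show "?h (a \<odot>\<^bsub>?F\<^esub> v) = a \<odot>\<^bsub>?F\<^esub> ?h v" for a
        using v c G.sm_closed[OF v, of a]
        by (simp del: gfree_simps add: hom_sm[OF pi] hom_sm[OF sigma] hom_closed[OF pi] G.minus_eq G.sm_r G.sm_neg_r)
      fix v' assume v': "v' \<in> carrier ?F"
      show "?h (v \<oplus>\<^bsub>?F\<^esub> v') = ?h v \<oplus>\<^bsub>?F\<^esub> ?h v'"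
        using v v' c G.a_closed[OF v v']
        by (simp del: gfree_simps add: hom_add[OF pi] hom_add[OF sigma] hom_closed[OF pi] G.minus_eq G.minus_add G.a_ac)
    next
      fix n v assume v: "v \<in> gr ?F n"
      show "?h v \<in> gr ?F n"
        unfolding restrict_apply'[OF G.gr_carrier[OF v]] G.minus_eq
        by (rule G.gr_add[OF v G.gr_neg[OF hom_gr[OF sigma hom_gr[OF pi v]]]])
    qed
    have "v = ?h v"
      unfolding restrict_apply'[OF v] z hom_zero[OF P G sigma] by (rule G.minus_zero_right[OF v, symmetric])
    also have "\<dots> = (\<Oplus>\<^bsub>?F\<^esub>k\<in>I. v k \<odot>\<^bsub>?F\<^esub> ?h (gunit i k))"
      by (rule hom_gfree[OF fin iI G h v])
    also have "\<dots> = (\<Oplus>\<^bsub>?F\<^esub>k\<in>I. v k \<odot>\<^bsub>?F\<^esub> w k)"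
    proof (rule G.finsum_cong'[OF refl])
      show "(\<lambda>k. v k \<odot>\<^bsub>?F\<^esub> w k) \<in> I \<rightarrow> carrier ?F" using G.sm_closed[OF wc] by (rule Pi_I)
      show "v k \<odot>\<^bsub>?F\<^esub> ?h (gunit i k) = v k \<odot>\<^bsub>?F\<^esub> w k" if "k \<in> I" for k
        unfolding restrict_apply'[OF u[OF that]] pu[OF that] w_def ..
    qed
    finally show ?thesis .
  qed
  \<comment> \<open>A nonzero coefficient of degree 0 would make a generator redundant.\<close>
  have unit: "v k = 0" if v: "v \<in> gr ?F n" and z: "?\<pi> v = \<zero>\<^bsub>P\<^esub>" and k: "k \<in> I" and nd: "n \<le> d k" for v n k
  proof (cases "n = d k")
    case False
    have "v k \<in> AZ (n - d k)" using v k by simp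
    then show ?thesis using nd False by (simp add: AZ_def)
  next
    case True
    have vk: "v k \<in> AZ (n - d k)" "v k * e (i k) = v k" using v k by auto
    then have "v k \<in> A 0" using True by (simp add: AZ_def)
    then obtain c where c: "\<forall>i\<in>{1..r}. v k * e i = scl (c i) (e i)" using A0_mult_e by blast
    have vc: "v k = scl (c (i k)) (e (i k))" by (rule trans[OF vk(2)[symmetric] c[rule_format, OF iI[OF k]]])
    show ?thesis
    proof (rule ccontr)
      assume nz: "v k \<noteq> 0"
      then have c0: "c (i k) \<noteq> 0" unfolding vc by auto
      let ?b = "scl (inverse (c (i k))) 1"
      have bv: "?b * v k = e (i k)" unfolding vc using c0 by (simp add: scl_l[symmetric])
      let ?R = "\<Oplus>\<^bsub>P\<^esub>l\<in>I - {k}. v l \<odot>\<^bsub>P\<^esub> s l"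
      have Rc: "?R \<in> carrier P" by (rule P.lc_in_carrier) (use sc in auto)
      have "\<zero>\<^bsub>P\<^esub> = (\<Oplus>\<^bsub>P\<^esub>l\<in>I. v l \<odot>\<^bsub>P\<^esub> s l)"
        unfolding z[symmetric] ev_def restrict_apply'[OF G.gr_carrier[OF v]] ..
      also have "\<dots> = v k \<odot>\<^bsub>P\<^esub> s k \<oplus>\<^bsub>P\<^esub> ?R"
        by (rule P.lc_split[OF fin k]) (use sc in auto)
      finally have z': "v k \<odot>\<^bsub>P\<^esub> s k \<oplus>\<^bsub>P\<^esub> ?R = \<zero>\<^bsub>P\<^esub>" by (rule sym)
      have "?b \<odot>\<^bsub>P\<^esub> (v k \<odot>\<^bsub>P\<^esub> s k \<oplus>\<^bsub>P\<^esub> ?R) = (?b * v k) \<odot>\<^bsub>P\<^esub> s k \<oplus>\<^bsub>P\<^esub> ?b \<odot>\<^bsub>P\<^esub> ?R"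
        using P.sm_r[OF P.sm_closed[OF sc[OF k]] Rc] P.sm_assoc[OF sc[OF k]] by simp
      then have "s k \<oplus>\<^bsub>P\<^esub> ?b \<odot>\<^bsub>P\<^esub> ?R = \<zero>\<^bsub>P\<^esub>" unfolding z' bv es[OF k] by simp
      then have "s k = \<ominus>\<^bsub>P\<^esub> (?b \<odot>\<^bsub>P\<^esub> ?R)"
        using P.minus_equality[OF _ P.sm_closed[OF Rc] sc[OF k]] by simp
      also have "\<dots> = (- ?b) \<odot>\<^bsub>P\<^esub> ?R" by (rule P.sm_neg_l[OF Rc, symmetric])
      also have "\<dots> = (\<Oplus>\<^bsub>P\<^esub>l\<in>I - {k}. (- ?b * v l) \<odot>\<^bsub>P\<^esub> s l)"
        by (rule P.lc_sm[symmetric]) (use fin sc in auto)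
      finally have "gens P (I - {k}) i d s" by (rule gens_drop[OF P g k])
      then have "card I \<le> card (I - {k})" by (rule min)
      then show False using card_Diff1_less[OF fin k] by simp
    qed
  qed
  have step: "v = \<zero>\<^bsub>?F\<^esub>" if v: "v \<in> gr ?F n" and z: "?\<pi> v = \<zero>\<^bsub>P\<^esub>"
    and low: "\<And>k. k \<in> I \<Longrightarrow> d k < n \<Longrightarrow> w k = \<zero>\<^bsub>?F\<^esub>" for v n
  proof -
    have "v k \<odot>\<^bsub>?F\<^esub> w k = \<zero>\<^bsub>?F\<^esub>" if k: "k \<in> I" for k
    proof (cases "d k < n")
      case True
      show ?thesis unfolding low[OF k True] by (rule G.sm_zero_r)
    next
      case False
      then have "v k = 0" using unit[OF v z k] by simp
      then show ?thesis using G.sm_zero_l[OF wc[OF k]] by simp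
    qed
    then have "(\<Oplus>\<^bsub>?F\<^esub>k\<in>I. v k \<odot>\<^bsub>?F\<^esub> w k) = \<zero>\<^bsub>?F\<^esub>" by (rule G.add.finprod_one_eqI)
    then show ?thesis by (rule trans[OF vw[OF G.gr_carrier[OF v] z]])
  qed
  \<comment> \<open>Relations live in degrees at least \<open>D\<close>, and each step excludes one more degree.\<close>
  define D where "D = Min (insert 0 (d ` I))"
  have D: "D \<le> d k" if "k \<in> I" for k unfolding D_def using fin that by auto
  have ker_hom: "\<forall>v n. v \<in> gr ?F n \<longrightarrow> ?\<pi> v = \<zero>\<^bsub>P\<^esub> \<longrightarrow> n < D + int m \<longrightarrow> v = \<zero>\<^bsub>?F\<^esub>" for m
  proof (induction m)
    case 0
    show ?case
    proof (intro allI impI)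
      fix v n assume v: "v \<in> gr ?F n" "?\<pi> v = \<zero>\<^bsub>P\<^esub>" "n < D + int 0"
      show "v = \<zero>\<^bsub>?F\<^esub>" by (rule step[OF v(1,2)]) (use D v(3) in force)
    qed
  next
    case (Suc m)
    show ?case
    proof (intro allI impI)
      fix v n assume v: "v \<in> gr ?F n" "?\<pi> v = \<zero>\<^bsub>P\<^esub>" "n < D + int (Suc m)"
      show "v = \<zero>\<^bsub>?F\<^esub>"
      proof (rule step[OF v(1,2)])
        fix k assume k: "k \<in> I" "d k < n"
        show "w k = \<zero>\<^bsub>?F\<^esub>"
          using Suc.IH[rule_format, OF wgr[OF k(1)] wker[OF k(1)]] k(2) v(3) by simp
      qed
    qed
  qed
  have ker: "v = \<zero>\<^bsub>?F\<^esub>" if v: "v \<in> carrier ?F" and z: "?\<pi> v = \<zero>\<^bsub>P\<^esub>" for v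
  proof -
    have 0: "G.gcomp v n = \<zero>\<^bsub>?F\<^esub>" for n
    proof -
      have "?\<pi> (G.gcomp v n) = \<zero>\<^bsub>P\<^esub>"
        unfolding hom_gcomp[OF G P pi v, symmetric] z P.gcomp_zero ..
      then show ?thesis
        using ker_hom[rule_format, OF G.gcomp_gr[OF v], of n "nat (n - D + 1)"] by simp
    qed
    have "(\<Oplus>\<^bsub>?F\<^esub>n\<in>{n. G.gcomp v n \<noteq> \<zero>\<^bsub>?F\<^esub>}. G.gcomp v n) = \<zero>\<^bsub>?F\<^esub>"
      by (rule G.add.finprod_one_eqI) (rule 0)
    then show ?thesis by (rule trans[OF G.gcomp_sum[OF v]])
  qed
  have "inj_on ?\<pi> (carrier ?F)"
  proof (rule inj_onI)
    fix x y assume x: "x \<in> carrier ?F" and y: "y \<in> carrier ?F" and eq: "?\<pi> x = ?\<pi> y"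
    have "?\<pi> (x \<ominus>\<^bsub>?F\<^esub> y) = \<zero>\<^bsub>P\<^esub>"
      unfolding hom_minus[OF G P pi x y] eq
      by (rule P.minus_eq_zero_iff[THEN iffD2]) (use hom_closed[OF pi y] in auto)
    then have "x \<ominus>\<^bsub>?F\<^esub> y = \<zero>\<^bsub>?F\<^esub>" by (rule ker[OF G.minus_closed[OF x y]])
    then show "x = y" using G.minus_eq_zero_iff[OF x y] by blast
  qed
  then have bij: "bij_betw ?\<pi> (carrier ?F) (carrier P)" using onto by (rule bij_betw_imageI)
  have "\<forall>k\<in>I. i k \<in> {1..r}" using iI by blast
  then show thesis by (rule that[OF fin _ pi bij])
qed

end

section \<open>Spaces of graded maps\<close>

text \<open>Generation by a set of homogeneous elements, in a form that applies at once to a direct sum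
  and that shows that a homomorphism is determined by its values on the set.\<close>

definition hgen :: "('a::{ring,monoid_mult}, 'm) gmodule \<Rightarrow> 'm set \<Rightarrow> bool" where
  "hgen M S \<longleftrightarrow> finite S \<and> (\<forall>s\<in>S. \<exists>n. s \<in> gr M n) \<and>
     (\<forall>U. \<zero>\<^bsub>M\<^esub> \<in> U \<longrightarrow> (\<forall>v\<in>U. \<forall>w\<in>U. v \<oplus>\<^bsub>M\<^esub> w \<in> U) \<longrightarrow> (\<forall>a. \<forall>v\<in>U. a \<odot>\<^bsub>M\<^esub> v \<in> U) \<longrightarrow> S \<subseteq> U \<longrightarrow>
        carrier M \<subseteq> U)"

lemma hgen_induct:
  assumes "hgen M S" "\<zero>\<^bsub>M\<^esub> \<in> U" "\<And>v w. v \<in> U \<Longrightarrow> w \<in> U \<Longrightarrow> v \<oplus>\<^bsub>M\<^esub> w \<in> U"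
    "\<And>a v. v \<in> U \<Longrightarrow> a \<odot>\<^bsub>M\<^esub> v \<in> U" "S \<subseteq> U"
  shows "carrier M \<subseteq> U"
  using assms unfolding hgen_def by simp

lemma hom_plus:
  assumes "graded_module A M" "graded_module A N" "f \<in> gr_hom M N" "g \<in> gr_hom M N"
  shows "(\<lambda>v\<in>carrier M. f v \<oplus>\<^bsub>N\<^esub> g v) \<in> gr_hom M N"
proof (rule gr_homI)
  interpret M: gmod A M by (rule gmod.intro) fact
  interpret N: gmod A N by (rule gmod.intro) fact
  note c = hom_closed[OF assms(3)] hom_closed[OF assms(4)]
  show "(\<lambda>v\<in>carrier M. f v \<oplus>\<^bsub>N\<^esub> g v) \<in> carrier M \<rightarrow>\<^sub>E carrier N" using c by simp
  show "(\<lambda>v\<in>carrier M. f v \<oplus>\<^bsub>N\<^esub> g v) (v \<oplus>\<^bsub>M\<^esub> w) =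
      (\<lambda>v\<in>carrier M. f v \<oplus>\<^bsub>N\<^esub> g v) v \<oplus>\<^bsub>N\<^esub> (\<lambda>v\<in>carrier M. f v \<oplus>\<^bsub>N\<^esub> g v) w"
    if "v \<in> carrier M" "w \<in> carrier M" for v w
    using that c by (simp add: hom_add[OF assms(3)] hom_add[OF assms(4)] N.a_ac)
  show "(\<lambda>v\<in>carrier M. f v \<oplus>\<^bsub>N\<^esub> g v) (a \<odot>\<^bsub>M\<^esub> v) = a \<odot>\<^bsub>N\<^esub> (\<lambda>v\<in>carrier M. f v \<oplus>\<^bsub>N\<^esub> g v) v"
    if "v \<in> carrier M" for a v
    using that c by (simp add: hom_sm[OF assms(3)] hom_sm[OF assms(4)] N.sm_r)
  show "(\<lambda>v\<in>carrier M. f v \<oplus>\<^bsub>N\<^esub> g v) v \<in> gr N n" if "v \<in> gr M n" for n v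
    using N.gr_add[OF hom_gr[OF assms(3) that] hom_gr[OF assms(4) that]] M.gr_carrier[OF that] by simp
qed

lemma hom_const_zero:
  assumes "graded_module A M" "graded_module A N"
  shows "(\<lambda>v\<in>carrier M. \<zero>\<^bsub>N\<^esub>) \<in> gr_hom M N"
proof (rule gr_homI)
  interpret M: gmod A M by (rule gmod.intro) fact
  interpret N: gmod A N by (rule gmod.intro) fact
  show "(\<lambda>v\<in>carrier M. \<zero>\<^bsub>N\<^esub>) v \<in> gr N n" if "v \<in> gr M n" for n v
    using M.gr_carrier[OF that] by simp
  show "(\<lambda>v\<in>carrier M. \<zero>\<^bsub>N\<^esub>) \<in> carrier M \<rightarrow>\<^sub>E carrier N" by simp
qed (use gmod.intro[OF assms(1)] gmod.intro[OF assms(2)] in \<open>simp_all add: gmod.sm_closed gmod.sm_zero_r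
    abelian_groupE(1)[OF assms(1)[unfolded graded_module_def, THEN conjunct1]]
    abelian_groupE(2)[OF assms(2)[unfolded graded_module_def, THEN conjunct1]]
    abelian_groupE(5)[OF assms(2)[unfolded graded_module_def, THEN conjunct1]]\<close>)

context galg
begin

lemma sm1 [simp]: "scl c 1 * a = scl c a" "a * scl c 1 = scl c a"
  using scl_l[of c 1 a] scl_r[of c a 1] by simp_all

lemma scl1_AZ: "scl c 1 \<in> AZ 0" and scl1_A: "scl c 1 \<in> A 0"
  using vs.subspace_scale[OF subA oneA] by (simp_all add: AZ_def)

lemma hom_scale:
  assumes "graded_module A M" "graded_module A N" "f \<in> gr_hom M N"
  shows "(\<lambda>v\<in>carrier M. scl c 1 \<odot>\<^bsub>N\<^esub> f v) \<in> gr_hom M N"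
proof (rule gr_homI)
  interpret M: gmod A M by (rule gmod.intro) fact
  interpret N: gmod A N by (rule gmod.intro) fact
  note cl = hom_closed[OF assms(3)]
  let ?g = "\<lambda>v\<in>carrier M. scl c 1 \<odot>\<^bsub>N\<^esub> f v"
  show "?g \<in> carrier M \<rightarrow>\<^sub>E carrier N" using cl by simp
  show "?g (v \<oplus>\<^bsub>M\<^esub> w) = ?g v \<oplus>\<^bsub>N\<^esub> ?g w" if "v \<in> carrier M" "w \<in> carrier M" for v w
    using that cl by (simp add: hom_add[OF assms(3)] N.sm_r)
  show "?g (a \<odot>\<^bsub>M\<^esub> v) = a \<odot>\<^bsub>N\<^esub> ?g v" if "v \<in> carrier M" for a v
    using that cl by (simp add: hom_sm[OF assms(3)] N.sm_assoc[symmetric])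
  show "?g v \<in> gr N n" if "v \<in> gr M n" for n v
    using AZ_gr[OF assms(2) scl1_AZ hom_gr[OF assms(3) that]] M.gr_carrier[OF that] by simp
qed

text \<open>A module over the algebra as a vector space, with the scalars acting through \<open>c \<mapsto> c1\<close>.\<close>

definition kmod :: "('a, 'm) gmodule \<Rightarrow> ('k, 'm) module" where
  "kmod M = \<lparr>carrier = carrier M, mult = undefined, one = undefined, zero = \<zero>\<^bsub>M\<^esub>, add = add M,
     smult = (\<lambda>c v. scl c 1 \<odot>\<^bsub>M\<^esub> v)\<rparr>"

lemma kmod_simps [simp]:
  "carrier (kmod M) = carrier M" "zero (kmod M) = \<zero>\<^bsub>M\<^esub>" "add (kmod M) = add M"
  "smult (kmod M) = (\<lambda>c v. scl c 1 \<odot>\<^bsub>M\<^esub> v)"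
  by (simp_all add: kmod_def)

lemma kspace_kmod:
  assumes "graded_module A M" shows "kspace (kmod M)"
proof (rule kspaceI)
  interpret M: gmod A M by (rule gmod.intro) fact
  show "abelian_group (kmod M)"
  proof (rule abelian_groupI)
    fix x assume "x \<in> carrier (kmod M)"
    then show "\<exists>y\<in>carrier (kmod M). y \<oplus>\<^bsub>kmod M\<^esub> x = \<zero>\<^bsub>kmod M\<^esub>"
      by (intro bexI[of _ "\<ominus>\<^bsub>M\<^esub> x"]) (simp_all add: M.l_neg)
  qed (simp_all add: M.a_ac)
  show "(a + b) \<odot>\<^bsub>kmod M\<^esub> x = a \<odot>\<^bsub>kmod M\<^esub> x \<oplus>\<^bsub>kmod M\<^esub> b \<odot>\<^bsub>kmod M\<^esub> x" if "x \<in> carrier (kmod M)" for a b x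
    using that by (simp add: vs.scale_left_distrib M.sm_l)
  show "(a * b) \<odot>\<^bsub>kmod M\<^esub> x = a \<odot>\<^bsub>kmod M\<^esub> (b \<odot>\<^bsub>kmod M\<^esub> x)" if "x \<in> carrier (kmod M)" for a b x
    using that M.sm_assoc[of x "scl a 1" "scl b 1"] by (simp add: mult.commute)
  show "c \<odot>\<^bsub>kmod M\<^esub> (x \<oplus>\<^bsub>kmod M\<^esub> y) = c \<odot>\<^bsub>kmod M\<^esub> x \<oplus>\<^bsub>kmod M\<^esub> c \<odot>\<^bsub>kmod M\<^esub> y"
    if "x \<in> carrier (kmod M)" "y \<in> carrier (kmod M)" for c x y
    using that by (simp add: M.sm_r)
  show "c \<odot>\<^bsub>kmod M\<^esub> x \<in> carrier (kmod M)" "1 \<odot>\<^bsub>kmod M\<^esub> x = x" if "x \<in> carrier (kmod M)" for c x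
    using that by simp_all
qed

lemma ksubspace_gr:
  assumes "graded_module A M" shows "ksubspace (kmod M) (gr M n)"
proof -
  interpret M: gmod A M by (rule gmod.intro) fact
  show ?thesis unfolding ksubspace_def
    using AZ_gr[OF assms scl1_AZ] M.gr_carrier M.gr_add by (simp add: subset_iff)
qed

lemma has_dim_AZ: "\<exists>d. has_dim (sub_space scl (AZ m)) d"
proof (cases "0 \<le> m")
  case True
  obtain B where B: "finite B" "A (nat m) = vs.span B" using finA by blast
  have "has_dim (sub_space scl (AZ m)) (vs.dim (AZ m))"
    by (rule has_dim_sub_space[OF vs.vector_space_axioms AZ_sub B(1)]) (use B True in \<open>simp add: AZ_def\<close>)
  then show ?thesis by blast
next
  case False
  have "has_dim (sub_space scl (AZ m)) 0"
    by (rule has_dim_trivial[OF kspace_sub_space[OF vs.vector_space_axioms AZ_sub]])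
      (use False in \<open>simp add: AZ_def\<close>)
  then show ?thesis by blast
qed

text \<open>The component of degree \<open>n\<close> is the sum over the generators \<open>s k\<close> of the images of
  \<open>A\<^bsub>n - d k\<^esub>\<close>, which are finite-dimensional.\<close>

lemma gens_fd:
  assumes M: "graded_module A M" and g: "gens M I i d s"
  shows "fd_subspace (kmod M) (gr M n)"
proof -
  interpret M: gmod A M by (rule gmod.intro) fact
  have fin: "finite I" and sgr: "\<And>k. k \<in> I \<Longrightarrow> s k \<in> gr M (d k)" using g by (auto simp: gens_def)
  have sc: "s k \<in> carrier M" if "k \<in> I" for k by (rule M.gr_carrier[OF sgr[OF that]])
  have K: "kspace (kmod M)" by (rule kspace_kmod[OF M])
  define U where "U k = (\<lambda>a. a \<odot>\<^bsub>M\<^esub> s k) ` AZ (n - d k)" for k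
  have U: "fd_subspace (kmod M) (U k)" if k: "k \<in> I" for k
  proof -
    let ?V = "sub_space scl (AZ (n - d k))" and ?f = "\<lambda>a. a \<odot>\<^bsub>M\<^esub> s k"
    have lin: "lin ?V (kmod M) ?f"
    proof (rule linI)
      show "?f (c \<odot>\<^bsub>?V\<^esub> x) = c \<odot>\<^bsub>kmod M\<^esub> ?f x" for c x
        using M.sm_assoc[OF sc[OF k], of "scl c 1" x] by simp
    qed (use sc[OF k] M.sm_l in simp_all)
    obtain D where D: "has_dim ?V D" using has_dim_AZ by blast
    obtain b where "has_dim ((kmod M)\<lparr>carrier := ?f ` carrier ?V\<rparr>) b"
      using has_dim_image[OF D K lin] by blast
    moreover have "ksubspace (kmod M) (?f ` carrier ?V)"
      by (rule ksubspace_image[OF has_dim_kspace[OF D] K lin])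
    ultimately show ?thesis by (auto simp: fd_subspace_def U_def)
  qed
  let ?lc = "\<lambda>J f. \<Oplus>\<^bsub>M\<^esub>k\<in>J. f k \<odot>\<^bsub>M\<^esub> s k"
  define W where "W J = {v. \<exists>f. (\<forall>k\<in>J. f k \<in> AZ (n - d k)) \<and> v = ?lc J f}" for J
  have W: "fd_subspace (kmod M) (W J)" if "J \<subseteq> I" for J
    using finite_subset[OF that fin] that
  proof (induction J rule: finite_induct)
    case empty
    have "W {} = {\<zero>\<^bsub>M\<^esub>}" by (auto simp: W_def)
    then show ?case using fd_subspace_zero[OF K] by simp
  next
    case (insert k J)
    have kJ: "k \<in> I" "J \<subseteq> I" using insert.prems by auto
    have ins: "?lc (insert k J) f = f k \<odot>\<^bsub>M\<^esub> s k \<oplus>\<^bsub>M\<^esub> ?lc J f" for f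
      by (rule M.finsum_insert[OF insert.hyps]) (use sc kJ in auto)
    have "W (insert k J) = {x \<oplus>\<^bsub>kmod M\<^esub> y |x y. x \<in> U k \<and> y \<in> W J}"
    proof (rule equalityI; rule subsetI)
      fix v assume "v \<in> W (insert k J)"
      then obtain f where f: "\<forall>l\<in>insert k J. f l \<in> AZ (n - d l)" "v = ?lc (insert k J) f"
        unfolding W_def by blast
      have "f k \<odot>\<^bsub>M\<^esub> s k \<in> U k" unfolding U_def using f(1) by simp
      moreover have "?lc J f \<in> W J" unfolding W_def using f(1) by auto
      ultimately show "v \<in> {x \<oplus>\<^bsub>kmod M\<^esub> y |x y. x \<in> U k \<and> y \<in> W J}"
        unfolding f(2) ins by auto
    next
      fix v assume "v \<in> {x \<oplus>\<^bsub>kmod M\<^esub> y |x y. x \<in> U k \<and> y \<in> W J}"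
      then obtain a f where af: "a \<in> AZ (n - d k)" "\<forall>l\<in>J. f l \<in> AZ (n - d l)" "v = a \<odot>\<^bsub>M\<^esub> s k \<oplus>\<^bsub>M\<^esub> ?lc J f"
        unfolding W_def U_def by auto
      let ?g = "f(k := a)"
      have "?lc J f = ?lc J ?g"
        by (rule M.finsum_cong') (use insert.hyps sc kJ in auto)
      then have "v = ?lc (insert k J) ?g" unfolding ins af(3) by simp
      then show "v \<in> W (insert k J)" unfolding W_def
        by (intro CollectI exI[of _ ?g] conjI) (use af insert.hyps in auto)
    qed
    then show ?case using fd_subspace_sum[OF K U[OF kJ(1)] insert.IH[OF kJ(2)]] by simp
  qed
  have "gr M n = W I"
  proof (rule equalityI; rule subsetI)
    fix v assume v: "v \<in> gr M n"
    obtain f where f: "v = ?lc I f" using g M.gr_carrier[OF v] unfolding gens_def by meson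
    have "v = M.gcomp v n" using M.gcomp_homog[OF v] by simp
    also have "\<dots> = M.gcomp (?lc I f) n" by (rule arg_cong[where f = "\<lambda>v. M.gcomp v n", OF f])
    also have "\<dots> = (\<Oplus>\<^bsub>M\<^esub>k\<in>I. M.gcomp (f k \<odot>\<^bsub>M\<^esub> s k) n)"
      by (rule M.gcomp_finsum[OF fin]) (rule M.sm_closed, rule sc)
    also have "\<dots> = ?lc I (\<lambda>k. part (f k) (n - d k))"
      by (rule M.finsum_cong') (use gcomp_sm[OF M sgr] sc in auto)
    finally have v_eq: "v = ?lc I (\<lambda>k. part (f k) (n - d k))" .
    show "v \<in> W I" unfolding W_def
      by (rule CollectI, rule exI[of _ "\<lambda>k. part (f k) (n - d k)"], rule conjI[OF ballI[OF part_AZ] v_eq])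
  next
    fix v assume "v \<in> W I"
    then obtain f where f: "\<forall>k\<in>I. f k \<in> AZ (n - d k)" "v = ?lc I f" unfolding W_def by blast
    show "v \<in> gr M n" unfolding f(2)
    proof (rule M.finsum_mem[OF fin])
      show "f k \<odot>\<^bsub>M\<^esub> s k \<in> gr M n" if "k \<in> I" for k
        using AZ_gr[OF M f(1)[rule_format, OF that] sgr[OF that]] by simp
    qed (use M.gr_add M.gr_carrier in auto)
  qed
  then show ?thesis using W[OF order_refl] by simp
qed

lemma gens_hgen:
  assumes M: "graded_module A M" and g: "gens M I i d s"
  shows "hgen M (s ` I)"
  unfolding hgen_def
proof (intro conjI allI impI)
  interpret M: gmod A M by (rule gmod.intro) fact
  have fin: "finite I" and sgr: "\<And>k. k \<in> I \<Longrightarrow> s k \<in> gr M (d k)" using g by (auto simp: gens_def)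
  have sc: "s k \<in> carrier M" if "k \<in> I" for k by (rule M.gr_carrier[OF sgr[OF that]])
  show "finite (s ` I)" using fin by simp
  show "\<forall>s\<in>s ` I. \<exists>n. s \<in> gr M n" using sgr by blast
  fix U assume U: "\<zero>\<^bsub>M\<^esub> \<in> U" "\<forall>v\<in>U. \<forall>w\<in>U. v \<oplus>\<^bsub>M\<^esub> w \<in> U" "\<forall>a. \<forall>v\<in>U. a \<odot>\<^bsub>M\<^esub> v \<in> U" "s ` I \<subseteq> U"
  show "carrier M \<subseteq> U"
  proof
    fix v assume "v \<in> carrier M"
    then obtain f where f: "v = (\<Oplus>\<^bsub>M\<^esub>k\<in>I. f k \<odot>\<^bsub>M\<^esub> s k)" using g unfolding gens_def by meson
    have "(\<Oplus>\<^bsub>M\<^esub>k\<in>I. f k \<odot>\<^bsub>M\<^esub> s k) \<in> U \<inter> carrier M"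
    proof (rule M.finsum_mem[OF fin])
      show "f k \<odot>\<^bsub>M\<^esub> s k \<in> U \<inter> carrier M" if "k \<in> I" for k using U(3,4) sc that by auto
    qed (use U in auto)
    then show "v \<in> U" unfolding f by blast
  qed
qed

text \<open>Families of graded maps between the terms, with no condition on the differentials: the degree
  zero part of the complex of maps from \<open>X\<close> to \<open>Y\<close>. Its part of degree \<open>i\<close> is \<open>gmaps X (translate i Y)\<close>.\<close>

definition gmaps :: "('a, 'm) gcomplex \<Rightarrow> ('a, 'n) gcomplex \<Rightarrow> (int \<Rightarrow> 'm \<Rightarrow> 'n) set" where
  "gmaps X Y = {f. \<forall>i. f i \<in> gr_hom (obj X i) (obj Y i)}"

definition gmap_space :: "('a, 'm) gcomplex \<Rightarrow> ('a, 'n) gcomplex \<Rightarrow> ('k, int \<Rightarrow> 'm \<Rightarrow> 'n) module" where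
  "gmap_space X Y = (chain_map_space scl X Y)\<lparr>carrier := gmaps X Y\<rparr>"

lemma gmap_space_simps [simp]:
  "carrier (gmap_space X Y) = gmaps X Y" "zero (gmap_space X Y) = zero_map X Y"
  "add (gmap_space X Y) = (\<lambda>f g i. \<lambda>v\<in>carrier (obj X i). f i v \<oplus>\<^bsub>obj Y i\<^esub> g i v)"
  "smult (gmap_space X Y) = (\<lambda>c f i. \<lambda>v\<in>carrier (obj X i). scl c 1 \<odot>\<^bsub>obj Y i\<^esub> f i v)"
  by (simp_all add: gmap_space_def chain_map_space_def)

definition gobj :: "('a, 'm) gcomplex \<Rightarrow> bool" where
  "gobj X \<longleftrightarrow> (\<forall>i. graded_module A (obj X i))"

lemma gobjD: "gobj X \<Longrightarrow> graded_module A (obj X i)"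
  by (simp add: gobj_def)

lemma gmapsD: "f \<in> gmaps X Y \<Longrightarrow> f i \<in> gr_hom (obj X i) (obj Y i)"
  by (simp add: gmaps_def)

lemma gmaps_closed: "f \<in> gmaps X Y \<Longrightarrow> v \<in> carrier (obj X i) \<Longrightarrow> f i v \<in> carrier (obj Y i)"
  by (rule hom_closed[OF gmapsD])

lemma gmaps_eqI:
  assumes "f \<in> gmaps X Y" "g \<in> gmaps X Y" "\<And>i v. v \<in> carrier (obj X i) \<Longrightarrow> f i v = g i v"
  shows "f = g"
proof
  fix i show "f i = g i" by (rule hom_eqI[OF gmapsD[OF assms(1)] gmapsD[OF assms(2)] assms(3)])
qed

lemma kspace_gmap:
  assumes X: "gobj X" and Y: "gobj Y"
  shows "kspace (gmap_space X Y)"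
proof -
  let ?V = "gmap_space X Y"
  have M: "gmod A (obj X i)" "gmod A (obj Y i)" for i
    using gobjD[OF X] gobjD[OF Y] by (simp_all add: gmod.intro)
  have ab: "abelian_group (obj Y i)" for i using gobjD[OF Y] by (simp add: graded_module_def)
  have add: "f \<oplus>\<^bsub>?V\<^esub> g \<in> gmaps X Y" if "f \<in> gmaps X Y" "g \<in> gmaps X Y" for f g
    using hom_plus[OF gobjD[OF X] gobjD[OF Y] gmapsD[OF that(1)] gmapsD[OF that(2)]] by (simp add: gmaps_def)
  have sm: "c \<odot>\<^bsub>?V\<^esub> f \<in> gmaps X Y" if "f \<in> gmaps X Y" for c f
    using hom_scale[OF gobjD[OF X] gobjD[OF Y] gmapsD[OF that]] by (simp add: gmaps_def)
  have zero: "zero_map X Y \<in> gmaps X Y"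
    using hom_const_zero[OF gobjD[OF X] gobjD[OF Y]] by (simp add: gmaps_def zero_map_def)
  note cl = gmaps_closed and ag = abelian_groupE[OF ab]
  have AG: "abelian_group ?V"
  proof (rule abelian_groupI)
    show "x \<oplus>\<^bsub>?V\<^esub> y \<in> carrier ?V" if "x \<in> carrier ?V" "y \<in> carrier ?V" for x y
      using add that unfolding gmap_space_simps(1) .
    show "\<zero>\<^bsub>?V\<^esub> \<in> carrier ?V" using zero by simp
    fix x assume x: "x \<in> carrier ?V"
    then have x': "x \<in> gmaps X Y" by simp
    show "\<zero>\<^bsub>?V\<^esub> \<oplus>\<^bsub>?V\<^esub> x = x"
      by (rule gmaps_eqI[OF add _]) (use x' zero cl[OF x'] ag(5) in \<open>simp_all add: zero_map_def\<close>)
    show "\<exists>y\<in>carrier ?V. y \<oplus>\<^bsub>?V\<^esub> x = \<zero>\<^bsub>?V\<^esub>"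
    proof (rule bexI)
      show "(- 1) \<odot>\<^bsub>?V\<^esub> x \<in> carrier ?V" using sm[OF x', of "- 1"] unfolding gmap_space_simps(1) .
      show "(- 1) \<odot>\<^bsub>?V\<^esub> x \<oplus>\<^bsub>?V\<^esub> x = \<zero>\<^bsub>?V\<^esub>"
      proof (rule gmaps_eqI[OF add[OF sm[OF x'] x']])
        show "\<zero>\<^bsub>?V\<^esub> \<in> gmaps X Y" using zero by simp
        fix i v assume v: "v \<in> carrier (obj X i)"
        interpret N: gmod A "obj Y i" by (rule M)
        show "((- 1) \<odot>\<^bsub>?V\<^esub> x \<oplus>\<^bsub>?V\<^esub> x) i v = \<zero>\<^bsub>?V\<^esub> i v"
          using v cl[OF x' v] by (simp add: zero_map_def N.sm_neg_l N.l_neg)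
      qed
    qed
    fix y assume y: "y \<in> carrier ?V"
    then have y': "y \<in> gmaps X Y" by simp
    show "x \<oplus>\<^bsub>?V\<^esub> y = y \<oplus>\<^bsub>?V\<^esub> x"
      by (rule gmaps_eqI[OF add[OF x' y'] add[OF y' x']]) (use cl[OF x'] cl[OF y'] ag(4) in simp)
    fix z assume z: "z \<in> carrier ?V"
    then have z': "z \<in> gmaps X Y" by simp
    show "x \<oplus>\<^bsub>?V\<^esub> y \<oplus>\<^bsub>?V\<^esub> z = x \<oplus>\<^bsub>?V\<^esub> (y \<oplus>\<^bsub>?V\<^esub> z)"
      by (rule gmaps_eqI[OF add[OF add[OF x' y'] z'] add[OF x' add[OF y' z']]])
        (use cl[OF x'] cl[OF y'] cl[OF z'] ag(3) in simp)
  qed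
  show ?thesis
  proof (rule kspaceI[OF AG])
    fix c a b and x assume x: "x \<in> carrier ?V"
    then have x': "x \<in> gmaps X Y" by simp
    note cx = cl[OF x']
    show "c \<odot>\<^bsub>?V\<^esub> x \<in> carrier ?V" using sm[OF x'] by simp
    show "(a + b) \<odot>\<^bsub>?V\<^esub> x = a \<odot>\<^bsub>?V\<^esub> x \<oplus>\<^bsub>?V\<^esub> b \<odot>\<^bsub>?V\<^esub> x"
      by (rule gmaps_eqI[OF sm[OF x'] add[OF sm[OF x'] sm[OF x']]])
        (use cx gmod.sm_l[OF M(2)] in \<open>simp add: vs.scale_left_distrib\<close>)
    show "(a * b) \<odot>\<^bsub>?V\<^esub> x = a \<odot>\<^bsub>?V\<^esub> (b \<odot>\<^bsub>?V\<^esub> x)"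
      by (rule gmaps_eqI[OF sm[OF x'] sm[OF sm[OF x']]])
        (use cx in \<open>simp add: gmod.sm_assoc[OF M(2), symmetric] mult.commute\<close>)
    show "1 \<odot>\<^bsub>?V\<^esub> x = x"
      by (rule gmaps_eqI[OF sm[OF x'] x']) (use cx gmod.sm_one[OF M(2)] in simp)
    fix y assume y: "y \<in> carrier ?V"
    then have y': "y \<in> gmaps X Y" by simp
    show "c \<odot>\<^bsub>?V\<^esub> (x \<oplus>\<^bsub>?V\<^esub> y) = c \<odot>\<^bsub>?V\<^esub> x \<oplus>\<^bsub>?V\<^esub> c \<odot>\<^bsub>?V\<^esub> y"
      by (rule gmaps_eqI[OF sm[OF add[OF x' y']] add[OF sm[OF x'] sm[OF y']]])
        (use cx cl[OF y'] gmod.sm_r[OF M(2)] in simp)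
  qed
qed

definition bounded_cpx :: "('a, 'm) gcomplex \<Rightarrow> bool" where
  "bounded_cpx X \<longleftrightarrow> (\<exists>N. \<forall>i. N < \<bar>i\<bar> \<longrightarrow> carrier (obj X i) = {\<zero>\<^bsub>obj X i\<^esub>})"

text \<open>The condition on objects that makes all spaces of maps finite-dimensional; unlike
  projectivity it is stable under cones with carriers in product types.\<close>

definition tame :: "('a, 'm) gcomplex \<Rightarrow> bool" where
  "tame X \<longleftrightarrow> gobj X \<and> bounded_cpx X \<and>
     (\<forall>i. (\<exists>S. hgen (obj X i) S) \<and> (\<forall>n. fd_subspace (kmod (obj X i)) (gr (obj X i) n)))"

text \<open>The values on homogeneous generators of the finitely many nonzero terms of \<open>X\<close> separate the
  families of maps, and they lie in finite-dimensional graded pieces.\<close>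

lemma gmap_fd:
  assumes X: "tame X" and Y: "tame Y"
  shows "\<exists>d. has_dim (gmap_space X Y) d"
proof -
  have GX: "gobj X" and GY: "gobj Y" using X Y by (auto simp: tame_def)
  obtain N where N: "\<And>i. N < \<bar>i\<bar> \<Longrightarrow> carrier (obj X i) = {\<zero>\<^bsub>obj X i\<^esub>}"
    using X unfolding tame_def bounded_cpx_def by blast
  have "\<forall>i. \<exists>S. hgen (obj X i) S" using X by (simp add: tame_def)
  then obtain S where S: "\<And>i. hgen (obj X i) (S i)" by metis
  then have "\<forall>i s. \<exists>n. s \<in> S i \<longrightarrow> s \<in> gr (obj X i) n" unfolding hgen_def by blast
  then obtain dg where dg: "\<And>i s. s \<in> S i \<Longrightarrow> s \<in> gr (obj X i) (dg i s)" by metis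
  let ?F = "SIGMA i:{-N..N}. S i"
  let ?W = "\<lambda>(i, s). (kmod (obj Y i))\<lparr>carrier := gr (obj Y i) (dg i s)\<rparr>"
  let ?g = "\<lambda>(i, s) f. f i s"
  show ?thesis
  proof (rule has_dim_separating[of _ ?F ?W ?g])
    show "kspace (gmap_space X Y)" by (rule kspace_gmap[OF GX GY])
    show "finite ?F" using S by (intro finite_SigmaI) (auto simp: hgen_def)
    fix t assume t: "t \<in> ?F"
    then obtain i s where ts: "t = (i, s)" "s \<in> S i" by auto
    have sc: "s \<in> carrier (obj X i)" by (rule gmod.gr_carrier[OF gmod.intro[OF gobjD[OF GX]] dg[OF ts(2)]])
    have "lin (gmap_space X Y) (?W (i, s)) (?g (i, s))"
      using hom_gr[OF gmapsD dg[OF ts(2)]] sc by (intro linI) auto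
    then show "lin (gmap_space X Y) (?W t) (?g t)" unfolding ts(1) .
    have "\<exists>d. has_dim (?W (i, s)) d" using Y by (simp add: tame_def fd_subspace_def)
    then show "\<exists>d. has_dim (?W t) d" unfolding ts(1) .
  next
    fix f assume f: "f \<in> carrier (gmap_space X Y)" and z: "\<And>t. t \<in> ?F \<Longrightarrow> ?g t f = \<zero>\<^bsub>?W t\<^esub>"
    have f': "f \<in> gmaps X Y" using f by simp
    have "f i v = \<zero>\<^bsub>obj Y i\<^esub>" if v: "v \<in> carrier (obj X i)" for i v
    proof -
      interpret M: gmod A "obj X i" by (rule gmod.intro[OF gobjD[OF GX]])
      interpret N: gmod A "obj Y i" by (rule gmod.intro[OF gobjD[OF GY]])
      note h = gmapsD[OF f', of i]
      have f0: "f i \<zero>\<^bsub>obj X i\<^esub> = \<zero>\<^bsub>obj Y i\<^esub>" by (rule hom_zero[OF gobjD[OF GX] gobjD[OF GY] h])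
      show ?thesis
      proof (cases "N < \<bar>i\<bar>")
        case True
        then show ?thesis using N[OF True] v f0 by simp
      next
        case False
        then have "i \<in> {- N..N}" unfolding atLeastAtMost_iff by linarith
        then have zi: "f i s = \<zero>\<^bsub>obj Y i\<^esub>" if "s \<in> S i" for s using z[of "(i, s)"] that by simp
        have sc: "s \<in> carrier (obj X i)" if "s \<in> S i" for s by (rule M.gr_carrier[OF dg[OF that]])
        have "carrier (obj X i) \<subseteq> {v \<in> carrier (obj X i). f i v = \<zero>\<^bsub>obj Y i\<^esub>}"
          by (rule hgen_induct[OF S[of i]]) (use f0 zi sc hom_add[OF h] hom_sm[OF h] in auto)
        then show ?thesis using v by blast
      qed
    qed
    then show "f = \<zero>\<^bsub>gmap_space X Y\<^esub>"
      by (intro gmaps_eqI[OF f']) (use hom_const_zero[OF gobjD[OF GX] gobjD[OF GY]] in \<open>simp_all add: zero_map_def gmaps_def\<close>)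
  qed
qed

end

section \<open>Complexes of maps and their Euler characteristic\<close>

lemma obj_translate [simp]: "obj (translate k X) i = obj X (i + k)"
  by (simp add: translate_def)

lemma dif_translate:
  "dif (translate k X) i = (\<lambda>v\<in>carrier (obj X (i + k)).
     if even k then dif X (i + k) v else \<ominus>\<^bsub>obj X (i + k + 1)\<^esub> dif X (i + k) v)"
  by (simp add: translate_def)

lemma dif_hom: "is_complex X \<Longrightarrow> j = i + 1 \<Longrightarrow> dif X i \<in> gr_hom (obj X i) (obj X j)"
  by (simp add: is_complex_def)

lemma dif_dif:
  "is_complex X \<Longrightarrow> v \<in> carrier (obj X i) \<Longrightarrow> j = i + 1 \<Longrightarrow> k = i + 2 \<Longrightarrow> dif X j (dif X i v) = \<zero>\<^bsub>obj X k\<^esub>"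
  by (simp add: is_complex_def)

lemma dif_closed: "is_complex X \<Longrightarrow> v \<in> carrier (obj X i) \<Longrightarrow> j = i + 1 \<Longrightarrow> dif X i v \<in> carrier (obj X j)"
  by (rule hom_closed[OF dif_hom])

context galg
begin

lemma chain_mapsD1: "f \<in> chain_maps X Y \<Longrightarrow> f i \<in> gr_hom (obj X i) (obj Y i)"
  and chain_mapsD2: "f \<in> chain_maps X Y \<Longrightarrow> v \<in> carrier (obj X i) \<Longrightarrow> j = i + 1 \<Longrightarrow> f j (dif X i v) = dif Y i (f i v)"
  by (simp_all add: chain_maps_def)

lemma chain_mapsI:
  assumes "\<And>i. f i \<in> gr_hom (obj X i) (obj Y i)"
    "\<And>i v. v \<in> carrier (obj X i) \<Longrightarrow> f (i + 1) (dif X i v) = dif Y i (f i v)"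
  shows "f \<in> chain_maps X Y"
  using assms by (simp add: chain_maps_def)

lemma chain_gmaps: "f \<in> chain_maps X Y \<Longrightarrow> f \<in> gmaps X Y"
  by (simp add: chain_maps_def gmaps_def)

lemma hom_uminus:
  assumes "graded_module A M" "graded_module A N" "f \<in> gr_hom M N"
  shows "(\<lambda>v\<in>carrier M. \<ominus>\<^bsub>N\<^esub> f v) \<in> gr_hom M N"
proof -
  interpret N: gmod A N by (rule gmod.intro) fact
  have "(\<lambda>v\<in>carrier M. \<ominus>\<^bsub>N\<^esub> f v) = (\<lambda>v\<in>carrier M. scl (- 1) 1 \<odot>\<^bsub>N\<^esub> f v)"
    by (rule restrict_ext) (simp add: N.sm_neg_l hom_closed[OF assms(3)])
  then show ?thesis using hom_scale[OF assms, of "- 1"] by (simp only:)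
qed

lemma gobj_translate: "gobj X \<Longrightarrow> gobj (translate k X)"
  by (simp add: gobj_def)

lemma tame_translate: assumes "tame X" shows "tame (translate k X)"
proof -
  obtain N where N: "\<And>i. N < \<bar>i\<bar> \<Longrightarrow> carrier (obj X i) = {\<zero>\<^bsub>obj X i\<^esub>}"
    using assms unfolding tame_def bounded_cpx_def by blast
  have "carrier (obj (translate k X) i) = {\<zero>\<^bsub>obj (translate k X) i\<^esub>}" if "N + \<bar>k\<bar> < \<bar>i\<bar>" for i
    using N[of "i + k"] that by simp
  then have "bounded_cpx (translate k X)" unfolding bounded_cpx_def by blast
  then show ?thesis using assms gobj_translate[of X k] by (simp add: tame_def)
qed

lemma complex_translate:
  assumes G: "gobj X" and C: "is_complex X"
  shows "is_complex (translate k X)"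
  unfolding is_complex_def
proof (intro allI conjI ballI)
  fix i
  have h: "dif X (i + k) \<in> gr_hom (obj X (i + k)) (obj X (i + k + 1))" by (rule dif_hom[OF C]) simp
  have e: "i + 1 + k = i + k + 1" by simp
  show "dif (translate k X) i \<in> gr_hom (obj (translate k X) i) (obj (translate k X) (i + 1))"
  proof (cases "even k")
    case True
    have "restrict (dif X (i + k)) (carrier (obj X (i + k))) = dif X (i + k)"
      using hom_ext[OF h] by (intro extensional_restrict) (auto simp: PiE_def)
    then show ?thesis using h True by (simp add: dif_translate e)
  next
    case False
    then show ?thesis using hom_uminus[OF gobjD[OF G] gobjD[OF G] h] by (simp add: dif_translate e)
  qed
  fix v assume v: "v \<in> carrier (obj (translate k X) i)"
  then have v': "v \<in> carrier (obj X (i + k))" by simp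
  have dv: "dif X (i + k) v \<in> carrier (obj X (i + k + 1))" by (rule hom_closed[OF h v'])
  have h2: "dif X (i + k + 1) \<in> gr_hom (obj X (i + k + 1)) (obj X (i + k + 2))" by (rule dif_hom[OF C]) simp
  have dd: "dif X (i + k + 1) (dif X (i + k) v) = \<zero>\<^bsub>obj X (i + k + 2)\<^esub>" by (rule dif_dif[OF C v']) simp_all
  interpret M: gmod A "obj X (i + k + 1)" by (rule gmod.intro[OF gobjD[OF G]])
  interpret N: gmod A "obj X (i + k + 2)" by (rule gmod.intro[OF gobjD[OF G]])
  have e2: "i + 2 + k = i + k + 2" "i + k + 1 + 1 = i + k + 2" by simp_all
  show "dif (translate k X) (i + 1) (dif (translate k X) i v) = \<zero>\<^bsub>obj (translate k X) (i + 2)\<^esub>"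
    using v' dv dd hom_neg[OF gobjD[OF G] gobjD[OF G] h2 dv]
    by (simp add: dif_translate e e2 N.add.inv_one)
qed

text \<open>The signs of the two translations multiply.\<close>

lemma translate_translate:
  assumes G: "gobj X" and C: "is_complex X"
  shows "translate j (translate k X) = translate (j + k) X"
proof -
  have "dif (translate j (translate k X)) = dif (translate (j + k) X)"
  proof
    fix i
    have e: "i + j + k = i + (j + k)" "i + j + 1 + k = i + (j + k) + 1" by simp_all
    show "dif (translate j (translate k X)) i = dif (translate (j + k) X) i"
      unfolding dif_translate obj_translate e
    proof (rule restrict_ext)
      fix v assume v: "v \<in> carrier (obj X (i + (j + k)))"
      have dv: "dif X (i + (j + k)) v \<in> carrier (obj X (i + (j + k) + 1))" by (rule dif_closed[OF C v refl])
      interpret M: gmod A "obj X (i + (j + k) + 1)" by (rule gmod.intro[OF gobjD[OF G]])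
      show "(if even j then (\<lambda>v\<in>carrier (obj X (i + (j + k))). if even k then dif X (i + (j + k)) v
                else \<ominus>\<^bsub>obj X (i + (j + k) + 1)\<^esub> dif X (i + (j + k)) v) v
         else \<ominus>\<^bsub>obj X (i + (j + k) + 1)\<^esub> (\<lambda>v\<in>carrier (obj X (i + (j + k))). if even k then dif X (i + (j + k)) v
                else \<ominus>\<^bsub>obj X (i + (j + k) + 1)\<^esub> dif X (i + (j + k)) v) v) =
        (if even (j + k) then dif X (i + (j + k)) v else \<ominus>\<^bsub>obj X (i + (j + k) + 1)\<^esub> dif X (i + (j + k)) v)"
        using v dv by simp
    qed
  qed
  moreover have "obj (translate j (translate k X)) = obj (translate (j + k) X)"
    by (rule ext) (simp add: add.assoc)
  ultimately show ?thesis by (intro gcomplex.equality) simp_all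
qed

lemma translate_0:
  assumes "is_complex X" shows "translate 0 X = X"
proof (rule gcomplex.equality)
  show "obj (translate 0 X) = obj X" by (rule ext) simp
  show "dif (translate 0 X) = dif X"
  proof
    fix i
    have "dif X i \<in> gr_hom (obj X i) (obj X (i + 1))" by (rule dif_hom[OF assms refl])
    then have "restrict (dif X i) (carrier (obj X i)) = dif X i"
      using hom_ext[of "dif X i"] by (intro extensional_restrict) (auto simp: PiE_def)
    then show "dif (translate 0 X) i = dif X i" by (simp add: dif_translate)
  qed
qed simp

definition good :: "('a, 'm) gcomplex \<Rightarrow> bool" where
  "good X \<longleftrightarrow> tame X \<and> is_complex X"

lemma goodD: "good X \<Longrightarrow> tame X" "good X \<Longrightarrow> gobj X" "good X \<Longrightarrow> is_complex X"
  by (auto simp: good_def tame_def)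

lemma good_translate: "good X \<Longrightarrow> good (translate k X)"
  using tame_translate[of X k] complex_translate[of X k] by (simp add: good_def tame_def)

lemma good_gm: "good X \<Longrightarrow> graded_module A (obj X i)"
  by (rule gobjD[OF goodD(2)])

abbreviation "CM X Y \<equiv> chain_map_space scl X Y"

lemma CM_simps [simp]:
  "carrier (CM X Y) = chain_maps X Y" "zero (CM X Y) = zero_map X Y"
  "add (CM X Y) = (\<lambda>f g i. \<lambda>v\<in>carrier (obj X i). f i v \<oplus>\<^bsub>obj Y i\<^esub> g i v)"
  "smult (CM X Y) = (\<lambda>c f i. \<lambda>v\<in>carrier (obj X i). scl c 1 \<odot>\<^bsub>obj Y i\<^esub> f i v)"
  by (simp_all add: chain_map_space_def)

lemma CM_eq: "CM X Y = (gmap_space X Y)\<lparr>carrier := chain_maps X Y\<rparr>"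
  by (simp add: gmap_space_def chain_map_space_def)

lemma zero_map_chain:
  assumes X: "good X" and Y: "good Y" shows "zero_map X Y \<in> chain_maps X Y"
proof (rule chain_mapsI)
  show "zero_map X Y i \<in> gr_hom (obj X i) (obj Y i)" for i
    using hom_const_zero[OF good_gm[OF X] good_gm[OF Y]] by (simp add: zero_map_def)
  fix i v assume v: "v \<in> carrier (obj X i)"
  show "zero_map X Y (i + 1) (dif X i v) = dif Y i (zero_map X Y i v)"
    using v dif_closed[OF goodD(3)[OF X] v refl] hom_zero[OF good_gm[OF Y] good_gm[OF Y] dif_hom[OF goodD(3)[OF Y] refl]]
    by (simp add: zero_map_def)
qed

lemma ksubspace_chain:
  assumes X: "good X" and Y: "good Y"
  shows "ksubspace (gmap_space X Y) (chain_maps X Y)"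
  unfolding ksubspace_def
proof (intro conjI ballI allI)
  interpret V: Module.module univ_ring "gmap_space X Y" by (rule kspace_gmap[OF goodD(2)[OF X] goodD(2)[OF Y]])
  show "chain_maps X Y \<subseteq> carrier (gmap_space X Y)" using chain_gmaps by auto
  show "\<zero>\<^bsub>gmap_space X Y\<^esub> \<in> chain_maps X Y" using zero_map_chain[OF X Y] by simp
  note dX = dif_closed[OF goodD(3)[OF X] _ refl] and hY = dif_hom[OF goodD(3)[OF Y] refl]
  fix f assume f: "f \<in> chain_maps X Y"
  note cf = hom_closed[OF chain_mapsD1[OF f]]
  show "c \<odot>\<^bsub>gmap_space X Y\<^esub> f \<in> chain_maps X Y" for c
  proof (rule chain_mapsI)
    have "c \<odot>\<^bsub>gmap_space X Y\<^esub> f \<in> carrier (gmap_space X Y)"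
      by (rule V.smult_closed) (use chain_gmaps[OF f] in simp_all)
    then show "(c \<odot>\<^bsub>gmap_space X Y\<^esub> f) i \<in> gr_hom (obj X i) (obj Y i)" for i
      unfolding gmap_space_simps(1) by (rule gmapsD)
    fix i v assume v: "v \<in> carrier (obj X i)"
    show "(c \<odot>\<^bsub>gmap_space X Y\<^esub> f) (i + 1) (dif X i v) = dif Y i ((c \<odot>\<^bsub>gmap_space X Y\<^esub> f) i v)"
      using v dX[OF v] cf[OF v] chain_mapsD2[OF f v refl] hom_sm[OF hY cf[OF v]] by simp
  qed
  fix g assume g: "g \<in> chain_maps X Y"
  note cg = hom_closed[OF chain_mapsD1[OF g]]
  show "f \<oplus>\<^bsub>gmap_space X Y\<^esub> g \<in> chain_maps X Y"
  proof (rule chain_mapsI)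
    have "f \<oplus>\<^bsub>gmap_space X Y\<^esub> g \<in> carrier (gmap_space X Y)"
      by (rule V.M.a_closed) (use chain_gmaps[OF f] chain_gmaps[OF g] in simp_all)
    then show "(f \<oplus>\<^bsub>gmap_space X Y\<^esub> g) i \<in> gr_hom (obj X i) (obj Y i)" for i
      unfolding gmap_space_simps(1) by (rule gmapsD)
    fix i v assume v: "v \<in> carrier (obj X i)"
    show "(f \<oplus>\<^bsub>gmap_space X Y\<^esub> g) (i + 1) (dif X i v) = dif Y i ((f \<oplus>\<^bsub>gmap_space X Y\<^esub> g) i v)"
      using v dX[OF v] cf[OF v] cg[OF v] chain_mapsD2[OF f v refl] chain_mapsD2[OF g v refl]
        hom_add[OF hY cf[OF v] cg[OF v]] by simp
  qed
qed

lemma kspace_CM: "good X \<Longrightarrow> good Y \<Longrightarrow> kspace (CM X Y)"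
  unfolding CM_eq by (rule kspace_restrict[OF kspace_gmap ksubspace_chain]) (auto dest: goodD)

lemma CM_fd:
  assumes "good X" "good Y" shows "\<exists>d. has_dim (CM X Y) d"
proof -
  obtain d where d: "has_dim (gmap_space X Y) d" using gmap_fd[OF goodD(1)[OF assms(1)] goodD(1)[OF assms(2)]] by blast
  show ?thesis
    by (rule has_dim_inj[OF kspace_CM[OF assms] _ _ d, of "\<lambda>x. x"])
      (auto simp: lin_def chain_gmaps)
qed

text \<open>The subspace of chain maps that is divided out in \<open>Hom_per\<close>.\<close>

definition null :: "('a, 'm) gcomplex \<Rightarrow> ('a, 'n) gcomplex \<Rightarrow> (int \<Rightarrow> 'm \<Rightarrow> 'n) set" where
  "null X Y = {f \<in> chain_maps X Y. homotopic X Y f (zero_map X Y)}"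

text \<open>The differential of the complex of maps. Its values are the null-homotopic chain maps; with
  the sign in \<open>translate\<close>, its kernel consists of the chain maps of degree \<open>-1\<close>.\<close>

definition map_dif :: "('a, 'm) gcomplex \<Rightarrow> ('a, 'n) gcomplex \<Rightarrow> (int \<Rightarrow> 'm \<Rightarrow> 'n) \<Rightarrow> int \<Rightarrow> 'm \<Rightarrow> 'n" where
  "map_dif X Y h = (\<lambda>p. \<lambda>v\<in>carrier (obj X p). dif Y (p - 1) (h p v) \<oplus>\<^bsub>obj Y p\<^esub> h (p + 1) (dif X p v))"

lemma gmaps_shift: "h \<in> gmaps X (translate (- 1) Y) \<Longrightarrow> j = i - 1 \<Longrightarrow> h i \<in> gr_hom (obj X i) (obj Y j)"
  by (simp add: gmaps_def)

lemma gmaps_shiftI: "(\<And>i. h i \<in> gr_hom (obj X i) (obj Y (i - 1))) \<Longrightarrow> h \<in> gmaps X (translate (- 1) Y)"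
  by (simp add: gmaps_def)

lemma map_dif_parts:
  assumes X: "good X" and Y: "good Y" and h: "h \<in> gmaps X (translate (- 1) Y)" and v: "v \<in> carrier (obj X p)"
  shows "h p v \<in> carrier (obj Y (p - 1))" "dif Y (p - 1) (h p v) \<in> carrier (obj Y p)"
    "h (p + 1) (dif X p v) \<in> carrier (obj Y p)"
proof -
  show 1: "h p v \<in> carrier (obj Y (p - 1))" by (rule hom_closed[OF gmaps_shift[OF h refl] v])
  show "dif Y (p - 1) (h p v) \<in> carrier (obj Y p)" by (rule dif_closed[OF goodD(3)[OF Y] 1]) simp
  show "h (p + 1) (dif X p v) \<in> carrier (obj Y p)"
    by (rule hom_closed[OF gmaps_shift[OF h] dif_closed[OF goodD(3)[OF X] v refl]]) simp
qed

lemma map_dif_chain: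
  assumes X: "good X" and Y: "good Y" and h: "h \<in> gmaps X (translate (- 1) Y)"
  shows "map_dif X Y h \<in> chain_maps X Y"
proof (rule chain_mapsI)
  fix p
  have h1: "h p \<in> gr_hom (obj X p) (obj Y (p - 1))" by (rule gmaps_shift[OF h refl])
  have h2: "h (p + 1) \<in> gr_hom (obj X (p + 1)) (obj Y p)" by (rule gmaps_shift[OF h]) simp
  have dY: "dif Y (p - 1) \<in> gr_hom (obj Y (p - 1)) (obj Y p)" by (rule dif_hom[OF goodD(3)[OF Y]]) simp
  have dX: "dif X p \<in> gr_hom (obj X p) (obj X (p + 1))" by (rule dif_hom[OF goodD(3)[OF X] refl])
  let ?a = "compose (carrier (obj X p)) (dif Y (p - 1)) (h p)" and ?b = "compose (carrier (obj X p)) (h (p + 1)) (dif X p)"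
  have "map_dif X Y h p = (\<lambda>v\<in>carrier (obj X p). ?a v \<oplus>\<^bsub>obj Y p\<^esub> ?b v)"
    unfolding map_dif_def by (rule restrict_ext) (simp add: compose_eq)
  then show "map_dif X Y h p \<in> gr_hom (obj X p) (obj Y p)"
    using hom_plus[OF good_gm[OF X] good_gm[OF Y] hom_comp[OF good_gm[OF X] h1 dY] hom_comp[OF good_gm[OF X] dX h2]]
    by simp
  fix v assume v: "v \<in> carrier (obj X p)"
  have dv: "dif X p v \<in> carrier (obj X (p + 1))" by (rule hom_closed[OF dX v])
  have h3: "h (p + 1 + 1) \<in> gr_hom (obj X (p + 2)) (obj Y (p + 1))"
    using gmaps_shift[OF h, of "p + 1" "p + 2"] by (simp add: add.assoc)
  have dY2: "dif Y p \<in> gr_hom (obj Y p) (obj Y (p + 1))" by (rule dif_hom[OF goodD(3)[OF Y] refl])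
  have z1: "h (p + 1 + 1) (dif X (p + 1) (dif X p v)) = \<zero>\<^bsub>obj Y (p + 1)\<^esub>"
    using dif_dif[OF goodD(3)[OF X] v refl refl] hom_zero[OF good_gm[OF X] good_gm[OF Y] h3] by simp
  note P = map_dif_parts[OF X Y h v]
  have z2: "dif Y p (dif Y (p - 1) (h p v)) = \<zero>\<^bsub>obj Y (p + 1)\<^esub>"
    by (rule dif_dif[OF goodD(3)[OF Y] P(1)]) simp_all
  interpret N: gmod A "obj Y (p + 1)" by (rule gmod.intro[OF good_gm[OF Y]])
  have c: "dif Y p (h (p + 1) (dif X p v)) \<in> carrier (obj Y (p + 1))" by (rule hom_closed[OF dY2 P(3)])
  have "map_dif X Y h (p + 1) (dif X p v) = dif Y p (h (p + 1) (dif X p v)) \<oplus>\<^bsub>obj Y (p + 1)\<^esub> \<zero>\<^bsub>obj Y (p + 1)\<^esub>"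
    using dv z1 by (simp add: map_dif_def)
  moreover have "dif Y p (map_dif X Y h p v) = \<zero>\<^bsub>obj Y (p + 1)\<^esub> \<oplus>\<^bsub>obj Y (p + 1)\<^esub> dif Y p (h (p + 1) (dif X p v))"
    using v z2 hom_add[OF dY2 P(2,3)] by (simp add: map_dif_def)
  ultimately show "map_dif X Y h (p + 1) (dif X p v) = dif Y p (map_dif X Y h p v)"
    using c by simp
qed

lemma homotopic_zero_iff:
  assumes Y: "good Y" and X: "good X" and f: "f \<in> chain_maps X Y"
  shows "homotopic X Y f (zero_map X Y) \<longleftrightarrow> (\<exists>h\<in>gmaps X (translate (- 1) Y). f = map_dif X Y h)"
proof
  assume "homotopic X Y f (zero_map X Y)"
  then obtain h where h: "\<And>i. h i \<in> gr_hom (obj X i) (obj Y (i - 1))"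
    "\<And>i v. v \<in> carrier (obj X i) \<Longrightarrow> f i v = zero_map X Y i v \<oplus>\<^bsub>obj Y i\<^esub>
      (dif Y (i - 1) (h i v) \<oplus>\<^bsub>obj Y i\<^esub> h (i + 1) (dif X i v))"
    unfolding homotopic_def by blast
  have hg: "h \<in> gmaps X (translate (- 1) Y)" by (rule gmaps_shiftI[OF h(1)])
  have "f = map_dif X Y h"
  proof (rule gmaps_eqI[OF chain_gmaps[OF f] chain_gmaps[OF map_dif_chain[OF X Y hg]]])
    fix i v assume v: "v \<in> carrier (obj X i)"
    interpret N: gmod A "obj Y i" by (rule gmod.intro[OF good_gm[OF Y]])
    show "f i v = map_dif X Y h i v"
      using h(2)[OF v] v map_dif_parts[OF X Y hg v] by (simp add: map_dif_def zero_map_def)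
  qed
  then show "\<exists>h\<in>gmaps X (translate (- 1) Y). f = map_dif X Y h" using hg by blast
next
  assume "\<exists>h\<in>gmaps X (translate (- 1) Y). f = map_dif X Y h"
  then obtain h where h: "h \<in> gmaps X (translate (- 1) Y)" "f = map_dif X Y h" by blast
  show "homotopic X Y f (zero_map X Y)"
    unfolding homotopic_def
  proof (intro exI[of _ h] conjI allI ballI)
    show "h i \<in> gr_hom (obj X i) (obj Y (i - 1))" for i by (rule gmaps_shift[OF h(1) refl])
    fix i v assume v: "v \<in> carrier (obj X i)"
    interpret N: gmod A "obj Y i" by (rule gmod.intro[OF good_gm[OF Y]])
    show "f i v = zero_map X Y i v \<oplus>\<^bsub>obj Y i\<^esub> (dif Y (i - 1) (h i v) \<oplus>\<^bsub>obj Y i\<^esub> h (i + 1) (dif X i v))"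
      using v map_dif_parts[OF X Y h(1) v] by (simp add: h(2) map_dif_def zero_map_def)
  qed
qed

lemma map_dif_image:
  assumes "good X" "good Y" shows "map_dif X Y ` gmaps X (translate (- 1) Y) = null X Y"
proof (rule equalityI; rule subsetI)
  fix f assume "f \<in> map_dif X Y ` gmaps X (translate (- 1) Y)"
  then obtain h where h: "h \<in> gmaps X (translate (- 1) Y)" "f = map_dif X Y h" by blast
  have f: "f \<in> chain_maps X Y" unfolding h(2) by (rule map_dif_chain[OF assms h(1)])
  then show "f \<in> null X Y" using homotopic_zero_iff[OF assms(2,1) f] h by (auto simp: null_def)
next
  fix f assume f: "f \<in> null X Y"
  then have c: "f \<in> chain_maps X Y" by (simp add: null_def)
  show "f \<in> map_dif X Y ` gmaps X (translate (- 1) Y)"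
    using homotopic_zero_iff[OF assms(2,1) c] f by (auto simp: null_def)
qed

lemma map_dif_lin:
  assumes X: "good X" and Y: "good Y"
  shows "lin (gmap_space X (translate (- 1) Y)) (CM X Y) (map_dif X Y)"
proof (rule linI)
  interpret V: Module.module univ_ring "gmap_space X (translate (- 1) Y)"
    by (rule kspace_gmap[OF goodD(2)[OF X] goodD(2)[OF good_translate[OF Y]]])
  interpret W: Module.module univ_ring "CM X Y" by (rule kspace_CM[OF X Y])
  fix g assume "g \<in> carrier (gmap_space X (translate (- 1) Y))"
  then have g: "g \<in> gmaps X (translate (- 1) Y)" by simp
  show Dg: "map_dif X Y g \<in> carrier (CM X Y)" using map_dif_chain[OF X Y g] by simp
  note dX = dif_closed[OF goodD(3)[OF X] _ refl]
  have dY: "dif Y (p - 1) \<in> gr_hom (obj Y (p - 1)) (obj Y p)" for p by (rule dif_hom[OF goodD(3)[OF Y]]) simp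
  show "map_dif X Y (c \<odot>\<^bsub>gmap_space X (translate (- 1) Y)\<^esub> g) = c \<odot>\<^bsub>CM X Y\<^esub> map_dif X Y g" for c
  proof (rule gmaps_eqI)
    have cg: "c \<odot>\<^bsub>gmap_space X (translate (- 1) Y)\<^esub> g \<in> gmaps X (translate (- 1) Y)"
      using V.smult_closed[of c g] g by simp
    show "map_dif X Y (c \<odot>\<^bsub>gmap_space X (translate (- 1) Y)\<^esub> g) \<in> gmaps X Y"
      by (rule chain_gmaps[OF map_dif_chain[OF X Y cg]])
    have "c \<odot>\<^bsub>CM X Y\<^esub> map_dif X Y g \<in> carrier (CM X Y)" by (rule W.smult_closed) (use Dg in simp_all)
    then show "c \<odot>\<^bsub>CM X Y\<^esub> map_dif X Y g \<in> gmaps X Y" unfolding CM_simps(1) by (rule chain_gmaps)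
    fix p v assume v: "v \<in> carrier (obj X p)"
    interpret N: gmod A "obj Y p" by (rule gmod.intro[OF good_gm[OF Y]])
    show "map_dif X Y (c \<odot>\<^bsub>gmap_space X (translate (- 1) Y)\<^esub> g) p v = (c \<odot>\<^bsub>CM X Y\<^esub> map_dif X Y g) p v"
      using v dX[OF v] map_dif_parts[OF X Y g v] hom_sm[OF dY[of p] map_dif_parts(1)[OF X Y g v]]
      by (simp add: map_dif_def N.sm_r)
  qed
  fix h assume "h \<in> carrier (gmap_space X (translate (- 1) Y))"
  then have h: "h \<in> gmaps X (translate (- 1) Y)" by simp
  show "map_dif X Y (g \<oplus>\<^bsub>gmap_space X (translate (- 1) Y)\<^esub> h) = map_dif X Y g \<oplus>\<^bsub>CM X Y\<^esub> map_dif X Y h"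
  proof (rule gmaps_eqI)
    have gh: "g \<oplus>\<^bsub>gmap_space X (translate (- 1) Y)\<^esub> h \<in> gmaps X (translate (- 1) Y)"
      using V.M.a_closed[of g h] g h by simp
    show "map_dif X Y (g \<oplus>\<^bsub>gmap_space X (translate (- 1) Y)\<^esub> h) \<in> gmaps X Y"
      by (rule chain_gmaps[OF map_dif_chain[OF X Y gh]])
    have "map_dif X Y g \<oplus>\<^bsub>CM X Y\<^esub> map_dif X Y h \<in> carrier (CM X Y)"
      by (rule W.M.a_closed) (use Dg map_dif_chain[OF X Y h] in simp_all)
    then show "map_dif X Y g \<oplus>\<^bsub>CM X Y\<^esub> map_dif X Y h \<in> gmaps X Y" unfolding CM_simps(1) by (rule chain_gmaps)
    fix p v assume v: "v \<in> carrier (obj X p)"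
    interpret N: gmod A "obj Y p" by (rule gmod.intro[OF good_gm[OF Y]])
    show "map_dif X Y (g \<oplus>\<^bsub>gmap_space X (translate (- 1) Y)\<^esub> h) p v = (map_dif X Y g \<oplus>\<^bsub>CM X Y\<^esub> map_dif X Y h) p v"
      using v dX[OF v] map_dif_parts[OF X Y g v] map_dif_parts[OF X Y h v]
        hom_add[OF dY[of p] map_dif_parts(1)[OF X Y g v] map_dif_parts(1)[OF X Y h v]]
      by (simp add: map_dif_def N.a_ac)
  qed
qed

text \<open>\<open>dif (translate (- 1) Y)\<close> is minus the differential of \<open>Y\<close>, which turns the vanishing of \<open>map_dif X Y h\<close>
  into the commutation of \<open>h\<close> with the differentials.\<close>

lemma map_dif_ker:
  assumes X: "good X" and Y: "good Y"
  shows "lker (gmap_space X (translate (- 1) Y)) (CM X Y) (map_dif X Y) = chain_maps X (translate (- 1) Y)"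
proof -
  have iff: "map_dif X Y h = zero_map X Y \<longleftrightarrow> h \<in> chain_maps X (translate (- 1) Y)" if h: "h \<in> gmaps X (translate (- 1) Y)" for h
  proof -
    have pt: "map_dif X Y h p v = \<zero>\<^bsub>obj Y p\<^esub> \<longleftrightarrow> h (p + 1) (dif X p v) = dif (translate (- 1) Y) p (h p v)"
      if v: "v \<in> carrier (obj X p)" for p v
    proof -
      interpret N: gmod A "obj Y p" by (rule gmod.intro[OF good_gm[OF Y]])
      note P = map_dif_parts[OF X Y h v]
      have "dif (translate (- 1) Y) p (h p v) = \<ominus>\<^bsub>obj Y p\<^esub> dif Y (p - 1) (h p v)"
        using P(1) by (simp add: dif_translate)
      moreover have "map_dif X Y h p v = h (p + 1) (dif X p v) \<oplus>\<^bsub>obj Y p\<^esub> dif Y (p - 1) (h p v)"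
        using v P by (simp add: map_dif_def N.a_comm)
      moreover have "a \<oplus>\<^bsub>obj Y p\<^esub> b = \<zero>\<^bsub>obj Y p\<^esub> \<longleftrightarrow> a = \<ominus>\<^bsub>obj Y p\<^esub> b" if "a \<in> carrier (obj Y p)" "b \<in> carrier (obj Y p)" for a b
        using that N.minus_equality[of a b] N.l_neg[of b] by auto
      ultimately show ?thesis using P by simp
    qed
    have "map_dif X Y h = zero_map X Y \<longleftrightarrow> (\<forall>p. \<forall>v\<in>carrier (obj X p). map_dif X Y h p v = \<zero>\<^bsub>obj Y p\<^esub>)"
    proof
      assume "\<forall>p. \<forall>v\<in>carrier (obj X p). map_dif X Y h p v = \<zero>\<^bsub>obj Y p\<^esub>"
      then show "map_dif X Y h = zero_map X Y"
        by (intro gmaps_eqI[OF chain_gmaps[OF map_dif_chain[OF X Y h]] chain_gmaps[OF zero_map_chain[OF X Y]]])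
          (simp add: zero_map_def)
    qed (simp add: zero_map_def)
    also have "\<dots> \<longleftrightarrow> h \<in> chain_maps X (translate (- 1) Y)"
      using pt gmapsD[OF h] by (auto simp: chain_maps_def)
    finally show ?thesis .
  qed
  show ?thesis
  proof (rule equalityI; rule subsetI)
    show "h \<in> chain_maps X (translate (- 1) Y)" if "h \<in> lker (gmap_space X (translate (- 1) Y)) (CM X Y) (map_dif X Y)" for h
      using that iff[of h] by (simp add: lker_def)
    show "h \<in> lker (gmap_space X (translate (- 1) Y)) (CM X Y) (map_dif X Y)" if "h \<in> chain_maps X (translate (- 1) Y)" for h
      using that iff[OF chain_gmaps[OF that]] chain_gmaps[OF that] by (simp add: lker_def)
  qed
qed

lemma ksubspace_null:
  assumes "good X" "good Y" shows "ksubspace (CM X Y) (null X Y)"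
  using ksubspace_image[OF kspace_gmap[OF goodD(2)[OF assms(1)] goodD(2)[OF good_translate[OF assms(2)]]]
      kspace_CM[OF assms] map_dif_lin[OF assms]] map_dif_image[OF assms] by simp

text \<open>Dimensions in degree zero of the complex of maps from \<open>X\<close> to \<open>Y\<close>: of all graded maps, of the
  cocycles, of the coboundaries, and of the cohomology.\<close>

definition gdim :: "('a, 'm) gcomplex \<Rightarrow> ('a, 'n) gcomplex \<Rightarrow> nat" where
  "gdim X Y = kdim (gmap_space X Y)"
definition cdim :: "('a, 'm) gcomplex \<Rightarrow> ('a, 'n) gcomplex \<Rightarrow> nat" where
  "cdim X Y = kdim (CM X Y)"
definition ndim :: "('a, 'm) gcomplex \<Rightarrow> ('a, 'n) gcomplex \<Rightarrow> nat" where
  "ndim X Y = kdim ((CM X Y)\<lparr>carrier := null X Y\<rparr>)"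
definition hdim :: "('a, 'm) gcomplex \<Rightarrow> ('a, 'n) gcomplex \<Rightarrow> nat" where
  "hdim X Y = kdim (Hom_per scl X Y)"

lemma Hom_per_eq: "Hom_per scl X Y = quot_module (CM X Y) (null X Y)"
  by (simp add: Hom_per_def null_def)

lemma hdim_ndim:
  assumes "good X" "good Y"
  shows "fin_dim (Hom_per scl X Y)" "ndim X Y + hdim X Y = cdim X Y"
proof -
  obtain d where d: "has_dim (CM X Y) d" using CM_fd[OF assms] by blast
  obtain a b where ab: "has_dim ((CM X Y)\<lparr>carrier := null X Y\<rparr>) a" "has_dim (Hom_per scl X Y) b" "a + b = d"
    unfolding Hom_per_eq by (rule has_dim_quot[OF d ksubspace_null[OF assms]])
  show "fin_dim (Hom_per scl X Y)" by (rule has_dim_fin_dim[OF ab(2)])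
  show "ndim X Y + hdim X Y = cdim X Y"
    using has_dim_kdim[OF d] has_dim_kdim[OF ab(1)] has_dim_kdim[OF ab(2)] ab(3)
    by (simp add: ndim_def hdim_def cdim_def)
qed

text \<open>Rank and nullity of the differential of the complex of maps.\<close>

lemma gdim_eq:
  assumes "good X" "good Y"
  shows "gdim X (translate (- 1) Y) = cdim X (translate (- 1) Y) + ndim X Y"
proof -
  obtain d where d: "has_dim (gmap_space X (translate (- 1) Y)) d"
    using gmap_fd[OF goodD(1)[OF assms(1)] goodD(1)[OF good_translate[OF assms(2)]]] by blast
  obtain a b where ab: "has_dim ((gmap_space X (translate (- 1) Y))\<lparr>carrier := chain_maps X (translate (- 1) Y)\<rparr>) a"
    "has_dim ((CM X Y)\<lparr>carrier := null X Y\<rparr>) b" "a + b = d"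
    using has_dim_image[OF d kspace_CM[OF assms] map_dif_lin[OF assms]]
    unfolding map_dif_ker[OF assms] gmap_space_simps(1) map_dif_image[OF assms] by blast
  show ?thesis
    using has_dim_kdim[OF d] has_dim_kdim[OF ab(1)] has_dim_kdim[OF ab(2)] ab(3)
    unfolding CM_eq[symmetric] by (simp add: gdim_def cdim_def ndim_def)
qed

lemma gdim_step:
  assumes "good X" "good Y"
  shows "gdim X (translate i Y) = cdim X (translate i Y) + ndim X (translate (i + 1) Y)"
  using gdim_eq[OF assms(1) good_translate[OF assms(2), of "i + 1"]]
    translate_translate[OF goodD(2)[OF assms(2)] goodD(3)[OF assms(2)], of "- 1" "i + 1"] by simp

definition euler_sign :: "int \<Rightarrow> int" where "euler_sign i = (- 1) ^ nat \<bar>i\<bar>"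

lemma euler_sign_step: "euler_sign (i + 1) = - euler_sign i"
proof (cases "0 \<le> i")
  case True
  then have "nat \<bar>i + 1\<bar> = Suc (nat \<bar>i\<bar>)" by simp
  then show ?thesis unfolding euler_sign_def by (simp only: power_Suc mult_minus1)
next
  case False
  then have "nat \<bar>i\<bar> = Suc (nat \<bar>i + 1\<bar>)" by simp
  then show ?thesis unfolding euler_sign_def by (simp only: power_Suc mult_minus1 minus_minus)
qed

lemma euler_sign_minus: "euler_sign (i - 1) = - euler_sign i" using euler_sign_step[of "i - 1"] by simp

text \<open>The coefficients of the pairing are of this form, with \<open>Y\<close> a shift of the second argument.\<close>

definition euler :: "('a, 'm) gcomplex \<Rightarrow> ('a, 'n) gcomplex \<Rightarrow> int" where
  "euler X Y = (\<Sum>i | hdim X (translate i Y) \<noteq> 0. euler_sign i * int (hdim X (translate i Y)))"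

lemma has_dim_0_carrier: "kspace V \<Longrightarrow> carrier V \<subseteq> {\<zero>\<^bsub>V\<^esub>} \<Longrightarrow> kdim V = 0"
proof -
  assume V: "kspace V" and c: "carrier V \<subseteq> {\<zero>\<^bsub>V\<^esub>}"
  interpret V: Module.module univ_ring V by fact
  have "carrier V = {\<zero>\<^bsub>V\<^esub>}" using c V.zero_closed by blast
  then show ?thesis by (rule has_dim_kdim[OF has_dim_trivial[OF V]])
qed

lemma gdim_bounded:
  assumes X: "good X" and Y: "good Y"
  shows "\<exists>N. \<forall>i. N < \<bar>i\<bar> \<longrightarrow> gdim X (translate i Y) = 0"
proof -
  obtain N where N: "\<And>i. N < \<bar>i\<bar> \<Longrightarrow> carrier (obj X i) = {\<zero>\<^bsub>obj X i\<^esub>}"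
    using goodD(1)[OF X] unfolding tame_def bounded_cpx_def by blast
  obtain N' where N': "\<And>i. N' < \<bar>i\<bar> \<Longrightarrow> carrier (obj Y i) = {\<zero>\<^bsub>obj Y i\<^esub>}"
    using goodD(1)[OF Y] unfolding tame_def bounded_cpx_def by blast
  have "gdim X (translate i Y) = 0" if i: "\<bar>N\<bar> + \<bar>N'\<bar> < \<bar>i\<bar>" for i
    unfolding gdim_def
  proof (rule has_dim_0_carrier[OF kspace_gmap[OF goodD(2)[OF X] goodD(2)[OF good_translate[OF Y]]]], rule subsetI)
    fix f assume "f \<in> carrier (gmap_space X (translate i Y))"
    then have f: "f \<in> gmaps X (translate i Y)" by simp
    have "f = zero_map X (translate i Y)"
    proof (rule gmaps_eqI[OF f chain_gmaps[OF zero_map_chain[OF X good_translate[OF Y]]]])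
      fix p v assume v: "v \<in> carrier (obj X p)"
      have "f p v = \<zero>\<^bsub>obj Y (p + i)\<^esub>"
      proof (cases "N < \<bar>p\<bar>")
        case True
        then have "v = \<zero>\<^bsub>obj X p\<^esub>" using N v by simp
        then show ?thesis using hom_zero[OF good_gm[OF X] good_gm[OF good_translate[OF Y]] gmapsD[OF f]] by simp
      next
        case False
        then have "N' < \<bar>p + i\<bar>" using i by linarith
        then show ?thesis using N' gmaps_closed[OF f v] by simp
      qed
      then show "f p v = zero_map X (translate i Y) p v" using v by (simp add: zero_map_def)
    qed
    then show "f \<in> {\<zero>\<^bsub>gmap_space X (translate i Y)\<^esub>}" by simp
  qed
  then show ?thesis by blast
qed

text \<open>Euler characteristic of a bounded complex: in degree \<open>i\<close> the graded maps count the cocycles of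
  degree \<open>i\<close> and the coboundaries of degree \<open>i + 1\<close>, and the alternating sum of the latter cancels
  against the coboundaries of degree \<open>i\<close>.\<close>

lemma euler_eq:
  assumes X: "good X" and Y: "good Y"
  shows "finite {i. gdim X (translate i Y) \<noteq> 0}" "finite {i. hdim X (translate i Y) \<noteq> 0}"
    "finite F \<Longrightarrow> {i. gdim X (translate i Y) \<noteq> 0} \<subseteq> F \<Longrightarrow>
      euler X Y = (\<Sum>i\<in>F. euler_sign i * int (gdim X (translate i Y)))"
proof -
  let ?g = "\<lambda>i. gdim X (translate i Y)" and ?c = "\<lambda>i. cdim X (translate i Y)"
    and ?n = "\<lambda>i. ndim X (translate i Y)" and ?h = "\<lambda>i. hdim X (translate i Y)"
  obtain N where N: "\<And>i. N < \<bar>i\<bar> \<Longrightarrow> ?g i = 0"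
    using gdim_bounded[OF X Y] by blast
  have g: "?g i = ?c i + ?n (i + 1)" for i by (rule gdim_step[OF X Y])
  have h: "?n i + ?h i = ?c i" for i by (rule hdim_ndim(2)[OF X good_translate[OF Y]])
  have sub: "{i. ?h i \<noteq> 0} \<subseteq> {i. ?g i \<noteq> 0}"
  proof
    fix i assume "i \<in> {i. ?h i \<noteq> 0}"
    then show "i \<in> {i. ?g i \<noteq> 0}" using g[of i] h[of i] by simp
  qed
  have sub2: "{i. ?g i \<noteq> 0} \<subseteq> {- \<bar>N\<bar>..\<bar>N\<bar>}"
  proof
    fix i assume "i \<in> {i. ?g i \<noteq> 0}"
    then have "\<not> N < \<bar>i\<bar>" using N by auto
    then show "i \<in> {- \<bar>N\<bar>..\<bar>N\<bar>}" unfolding atLeastAtMost_iff by linarith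
  qed
  show fin: "finite {i. ?g i \<noteq> 0}" using sub2 by (rule finite_subset) simp
  show finh: "finite {i. ?h i \<noteq> 0}" using sub fin by (rule finite_subset)
  let ?G = "\<lambda>i. euler_sign i * int (?g i)" and ?H = "\<lambda>i. euler_sign i * int (?h i)" and ?B = "\<lambda>i. euler_sign i * int (?n i)"
  have nz: "?n i = 0" if "\<bar>N\<bar> < \<bar>i - 1\<bar>" for i using N[of "i - 1"] g[of "i - 1"] that by simp
  have pt: "?G i = ?H i + (?B i - ?B (i + 1))" for i
  proof -
    have "int (?g i) = int (?h i) + int (?n i) + int (?n (i + 1))" using g[of i] h[of i] by simp
    then show ?thesis by (simp only: euler_sign_step) (simp add: distrib_left)
  qed
  have tele: "(\<Sum>i\<in>{a..<a + int k}. ?B i - ?B (i + 1)) = ?B a - ?B (a + int k)" for a k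
  proof (induction k)
    case (Suc k)
    have "{a..<a + int (Suc k)} = insert (a + int k) {a..<a + int k}" by auto
    then show ?case using Suc by (simp add: algebra_simps)
  qed simp
  assume F: "finite F" "{i. ?g i \<noteq> 0} \<subseteq> F"
  let ?M = "\<bar>N\<bar> + 1"
  let ?R = "{- ?M..<- ?M + int (nat (2 * ?M + 1))}"
  have R: "{- \<bar>N\<bar>..\<bar>N\<bar>} \<subseteq> ?R" by auto
  have "(\<Sum>i\<in>F. ?G i) = (\<Sum>i\<in>{i. ?g i \<noteq> 0}. ?G i)"
    by (rule sum.mono_neutral_right) (use F in auto)
  also have "\<dots> = (\<Sum>i\<in>?R. ?G i)"
    by (rule sum.mono_neutral_left) (use order_trans[OF sub2 R] in auto)
  also have "\<dots> = (\<Sum>i\<in>?R. ?H i) + (\<Sum>i\<in>?R. ?B i - ?B (i + 1))"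
    unfolding sum.distrib[symmetric] by (rule sum.cong[OF refl pt])
  also have "(\<Sum>i\<in>?R. ?B i - ?B (i + 1)) = ?B (- ?M) - ?B (- ?M + int (nat (2 * ?M + 1)))"
    by (rule tele)
  also have "\<dots> = 0"
  proof -
    have "?n (- ?M) = 0" by (rule nz) simp
    moreover have "?n (- ?M + int (nat (2 * ?M + 1))) = 0" by (rule nz) simp
    ultimately show ?thesis by simp
  qed
  also have "(\<Sum>i\<in>?R. ?H i) = (\<Sum>i\<in>{i. ?h i \<noteq> 0}. ?H i)"
    by (rule sum.mono_neutral_right) (use order_trans[OF order_trans[OF sub sub2] R] in auto)
  finally show "euler X Y = (\<Sum>i\<in>F. ?G i)" unfolding euler_def by simp
qed

end

section \<open>Homotopy invariance and cones\<close>

text \<open>Linear maps that are inverse to each other modulo the subspaces induce inverse isomorphisms of the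
  quotients.\<close>

lemma quot_dim_eq:
  fixes V :: "('k::field, 'v, 'x) module_scheme" and V' :: "('k, 'w, 'y) module_scheme"
  assumes d: "has_dim V d" and d': "has_dim V' d'" and N: "ksubspace V N" and N': "ksubspace V' N'"
    and p: "lin V V' \<phi>" and q: "lin V' V \<psi>"
    and pN: "\<And>v. v \<in> N \<Longrightarrow> \<phi> v \<in> N'" and qN: "\<And>v. v \<in> N' \<Longrightarrow> \<psi> v \<in> N"
    and qp: "\<And>v. v \<in> carrier V \<Longrightarrow> \<psi> (\<phi> v) \<ominus>\<^bsub>V\<^esub> v \<in> N"
    and pq: "\<And>v. v \<in> carrier V' \<Longrightarrow> \<phi> (\<psi> v) \<ominus>\<^bsub>V'\<^esub> v \<in> N'"
  shows "kdim (quot_module V N) = kdim (quot_module V' N')"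
proof -
  have KV: "kspace V" and KV': "kspace V'" using d d' by (auto dest: has_dim_kspace)
  have S': "submod V' N'" by (rule submod.intro[OF KV' N'])
  interpret V: Module.module univ_ring V by fact
  let ?Q = "quot_module V' N'" and ?f = "\<lambda>v. N' +>\<^bsub>V'\<^esub> \<phi> v"
  note cp = lin_closed[OF p] and cq = lin_closed[OF q]
  have f: "lin V ?Q ?f"
  proof (rule linI)
    show "?f x \<in> carrier ?Q" if "x \<in> carrier V" for x
      unfolding submod.Q_simps(1)[OF S'] by (rule imageI) (rule cp[OF that])
  qed (simp_all add: submod.Q_add[OF S'] submod.Q_smult[OF S'] cp lin_add[OF p] lin_smult[OF p])
  have onto: "?f ` carrier V = carrier ?Q"
  proof (rule equalityI)
    show "?f ` carrier V \<subseteq> carrier ?Q" using lin_closed[OF f] by (rule image_subsetI)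
    show "carrier ?Q \<subseteq> ?f ` carrier V"
      unfolding submod.Q_simps(1)[OF S']
    proof (rule image_subsetI)
      fix v assume v: "v \<in> carrier V'"
      have "N' +>\<^bsub>V'\<^esub> v = N' +>\<^bsub>V'\<^esub> \<phi> (\<psi> v)"
        using submod.coset_eq_iff[OF S' cp[OF cq[OF v]] v] pq[OF v] by simp
      then show "N' +>\<^bsub>V'\<^esub> v \<in> ?f ` carrier V" by (rule image_eqI[where f = ?f]) (rule cq[OF v])
    qed
  qed
  have ker: "lker V ?Q ?f = N"
  proof (rule equalityI; rule subsetI)
    fix v assume v: "v \<in> N"
    have vV: "v \<in> carrier V" using N v by (auto simp: ksubspace_def)
    then show "v \<in> lker V ?Q ?f"
      using submod.coset_eq_N_iff[OF S' cp[OF vV]] pN[OF v] by (simp add: lker_def submod.Q_simps(2)[OF S'])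
  next
    fix v assume "v \<in> lker V ?Q ?f"
    then have vV: "v \<in> carrier V" and "N' +>\<^bsub>V'\<^esub> \<phi> v = N'" by (simp_all add: lker_def submod.Q_simps(2)[OF S'])
    then have "\<phi> v \<in> N'" using submod.coset_eq_N_iff[OF S' cp[OF vV]] by simp
    then have w: "\<psi> (\<phi> v) \<in> N" by (rule qN)
    have wV: "\<psi> (\<phi> v) \<in> carrier V" by (rule cq[OF cp[OF vV]])
    have "\<ominus>\<^bsub>V\<^esub> (\<psi> (\<phi> v) \<ominus>\<^bsub>V\<^esub> v) \<in> N" by (rule ksubspace_neg[OF KV N qp[OF vV]])
    then have "\<psi> (\<phi> v) \<oplus>\<^bsub>V\<^esub> \<ominus>\<^bsub>V\<^esub> (\<psi> (\<phi> v) \<ominus>\<^bsub>V\<^esub> v) \<in> N" using w N by (simp add: ksubspace_def)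
    moreover have "\<psi> (\<phi> v) \<oplus>\<^bsub>V\<^esub> \<ominus>\<^bsub>V\<^esub> (\<psi> (\<phi> v) \<ominus>\<^bsub>V\<^esub> v) = v"
      using wV vV by (simp add: V.minus_eq V.minus_add V.r_neg2)
    ultimately show "v \<in> N" by simp
  qed
  obtain a b where ab: "has_dim (V\<lparr>carrier := N\<rparr>) a" "has_dim ?Q b" "a + b = d"
    using rank_nullity[OF d submod.Q_module[OF S'] f onto] unfolding ker by blast
  obtain a' b' where ab': "has_dim (V\<lparr>carrier := N\<rparr>) a'" "has_dim (quot_module V N) b'" "a' + b' = d"
    by (rule has_dim_quot[OF d N])
  have "b = b'" using has_dim_unique[OF ab(1) ab'(1)] ab(3) ab'(3) by simp
  then show ?thesis using has_dim_kdim[OF ab(2)] has_dim_kdim[OF ab'(2)] by simp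
qed

context galg
begin

lemma comp_map_apply: "v \<in> carrier (obj X i) \<Longrightarrow> comp_map X g f i v = g i (f i v)"
  by (simp add: comp_map_def compose_eq)

lemma comp_chain:
  assumes X: "good X" and f: "f \<in> chain_maps X Y" and g: "g \<in> chain_maps Y Z"
  shows "comp_map X g f \<in> chain_maps X Z"
proof (rule chain_mapsI)
  show "comp_map X g f i \<in> gr_hom (obj X i) (obj Z i)" for i
    unfolding comp_map_def by (rule hom_comp[OF good_gm[OF X] chain_mapsD1[OF f] chain_mapsD1[OF g]])
  fix i v assume v: "v \<in> carrier (obj X i)"
  show "comp_map X g f (i + 1) (dif X i v) = dif Z i (comp_map X g f i v)"
    using v dif_closed[OF goodD(3)[OF X] v refl] chain_mapsD2[OF f v refl]
      chain_mapsD2[OF g hom_closed[OF chain_mapsD1[OF f] v] refl] by (simp add: comp_map_apply)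
qed

lemma id_chain: assumes X: "good X" shows "id_map X \<in> chain_maps X X"
proof (rule chain_mapsI)
  fix i
  interpret M: gmod A "obj X i" by (rule gmod.intro[OF good_gm[OF X]])
  show "id_map X i \<in> gr_hom (obj X i) (obj X i)"
    unfolding id_map_def by (rule gr_homI) (auto dest: M.gr_carrier)
  show "id_map X (i + 1) (dif X i v) = dif X i (id_map X i v)" if "v \<in> carrier (obj X i)" for v
    using that dif_closed[OF goodD(3)[OF X] that refl] by (simp add: id_map_def)
qed

lemma homotopic_refl:
  assumes X: "good X" and Y: "good Y" and f: "f \<in> chain_maps X Y"
  shows "homotopic X Y f f"
  unfolding homotopic_def
proof (intro exI[of _ "\<lambda>i. \<lambda>v\<in>carrier (obj X i). \<zero>\<^bsub>obj Y (i - 1)\<^esub>"] conjI allI ballI)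
  show "(\<lambda>v\<in>carrier (obj X i). \<zero>\<^bsub>obj Y (i - 1)\<^esub>) \<in> gr_hom (obj X i) (obj Y (i - 1))" for i
    by (rule hom_const_zero[OF good_gm[OF X] good_gm[OF Y]])
  fix i v assume v: "v \<in> carrier (obj X i)"
  interpret N: gmod A "obj Y i" by (rule gmod.intro[OF good_gm[OF Y]])
  have "dif Y (i - 1) \<in> gr_hom (obj Y (i - 1)) (obj Y i)" by (rule dif_hom[OF goodD(3)[OF Y]]) simp
  then have "dif Y (i - 1) \<zero>\<^bsub>obj Y (i - 1)\<^esub> = \<zero>\<^bsub>obj Y i\<^esub>" by (rule hom_zero[OF good_gm[OF Y] good_gm[OF Y]])
  then show "f i v = f i v \<oplus>\<^bsub>obj Y i\<^esub> (dif Y (i - 1) ((\<lambda>v\<in>carrier (obj X i). \<zero>\<^bsub>obj Y (i - 1)\<^esub>) v) \<oplus>\<^bsub>obj Y i\<^esub>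
      (\<lambda>v\<in>carrier (obj X (i + 1)). \<zero>\<^bsub>obj Y (i + 1 - 1)\<^esub>) (dif X i v))"
    using v dif_closed[OF goodD(3)[OF X] v refl] hom_closed[OF chain_mapsD1[OF f] v] by simp
qed

lemma homotopic_comp_left:
  assumes X: "good X" and h: "homotopic Y Z g g'" and f: "f \<in> chain_maps X Y"
  shows "homotopic X Z (comp_map X g f) (comp_map X g' f)"
proof -
  obtain k where k: "\<And>i. k i \<in> gr_hom (obj Y i) (obj Z (i - 1))"
    "\<And>i v. v \<in> carrier (obj Y i) \<Longrightarrow> g i v = g' i v \<oplus>\<^bsub>obj Z i\<^esub> (dif Z (i - 1) (k i v) \<oplus>\<^bsub>obj Z i\<^esub> k (i + 1) (dif Y i v))"
    using h unfolding homotopic_def by blast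
  show ?thesis
    unfolding homotopic_def
  proof (intro exI[of _ "\<lambda>i. compose (carrier (obj X i)) (k i) (f i)"] conjI allI ballI)
    show "compose (carrier (obj X i)) (k i) (f i) \<in> gr_hom (obj X i) (obj Z (i - 1))" for i
      by (rule hom_comp[OF good_gm[OF X] chain_mapsD1[OF f] k(1)])
    fix i v assume v: "v \<in> carrier (obj X i)"
    show "comp_map X g f i v = comp_map X g' f i v \<oplus>\<^bsub>obj Z i\<^esub>
        (dif Z (i - 1) (compose (carrier (obj X i)) (k i) (f i) v) \<oplus>\<^bsub>obj Z i\<^esub>
          compose (carrier (obj X (i + 1))) (k (i + 1)) (f (i + 1)) (dif X i v))"
      using v dif_closed[OF goodD(3)[OF X] v refl] k(2)[OF hom_closed[OF chain_mapsD1[OF f] v]]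
        chain_mapsD2[OF f v refl] by (simp add: comp_map_apply compose_eq)
  qed
qed

lemma homotopic_comp_right:
  assumes X: "good X" and Y: "good Y" and h: "homotopic X Y f f'" and f': "f' \<in> chain_maps X Y" and g: "g \<in> chain_maps Y Z"
  shows "homotopic X Z (comp_map X g f) (comp_map X g f')"
proof -
  obtain k where k: "\<And>i. k i \<in> gr_hom (obj X i) (obj Y (i - 1))"
    "\<And>i v. v \<in> carrier (obj X i) \<Longrightarrow> f i v = f' i v \<oplus>\<^bsub>obj Y i\<^esub> (dif Y (i - 1) (k i v) \<oplus>\<^bsub>obj Y i\<^esub> k (i + 1) (dif X i v))"
    using h unfolding homotopic_def by blast
  have kg: "k \<in> gmaps X (translate (- 1) Y)" by (rule gmaps_shiftI[OF k(1)])
  show ?thesis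
    unfolding homotopic_def
  proof (intro exI[of _ "\<lambda>i. compose (carrier (obj X i)) (g (i - 1)) (k i)"] conjI allI ballI)
    show "compose (carrier (obj X i)) (g (i - 1)) (k i) \<in> gr_hom (obj X i) (obj Z (i - 1))" for i
      by (rule hom_comp[OF good_gm[OF X] k(1) chain_mapsD1[OF g]])
    fix i v assume v: "v \<in> carrier (obj X i)"
    interpret N: gmod A "obj Y i" by (rule gmod.intro[OF good_gm[OF Y]])
    note P = map_dif_parts[OF X Y kg v]
    have c: "f' i v \<in> carrier (obj Y i)" by (rule hom_closed[OF chain_mapsD1[OF f'] v])
    have gd: "g i (dif Y (i - 1) (k i v)) = dif Z (i - 1) (g (i - 1) (k i v))"
      by (rule chain_mapsD2[OF g P(1)]) simp
    have "g i (f i v) = g i (f' i v) \<oplus>\<^bsub>obj Z i\<^esub> (g i (dif Y (i - 1) (k i v)) \<oplus>\<^bsub>obj Z i\<^esub> g i (k (i + 1) (dif X i v)))"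
      unfolding k(2)[OF v] using hom_add[OF chain_mapsD1[OF g, of i] c N.a_closed[OF P(2,3)]]
        hom_add[OF chain_mapsD1[OF g, of i] P(2,3)] by simp
    then show "comp_map X g f i v = comp_map X g f' i v \<oplus>\<^bsub>obj Z i\<^esub>
        (dif Z (i - 1) (compose (carrier (obj X i)) (g (i - 1)) (k i) v) \<oplus>\<^bsub>obj Z i\<^esub>
          compose (carrier (obj X (i + 1))) (g (i + 1 - 1)) (k (i + 1)) (dif X i v))"
      using v dif_closed[OF goodD(3)[OF X] v refl] gd by (simp add: comp_map_apply compose_eq)
  qed
qed

lemma comp_zero_right:
  assumes X: "good X" and Y: "good Y" and Z: "good Z" and g: "g \<in> chain_maps Y Z"
  shows "comp_map X g (zero_map X Y) = zero_map X Z"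
  by (rule gmaps_eqI[OF chain_gmaps[OF comp_chain[OF X zero_map_chain[OF X Y] g]] chain_gmaps[OF zero_map_chain[OF X Z]]])
    (simp add: comp_map_apply zero_map_def hom_zero[OF good_gm[OF Y] good_gm[OF Z] chain_mapsD1[OF g]])

lemma comp_zero_left:
  assumes X: "good X" and Y: "good Y" and Z: "good Z" and f: "f \<in> chain_maps X Y"
  shows "comp_map X (zero_map Y Z) f = zero_map X Z"
  by (rule gmaps_eqI[OF chain_gmaps[OF comp_chain[OF X f zero_map_chain[OF Y Z]]] chain_gmaps[OF zero_map_chain[OF X Z]]])
    (simp add: comp_map_apply zero_map_def hom_closed[OF chain_mapsD1[OF f]])

lemma comp_null_right:
  assumes X: "good X" and Y: "good Y" and Z: "good Z" and f: "f \<in> null X Y" and g: "g \<in> chain_maps Y Z"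
  shows "comp_map X g f \<in> null X Z"
  using f homotopic_comp_right[OF X Y _ zero_map_chain[OF X Y] g, of f] comp_chain[OF X _ g, of f]
  by (simp add: null_def comp_zero_right[OF X Y Z g])

lemma comp_null_left:
  assumes X: "good X" and Y: "good Y" and Z: "good Z" and g: "g \<in> null Y Z" and f: "f \<in> chain_maps X Y"
  shows "comp_map X g f \<in> null X Z"
  using g homotopic_comp_left[OF X _ f, of Z g "zero_map Y Z"] comp_chain[OF X f, of g]
  by (simp add: null_def comp_zero_left[OF X Y Z f])

lemma homotopic_diff:
  assumes X: "good X" and Y: "good Y" and h: "homotopic X Y f g" and f: "f \<in> chain_maps X Y" and g: "g \<in> chain_maps X Y"
  shows "f \<ominus>\<^bsub>CM X Y\<^esub> g \<in> null X Y"
proof -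
  interpret V: Module.module univ_ring "CM X Y" by (rule kspace_CM[OF X Y])
  obtain k where k: "\<And>i. k i \<in> gr_hom (obj X i) (obj Y (i - 1))"
    "\<And>i v. v \<in> carrier (obj X i) \<Longrightarrow> f i v = g i v \<oplus>\<^bsub>obj Y i\<^esub> (dif Y (i - 1) (k i v) \<oplus>\<^bsub>obj Y i\<^esub> k (i + 1) (dif X i v))"
    using h unfolding homotopic_def by blast
  have kg: "k \<in> gmaps X (translate (- 1) Y)" by (rule gmaps_shiftI[OF k(1)])
  have n: "map_dif X Y k \<in> null X Y" using map_dif_image[OF X Y] kg by blast
  then have nc: "map_dif X Y k \<in> carrier (CM X Y)" by (simp add: null_def)
  have fc: "f \<in> carrier (CM X Y)" "g \<in> carrier (CM X Y)" using f g by simp_all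
  have "f = g \<oplus>\<^bsub>CM X Y\<^esub> map_dif X Y k"
  proof (rule gmaps_eqI[OF chain_gmaps[OF f]])
    show "g \<oplus>\<^bsub>CM X Y\<^esub> map_dif X Y k \<in> gmaps X Y"
      using V.M.a_closed[OF fc(2) nc] unfolding CM_simps(1) by (rule chain_gmaps)
    show "f i v = (g \<oplus>\<^bsub>CM X Y\<^esub> map_dif X Y k) i v" if "v \<in> carrier (obj X i)" for i v
      using that k(2)[OF that] by (simp add: map_dif_def)
  qed
  then have "f \<ominus>\<^bsub>CM X Y\<^esub> g = map_dif X Y k \<oplus>\<^bsub>CM X Y\<^esub> g \<oplus>\<^bsub>CM X Y\<^esub> \<ominus>\<^bsub>CM X Y\<^esub> g"
    unfolding V.M.minus_eq by (simp only: V.M.a_comm[OF fc(2) nc])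
  also have "\<dots> = map_dif X Y k \<oplus>\<^bsub>CM X Y\<^esub> (g \<oplus>\<^bsub>CM X Y\<^esub> \<ominus>\<^bsub>CM X Y\<^esub> g)"
    by (rule V.M.a_assoc[OF nc fc(2) V.M.a_inv_closed[OF fc(2)]])
  also have "\<dots> = map_dif X Y k"
    unfolding V.M.r_neg[OF fc(2)] by (rule V.M.r_zero[OF nc])
  finally show ?thesis using n by simp
qed

lemma comp_lin_right:
  assumes P: "good P" and Y: "good Y" and Z: "good Z" and g: "g \<in> chain_maps Y Z"
  shows "lin (CM P Y) (CM P Z) (comp_map P g)"
proof (rule linI)
  interpret V: Module.module univ_ring "CM P Y" by (rule kspace_CM[OF P Y])
  interpret W: Module.module univ_ring "CM P Z" by (rule kspace_CM[OF P Z])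
  have cl: "comp_map P g x \<in> carrier (CM P Z)" if "x \<in> carrier (CM P Y)" for x
    using comp_chain[OF P _ g] that by simp
  have ga: "x \<in> gmaps P Z" if "x \<in> carrier (CM P Z)" for x using that chain_gmaps by simp
  fix x c assume x: "x \<in> carrier (CM P Y)"
  show "comp_map P g x \<in> carrier (CM P Z)" by (rule cl[OF x])
  have xc: "x \<in> chain_maps P Y" using x by simp
  note cx = hom_closed[OF chain_mapsD1[OF xc]]
  show "comp_map P g (c \<odot>\<^bsub>CM P Y\<^esub> x) = c \<odot>\<^bsub>CM P Z\<^esub> comp_map P g x"
  proof (rule gmaps_eqI[OF ga[OF cl[OF V.smult_closed[OF _ x]]] ga[OF W.smult_closed[OF _ cl[OF x]]]])
    show "comp_map P g (c \<odot>\<^bsub>CM P Y\<^esub> x) i v = (c \<odot>\<^bsub>CM P Z\<^esub> comp_map P g x) i v" if "v \<in> carrier (obj P i)" for i v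
      using that cx[OF that] by (simp add: comp_map_apply hom_sm[OF chain_mapsD1[OF g]])
  qed simp_all
  fix y assume y: "y \<in> carrier (CM P Y)"
  have yc: "y \<in> chain_maps P Y" using y by simp
  note cy = hom_closed[OF chain_mapsD1[OF yc]]
  show "comp_map P g (x \<oplus>\<^bsub>CM P Y\<^esub> y) = comp_map P g x \<oplus>\<^bsub>CM P Z\<^esub> comp_map P g y"
  proof (rule gmaps_eqI[OF ga[OF cl[OF V.M.a_closed[OF x y]]] ga[OF W.M.a_closed[OF cl[OF x] cl[OF y]]]])
    show "comp_map P g (x \<oplus>\<^bsub>CM P Y\<^esub> y) i v = (comp_map P g x \<oplus>\<^bsub>CM P Z\<^esub> comp_map P g y) i v" if "v \<in> carrier (obj P i)" for i v
      using that cx[OF that] cy[OF that] by (simp add: comp_map_apply hom_add[OF chain_mapsD1[OF g]])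
  qed
qed

lemma comp_lin_left:
  assumes Y: "good Y" and Z: "good Z" and Q: "good Q" and g: "g \<in> chain_maps Y Z"
  shows "lin (CM Z Q) (CM Y Q) (\<lambda>f. comp_map Y f g)"
proof (rule linI)
  interpret V: Module.module univ_ring "CM Z Q" by (rule kspace_CM[OF Z Q])
  interpret W: Module.module univ_ring "CM Y Q" by (rule kspace_CM[OF Y Q])
  have cl: "comp_map Y x g \<in> carrier (CM Y Q)" if "x \<in> carrier (CM Z Q)" for x
    using comp_chain[OF Y g] that by simp
  have ga: "x \<in> gmaps Y Q" if "x \<in> carrier (CM Y Q)" for x using that chain_gmaps by simp
  note cg = hom_closed[OF chain_mapsD1[OF g]]
  fix x c assume x: "x \<in> carrier (CM Z Q)"
  show "comp_map Y x g \<in> carrier (CM Y Q)" by (rule cl[OF x])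
  show "comp_map Y (c \<odot>\<^bsub>CM Z Q\<^esub> x) g = c \<odot>\<^bsub>CM Y Q\<^esub> comp_map Y x g"
  proof (rule gmaps_eqI[OF ga[OF cl[OF V.smult_closed[OF _ x]]] ga[OF W.smult_closed[OF _ cl[OF x]]]])
    show "comp_map Y (c \<odot>\<^bsub>CM Z Q\<^esub> x) g i v = (c \<odot>\<^bsub>CM Y Q\<^esub> comp_map Y x g) i v" if "v \<in> carrier (obj Y i)" for i v
      using that cg[OF that] by (simp add: comp_map_apply)
  qed simp_all
  fix y assume y: "y \<in> carrier (CM Z Q)"
  show "comp_map Y (x \<oplus>\<^bsub>CM Z Q\<^esub> y) g = comp_map Y x g \<oplus>\<^bsub>CM Y Q\<^esub> comp_map Y y g"
  proof (rule gmaps_eqI[OF ga[OF cl[OF V.M.a_closed[OF x y]]] ga[OF W.M.a_closed[OF cl[OF x] cl[OF y]]]])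
    show "comp_map Y (x \<oplus>\<^bsub>CM Z Q\<^esub> y) g i v = (comp_map Y x g \<oplus>\<^bsub>CM Y Q\<^esub> comp_map Y y g) i v" if "v \<in> carrier (obj Y i)" for i v
      using that cg[OF that] by (simp add: comp_map_apply)
  qed
qed

lemma comp_comp:
  assumes X: "good X" and f: "f \<in> chain_maps X Y" and g: "g \<in> chain_maps Y Z" and h: "h \<in> chain_maps Z W"
    and Y: "good Y"
  shows "comp_map X (comp_map Y h g) f = comp_map X h (comp_map X g f)"
  by (rule gmaps_eqI[OF chain_gmaps[OF comp_chain[OF X f comp_chain[OF Y g h]]] chain_gmaps[OF comp_chain[OF X comp_chain[OF X f g] h]]])
    (simp add: comp_map_apply hom_closed[OF chain_mapsD1[OF f]])

lemma comp_id_left: "good X \<Longrightarrow> good Y \<Longrightarrow> f \<in> chain_maps X Y \<Longrightarrow> comp_map X (id_map Y) f = f"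
  by (rule gmaps_eqI[OF chain_gmaps[OF comp_chain[OF _ _ id_chain]] chain_gmaps])
    (simp_all add: comp_map_apply id_map_def hom_closed[OF chain_mapsD1])

lemma comp_id_right: "good X \<Longrightarrow> good Y \<Longrightarrow> f \<in> chain_maps X Y \<Longrightarrow> comp_map X f (id_map X) = f"
  by (rule gmaps_eqI[OF chain_gmaps[OF comp_chain[OF _ id_chain]] chain_gmaps])
    (simp_all add: comp_map_apply id_map_def)

text \<open>Composition with \<open>f\<close> and with a homotopy inverse of \<open>f\<close> are inverse to each other modulo
  null-homotopic maps.\<close>

lemma hdim_equiv_right:
  assumes P: "good P" and Y: "good Y" and Z: "good Z" and e: "homotopy_equiv Y Z f"
  shows "hdim P Y = hdim P Z"
proof -
  obtain g where f: "f \<in> chain_maps Y Z" and g: "g \<in> chain_maps Z Y"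
    and gf: "homotopic Y Y (comp_map Y g f) (id_map Y)" and fg: "homotopic Z Z (comp_map Z f g) (id_map Z)"
    using e unfolding homotopy_equiv_def by blast
  obtain d where d: "has_dim (CM P Y) d" using CM_fd[OF P Y] by blast
  obtain d' where d': "has_dim (CM P Z) d'" using CM_fd[OF P Z] by blast
  show ?thesis
    unfolding hdim_def Hom_per_eq
  proof (rule quot_dim_eq[OF d d' ksubspace_null[OF P Y] ksubspace_null[OF P Z]
        comp_lin_right[OF P Y Z f] comp_lin_right[OF P Z Y g]
        comp_null_right[OF P Y Z _ f] comp_null_right[OF P Z Y _ g]])
    fix v assume "v \<in> carrier (CM P Y)"
    then have v: "v \<in> chain_maps P Y" by simp
    show "comp_map P g (comp_map P f v) \<ominus>\<^bsub>CM P Y\<^esub> v \<in> null P Y"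
      using homotopic_diff[OF P Y homotopic_comp_left[OF P gf v] comp_chain[OF P v comp_chain[OF Y f g]]
          comp_chain[OF P v id_chain[OF Y]]]
      unfolding comp_comp[OF P v f g Y] comp_id_left[OF P Y v] .
  next
    fix v assume "v \<in> carrier (CM P Z)"
    then have v: "v \<in> chain_maps P Z" by simp
    show "comp_map P f (comp_map P g v) \<ominus>\<^bsub>CM P Z\<^esub> v \<in> null P Z"
      using homotopic_diff[OF P Z homotopic_comp_left[OF P fg v] comp_chain[OF P v comp_chain[OF Z g f]]
          comp_chain[OF P v id_chain[OF Z]]]
      unfolding comp_comp[OF P v g f Z] comp_id_left[OF P Z v] .
  qed
qed

lemma hdim_equiv_left:
  assumes Y: "good Y" and Z: "good Z" and Q: "good Q" and e: "homotopy_equiv Y Z f"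
  shows "hdim Y Q = hdim Z Q"
proof -
  obtain g where f: "f \<in> chain_maps Y Z" and g: "g \<in> chain_maps Z Y"
    and gf: "homotopic Y Y (comp_map Y g f) (id_map Y)" and fg: "homotopic Z Z (comp_map Z f g) (id_map Z)"
    using e unfolding homotopy_equiv_def by blast
  obtain d where d: "has_dim (CM Y Q) d" using CM_fd[OF Y Q] by blast
  obtain d' where d': "has_dim (CM Z Q) d'" using CM_fd[OF Z Q] by blast
  show ?thesis
    unfolding hdim_def Hom_per_eq
  proof (rule quot_dim_eq[OF d d' ksubspace_null[OF Y Q] ksubspace_null[OF Z Q]
        comp_lin_left[OF Z Y Q g] comp_lin_left[OF Y Z Q f]
        comp_null_left[OF Z Y Q _ g] comp_null_left[OF Y Z Q _ f]])
    fix v assume "v \<in> carrier (CM Y Q)"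
    then have v: "v \<in> chain_maps Y Q" by simp
    show "comp_map Y (comp_map Z v g) f \<ominus>\<^bsub>CM Y Q\<^esub> v \<in> null Y Q"
      using homotopic_diff[OF Y Q homotopic_comp_right[OF Y Y gf id_chain[OF Y] v] comp_chain[OF Y comp_chain[OF Y f g] v]
          comp_chain[OF Y id_chain[OF Y] v]]
      unfolding comp_comp[OF Y f g v Z, symmetric] comp_id_right[OF Y Q v] .
  next
    fix v assume "v \<in> carrier (CM Z Q)"
    then have v: "v \<in> chain_maps Z Q" by simp
    show "comp_map Z (comp_map Y v f) g \<ominus>\<^bsub>CM Z Q\<^esub> v \<in> null Z Q"
      using homotopic_diff[OF Z Q homotopic_comp_right[OF Z Z fg id_chain[OF Z] v] comp_chain[OF Z comp_chain[OF Z g f] v]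
          comp_chain[OF Z id_chain[OF Z] v]]
      unfolding comp_comp[OF Z g f v Y, symmetric] comp_id_right[OF Z Q v] .
  qed
qed

lemma chain_translate:
  assumes X: "good X" and Y: "good Y" and f: "f \<in> chain_maps X Y"
  shows "translate_map k f \<in> chain_maps (translate k X) (translate k Y)"
proof (rule chain_mapsI)
  show "translate_map k f i \<in> gr_hom (obj (translate k X) i) (obj (translate k Y) i)" for i
    using chain_mapsD1[OF f, of "i + k"] by (simp add: translate_map_def)
  fix i v assume "v \<in> carrier (obj (translate k X) i)"
  then have v: "v \<in> carrier (obj X (i + k))" by simp
  have e: "i + 1 + k = i + k + 1" by simp
  have dv: "dif X (i + k) v \<in> carrier (obj X (i + k + 1))" by (rule dif_closed[OF goodD(3)[OF X] v refl])
  show "translate_map k f (i + 1) (dif (translate k X) i v) = dif (translate k Y) i (translate_map k f i v)"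
    using v dv hom_closed[OF chain_mapsD1[OF f] v] chain_mapsD2[OF f v refl]
      hom_neg[OF good_gm[OF X] good_gm[OF Y] chain_mapsD1[OF f] dv]
    by (simp add: translate_map_def dif_translate e)
qed

text \<open>The homotopy is transported with the sign of the translated differential.\<close>

lemma homotopic_translate:
  assumes X: "good X" and Y: "good Y" and h: "homotopic X Y f g"
  shows "homotopic (translate k X) (translate k Y) (translate_map k f) (translate_map k g)"
proof -
  obtain s where s: "\<And>i. s i \<in> gr_hom (obj X i) (obj Y (i - 1))"
    "\<And>i v. v \<in> carrier (obj X i) \<Longrightarrow> f i v = g i v \<oplus>\<^bsub>obj Y i\<^esub> (dif Y (i - 1) (s i v) \<oplus>\<^bsub>obj Y i\<^esub> s (i + 1) (dif X i v))"
    using h unfolding homotopic_def by blast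
  have sdeg: "s \<in> gmaps X (translate (- 1) Y)" by (rule gmaps_shiftI[OF s(1)])
  define t where "t i = (\<lambda>v\<in>carrier (obj X (i + k)). if even k then s (i + k) v else \<ominus>\<^bsub>obj Y (i + k - 1)\<^esub> s (i + k) v)" for i
  show ?thesis
    unfolding homotopic_def
  proof (intro exI[of _ t] conjI allI ballI)
    fix i
    have e: "i - 1 + k = i + k - 1" "i + 1 + k = i + k + 1" by simp_all
    show "t i \<in> gr_hom (obj (translate k X) i) (obj (translate k Y) (i - 1))"
    proof (cases "even k")
      case True
      have "restrict (s (i + k)) (carrier (obj X (i + k))) = s (i + k)"
        using hom_ext[OF s(1)[of "i + k"]] by (intro extensional_restrict) (auto simp: PiE_def)
      then show ?thesis using s(1)[of "i + k"] True by (simp add: t_def e)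
    next
      case False
      then show ?thesis using hom_uminus[OF good_gm[OF X] good_gm[OF Y] s(1)[of "i + k"]] by (simp add: t_def e)
    qed
    fix v assume "v \<in> carrier (obj (translate k X) i)"
    then have v: "v \<in> carrier (obj X (i + k))" by simp
    note P = map_dif_parts[OF X Y sdeg v]
    interpret N: gmod A "obj Y (i + k)" by (rule gmod.intro[OF good_gm[OF Y]])
    interpret N1: gmod A "obj Y (i + k - 1)" by (rule gmod.intro[OF good_gm[OF Y]])
    have dv: "dif X (i + k) v \<in> carrier (obj X (i + k + 1))" by (rule dif_closed[OF goodD(3)[OF X] v refl])
    have sv: "s (i + k) v \<in> carrier (obj Y (i + k - 1))" by (rule P(1))
    have dY: "dif Y (i + k - 1) \<in> gr_hom (obj Y (i + k - 1)) (obj Y (i + k))" by (rule dif_hom[OF goodD(3)[OF Y]]) simp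
    have s1: "s (i + k + 1) \<in> gr_hom (obj X (i + k + 1)) (obj Y (i + k))" by (rule gmaps_shift[OF sdeg]) simp
    have n1: "dif Y (i + k - 1) (\<ominus>\<^bsub>obj Y (i + k - 1)\<^esub> s (i + k) v) = \<ominus>\<^bsub>obj Y (i + k)\<^esub> dif Y (i + k - 1) (s (i + k) v)"
      by (rule hom_neg[OF good_gm[OF Y] good_gm[OF Y] dY sv])
    have n2: "s (i + k + 1) (\<ominus>\<^bsub>obj X (i + k + 1)\<^esub> dif X (i + k) v) = \<ominus>\<^bsub>obj Y (i + k)\<^esub> s (i + k + 1) (dif X (i + k) v)"
      by (rule hom_neg[OF good_gm[OF X] good_gm[OF Y] s1 dv])
    interpret M1: gmod A "obj X (i + k + 1)" by (rule gmod.intro[OF good_gm[OF X]])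
    have t0: "dif (translate k Y) (i - 1) (t i v) = dif Y (i + k - 1) (s (i + k) v)"
      using v sv n1 P(2) by (simp add: t_def dif_translate e)
    have t1: "t (i + 1) (dif (translate k X) i v) = s (i + k + 1) (dif X (i + k) v)"
      using v dv n2 P(3) by (simp add: t_def dif_translate e)
    show "translate_map k f i v = translate_map k g i v \<oplus>\<^bsub>obj (translate k Y) i\<^esub>
        (dif (translate k Y) (i - 1) (t i v) \<oplus>\<^bsub>obj (translate k Y) i\<^esub> t (i + 1) (dif (translate k X) i v))"
      unfolding t0 t1 using s(2)[OF v] by (simp add: translate_map_def)
  qed
qed

lemma comp_translate: "comp_map (translate k U) (translate_map k a) (translate_map k b) = translate_map k (comp_map U a b)"
  by (simp add: comp_map_def translate_map_def fun_eq_iff)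

lemma id_translate: "id_map (translate k U) = translate_map k (id_map U)"
  unfolding id_map_def translate_map_def obj_translate ..

lemma equiv_translate:
  assumes X: "good X" and Y: "good Y" and e: "homotopy_equiv X Y f"
  shows "homotopy_equiv (translate k X) (translate k Y) (translate_map k f)"
proof -
  obtain g where f: "f \<in> chain_maps X Y" and g: "g \<in> chain_maps Y X"
    and gf: "homotopic X X (comp_map X g f) (id_map X)" and fg: "homotopic Y Y (comp_map Y f g) (id_map Y)"
    using e unfolding homotopy_equiv_def by blast
  have "homotopic (translate k X) (translate k X) (comp_map (translate k X) (translate_map k g) (translate_map k f)) (id_map (translate k X))"
    using homotopic_translate[OF X X gf, of k] unfolding comp_translate id_translate .
  moreover have "homotopic (translate k Y) (translate k Y) (comp_map (translate k Y) (translate_map k f) (translate_map k g)) (id_map (translate k Y))"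
    using homotopic_translate[OF Y Y fg, of k] unfolding comp_translate id_translate .
  ultimately show ?thesis
    unfolding homotopy_equiv_def using chain_translate[OF X Y f, of k] chain_translate[OF Y X g, of k] by blast
qed

lemma euler_equiv_right:
  assumes "good P" "good Y" "good Z" "homotopy_equiv Y Z f"
  shows "euler P Y = euler P Z"
proof -
  have "hdim P (translate i Y) = hdim P (translate i Z)" for i
    by (rule hdim_equiv_right[OF assms(1) good_translate[OF assms(2)] good_translate[OF assms(3)] equiv_translate[OF assms(2-4)]])
  then show ?thesis by (simp add: euler_def)
qed

lemma euler_equiv_left:
  assumes "good Y" "good Z" "good Q" "homotopy_equiv Y Z f"
  shows "euler Y Q = euler Z Q"
proof -
  have "hdim Y (translate i Q) = hdim Z (translate i Q)" for i
    by (rule hdim_equiv_left[OF assms(1,2) good_translate[OF assms(3)] assms(4)])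
  then show ?thesis by (simp add: euler_def)
qed

end

lemma dsum_simps [simp]:
  "carrier (dsum_gmodule M N) = carrier M \<times> carrier N"
  "zero (dsum_gmodule M N) = (\<zero>\<^bsub>M\<^esub>, \<zero>\<^bsub>N\<^esub>)"
  "add (dsum_gmodule M N) = (\<lambda>(v, w) (v', w'). (v \<oplus>\<^bsub>M\<^esub> v', w \<oplus>\<^bsub>N\<^esub> w'))"
  "smult (dsum_gmodule M N) = (\<lambda>a (v, w). (a \<odot>\<^bsub>M\<^esub> v, a \<odot>\<^bsub>N\<^esub> w))"
  "gr (dsum_gmodule M N) n = gr M n \<times> gr N n"
  by (simp_all add: dsum_gmodule_def)

lemma dsum_ab:
  assumes "abelian_group M" "abelian_group N"
  shows "abelian_group (dsum_gmodule M N)"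
proof (rule abelian_groupI)
  interpret M: abelian_group M by fact
  interpret N: abelian_group N by fact
  fix p assume "p \<in> carrier (dsum_gmodule M N)"
  then show "\<exists>q\<in>carrier (dsum_gmodule M N). q \<oplus>\<^bsub>dsum_gmodule M N\<^esub> p = \<zero>\<^bsub>dsum_gmodule M N\<^esub>"
    by (intro bexI[of _ "(\<ominus>\<^bsub>M\<^esub> fst p, \<ominus>\<^bsub>N\<^esub> snd p)"]) (auto simp: M.l_neg N.l_neg)
qed (use abelian_groupE[OF assms(1)] abelian_groupE[OF assms(2)] in auto)

lemma dsum_neg:
  assumes "abelian_group M" "abelian_group N" "v \<in> carrier M" "w \<in> carrier N"
  shows "\<ominus>\<^bsub>dsum_gmodule M N\<^esub> (v, w) = (\<ominus>\<^bsub>M\<^esub> v, \<ominus>\<^bsub>N\<^esub> w)"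
proof -
  interpret M: abelian_group M by fact
  interpret N: abelian_group N by fact
  show ?thesis
    by (rule abelian_group.minus_equality[OF dsum_ab[OF assms(1,2)]]) (use assms(3,4) in \<open>auto simp: M.l_neg N.l_neg\<close>)
qed

lemma dsum_finsum:
  assumes "abelian_group M" "abelian_group N" "finite F" "\<And>n. n \<in> F \<Longrightarrow> c n \<in> carrier M" "\<And>n. n \<in> F \<Longrightarrow> c' n \<in> carrier N"
  shows "(\<Oplus>\<^bsub>dsum_gmodule M N\<^esub>n\<in>F. (c n, c' n)) = (\<Oplus>\<^bsub>M\<^esub>n\<in>F. c n, \<Oplus>\<^bsub>N\<^esub>n\<in>F. c' n)"
  using assms(3-5)
proof (induction F rule: finite_induct)
  interpret M: abelian_group M by fact
  interpret N: abelian_group N by fact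
  interpret D: abelian_group "dsum_gmodule M N" by (rule dsum_ab[OF assms(1,2)])
  case empty
  show ?case unfolding M.finsum_empty N.finsum_empty D.finsum_empty by simp
next
  interpret M: abelian_group M by fact
  interpret N: abelian_group N by fact
  interpret D: abelian_group "dsum_gmodule M N" by (rule dsum_ab[OF assms(1,2)])
  case (insert n F)
  have 1: "c \<in> F \<rightarrow> carrier M" "c n \<in> carrier M" "c' \<in> F \<rightarrow> carrier N" "c' n \<in> carrier N" using insert.prems by auto
  have 2: "(\<lambda>n. (c n, c' n)) \<in> F \<rightarrow> carrier (dsum_gmodule M N)" "(c n, c' n) \<in> carrier (dsum_gmodule M N)" using 1 by auto
  have IH: "(\<Oplus>\<^bsub>dsum_gmodule M N\<^esub>n\<in>F. (c n, c' n)) = (\<Oplus>\<^bsub>M\<^esub>n\<in>F. c n, \<Oplus>\<^bsub>N\<^esub>n\<in>F. c' n)"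
    by (rule insert.IH) (use insert.prems in auto)
  show ?case
    unfolding M.finsum_insert[OF insert.hyps 1(1,2)] N.finsum_insert[OF insert.hyps 1(3,4)]
      D.finsum_insert[OF insert.hyps 2] IH by simp
qed

lemma graded_dsum:
  assumes M: "graded_module A M" and N: "graded_module A N"
  shows "graded_module A (dsum_gmodule M N)"
  unfolding graded_module_def
proof (intro conjI allI ballI)
  let ?D = "dsum_gmodule M N"
  interpret M: gmod A M by (rule gmod.intro) fact
  interpret N: gmod A N by (rule gmod.intro) fact
  have abM: "abelian_group M" and abN: "abelian_group N" by unfold_locales
  show "abelian_group ?D" by (rule dsum_ab[OF abM abN])
  show "subgroup (gr ?D n) (add_monoid ?D)" for n
  proof
    show "gr ?D n \<subseteq> carrier (add_monoid ?D)" using M.gr_carrier N.gr_carrier by auto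
    fix x assume x: "x \<in> gr ?D n"
    then obtain v w where vw: "x = (v, w)" "v \<in> gr M n" "w \<in> gr N n" by auto
    have "inv\<^bsub>add_monoid ?D\<^esub> x = \<ominus>\<^bsub>?D\<^esub> x" by (simp add: a_inv_def)
    also have "\<dots> = (\<ominus>\<^bsub>M\<^esub> v, \<ominus>\<^bsub>N\<^esub> w)"
      unfolding vw(1) by (rule dsum_neg[OF abM abN M.gr_carrier[OF vw(2)] N.gr_carrier[OF vw(3)]])
    finally show "inv\<^bsub>add_monoid ?D\<^esub> x \<in> gr ?D n" using vw M.gr_neg N.gr_neg by simp
  qed (auto simp: M.gr_add N.gr_add)
  show "a \<odot>\<^bsub>?D\<^esub> v \<in> gr ?D (int m + n)" if "a \<in> A m" "v \<in> gr ?D n" for m n a v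
    using that M.gr_sm[OF that(1)] N.gr_sm[OF that(1)] by auto
  fix x assume "x \<in> carrier ?D"
  then obtain v w where vw: "x = (v, w)" "v \<in> carrier M" "w \<in> carrier N" by auto
  let ?c = "\<lambda>n. (M.gcomp v n, N.gcomp w n)"
  let ?S = "{n. ?c n \<noteq> \<zero>\<^bsub>?D\<^esub>}"
  have S: "?S = {n. M.gcomp v n \<noteq> \<zero>\<^bsub>M\<^esub>} \<union> {n. N.gcomp w n \<noteq> \<zero>\<^bsub>N\<^esub>}" by auto
  have fin: "finite ?S" unfolding S using M.gcomp_finite[OF vw(2)] N.gcomp_finite[OF vw(3)] by simp
  have sv: "v = (\<Oplus>\<^bsub>M\<^esub>n\<in>?S. M.gcomp v n)"
    by (rule trans[OF M.gcomp_sum[OF vw(2)] M.finsum_support[OF fin]]) (use vw in auto)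
  have sw: "w = (\<Oplus>\<^bsub>N\<^esub>n\<in>?S. N.gcomp w n)"
    by (rule trans[OF N.gcomp_sum[OF vw(3)] N.finsum_support[OF fin]]) (use vw in auto)
  have sum: "x = (\<Oplus>\<^bsub>?D\<^esub>n\<in>?S. ?c n)"
  proof -
    have "(\<Oplus>\<^bsub>?D\<^esub>n\<in>?S. ?c n) = (\<Oplus>\<^bsub>M\<^esub>n\<in>?S. M.gcomp v n, \<Oplus>\<^bsub>N\<^esub>n\<in>?S. N.gcomp w n)"
      by (rule dsum_finsum[OF abM abN fin]) (use vw in simp_all)
    also have "\<dots> = (v, w)" by (rule arg_cong2[where f = Pair, OF sv[symmetric] sw[symmetric]])
    finally show ?thesis unfolding vw(1) by (rule sym)
  qed
  show "\<exists>!c. (\<forall>n. c n \<in> gr ?D n) \<and> finite {n. c n \<noteq> \<zero>\<^bsub>?D\<^esub>} \<and> x = (\<Oplus>\<^bsub>?D\<^esub>n\<in>{n. c n \<noteq> \<zero>\<^bsub>?D\<^esub>}. c n)"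
  proof (rule ex1I)
    show "(\<forall>n. ?c n \<in> gr ?D n) \<and> finite ?S \<and> x = (\<Oplus>\<^bsub>?D\<^esub>n\<in>?S. ?c n)"
      using M.gcomp_gr[OF vw(2)] N.gcomp_gr[OF vw(3)] by (intro conjI allI fin sum) simp
    fix c assume "(\<forall>n. c n \<in> gr ?D n) \<and> finite {n. c n \<noteq> \<zero>\<^bsub>?D\<^esub>} \<and> x = (\<Oplus>\<^bsub>?D\<^esub>n\<in>{n. c n \<noteq> \<zero>\<^bsub>?D\<^esub>}. c n)"
    then have c: "\<forall>n. c n \<in> gr ?D n" and finc: "finite {n. c n \<noteq> \<zero>\<^bsub>?D\<^esub>}"
      and xc: "x = (\<Oplus>\<^bsub>?D\<^esub>n\<in>{n. c n \<noteq> \<zero>\<^bsub>?D\<^esub>}. c n)" by blast+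
    let ?T = "{n. c n \<noteq> \<zero>\<^bsub>?D\<^esub>}"
    have c1: "fst (c n) \<in> gr M n" and c2: "snd (c n) \<in> gr N n" for n
      using c[rule_format, of n] by (auto simp: mem_Times_iff)
    have "(\<Oplus>\<^bsub>?D\<^esub>n\<in>?T. (fst (c n), snd (c n))) = (\<Oplus>\<^bsub>M\<^esub>n\<in>?T. fst (c n), \<Oplus>\<^bsub>N\<^esub>n\<in>?T. snd (c n))"
      by (rule dsum_finsum[OF abM abN finc]) (use M.gr_carrier[OF c1] N.gr_carrier[OF c2] in simp_all)
    then have "(v, w) = (\<Oplus>\<^bsub>M\<^esub>n\<in>?T. fst (c n), \<Oplus>\<^bsub>N\<^esub>n\<in>?T. snd (c n))"
      using xc unfolding vw(1) prod.collapse by (rule_tac trans)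
    then have s1: "v = (\<Oplus>\<^bsub>M\<^esub>n\<in>?T. fst (c n))" and s2: "w = (\<Oplus>\<^bsub>N\<^esub>n\<in>?T. snd (c n))" by (simp_all only: prod.inject)
    have "M.gcomp v = (\<lambda>n. fst (c n))" by (rule M.gcomp_unique[OF c1 finc _ s1]) simp
    moreover have "N.gcomp w = (\<lambda>n. snd (c n))" by (rule N.gcomp_unique[OF c2 finc _ s2]) simp
    ultimately show "c = ?c" by (simp add: fun_eq_iff)
  qed
qed (use gmod.intro[OF M] gmod.intro[OF N] in \<open>auto simp: gmod.sm_closed gmod.sm_l gmod.sm_r gmod.sm_assoc gmod.sm_one\<close>)

lemma hgen_dsum:
  assumes M: "graded_module A M" and N: "graded_module A N" and S: "hgen M S" and T: "hgen N T"
  shows "\<exists>R. hgen (dsum_gmodule M N) R"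
proof (rule exI)
  interpret M: gmod A M by (rule gmod.intro) fact
  interpret N: gmod A N by (rule gmod.intro) fact
  let ?D = "dsum_gmodule M N"
  let ?R = "(\<lambda>s. (s, \<zero>\<^bsub>N\<^esub>)) ` S \<union> (\<lambda>t. (\<zero>\<^bsub>M\<^esub>, t)) ` T"
  show "hgen ?D ?R"
    unfolding hgen_def
  proof (intro conjI allI impI)
    show "finite ?R" using S T by (simp add: hgen_def)
    show "\<forall>s\<in>?R. \<exists>n. s \<in> gr ?D n"
      using S T M.gr_zero N.gr_zero unfolding hgen_def by (auto simp del: M.gr_zero N.gr_zero)
    fix U assume U: "\<zero>\<^bsub>?D\<^esub> \<in> U" "\<forall>v\<in>U. \<forall>w\<in>U. v \<oplus>\<^bsub>?D\<^esub> w \<in> U" "\<forall>a. \<forall>v\<in>U. a \<odot>\<^bsub>?D\<^esub> v \<in> U" "?R \<subseteq> U"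
    have add: "(v \<oplus>\<^bsub>M\<^esub> v', w \<oplus>\<^bsub>N\<^esub> w') \<in> U" if "(v, w) \<in> U" "(v', w') \<in> U" for v w v' w'
      using U(2)[rule_format, OF that] by simp
    have sm: "(a \<odot>\<^bsub>M\<^esub> v, a \<odot>\<^bsub>N\<^esub> w) \<in> U" if "(v, w) \<in> U" for a v w
      using U(3)[rule_format, OF that] by simp
    have "carrier M \<subseteq> {v. (v, \<zero>\<^bsub>N\<^esub>) \<in> U}"
    proof (rule hgen_induct[OF S])
      show "v \<oplus>\<^bsub>M\<^esub> w \<in> {v. (v, \<zero>\<^bsub>N\<^esub>) \<in> U}" if "v \<in> {v. (v, \<zero>\<^bsub>N\<^esub>) \<in> U}" "w \<in> {v. (v, \<zero>\<^bsub>N\<^esub>) \<in> U}" for v w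
        using add[of v "\<zero>\<^bsub>N\<^esub>" w "\<zero>\<^bsub>N\<^esub>"] that by simp
      show "a \<odot>\<^bsub>M\<^esub> v \<in> {v. (v, \<zero>\<^bsub>N\<^esub>) \<in> U}" if "v \<in> {v. (v, \<zero>\<^bsub>N\<^esub>) \<in> U}" for a v
        using sm[of v "\<zero>\<^bsub>N\<^esub>" a] that by simp
    qed (use U in auto)
    moreover have "carrier N \<subseteq> {w. (\<zero>\<^bsub>M\<^esub>, w) \<in> U}"
    proof (rule hgen_induct[OF T])
      show "v \<oplus>\<^bsub>N\<^esub> w \<in> {v. (\<zero>\<^bsub>M\<^esub>, v) \<in> U}" if "v \<in> {v. (\<zero>\<^bsub>M\<^esub>, v) \<in> U}" "w \<in> {v. (\<zero>\<^bsub>M\<^esub>, v) \<in> U}" for v w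
        using add[of "\<zero>\<^bsub>M\<^esub>" v "\<zero>\<^bsub>M\<^esub>" w] that by simp
      show "a \<odot>\<^bsub>N\<^esub> v \<in> {v. (\<zero>\<^bsub>M\<^esub>, v) \<in> U}" if "v \<in> {v. (\<zero>\<^bsub>M\<^esub>, v) \<in> U}" for a v
        using sm[of "\<zero>\<^bsub>M\<^esub>" v a] that by simp
    qed (use U in auto)
    ultimately have "(v, w) \<in> U" if "v \<in> carrier M" "w \<in> carrier N" for v w
      using add[of v "\<zero>\<^bsub>N\<^esub>" "\<zero>\<^bsub>M\<^esub>" w] that by (auto simp: subset_iff)
    then show "carrier ?D \<subseteq> U" by auto
  qed
qed

lemma pair_hom:
  assumes "graded_module A P" "f \<in> gr_hom P M" "g \<in> gr_hom P N"
  shows "(\<lambda>v\<in>carrier P. (f v, g v)) \<in> gr_hom P (dsum_gmodule M N)"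
proof (rule gr_homI)
  interpret P: gmod A P by (rule gmod.intro) fact
  show "(\<lambda>v\<in>carrier P. (f v, g v)) v \<in> gr (dsum_gmodule M N) n" if "v \<in> gr P n" for n v
    using hom_gr[OF assms(2) that] hom_gr[OF assms(3) that] P.gr_carrier[OF that] by simp
qed (use hom_closed[OF assms(2)] hom_closed[OF assms(3)] hom_add[OF assms(2)] hom_add[OF assms(3)] hom_sm[OF assms(2)]
      hom_sm[OF assms(3)] gmod.sm_closed[OF gmod.intro[OF assms(1)]]
      abelian_groupE(1)[OF assms(1)[unfolded graded_module_def, THEN conjunct1]] in auto)

lemma hom_fst_snd:
  assumes P: "graded_module A P" and f: "f \<in> gr_hom P (dsum_gmodule M N)"
  shows "(\<lambda>v\<in>carrier P. fst (f v)) \<in> gr_hom P M" "(\<lambda>v\<in>carrier P. snd (f v)) \<in> gr_hom P N"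
proof -
  interpret P: gmod A P by (rule gmod.intro) fact
  have c: "f v \<in> carrier M \<times> carrier N" if "v \<in> carrier P" for v using hom_closed[OF f that] by simp
  have g: "f v \<in> gr M n \<times> gr N n" if "v \<in> gr P n" for v n using hom_gr[OF f that] by simp
  show "(\<lambda>v\<in>carrier P. fst (f v)) \<in> gr_hom P M" "(\<lambda>v\<in>carrier P. snd (f v)) \<in> gr_hom P N"
    by (rule gr_homI; use c g in \<open>auto simp: mem_Times_iff hom_add[OF f] hom_sm[OF f] split_beta dest: P.gr_carrier\<close>)+
qed

lemma hom_inl_inr:
  assumes M: "graded_module A M" and N: "graded_module A N" and f: "f \<in> gr_hom (dsum_gmodule M N) Q"
  shows "(\<lambda>v\<in>carrier M. f (v, \<zero>\<^bsub>N\<^esub>)) \<in> gr_hom M Q" "(\<lambda>w\<in>carrier N. f (\<zero>\<^bsub>M\<^esub>, w)) \<in> gr_hom N Q"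
proof -
  interpret M: gmod A M by (rule gmod.intro) fact
  interpret N: gmod A N by (rule gmod.intro) fact
  show "(\<lambda>v\<in>carrier M. f (v, \<zero>\<^bsub>N\<^esub>)) \<in> gr_hom M Q"
  proof (rule gr_homI)
    show "(\<lambda>v\<in>carrier M. f (v, \<zero>\<^bsub>N\<^esub>)) v \<in> gr Q n" if "v \<in> gr M n" for n v
      using hom_gr[OF f, of "(v, \<zero>\<^bsub>N\<^esub>)" n] that M.gr_carrier[OF that] by simp
  qed (use hom_closed[OF f] hom_add[OF f, of "(_, \<zero>\<^bsub>N\<^esub>)" "(_, \<zero>\<^bsub>N\<^esub>)"] hom_sm[OF f, of "(_, \<zero>\<^bsub>N\<^esub>)"] in simp_all)
  show "(\<lambda>w\<in>carrier N. f (\<zero>\<^bsub>M\<^esub>, w)) \<in> gr_hom N Q"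
  proof (rule gr_homI)
    show "(\<lambda>w\<in>carrier N. f (\<zero>\<^bsub>M\<^esub>, w)) w \<in> gr Q n" if "w \<in> gr N n" for n w
      using hom_gr[OF f, of "(\<zero>\<^bsub>M\<^esub>, w)" n] that N.gr_carrier[OF that] by simp
  qed (use hom_closed[OF f] hom_add[OF f, of "(\<zero>\<^bsub>M\<^esub>, _)" "(\<zero>\<^bsub>M\<^esub>, _)"] hom_sm[OF f, of "(\<zero>\<^bsub>M\<^esub>, _)"] in simp_all)
qed

lemma hom_copair:
  assumes M: "graded_module A M" and N: "graded_module A N" and Q: "graded_module A Q"
    and g: "g \<in> gr_hom M Q" and h: "h \<in> gr_hom N Q"
  shows "(\<lambda>q\<in>carrier (dsum_gmodule M N). g (fst q) \<oplus>\<^bsub>Q\<^esub> h (snd q)) \<in> gr_hom (dsum_gmodule M N) Q"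
proof (rule gr_homI)
  interpret M: gmod A M by (rule gmod.intro) fact
  interpret N: gmod A N by (rule gmod.intro) fact
  interpret Q: gmod A Q by (rule gmod.intro) fact
  let ?D = "dsum_gmodule M N"
  let ?k = "\<lambda>q\<in>carrier ?D. g (fst q) \<oplus>\<^bsub>Q\<^esub> h (snd q)"
  note c = hom_closed[OF g] hom_closed[OF h]
  show "?k \<in> carrier ?D \<rightarrow>\<^sub>E carrier Q" using c by auto
  show "?k (a \<odot>\<^bsub>?D\<^esub> q) = a \<odot>\<^bsub>Q\<^esub> ?k q" if "q \<in> carrier ?D" for a q
    using that c by (auto simp: hom_sm[OF g] hom_sm[OF h] Q.sm_r)
  show "?k (q \<oplus>\<^bsub>?D\<^esub> q') = ?k q \<oplus>\<^bsub>Q\<^esub> ?k q'" if "q \<in> carrier ?D" "q' \<in> carrier ?D" for q q'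
    using that c by (auto simp: hom_add[OF g] hom_add[OF h] Q.a_ac)
  show "?k q \<in> gr Q n" if "q \<in> gr ?D n" for n q
    using that M.gr_carrier N.gr_carrier Q.gr_add[OF hom_gr[OF g] hom_gr[OF h]] by auto
qed

lemma obj_cone [simp]: "obj (cone X Y u) i = dsum_gmodule (obj X (i + 1)) (obj Y i)"
  by (simp add: cone_def Let_def)

lemma dif_cone: "v \<in> carrier (obj X (i + 1)) \<Longrightarrow> w \<in> carrier (obj Y i) \<Longrightarrow>
    dif (cone X Y u) i (v, w) = (\<ominus>\<^bsub>obj X (i + 2)\<^esub> dif X (i + 1) v, u (i + 1) v \<oplus>\<^bsub>obj Y (i + 1)\<^esub> dif Y i w)"
  by (simp add: cone_def Let_def)

context galg
begin

lemma fd_dsum: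
  assumes M: "graded_module A M" and N: "graded_module A N"
    and "fd_subspace (kmod M) (gr M n)" "fd_subspace (kmod N) (gr N n)"
  shows "fd_subspace (kmod (dsum_gmodule M N)) (gr (dsum_gmodule M N) n)"
proof -
  let ?D = "dsum_gmodule M N"
  let ?V = "(kmod ?D)\<lparr>carrier := gr ?D n\<rparr>" and ?P = "prod_space ((kmod M)\<lparr>carrier := gr M n\<rparr>) ((kmod N)\<lparr>carrier := gr N n\<rparr>)"
  obtain a b where "has_dim ((kmod M)\<lparr>carrier := gr M n\<rparr>) a" "has_dim ((kmod N)\<lparr>carrier := gr N n\<rparr>) b"
    using assms(3,4) by (auto simp: fd_subspace_def)
  then have P: "has_dim ?P (a + b)" by (rule has_dim_prod)
  have sub: "ksubspace (kmod ?D) (gr ?D n)" by (rule ksubspace_gr[OF graded_dsum[OF M N]])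
  have "has_dim ?V (a + b)"
  proof (rule has_dim_iso[OF kspace_restrict[OF kspace_kmod[OF graded_dsum[OF M N]] sub] _ _ P])
    show "lin ?V ?P (\<lambda>x. x)" by (rule linI) auto
    show "bij_betw (\<lambda>x. x) (carrier ?V) (carrier ?P)" by (simp add: bij_betw_def)
  qed
  then show ?thesis using sub by (auto simp: fd_subspace_def)
qed

text \<open>A cone has carriers in a product type, which keeps it out of \<open>per\<close>; finiteness of the spaces of maps
  is what is retained for it.\<close>

lemma tame_cone:
  assumes X: "tame X" and Y: "tame Y" shows "tame (cone X Y u)"
proof -
  have G: "graded_module A (obj X i)" "graded_module A (obj Y i)" for i
    using X Y by (simp_all add: tame_def gobj_def)
  obtain N where N: "\<And>i. N < \<bar>i\<bar> \<Longrightarrow> carrier (obj X i) = {\<zero>\<^bsub>obj X i\<^esub>}"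
    using X unfolding tame_def bounded_cpx_def by blast
  obtain N' where N': "\<And>i. N' < \<bar>i\<bar> \<Longrightarrow> carrier (obj Y i) = {\<zero>\<^bsub>obj Y i\<^esub>}"
    using Y unfolding tame_def bounded_cpx_def by blast
  have "carrier (obj (cone X Y u) i) = {\<zero>\<^bsub>obj (cone X Y u) i\<^esub>}" if i: "max (N + 1) N' < \<bar>i\<bar>" for i
  proof -
    have "N < \<bar>i + 1\<bar>" "N' < \<bar>i\<bar>" using i by linarith+
    then show ?thesis using N[of "i + 1"] N'[of i] by simp
  qed
  then have "bounded_cpx (cone X Y u)" unfolding bounded_cpx_def by blast
  moreover have "gobj (cone X Y u)" unfolding gobj_def using graded_dsum[OF G] by simp
  moreover have "\<exists>S. hgen (obj (cone X Y u) i) S" for i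
  proof -
    obtain S T where "hgen (obj X (i + 1)) S" "hgen (obj Y i) T" using X Y unfolding tame_def by blast
    then show ?thesis using hgen_dsum[OF G] by simp
  qed
  moreover have "fd_subspace (kmod (obj (cone X Y u) i)) (gr (obj (cone X Y u) i) n)" for i n
    using fd_dsum[OF G, of "i + 1" n i] X Y by (simp add: tame_def)
  ultimately show ?thesis by (simp add: tame_def)
qed

lemma complex_cone:
  assumes X: "good X" and Y: "good Y" and u: "u \<in> chain_maps X Y"
  shows "is_complex (cone X Y u)"
  unfolding is_complex_def
proof (intro allI conjI ballI)
  fix i :: int
  let ?Z = "cone X Y u"
  have e: "i + 1 + 1 = i + 2" "i + 1 + 2 = i + 3" "i + 2 + 1 = i + 3" by simp_all
  have gX: "graded_module A (obj X j)" and gY: "graded_module A (obj Y j)" for j by (rule good_gm[OF X], rule good_gm[OF Y])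
  have d1: "dif X (i + 1) \<in> gr_hom (obj X (i + 1)) (obj X (i + 2))" by (rule dif_hom[OF goodD(3)[OF X]]) simp
  have d2: "dif Y i \<in> gr_hom (obj Y i) (obj Y (i + 1))" by (rule dif_hom[OF goodD(3)[OF Y] refl])
  have u1: "u (i + 1) \<in> gr_hom (obj X (i + 1)) (obj Y (i + 1))" by (rule chain_mapsD1[OF u])
  interpret X1: gmod A "obj X (i + 1)" by (rule gmod.intro[OF gX])
  interpret X2: gmod A "obj X (i + 2)" by (rule gmod.intro[OF gX])
  interpret Y0: gmod A "obj Y i" by (rule gmod.intro[OF gY])
  interpret Y1: gmod A "obj Y (i + 1)" by (rule gmod.intro[OF gY])
  note c1 = hom_closed[OF d1] and c2 = hom_closed[OF d2] and c3 = hom_closed[OF u1]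
  have D: "dif ?Z i (v, w) = (\<ominus>\<^bsub>obj X (i + 2)\<^esub> dif X (i + 1) v, u (i + 1) v \<oplus>\<^bsub>obj Y (i + 1)\<^esub> dif Y i w)"
    if "v \<in> carrier (obj X (i + 1))" "w \<in> carrier (obj Y i)" for v w by (rule dif_cone[OF that])
  have Dc: "dif ?Z i (v, w) \<in> carrier (obj X (i + 2)) \<times> carrier (obj Y (i + 1))"
    if "v \<in> carrier (obj X (i + 1))" "w \<in> carrier (obj Y i)" for v w
    using c1[OF that(1)] c2[OF that(2)] c3[OF that(1)] by (simp add: D[OF that])
  have hom: "dif ?Z i \<in> gr_hom (obj ?Z i) (dsum_gmodule (obj X (i + 2)) (obj Y (i + 1)))"
  proof (rule gr_homI)
    show "dif ?Z i \<in> carrier (obj ?Z i) \<rightarrow>\<^sub>E carrier (dsum_gmodule (obj X (i + 2)) (obj Y (i + 1)))"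
    proof (rule PiE_I)
      fix p assume "p \<in> carrier (obj ?Z i)"
      then show "dif ?Z i p \<in> carrier (dsum_gmodule (obj X (i + 2)) (obj Y (i + 1)))" using Dc by (cases p) simp
    next
      fix p assume "p \<notin> carrier (obj ?Z i)"
      then show "dif ?Z i p = undefined" by (simp add: cone_def Let_def restrict_def)
    qed
    fix p assume "p \<in> carrier (obj ?Z i)"
    then obtain v w where p: "p = (v, w)" "v \<in> carrier (obj X (i + 1))" "w \<in> carrier (obj Y i)" by auto
    show "dif ?Z i (a \<odot>\<^bsub>obj ?Z i\<^esub> p) = a \<odot>\<^bsub>dsum_gmodule (obj X (i + 2)) (obj Y (i + 1))\<^esub> dif ?Z i p" for a
      using p c1[OF p(2)] c2[OF p(3)] c3[OF p(2)]
      by (simp add: D hom_sm[OF d1] hom_sm[OF d2] hom_sm[OF u1] X2.sm_neg_r Y1.sm_r)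
    fix q assume "q \<in> carrier (obj ?Z i)"
    then obtain v' w' where q: "q = (v', w')" "v' \<in> carrier (obj X (i + 1))" "w' \<in> carrier (obj Y i)" by auto
    show "dif ?Z i (p \<oplus>\<^bsub>obj ?Z i\<^esub> q) = dif ?Z i p \<oplus>\<^bsub>dsum_gmodule (obj X (i + 2)) (obj Y (i + 1))\<^esub> dif ?Z i q"
      using p q c1[OF p(2)] c2[OF p(3)] c3[OF p(2)] c1[OF q(2)] c2[OF q(3)] c3[OF q(2)]
      by (simp add: D hom_add[OF d1] hom_add[OF d2] hom_add[OF u1] X2.minus_add Y1.a_ac)
  next
    fix n p assume "p \<in> gr (obj ?Z i) n"
    then obtain v w where p: "p = (v, w)" "v \<in> gr (obj X (i + 1)) n" "w \<in> gr (obj Y i) n" by auto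
    show "dif ?Z i p \<in> gr (dsum_gmodule (obj X (i + 2)) (obj Y (i + 1))) n"
      using X2.gr_neg[OF hom_gr[OF d1 p(2)]] Y1.gr_add[OF hom_gr[OF u1 p(2)] hom_gr[OF d2 p(3)]]
        X1.gr_carrier[OF p(2)] Y0.gr_carrier[OF p(3)] by (simp add: p(1) D)
  qed
  then show "dif ?Z i \<in> gr_hom (obj ?Z i) (obj ?Z (i + 1))" by (simp add: e)
  fix p assume "p \<in> carrier (obj ?Z i)"
  then obtain v w where p: "p = (v, w)" "v \<in> carrier (obj X (i + 1))" "w \<in> carrier (obj Y i)" by auto
  have d1': "dif X (i + 2) \<in> gr_hom (obj X (i + 2)) (obj X (i + 3))" by (rule dif_hom[OF goodD(3)[OF X]]) simp
  have d2': "dif Y (i + 1) \<in> gr_hom (obj Y (i + 1)) (obj Y (i + 2))" by (rule dif_hom[OF goodD(3)[OF Y]]) simp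
  have u2: "u (i + 2) \<in> gr_hom (obj X (i + 2)) (obj Y (i + 2))" by (rule chain_mapsD1[OF u])
  interpret X3: gmod A "obj X (i + 3)" by (rule gmod.intro[OF gX])
  interpret Y2: gmod A "obj Y (i + 2)" by (rule gmod.intro[OF gY])
  have z1: "dif X (i + 2) (dif X (i + 1) v) = \<zero>\<^bsub>obj X (i + 3)\<^esub>" by (rule dif_dif[OF goodD(3)[OF X] p(2)]) simp_all
  have z2: "dif Y (i + 1) (dif Y i w) = \<zero>\<^bsub>obj Y (i + 2)\<^esub>" by (rule dif_dif[OF goodD(3)[OF Y] p(3)]) simp_all
  have z3: "u (i + 2) (dif X (i + 1) v) = dif Y (i + 1) (u (i + 1) v)" by (rule chain_mapsD2[OF u p(2)]) simp
  have q: "dif ?Z (i + 1) (v', w') = (\<ominus>\<^bsub>obj X (i + 3)\<^esub> dif X (i + 2) v', u (i + 2) v' \<oplus>\<^bsub>obj Y (i + 2)\<^esub> dif Y (i + 1) w')"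
    if "v' \<in> carrier (obj X (i + 2))" "w' \<in> carrier (obj Y (i + 1))" for v' w'
    using dif_cone[of v' X "i + 1" w' Y u] that by (simp add: e)
  note cc = c1[OF p(2)] c2[OF p(3)] c3[OF p(2)]
  have "u (i + 2) (\<ominus>\<^bsub>obj X (i + 2)\<^esub> dif X (i + 1) v) = \<ominus>\<^bsub>obj Y (i + 2)\<^esub> dif Y (i + 1) (u (i + 1) v)"
    unfolding hom_neg[OF gX gY u2 cc(1)] z3 ..
  moreover have "dif Y (i + 1) (u (i + 1) v \<oplus>\<^bsub>obj Y (i + 1)\<^esub> dif Y i w) = dif Y (i + 1) (u (i + 1) v)"
    unfolding hom_add[OF d2' cc(3,2)] z2 using hom_closed[OF d2' cc(3)] by simp
  moreover have "dif X (i + 2) (\<ominus>\<^bsub>obj X (i + 2)\<^esub> dif X (i + 1) v) = \<zero>\<^bsub>obj X (i + 3)\<^esub>"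
    unfolding hom_neg[OF gX gX d1' cc(1)] z1 using X3.add.inv_one by simp
  ultimately have "dif ?Z (i + 1) (dif ?Z i p) = (\<zero>\<^bsub>obj X (i + 3)\<^esub>, \<zero>\<^bsub>obj Y (i + 2)\<^esub>)"
    using cc hom_closed[OF d2' cc(3)] X3.add.inv_one by (simp add: p(1) D[OF p(2,3)] q Y2.l_neg)
  then show "dif ?Z (i + 1) (dif ?Z i p) = \<zero>\<^bsub>obj ?Z (i + 2)\<^esub>" by (simp add: e)
qed

lemma good_cone: "good X \<Longrightarrow> good Y \<Longrightarrow> u \<in> chain_maps X Y \<Longrightarrow> good (cone X Y u)"
  by (simp add: good_def complex_cone[unfolded good_def] tame_cone)

text \<open>A map into a direct sum is a pair of maps.\<close>

lemma gdim_dsum_right: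
  assumes P: "tame P" and X: "tame X" and Y: "tame Y" and Z: "gobj Z" and o: "\<And>p. obj Z p = dsum_gmodule (obj X p) (obj Y p)"
  shows "gdim P Z = gdim P X + gdim P Y"
proof -
  have gP: "gobj P" and gX: "gobj X" and gY: "gobj Y" using P X Y by (simp_all add: tame_def)
  obtain a where a: "has_dim (gmap_space P X) a" using gmap_fd[OF P X] by blast
  obtain b where b: "has_dim (gmap_space P Y) b" using gmap_fd[OF P Y] by blast
  let ?V = "gmap_space P Z" and ?W = "prod_space (gmap_space P X) (gmap_space P Y)"
  let ?f = "\<lambda>f. (\<lambda>p. \<lambda>v\<in>carrier (obj P p). fst (f p v), \<lambda>p. \<lambda>v\<in>carrier (obj P p). snd (f p v))"
  let ?g = "\<lambda>(g, h) p. \<lambda>v\<in>carrier (obj P p). (g p v, h p v)"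
  have F: "?f f \<in> gmaps P X \<times> gmaps P Y" if f: "f \<in> gmaps P Z" for f
    using hom_fst_snd[OF gobjD[OF gP] gmapsD[OF f, unfolded o]] by (simp add: gmaps_def)
  have G: "?g (g, h) \<in> gmaps P Z" if g: "g \<in> gmaps P X" and h: "h \<in> gmaps P Y" for g h
    using pair_hom[OF gobjD[OF gP] gmapsD[OF g] gmapsD[OF h]] by (simp add: gmaps_def o)
  have lin: "lin ?V ?W ?f"
  proof (rule linI)
    show "?f x \<in> carrier ?W" if "x \<in> carrier ?V" for x using F that by simp
    show "?f (x \<oplus>\<^bsub>?V\<^esub> y) = ?f x \<oplus>\<^bsub>?W\<^esub> ?f y" for x y
      by (auto simp: o split_beta intro!: ext restrict_ext)
    show "?f (c \<odot>\<^bsub>?V\<^esub> x) = c \<odot>\<^bsub>?W\<^esub> ?f x" for c x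
      by (auto simp: o split_beta intro!: ext restrict_ext)
  qed
  have bij: "bij_betw ?f (carrier ?V) (carrier ?W)"
  proof (rule bij_betw_byWitness[of _ ?g])
    show "\<forall>x\<in>carrier ?V. ?g (?f x) = x"
    proof
      fix x assume "x \<in> carrier ?V"
      then have x: "x \<in> gmaps P Z" by simp
      have "?g (fst (?f x), snd (?f x)) \<in> gmaps P Z" by (rule G) (use F[OF x] in simp_all)
      then have gx: "?g (?f x) \<in> gmaps P Z" by simp
      show "?g (?f x) = x" by (rule gmaps_eqI[OF gx x]) simp
    qed
    show "\<forall>y\<in>carrier ?W. ?f (?g y) = y"
    proof
      fix y assume "y \<in> carrier ?W"
      then obtain g h where y: "y = (g, h)" "g \<in> gmaps P X" "h \<in> gmaps P Y" by auto
      have fg: "fst (?f (?g (g, h))) \<in> gmaps P X" "snd (?f (?g (g, h))) \<in> gmaps P Y"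
        using F[OF G[OF y(2,3)]] by (simp_all add: mem_Times_iff)
      have 1: "fst (?f (?g (g, h))) = g" by (rule gmaps_eqI[OF fg(1) y(2)]) simp
      have 2: "snd (?f (?g (g, h))) = h" by (rule gmaps_eqI[OF fg(2) y(3)]) simp
      show "?f (?g y) = y" unfolding y(1) using 1 2 by (intro prod_eqI) simp_all
    qed
    show "?f ` carrier ?V \<subseteq> carrier ?W" using lin_closed[OF lin] by (rule image_subsetI)
    show "?g ` carrier ?W \<subseteq> carrier ?V"
    proof (rule image_subsetI)
      fix y assume "y \<in> carrier ?W"
      then obtain g h where y: "y = (g, h)" "g \<in> gmaps P X" "h \<in> gmaps P Y" by auto
      show "?g y \<in> carrier ?V" unfolding y(1) gmap_space_simps(1) by (rule G[OF y(2,3)])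
    qed
  qed
  have "has_dim ?V (a + b)" by (rule has_dim_iso[OF kspace_gmap[OF gP Z] lin bij has_dim_prod[OF a b]])
  then show ?thesis unfolding gdim_def by (simp add: has_dim_kdim[OF a] has_dim_kdim[OF b] has_dim_kdim)
qed

text \<open>A map out of a direct sum is determined by its restrictions to the summands, which are arbitrary.\<close>

lemma gdim_dsum_left:
  assumes X: "tame X" and Y: "tame Y" and Q: "tame Q" and Z: "gobj Z" and o: "\<And>p. obj Z p = dsum_gmodule (obj X p) (obj Y p)"
  shows "gdim Z Q = gdim X Q + gdim Y Q"
proof -
  have gQ: "gobj Q" and gX: "gobj X" and gY: "gobj Y" using Q X Y by (simp_all add: tame_def)
  obtain a where a: "has_dim (gmap_space X Q) a" using gmap_fd[OF X Q] by blast
  obtain b where b: "has_dim (gmap_space Y Q) b" using gmap_fd[OF Y Q] by blast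
  let ?V = "gmap_space Z Q" and ?W = "prod_space (gmap_space X Q) (gmap_space Y Q)"
  let ?f = "\<lambda>f. (\<lambda>p. \<lambda>v\<in>carrier (obj X p). f p (v, \<zero>\<^bsub>obj Y p\<^esub>), \<lambda>p. \<lambda>w\<in>carrier (obj Y p). f p (\<zero>\<^bsub>obj X p\<^esub>, w))"
  let ?g = "\<lambda>(g, h) p. \<lambda>q\<in>carrier (obj Z p). g p (fst q) \<oplus>\<^bsub>obj Q p\<^esub> h p (snd q)"
  have iX: "gmod A (obj X p)" and iY: "gmod A (obj Y p)" and iQ: "gmod A (obj Q p)" for p
    using gobjD[OF gX] gobjD[OF gY] gobjD[OF gQ] by (simp_all add: gmod.intro)
  have F: "?f f \<in> gmaps X Q \<times> gmaps Y Q" if f: "f \<in> gmaps Z Q" for f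
    using hom_inl_inr[OF gobjD[OF gX] gobjD[OF gY] gmapsD[OF f, unfolded o]] by (simp add: gmaps_def)
  have G: "?g (g, h) \<in> gmaps Z Q" if g: "g \<in> gmaps X Q" and h: "h \<in> gmaps Y Q" for g h
    using hom_copair[OF gobjD[OF gX] gobjD[OF gY] gobjD[OF gQ] gmapsD[OF g] gmapsD[OF h]] by (simp add: gmaps_def o del: dsum_simps)
  have z: "\<zero>\<^bsub>obj X p\<^esub> \<in> carrier (obj X p)" "\<zero>\<^bsub>obj Y p\<^esub> \<in> carrier (obj Y p)" for p
    using abelian_groupE(2)[OF gobjD[OF gX, unfolded graded_module_def, THEN conjunct1]]
      abelian_groupE(2)[OF gobjD[OF gY, unfolded graded_module_def, THEN conjunct1]] by simp_all
  have lin: "lin ?V ?W ?f"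
  proof (rule linI)
    show "?f x \<in> carrier ?W" if "x \<in> carrier ?V" for x using F that by simp
    show "?f (x \<oplus>\<^bsub>?V\<^esub> y) = ?f x \<oplus>\<^bsub>?W\<^esub> ?f y" for x y
      by (auto simp: o z intro!: ext restrict_ext)
    show "?f (c \<odot>\<^bsub>?V\<^esub> x) = c \<odot>\<^bsub>?W\<^esub> ?f x" for c x
      by (auto simp: o z intro!: ext restrict_ext)
  qed
  have bij: "bij_betw ?f (carrier ?V) (carrier ?W)"
  proof (rule bij_betw_byWitness[of _ ?g])
    show "\<forall>x\<in>carrier ?V. ?g (?f x) = x"
    proof
      fix x assume "x \<in> carrier ?V"
      then have x: "x \<in> gmaps Z Q" by simp
      have h: "x p \<in> gr_hom (dsum_gmodule (obj X p) (obj Y p)) (obj Q p)" for p using gmapsD[OF x, of p] by (simp add: o)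
      have "?g (fst (?f x), snd (?f x)) \<in> gmaps Z Q" by (rule G) (use F[OF x] in simp_all)
      then have gx: "?g (?f x) \<in> gmaps Z Q" by simp
      show "?g (?f x) = x"
      proof (rule gmaps_eqI[OF gx x])
        fix p q assume "q \<in> carrier (obj Z p)"
        then obtain v w where q: "q = (v, w)" "v \<in> carrier (obj X p)" "w \<in> carrier (obj Y p)" by (auto simp: o)
        interpret M: gmod A "obj X p" by (rule iX)
        interpret N: gmod A "obj Y p" by (rule iY)
        show "?g (?f x) p q = x p q"
          using q hom_add[OF h, of "(v, \<zero>\<^bsub>obj Y p\<^esub>)" p "(\<zero>\<^bsub>obj X p\<^esub>, w)"] by (simp add: o)
      qed
    qed
    show "\<forall>y\<in>carrier ?W. ?f (?g y) = y"
    proof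
      fix y assume "y \<in> carrier ?W"
      then obtain g h where y: "y = (g, h)" "g \<in> gmaps X Q" "h \<in> gmaps Y Q" by auto
      have fg: "fst (?f (?g (g, h))) \<in> gmaps X Q" "snd (?f (?g (g, h))) \<in> gmaps Y Q"
        using F[OF G[OF y(2,3)]] by (simp_all add: mem_Times_iff)
      have g0: "g p \<zero>\<^bsub>obj X p\<^esub> = \<zero>\<^bsub>obj Q p\<^esub>" for p by (rule hom_zero[OF gobjD[OF gX] gobjD[OF gQ] gmapsD[OF y(2)]])
      have h0: "h p \<zero>\<^bsub>obj Y p\<^esub> = \<zero>\<^bsub>obj Q p\<^esub>" for p by (rule hom_zero[OF gobjD[OF gY] gobjD[OF gQ] gmapsD[OF y(3)]])
      have 1: "fst (?f (?g (g, h))) = g"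
      proof (rule gmaps_eqI[OF fg(1) y(2)])
        fix p v assume v: "v \<in> carrier (obj X p)"
        interpret R: gmod A "obj Q p" by (rule iQ)
        show "fst (?f (?g (g, h))) p v = g p v" using v z gmaps_closed[OF y(2) v] by (simp add: o h0)
      qed
      have 2: "snd (?f (?g (g, h))) = h"
      proof (rule gmaps_eqI[OF fg(2) y(3)])
        fix p v assume v: "v \<in> carrier (obj Y p)"
        interpret R: gmod A "obj Q p" by (rule iQ)
        show "snd (?f (?g (g, h))) p v = h p v" using v z gmaps_closed[OF y(3) v] by (simp add: o g0)
      qed
      show "?f (?g y) = y" unfolding y(1) using 1 2 by (intro prod_eqI) simp_all
    qed
    show "?f ` carrier ?V \<subseteq> carrier ?W" using lin_closed[OF lin] by (rule image_subsetI)
    show "?g ` carrier ?W \<subseteq> carrier ?V"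
    proof (rule image_subsetI)
      fix y assume "y \<in> carrier ?W"
      then obtain g h where y: "y = (g, h)" "g \<in> gmaps X Q" "h \<in> gmaps Y Q" by auto
      show "?g y \<in> carrier ?V" unfolding y(1) gmap_space_simps(1) by (rule G[OF y(2,3)])
    qed
  qed
  have "has_dim ?V (a + b)" by (rule has_dim_iso[OF kspace_gmap[OF Z gQ] lin bij has_dim_prod[OF a b]])
  then show ?thesis unfolding gdim_def by (simp add: has_dim_kdim[OF a] has_dim_kdim[OF b] has_dim_kdim)
qed

lemma gdim_cong: "obj X = obj X' \<Longrightarrow> obj Y = obj Y' \<Longrightarrow> gdim X Y = gdim X' Y'"
  by (simp add: gdim_def gmap_space_def chain_map_space_def gmaps_def zero_map_def)

lemma gdim_translate:
  assumes X: "tame X" and Y: "tame Y"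
  shows "gdim (translate k X) (translate k Y) = gdim X Y"
proof -
  have gX: "gobj X" and gY: "gobj Y" using X Y by (simp_all add: tame_def)
  obtain a where a: "has_dim (gmap_space X Y) a" using gmap_fd[OF X Y] by blast
  let ?V = "gmap_space (translate k X) (translate k Y)" and ?W = "gmap_space X Y"
  let ?f = "\<lambda>f p. f (p - k)" and ?g = "\<lambda>f p. f (p + k)"
  have F: "?f f \<in> gmaps X Y" if "f \<in> gmaps (translate k X) (translate k Y)" for f
    unfolding gmaps_def
  proof (intro CollectI allI)
    show "f (i - k) \<in> gr_hom (obj X i) (obj Y i)" for i using gmapsD[OF that, of "i - k"] by simp
  qed
  have lin: "lin ?V ?W ?f" by (rule linI) (simp_all add: F)
  have "bij_betw ?f (carrier ?V) (carrier ?W)"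
  proof (rule bij_betw_byWitness[of _ ?g])
    show "?f ` carrier ?V \<subseteq> carrier ?W" using lin_closed[OF lin] by (rule image_subsetI)
    show "?g ` carrier ?W \<subseteq> carrier ?V" by (auto simp: gmaps_def)
  qed simp_all
  then have "has_dim ?V a" using has_dim_iso[OF kspace_gmap[OF gobj_translate[OF gX] gobj_translate[OF gY]] lin _ a] by blast
  then show ?thesis unfolding gdim_def by (simp add: has_dim_kdim[OF a] has_dim_kdim)
qed

text \<open>The terms of the cone are those of \<open>Y\<close> together with those of \<open>X[1]\<close>, and the translation changes
  the sign of the Euler characteristic of \<open>X\<close>; the map \<open>u\<close> does not affect dimensions of spaces of
  graded maps.\<close>

lemma euler_cone_right:
  assumes P: "good P" and X: "good X" and Y: "good Y" and u: "u \<in> chain_maps X Y"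
  shows "euler P (cone X Y u) = euler P Y - euler P X"
proof -
  have Z: "good (cone X Y u)" by (rule good_cone[OF X Y u])
  let ?z = "\<lambda>i. gdim P (translate i (cone X Y u))" and ?x = "\<lambda>i. gdim P (translate i X)" and ?y = "\<lambda>i. gdim P (translate i Y)"
  have zxy: "?z i = ?x (i + 1) + ?y i" for i
    by (rule gdim_dsum_right[OF goodD(1)[OF P] goodD(1)[OF good_translate[OF X]] goodD(1)[OF good_translate[OF Y]]
          goodD(2)[OF good_translate[OF Z]]]) (simp add: algebra_simps)
  let ?F = "{i. ?z i \<noteq> 0} \<union> {i. ?y i \<noteq> 0} \<union> (\<lambda>i. i - 1) ` {i. ?x i \<noteq> 0}"
  have fin: "finite ?F" using euler_eq(1)[OF P Z] euler_eq(1)[OF P Y] euler_eq(1)[OF P X] by simp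
  have "euler P (cone X Y u) = (\<Sum>i\<in>?F. euler_sign i * int (?z i))" by (rule euler_eq(3)[OF P Z fin]) blast
  also have "\<dots> = (\<Sum>i\<in>?F. euler_sign i * int (?y i)) + (\<Sum>i\<in>?F. euler_sign i * int (?x (i + 1)))"
    unfolding sum.distrib[symmetric] by (rule sum.cong) (simp_all add: zxy distrib_left)
  also have "(\<Sum>i\<in>?F. euler_sign i * int (?y i)) = euler P Y" by (rule euler_eq(3)[OF P Y fin, symmetric]) blast
  also have "(\<Sum>i\<in>?F. euler_sign i * int (?x (i + 1))) = (\<Sum>j\<in>(\<lambda>i. i + 1) ` ?F. - (euler_sign j * int (?x j)))"
    by (subst sum.reindex) (simp_all add: euler_sign_step)
  also have "\<dots> = - (\<Sum>j\<in>(\<lambda>i. i + 1) ` ?F. euler_sign j * int (?x j))" by (rule sum_negf)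
  also have "(\<Sum>j\<in>(\<lambda>i. i + 1) ` ?F. euler_sign j * int (?x j)) = euler P X"
  proof (rule euler_eq(3)[OF P X, symmetric])
    show "finite ((\<lambda>i. i + 1) ` ?F)" using fin by (rule finite_imageI)
    show "{i. ?x i \<noteq> 0} \<subseteq> (\<lambda>i. i + 1) ` ?F"
    proof
      fix i assume "i \<in> {i. ?x i \<noteq> 0}"
      then have "i - 1 \<in> ?F" by blast
      then show "i \<in> (\<lambda>i. i + 1) ` ?F" by (rule rev_image_eqI) simp
    qed
  qed
  finally show ?thesis by simp
qed

lemma euler_cone_left:
  assumes Q: "good Q" and X: "good X" and Y: "good Y" and u: "u \<in> chain_maps X Y"
  shows "euler (cone X Y u) Q = euler Y Q - euler X Q"
proof -
  have Z: "good (cone X Y u)" by (rule good_cone[OF X Y u])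
  let ?z = "\<lambda>i. gdim (cone X Y u) (translate i Q)" and ?x = "\<lambda>i. gdim X (translate i Q)" and ?y = "\<lambda>i. gdim Y (translate i Q)"
  have zxy: "?z i = ?x (i - 1) + ?y i" for i
  proof -
    have "?z i = gdim (translate 1 X) (translate i Q) + ?y i"
      by (rule gdim_dsum_left[OF goodD(1)[OF good_translate[OF X]] goodD(1)[OF Y] goodD(1)[OF good_translate[OF Q]] goodD(2)[OF Z]]) simp
    also have "gdim (translate 1 X) (translate i Q) = gdim (translate 1 X) (translate 1 (translate (i - 1) Q))"
      by (rule gdim_cong) (simp_all add: fun_eq_iff algebra_simps)
    also have "\<dots> = ?x (i - 1)" by (rule gdim_translate[OF goodD(1)[OF X] goodD(1)[OF good_translate[OF Q]]])
    finally show ?thesis .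
  qed
  let ?F = "{i. ?z i \<noteq> 0} \<union> {i. ?y i \<noteq> 0} \<union> (\<lambda>i. i + 1) ` {i. ?x i \<noteq> 0}"
  have fin: "finite ?F" using euler_eq(1)[OF Z Q] euler_eq(1)[OF Y Q] euler_eq(1)[OF X Q] by simp
  have "euler (cone X Y u) Q = (\<Sum>i\<in>?F. euler_sign i * int (?z i))" by (rule euler_eq(3)[OF Z Q fin]) blast
  also have "\<dots> = (\<Sum>i\<in>?F. euler_sign i * int (?y i)) + (\<Sum>i\<in>?F. euler_sign i * int (?x (i - 1)))"
    unfolding sum.distrib[symmetric] by (rule sum.cong) (simp_all add: zxy distrib_left)
  also have "(\<Sum>i\<in>?F. euler_sign i * int (?y i)) = euler Y Q" by (rule euler_eq(3)[OF Y Q fin, symmetric]) blast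
  also have "(\<Sum>i\<in>?F. euler_sign i * int (?x (i - 1))) = (\<Sum>j\<in>(\<lambda>i. i - 1) ` ?F. - (euler_sign j * int (?x j)))"
    by (subst sum.reindex) (simp_all add: euler_sign_minus inj_on_def)
  also have "\<dots> = - (\<Sum>j\<in>(\<lambda>i. i - 1) ` ?F. euler_sign j * int (?x j))" by (rule sum_negf)
  also have "(\<Sum>j\<in>(\<lambda>i. i - 1) ` ?F. euler_sign j * int (?x j)) = euler X Q"
  proof (rule euler_eq(3)[OF X Q, symmetric])
    show "finite ((\<lambda>i. i - 1) ` ?F)" using fin by (rule finite_imageI)
    show "{i. ?x i \<noteq> 0} \<subseteq> (\<lambda>i. i - 1) ` ?F"
    proof
      fix i assume "i \<in> {i. ?x i \<noteq> 0}"
      then have "i + 1 \<in> ?F" by blast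
      then show "i \<in> (\<lambda>i. i - 1) ` ?F" by (rule rev_image_eqI) simp
    qed
  qed
  finally show ?thesis by simp
qed

lemma per_good: assumes "X \<in> per A" shows "good X"
proof -
  have fg: "fg_gr_projective A (obj X i)" for i using assms by (simp add: per_def)
  have G: "graded_module A (obj X i)" and F: "fin_gen (obj X i)" for i
    using fg[of i] by (simp_all add: fg_gr_projective_def gr_projective_def)
  have "(\<exists>S. hgen (obj X i) S) \<and> (\<forall>n. fd_subspace (kmod (obj X i)) (gr (obj X i) n))" for i
  proof -
    obtain I k d s where g: "gens (obj X i) I k d s" by (rule fin_gen_gens[OF G F])
    show ?thesis using gens_hgen[OF G g] gens_fd[OF G g] by blast
  qed
  then show ?thesis using G assms by (auto simp: good_def tame_def gobj_def bounded_cpx_def per_def)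
qed

text \<open>Each vertex of a distinguished triangle is homotopy equivalent to the corresponding vertex of a
  cone triangle, so homotopy invariance reduces additivity to cones.\<close>

lemma euler_triangle:
  assumes t: "distinguished_triangle A X Y Z f g h"
  shows "good Q \<Longrightarrow> euler Q Y = euler Q X + euler Q Z" "good Q \<Longrightarrow> euler Y Q = euler X Q + euler Z Q"
proof -
  obtain X' Y' u a b c where per: "X \<in> per A" "Y \<in> per A" "Z \<in> per A" "X' \<in> per A" "Y' \<in> per A"
    and u: "u \<in> chain_maps X' Y'"
    and e: "homotopy_equiv X X' a" "homotopy_equiv Y Y' b" "homotopy_equiv Z (cone X' Y' u) c"
    using t unfolding distinguished_triangle_def by blast
  note G = per(1-5)[THEN per_good]
  have C: "good (cone X' Y' u)" by (rule good_cone[OF G(4,5) u])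
  show "euler Q Y = euler Q X + euler Q Z" if Q: "good Q"
    using euler_equiv_right[OF Q G(1,4) e(1)] euler_equiv_right[OF Q G(2,5) e(2)] euler_equiv_right[OF Q G(3) C e(3)]
      euler_cone_right[OF Q G(4,5) u] by simp
  show "euler Y Q = euler X Q + euler Z Q" if Q: "good Q"
    using euler_equiv_left[OF G(1,4) Q e(1)] euler_equiv_left[OF G(2,5) Q e(2)] euler_equiv_left[OF G(3) C Q e(3)]
      euler_cone_left[OF Q G(4,5) u] by simp
qed

end

section \<open>Grading shifts\<close>

lemma gr_shift_simps [simp]:
  "carrier (gr_shift m M) = carrier M" "zero (gr_shift m M) = \<zero>\<^bsub>M\<^esub>" "add (gr_shift m M) = add M"
  "smult (gr_shift m M) = smult M" "gr (gr_shift m M) n = gr M (n - m)"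
  by (simp_all add: gr_shift_def)

lemma gr_shift_a_inv [simp]: "a_inv (gr_shift m M) = a_inv M"
  by (rule ext) (simp add: a_inv_def)

lemma gr_shift_finsum [simp]: "finsum (gr_shift m M) = finsum M"
  by (intro ext) (simp add: finsum_def)

lemma gr_shift_shift: "gr_shift m (gr_shift n M) = gr_shift (m + n) M"
  by (simp add: gr_shift_def algebra_simps)

lemma gr_shift_0: "gr_shift 0 M = M"
  by (simp add: gr_shift_def)

lemma gr_hom_shift [simp]: "gr_hom (gr_shift m M) (gr_shift m N) = gr_hom M N"
proof -
  have "(\<forall>n. f ` gr M (n - m) \<subseteq> gr N (n - m)) \<longleftrightarrow> (\<forall>n. f ` gr M n \<subseteq> gr N n)" for f
    by (metis add_diff_cancel_right')
  then show ?thesis by (simp add: gr_hom_def)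
qed

lemma dsum_shift: "dsum_gmodule (gr_shift m M) (gr_shift m N) = gr_shift m (dsum_gmodule M N)"
  by (simp add: dsum_gmodule_def gr_shift_def)

lemma obj_shift [simp]: "obj (cpx_shift m X) i = gr_shift m (obj X i)"
  and dif_shift [simp]: "dif (cpx_shift m X) = dif X"
  by (simp_all add: cpx_shift_def)

lemma cpx_shift_shift: "cpx_shift m (cpx_shift n X) = cpx_shift (m + n) X"
  by (simp add: cpx_shift_def gr_shift_shift)

lemma cpx_shift_0: "cpx_shift 0 X = X"
  by (simp add: cpx_shift_def gr_shift_0)

lemma chain_maps_shift [simp]: "chain_maps (cpx_shift m X) (cpx_shift m Y) = chain_maps X Y"
  by (simp add: chain_maps_def)

lemma homotopic_shift [simp]: "homotopic (cpx_shift m X) (cpx_shift m Y) = homotopic X Y"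
  by (intro ext) (simp add: homotopic_def)

lemma comp_map_shift [simp]: "comp_map (cpx_shift m X) = comp_map X"
  by (intro ext) (simp add: comp_map_def)

lemma id_map_shift [simp]: "id_map (cpx_shift m X) = id_map X"
  unfolding id_map_def obj_shift gr_shift_simps ..

lemma homotopy_equiv_shift [simp]: "homotopy_equiv (cpx_shift m X) (cpx_shift m Y) = homotopy_equiv X Y"
  by (intro ext) (simp add: homotopy_equiv_def)

lemma translate_shift: "translate k (cpx_shift m X) = cpx_shift m (translate k X)"
proof (rule gcomplex.equality)
  show "obj (translate k (cpx_shift m X)) = obj (cpx_shift m (translate k X))" by (rule ext) simp
  show "dif (translate k (cpx_shift m X)) = dif (cpx_shift m (translate k X))"
    by (rule ext) (unfold dif_shift dif_translate obj_shift gr_shift_simps gr_shift_a_inv, rule refl)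
qed simp

lemma cone_shift: "cone (cpx_shift m X) (cpx_shift m Y) u = cpx_shift m (cone X Y u)"
  by (simp add: cone_def cpx_shift_def Let_def dsum_shift)

lemma cone_in_shift [simp]: "cone_in (cpx_shift m X) (cpx_shift m Y) = cone_in X Y"
  by (simp add: cone_in_def)

lemma cone_out_shift [simp]: "cone_out (cpx_shift m X) (cpx_shift m Y) = cone_out X Y"
  by (simp add: cone_out_def)

lemma graded_shift:
  assumes "graded_module A M" shows "graded_module A (gr_shift m M)"
  unfolding graded_module_def
proof (intro conjI allI ballI)
  interpret M: gmod A M by (rule gmod.intro) fact
  let ?N = "gr_shift m M"
  show "abelian_group ?N"
    by (rule abelian_groupI) (use abelian_groupE[OF M.abelian_group_axioms] in auto)
  show "subgroup (gr ?N n) (add_monoid ?N)" for n using M.gr_subgroup[of "n - m"] by simp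
  show "a \<odot>\<^bsub>?N\<^esub> v \<in> gr ?N (int k + n)" if "a \<in> A k" "v \<in> gr ?N n" for k n a v
    using M.gr_sm[OF that(1), of v "n - m"] that(2) by (simp add: add_diff_eq)
  fix v assume "v \<in> carrier ?N"
  then have v: "v \<in> carrier M" by simp
  let ?c = "\<lambda>n. M.gcomp v (n - m)" and ?S = "{n. M.gcomp v n \<noteq> \<zero>\<^bsub>M\<^esub>}"
  have S: "{n. ?c n \<noteq> \<zero>\<^bsub>M\<^esub>} = (\<lambda>n. n + m) ` ?S"
  proof (rule equalityI; rule subsetI)
    fix n assume "n \<in> {n. ?c n \<noteq> \<zero>\<^bsub>M\<^esub>}"
    then show "n \<in> (\<lambda>n. n + m) ` ?S" by (intro image_eqI[of _ _ "n - m"]) auto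
  qed auto
  have sum: "v = (\<Oplus>\<^bsub>M\<^esub>n\<in>{n. ?c n \<noteq> \<zero>\<^bsub>M\<^esub>}. ?c n)"
  proof -
    have "(\<Oplus>\<^bsub>M\<^esub>n\<in>(\<lambda>n. n + m) ` ?S. ?c n) = (\<Oplus>\<^bsub>M\<^esub>n\<in>?S. ?c (n + m))"
      by (rule M.add.finprod_reindex) (use v in \<open>auto simp: inj_on_def\<close>)
    also have "\<dots> = (\<Oplus>\<^bsub>M\<^esub>n\<in>?S. M.gcomp v n)" by simp
    finally show ?thesis unfolding S by (intro trans[OF M.gcomp_sum[OF v]]) (rule sym)
  qed
  show "\<exists>!c. (\<forall>n. c n \<in> gr ?N n) \<and> finite {n. c n \<noteq> \<zero>\<^bsub>?N\<^esub>} \<and> v = (\<Oplus>\<^bsub>?N\<^esub>n\<in>{n. c n \<noteq> \<zero>\<^bsub>?N\<^esub>}. c n)"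
  proof (rule ex1I)
    show "(\<forall>n. ?c n \<in> gr ?N n) \<and> finite {n. ?c n \<noteq> \<zero>\<^bsub>?N\<^esub>} \<and> v = (\<Oplus>\<^bsub>?N\<^esub>n\<in>{n. ?c n \<noteq> \<zero>\<^bsub>?N\<^esub>}. ?c n)"
      unfolding gr_shift_simps gr_shift_finsum
    proof (intro conjI allI)
      show "finite {n. ?c n \<noteq> \<zero>\<^bsub>M\<^esub>}" unfolding S using M.gcomp_finite[OF v] by simp
      show "v = (\<Oplus>\<^bsub>M\<^esub>n\<in>{n. ?c n \<noteq> \<zero>\<^bsub>M\<^esub>}. ?c n)" by (rule sum)
    qed (rule M.gcomp_gr[OF v])
    fix c assume "(\<forall>n. c n \<in> gr ?N n) \<and> finite {n. c n \<noteq> \<zero>\<^bsub>?N\<^esub>} \<and> v = (\<Oplus>\<^bsub>?N\<^esub>n\<in>{n. c n \<noteq> \<zero>\<^bsub>?N\<^esub>}. c n)"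
    then have c: "\<And>n. c n \<in> gr M (n - m)" and fin: "finite {n. c n \<noteq> \<zero>\<^bsub>M\<^esub>}" and vc: "v = (\<Oplus>\<^bsub>M\<^esub>n\<in>{n. c n \<noteq> \<zero>\<^bsub>M\<^esub>}. c n)"
      by simp_all
    let ?T = "{n. c n \<noteq> \<zero>\<^bsub>M\<^esub>}"
    have "M.gcomp v = (\<lambda>n. c (n + m))"
    proof (rule M.gcomp_unique[of _ "(\<lambda>n. n - m) ` ?T"])
      show "c (n + m) \<in> gr M n" for n using c[of "n + m"] by simp
      show "c (n + m) = \<zero>\<^bsub>M\<^esub>" if "n \<notin> (\<lambda>n. n - m) ` ?T" for n
      proof (rule ccontr)
        assume "c (n + m) \<noteq> \<zero>\<^bsub>M\<^esub>"
        then have "n \<in> (\<lambda>n. n - m) ` ?T" by (intro image_eqI[of _ _ "n + m"]) auto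
        then show False using that by simp
      qed
      have "(\<Oplus>\<^bsub>M\<^esub>n\<in>(\<lambda>n. n - m) ` ?T. c (n + m)) = (\<Oplus>\<^bsub>M\<^esub>n\<in>?T. c (n - m + m))"
        by (rule M.add.finprod_reindex) (use M.gr_carrier[OF c] in \<open>auto simp: inj_on_def\<close>)
      then have e: "(\<Oplus>\<^bsub>M\<^esub>n\<in>(\<lambda>n. n - m) ` ?T. c (n + m)) = (\<Oplus>\<^bsub>M\<^esub>n\<in>?T. c n)" by simp
      show "v = (\<Oplus>\<^bsub>M\<^esub>n\<in>(\<lambda>n. n - m) ` ?T. c (n + m))" unfolding e by (rule vc)
    qed (use fin in simp)
    then show "c = ?c" by (simp add: fun_eq_iff)
  qed
qed (use gmod.intro[OF assms] in \<open>simp_all add: gmod.sm_closed gmod.sm_l gmod.sm_r gmod.sm_assoc gmod.sm_one\<close>)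

lemma fin_gen_shift [simp]: "fin_gen (gr_shift m M) = fin_gen M"
  by (simp add: fin_gen_def)

lemma projective_shift:
  assumes "fg_gr_projective A P" shows "fg_gr_projective A (gr_shift m P)"
proof -
  have P: "graded_module A P" "fin_gen P" using assms by (auto simp: fg_gr_projective_def gr_projective_def)
  have h: "gr_hom (gr_shift m P) N = gr_hom P (gr_shift (- m) N)" for N :: "'a univ_gmodule"
    using gr_hom_shift[of m P "gr_shift (- m) N"] by (simp add: gr_shift_shift gr_shift_0)
  have h2: "gr_hom M N = gr_hom (gr_shift (- m) M) (gr_shift (- m) N)" for M N :: "'a univ_gmodule"
    by simp
  have lift: "\<exists>h\<in>gr_hom P (gr_shift (- m) M). \<forall>v\<in>carrier P. g (h v) = f v"
    if "graded_module A M" "graded_module A N" "g \<in> gr_hom M N" "f \<in> gr_hom P (gr_shift (- m) N)" "g ` carrier M = carrier N"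
    for M N :: "'a univ_gmodule" and g f
  proof -
    have "\<forall>(M :: 'a univ_gmodule) (N :: 'a univ_gmodule). graded_module A M \<longrightarrow> graded_module A N \<longrightarrow>
        (\<forall>g\<in>gr_hom M N. \<forall>f\<in>gr_hom P N. g ` carrier M = carrier N \<longrightarrow>
           (\<exists>h\<in>gr_hom P M. \<forall>v\<in>carrier P. g (h v) = f v))"
      using assms by (simp add: fg_gr_projective_def gr_projective_def)
    from this[rule_format, OF graded_shift[OF that(1)] graded_shift[OF that(2)], of g "- m" "- m" f]
    show ?thesis using that by simp
  qed
  show ?thesis
    unfolding fg_gr_projective_def gr_projective_def
    using P graded_shift[OF P(1)] lift by (auto simp: h)
qed

lemma per_shift:
  assumes "X \<in> per A" shows "cpx_shift m X \<in> per A"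
proof -
  have "is_complex (cpx_shift m X)" using assms by (simp add: per_def is_complex_def)
  then show ?thesis using assms by (simp add: per_def projective_shift)
qed

text \<open>The shift of the grading commutes with all ingredients of a distinguished triangle.\<close>

lemma triangle_shift:
  assumes "distinguished_triangle A X Y Z f g h"
  shows "distinguished_triangle A (cpx_shift m X) (cpx_shift m Y) (cpx_shift m Z) f g h"
proof -
  obtain X' Y' u a b c where t: "X \<in> per A" "Y \<in> per A" "Z \<in> per A" "f \<in> chain_maps X Y" "g \<in> chain_maps Y Z"
    "h \<in> chain_maps Z (translate 1 X)" "X' \<in> per A" "Y' \<in> per A" "u \<in> chain_maps X' Y'"
    "homotopy_equiv X X' a" "homotopy_equiv Y Y' b" "homotopy_equiv Z (cone X' Y' u) c"
    "homotopic X Y' (comp_map X u a) (comp_map X b f)"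
    "homotopic Y (cone X' Y' u) (comp_map Y (cone_in X' Y') b) (comp_map Y c g)"
    "homotopic Z (translate 1 X') (comp_map Z (cone_out X' Y') c) (comp_map Z (translate_map 1 a) h)"
    using assms unfolding distinguished_triangle_def by blast
  show ?thesis
    unfolding distinguished_triangle_def
    by (intro conjI bexI[of _ "cpx_shift m X'"] bexI[of _ "cpx_shift m Y'"] bexI[of _ u] exI[of _ a] exI[of _ b] exI[of _ c])
      (use t per_shift in \<open>simp_all add: translate_shift cone_shift\<close>)
qed

section \<open>Biadditive extensions\<close>

lemma pm_induct [consumes 1, case_names zero single add]:
  assumes "Poly_Mapping.keys g \<subseteq> S" "P 0" "\<And>X c. X \<in> S \<Longrightarrow> P (Poly_Mapping.single X c)"
    "\<And>g h. P g \<Longrightarrow> P h \<Longrightarrow> P (g + h)"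
  shows "P (g :: 'x \<Rightarrow>\<^sub>0 'c::comm_monoid_add)"
proof -
  have "P (\<Sum>X\<in>K. Poly_Mapping.single X (Poly_Mapping.lookup g X))" if "finite K" "K \<subseteq> S" for K
    using that by (induction K rule: finite_induct) (auto intro: assms)
  from this[OF finite_keys assms(1)]
  have "P (\<Sum>X\<in>Poly_Mapping.keys g. Poly_Mapping.single X (Poly_Mapping.lookup g X))" .
  moreover have "(\<Sum>X\<in>Poly_Mapping.keys g. Poly_Mapping.single X (Poly_Mapping.lookup g X)) = g"
  proof (rule poly_mapping_eqI)
    fix Y
    have "Poly_Mapping.lookup (\<Sum>X\<in>Poly_Mapping.keys g. Poly_Mapping.single X (Poly_Mapping.lookup g X)) Y =
        (\<Sum>X\<in>Poly_Mapping.keys g. if X = Y then Poly_Mapping.lookup g Y else 0)"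
      unfolding lookup_sum by (rule sum.cong) (auto simp: lookup_single)
    then show "Poly_Mapping.lookup (\<Sum>X\<in>Poly_Mapping.keys g. Poly_Mapping.single X (Poly_Mapping.lookup g X)) Y =
        Poly_Mapping.lookup g Y"
      by (simp add: in_keys_iff)
  qed
  ultimately show ?thesis by simp
qed

abbreviation cls :: "'x \<Rightarrow> 'x \<Rightarrow>\<^sub>0 int" where
  "cls X \<equiv> Poly_Mapping.single X 1"

text \<open>Biadditive extension of a map given on basis elements. Both the action of Laurent polynomials on
  the free group and the sesquilinear form are obtained in this way; the coefficient is an argument
  of \<open>\<phi>\<close> so that no scalar multiplication on the target is required.\<close>

definition bext :: "('x \<Rightarrow> 'y \<Rightarrow> int \<Rightarrow> 'z::ab_group_add) \<Rightarrow> ('x \<Rightarrow>\<^sub>0 int) \<Rightarrow> ('y \<Rightarrow>\<^sub>0 int) \<Rightarrow> 'z" where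
  "bext \<phi> g h = (\<Sum>X\<in>Poly_Mapping.keys g. \<Sum>Y\<in>Poly_Mapping.keys h.
     \<phi> X Y (Poly_Mapping.lookup g X * Poly_Mapping.lookup h Y))"

locale biadd =
  fixes \<phi> :: "'x \<Rightarrow> 'y \<Rightarrow> int \<Rightarrow> 'z::ab_group_add"
  assumes \<phi>_add: "\<phi> X Y (a + b) = \<phi> X Y a + \<phi> X Y b"
begin

lemma \<phi>_0 [simp]: "\<phi> X Y 0 = 0"
  using \<phi>_add[of X Y 0 0] by simp

lemma bext_superset:
  assumes "finite K" "finite L" "Poly_Mapping.keys g \<subseteq> K" "Poly_Mapping.keys h \<subseteq> L"
  shows "bext \<phi> g h = (\<Sum>X\<in>K. \<Sum>Y\<in>L. \<phi> X Y (Poly_Mapping.lookup g X * Poly_Mapping.lookup h Y))"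
proof -
  have "(\<Sum>Y\<in>Poly_Mapping.keys h. \<phi> X Y (Poly_Mapping.lookup g X * Poly_Mapping.lookup h Y)) =
      (\<Sum>Y\<in>L. \<phi> X Y (Poly_Mapping.lookup g X * Poly_Mapping.lookup h Y))" for X
    by (rule sum.mono_neutral_left) (use assms in \<open>auto simp: in_keys_iff\<close>)
  then have "bext \<phi> g h = (\<Sum>X\<in>Poly_Mapping.keys g. \<Sum>Y\<in>L. \<phi> X Y (Poly_Mapping.lookup g X * Poly_Mapping.lookup h Y))"
    by (simp add: bext_def)
  also have "\<dots> = (\<Sum>X\<in>K. \<Sum>Y\<in>L. \<phi> X Y (Poly_Mapping.lookup g X * Poly_Mapping.lookup h Y))"
    by (rule sum.mono_neutral_left) (use assms in \<open>auto simp: in_keys_iff\<close>)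
  finally show ?thesis .
qed

lemma bext_add_left: "bext \<phi> (g + g') h = bext \<phi> g h + bext \<phi> g' h"
proof -
  let ?K = "Poly_Mapping.keys g \<union> Poly_Mapping.keys g'" and ?L = "Poly_Mapping.keys h"
  have "bext \<phi> f h = (\<Sum>X\<in>?K. \<Sum>Y\<in>?L. \<phi> X Y (Poly_Mapping.lookup f X * Poly_Mapping.lookup h Y))"
    if "f \<in> {g, g', g + g'}" for f
    by (rule bext_superset) (use that Poly_Mapping.keys_add[of g g'] in auto)
  then show ?thesis by (simp add: lookup_add distrib_right \<phi>_add sum.distrib)
qed

lemma bext_add_right: "bext \<phi> g (h + h') = bext \<phi> g h + bext \<phi> g h'"
proof -
  let ?K = "Poly_Mapping.keys g" and ?L = "Poly_Mapping.keys h \<union> Poly_Mapping.keys h'"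
  have "bext \<phi> g f = (\<Sum>X\<in>?K. \<Sum>Y\<in>?L. \<phi> X Y (Poly_Mapping.lookup g X * Poly_Mapping.lookup f Y))"
    if "f \<in> {h, h', h + h'}" for f
    by (rule bext_superset) (use that Poly_Mapping.keys_add[of h h'] in auto)
  then show ?thesis by (simp add: lookup_add distrib_left \<phi>_add sum.distrib)
qed

lemma bext_single: "bext \<phi> (Poly_Mapping.single X a) (Poly_Mapping.single Y b) = \<phi> X Y (a * b)"
  using bext_superset[of "{X}" "{Y}" "Poly_Mapping.single X a" "Poly_Mapping.single Y b"] by (simp add: lookup_single)

lemma bext_zero_left [simp]: "bext \<phi> 0 h = 0" and bext_zero_right [simp]: "bext \<phi> g 0 = 0"
  by (simp_all add: bext_def)

lemma bext_minus_left: "bext \<phi> (- g) h = - bext \<phi> g h"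
  using bext_add_left[of g "- g" h] by (simp add: minus_unique)

lemma bext_minus_right: "bext \<phi> g (- h) = - bext \<phi> g h"
  using bext_add_right[of g h "- h"] by (simp add: minus_unique)

lemma bext_diff_left: "bext \<phi> (g - g') h = bext \<phi> g h - bext \<phi> g' h"
  using bext_add_left[of g "- g'" h] by (simp add: bext_minus_left)

lemma bext_diff_right: "bext \<phi> g (h - h') = bext \<phi> g h - bext \<phi> g h'"
  using bext_add_right[of g h "- h'"] by (simp add: bext_minus_right)

lemma bext_sum_right: "bext \<phi> g (\<Sum>i\<in>I. h i) = (\<Sum>i\<in>I. bext \<phi> g (h i))"
  by (induction I rule: infinite_finite_induct) (simp_all add: bext_add_right)

end

section \<open>The Grothendieck group as a module\<close>

text \<open>The action of Laurent polynomials in \<open>x\<close> on the free abelian group on complexes, \<open>x\<close> acting by the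
  grading shift.\<close>

definition act :: "(int \<Rightarrow>\<^sub>0 int) \<Rightarrow> ('a univ_gcomplex \<Rightarrow>\<^sub>0 int) \<Rightarrow> 'a univ_gcomplex \<Rightarrow>\<^sub>0 int" where
  "act = bext (\<lambda>m X. Poly_Mapping.single (cpx_shift m X))"

interpretation act: biadd "\<lambda>m (X :: 'a univ_gcomplex). Poly_Mapping.single (cpx_shift m X)"
  by unfold_locales (simp add: single_add)

lemmas act_simps = act.bext_add_left[folded act_def] act.bext_add_right[folded act_def]
  act.bext_minus_right[folded act_def] act.bext_diff_right[folded act_def]

lemma act_zero [simp]: "act 0 g = 0" "act p 0 = 0"
  by (simp_all add: act_def)

lemma act_single: "act (Poly_Mapping.single m a) (Poly_Mapping.single X b) = Poly_Mapping.single (cpx_shift m X) (a * b)"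
  by (simp add: act_def act.bext_single)

lemma act_one: "act 1 g = g"
proof -
  have "Poly_Mapping.keys g \<subseteq> UNIV" by simp
  then have "act (Poly_Mapping.single 0 1) g = g"
    by (induction g rule: pm_induct) (simp_all del: single_one add: act_simps act_single cpx_shift_0)
  then show ?thesis by simp
qed

lemma act_mult: "act (p * q) g = act p (act q g)"
proof -
  have 1: "act (Poly_Mapping.single m a * Poly_Mapping.single n b) g =
      act (Poly_Mapping.single m a) (act (Poly_Mapping.single n b) g)" for m a n b
  proof -
    have "Poly_Mapping.keys g \<subseteq> UNIV" by simp
    then show ?thesis
      by (induction g rule: pm_induct) (simp_all add: act_simps act_single mult_single cpx_shift_shift mult.assoc)
  qed
  have 2: "act (Poly_Mapping.single m a * q) g = act (Poly_Mapping.single m a) (act q g)" for m a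
  proof -
    have "Poly_Mapping.keys q \<subseteq> UNIV" by simp
    then show ?thesis by (induction q rule: pm_induct) (simp_all add: 1 act_simps distrib_left)
  qed
  have "Poly_Mapping.keys p \<subseteq> UNIV" by simp
  then show ?thesis by (induction p rule: pm_induct) (simp_all add: 2 act_simps distrib_right)
qed

lemma free_per_simps [simp]:
  "carrier (free_per A) = {g. Poly_Mapping.keys g \<subseteq> per A}" "zero (free_per A) = 0" "add (free_per A) = (+)"
  "smult (free_per A) = act"
  by (simp_all add: free_per_def act_def bext_def fun_eq_iff)

lemma keys_single_sub: "X \<in> S \<Longrightarrow> Poly_Mapping.keys (Poly_Mapping.single X c) \<subseteq> S"
  by simp

lemma keys_add_sub: "Poly_Mapping.keys g \<subseteq> S \<Longrightarrow> Poly_Mapping.keys h \<subseteq> S \<Longrightarrow> Poly_Mapping.keys (g + h) \<subseteq> S"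
  using Poly_Mapping.keys_add[of g h] by blast

lemma act_closed: assumes "Poly_Mapping.keys g \<subseteq> per A" shows "Poly_Mapping.keys (act p g) \<subseteq> per A"
proof -
  have 1: "Poly_Mapping.keys (act (Poly_Mapping.single m a) g) \<subseteq> per A" for m a
    using assms
  proof (induction g rule: pm_induct)
    case (single X c)
    then show ?case unfolding act_single by (intro keys_single_sub per_shift)
  next
    case (add g h)
    then show ?case unfolding act_simps by (intro keys_add_sub)
  qed simp
  have "Poly_Mapping.keys p \<subseteq> UNIV" by simp
  then show ?thesis
  proof (induction p rule: pm_induct)
    case (add p q)
    then show ?case unfolding act_simps by (intro keys_add_sub)
  qed (simp_all add: 1)
qed

lemma free_per_module: "Module.module laurent_ring (free_per A)"
proof (rule moduleI)
  show "cring laurent_ring" by (rule cring_univ_ring)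
  show "abelian_group (free_per A)"
  proof (rule abelian_groupI)
    show "x \<oplus>\<^bsub>free_per A\<^esub> y \<in> carrier (free_per A)" if "x \<in> carrier (free_per A)" "y \<in> carrier (free_per A)" for x y
      using keys_add_sub that by simp
    show "\<exists>y\<in>carrier (free_per A). y \<oplus>\<^bsub>free_per A\<^esub> x = \<zero>\<^bsub>free_per A\<^esub>" if "x \<in> carrier (free_per A)" for x
      by (rule bexI[of _ "- x"]) (use that in \<open>simp_all add: keys_minus\<close>)
  qed (simp_all add: algebra_simps)
qed (simp_all add: act_closed act_simps act_mult act_one)

lemma free_per_neg: "g \<in> carrier (free_per A) \<Longrightarrow> \<ominus>\<^bsub>free_per A\<^esub> g = - g"
proof -
  interpret F: Module.module laurent_ring "free_per A" by (rule free_per_module)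
  assume "g \<in> carrier (free_per A)"
  then show ?thesis by (intro F.M.minus_equality) (simp_all add: keys_minus)
qed

lemma free_per_minus: "g \<in> carrier (free_per A) \<Longrightarrow> h \<in> carrier (free_per A) \<Longrightarrow> g \<ominus>\<^bsub>free_per A\<^esub> h = g - h"
  by (simp add: a_minus_def free_per_neg)

abbreviation triangle_gens :: "(nat \<Rightarrow> 'a::{ring,monoid_mult} set) \<Rightarrow> ('a univ_gcomplex \<Rightarrow>\<^sub>0 int) set" where
  "triangle_gens A \<equiv> {Poly_Mapping.single Y 1 - Poly_Mapping.single X 1 - Poly_Mapping.single Z 1 | X Y Z.
        \<exists>f g h. distinguished_triangle A X Y Z f g h}"

lemma triangle_gens_carrier: "triangle_gens A \<subseteq> carrier (free_per A)"
proof
  fix s assume "s \<in> triangle_gens A"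
  then obtain X Y Z f g h where t: "distinguished_triangle A X Y Z f g h"
    "s = Poly_Mapping.single Y 1 - Poly_Mapping.single X 1 - Poly_Mapping.single Z 1" by blast
  then have p: "X \<in> per A" "Y \<in> per A" "Z \<in> per A" by (auto simp: distinguished_triangle_def)
  have "s = Poly_Mapping.single Y 1 + (- Poly_Mapping.single X 1 + - Poly_Mapping.single Z 1)"
    unfolding t(2) by (simp add: algebra_simps)
  moreover have "Poly_Mapping.keys (Poly_Mapping.single Y 1 + (- Poly_Mapping.single X 1 + - Poly_Mapping.single Z (1::int))) \<subseteq> per A"
    by (intro keys_add_sub) (use p in \<open>simp_all add: keys_minus\<close>)
  ultimately show "s \<in> carrier (free_per A)" by simp
qed

lemma relations_subgroup: "subgroup (triangle_relations A) (add_monoid (free_per A))"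
proof -
  have "group (add_monoid (free_per A))"
    by (rule abelian_group.a_group[OF Module.module.axioms(2)[OF free_per_module]])
  then show ?thesis unfolding triangle_relations_def
    by (rule group.generate_is_subgroup) (use triangle_gens_carrier[of A] in simp)
qed

lemma relations_carrier: "g \<in> triangle_relations A \<Longrightarrow> Poly_Mapping.keys g \<subseteq> per A"
  using subgroup.subset[OF relations_subgroup] by auto

lemma relations_add: "g \<in> triangle_relations A \<Longrightarrow> h \<in> triangle_relations A \<Longrightarrow> g + h \<in> triangle_relations A"
  using subgroup.m_closed[OF relations_subgroup] by simp

lemma relations_zero: "0 \<in> triangle_relations A"
  using subgroup.one_closed[OF relations_subgroup] by simp

lemma relations_neg: "g \<in> triangle_relations A \<Longrightarrow> - g \<in> triangle_relations A"
  using subgroup.m_inv_closed[OF relations_subgroup, of g A] free_per_neg[of g A] relations_carrier[of g A]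
  by (simp add: a_inv_def)

lemma relations_triangle:
  "distinguished_triangle A X Y Z f g h \<Longrightarrow>
    Poly_Mapping.single Y c - Poly_Mapping.single X c - Poly_Mapping.single Z c \<in> triangle_relations A"
proof -
  assume t: "distinguished_triangle A X Y Z f g h"
  let ?s = "\<lambda>c::int. Poly_Mapping.single Y c - Poly_Mapping.single X c - Poly_Mapping.single Z c"
  have 1: "?s 1 \<in> triangle_relations A"
    unfolding triangle_relations_def by (rule generate.incl) (use t in blast)
  have add: "?s (a + b) = ?s a + ?s b" for a b by (simp add: single_add)
  have nat: "?s (int n) \<in> triangle_relations A" for n
  proof (induction n)
    case (Suc n)
    have "?s (int (Suc n)) = ?s 1 + ?s (int n)" using add[of 1 "int n"] by simp
    then show ?case using relations_add[OF 1 Suc] by simp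
  qed (simp add: relations_zero)
  show ?thesis
  proof (cases c)
    case (nonneg n)
    then show ?thesis using nat by simp
  next
    case (neg n)
    have "?s c + ?s (int (Suc n)) = ?s 0" unfolding neg add[symmetric] by simp
    moreover have z: "?s 0 = 0" by simp
    ultimately have "?s c = - ?s (int (Suc n))" by (simp only: eq_neg_iff_add_eq_0 z)
    then show ?thesis using relations_neg[OF nat[of "Suc n"]] by (simp only:)
  qed
qed

lemma relations_induct [consumes 1, case_names zero gen neg add]:
  assumes "g \<in> triangle_relations A" "P 0"
    "\<And>X Y Z f g h. distinguished_triangle A X Y Z f g h \<Longrightarrow>
      P (Poly_Mapping.single Y 1 - Poly_Mapping.single X 1 - Poly_Mapping.single Z 1)"
    "\<And>g. P g \<Longrightarrow> P (- g)" "\<And>g h. P g \<Longrightarrow> P h \<Longrightarrow> P (g + h)"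
  shows "P g"
  using assms(1) unfolding triangle_relations_def
proof (induction rule: generate.induct)
  case one then show ?case using assms(2) by simp
next
  case (incl h) then show ?case using assms(3) by blast
next
  case (inv h)
  have "h \<in> carrier (free_per A)" using inv triangle_gens_carrier by blast
  then have "inv\<^bsub>add_monoid (free_per A)\<^esub> h = - h" using free_per_neg by (simp add: a_inv_def)
  moreover have "P h" using inv assms(3) by blast
  ultimately show ?case using assms(4) by simp
next
  case (eng g h) then show ?case using assms(5) by simp
qed

text \<open>Distinguished triangles are stable under shifts of the grading; hence the relations form a
  submodule over the Laurent polynomials, and \<open>K0\<close> is a quotient module.\<close>

lemma relations_act:
  assumes "g \<in> triangle_relations A" shows "act p g \<in> triangle_relations A"
  using assms
proof (induction g rule: relations_induct)
  case (gen X Y Z f g h)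
  have "Poly_Mapping.keys p \<subseteq> UNIV" by simp
  then show ?case
  proof (induction p rule: pm_induct)
    case (single m c)
    show ?case using relations_triangle[OF triangle_shift[OF gen, of m], of c] by (simp add: act_simps act_single)
  qed (simp_all add: relations_zero relations_add act_simps(1))
qed (simp_all add: relations_zero relations_neg relations_add act_simps)

lemma relations_submod: "submod (free_per A) (triangle_relations A)"
proof (rule submod.intro[OF free_per_module])
  show "ksubspace (free_per A) (triangle_relations A)"
    unfolding ksubspace_def using relations_carrier relations_zero relations_add relations_act by auto
qed

abbreviation K0_of :: "(nat \<Rightarrow> 'a::{ring,monoid_mult} set) \<Rightarrow> ('a univ_gcomplex \<Rightarrow>\<^sub>0 int) \<Rightarrow> ('a univ_gcomplex \<Rightarrow>\<^sub>0 int) set" where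
  "K0_of A g \<equiv> triangle_relations A +>\<^bsub>free_per A\<^esub> g"

lemma K0_module: "Module.module laurent_ring (K0 A)"
  unfolding K0_def by (rule submod.Q_module[OF relations_submod])

lemma K0_carrier: "carrier (K0 A) = K0_of A ` carrier (free_per A)"
  unfolding K0_def by (rule submod.Q_simps(1)[OF relations_submod])

lemma K0_zero: "\<zero>\<^bsub>K0 A\<^esub> = K0_of A 0"
  unfolding K0_def submod.Q_simps(2)[OF relations_submod]
  using submod.coset_zero[OF relations_submod, of A] by simp

lemma K0_add: "g \<in> carrier (free_per A) \<Longrightarrow> h \<in> carrier (free_per A) \<Longrightarrow> K0_of A g \<oplus>\<^bsub>K0 A\<^esub> K0_of A h = K0_of A (g + h)"
  unfolding K0_def using submod.Q_add[OF relations_submod, of g A h] by simp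

lemma K0_smult: "g \<in> carrier (free_per A) \<Longrightarrow> p \<odot>\<^bsub>K0 A\<^esub> K0_of A g = K0_of A (act p g)"
  unfolding K0_def using submod.Q_smult[OF relations_submod, of g A p] by simp

lemma K0_eq_iff: "g \<in> carrier (free_per A) \<Longrightarrow> h \<in> carrier (free_per A) \<Longrightarrow> K0_of A g = K0_of A h \<longleftrightarrow> g - h \<in> triangle_relations A"
  using submod.coset_eq_iff[OF relations_submod, of g A h] by (simp add: free_per_minus)

lemma K0_x: "P \<in> per A \<Longrightarrow> laurent_x \<odot>\<^bsub>K0 A\<^esub> K0_class A P = K0_class A (cpx_shift 1 P)"
  unfolding K0_class_def using K0_smult[of "Poly_Mapping.single P 1" A laurent_x] by (simp add: laurent_x_def act_single)

section \<open>Classes of cones\<close>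

lemma (in abelian_group) a_inv_zero: "\<ominus> \<zero> = \<zero>"
  using minus_equality[of \<zero> \<zero>] by simp

lemma zero_gmodule_simps [simp]:
  "carrier (zero_gmodule M) = {\<zero>\<^bsub>M\<^esub>}" "zero (zero_gmodule M) = \<zero>\<^bsub>M\<^esub>" "add (zero_gmodule M) = add M"
  "smult (zero_gmodule M) = smult M" "gr (zero_gmodule M) n = {\<zero>\<^bsub>M\<^esub>}"
  by (simp_all add: zero_gmodule_def)

lemma graded_zero:
  assumes "graded_module A M" shows "graded_module A (zero_gmodule M)"
  unfolding graded_module_def
proof (intro conjI allI ballI)
  interpret M: gmod A M by (rule gmod.intro) fact
  let ?Z = "zero_gmodule M"
  show ab: "abelian_group ?Z" by (rule abelian_groupI) auto
  interpret Z: abelian_group ?Z by (rule ab)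
  show "subgroup (gr ?Z n) (add_monoid ?Z)" for n
    using group.triv_subgroup[OF abelian_group.a_group[OF ab]] by simp
  show "\<exists>!c. (\<forall>n. c n \<in> gr ?Z n) \<and> finite {n. c n \<noteq> \<zero>\<^bsub>?Z\<^esub>} \<and> v = (\<Oplus>\<^bsub>?Z\<^esub>n\<in>{n. c n \<noteq> \<zero>\<^bsub>?Z\<^esub>}. c n)"
    if "v \<in> carrier ?Z" for v
  proof (rule ex1I[of _ "\<lambda>_. \<zero>\<^bsub>M\<^esub>"])
    have "(\<Oplus>\<^bsub>?Z\<^esub>n\<in>{}. \<zero>\<^bsub>M\<^esub>) = \<zero>\<^bsub>M\<^esub>" using Z.finsum_empty by simp
    then show "(\<forall>n. \<zero>\<^bsub>M\<^esub> \<in> gr ?Z n) \<and> finite {n::int. \<zero>\<^bsub>M\<^esub> \<noteq> \<zero>\<^bsub>?Z\<^esub>} \<and> v = (\<Oplus>\<^bsub>?Z\<^esub>n\<in>{n::int. \<zero>\<^bsub>M\<^esub> \<noteq> \<zero>\<^bsub>?Z\<^esub>}. \<zero>\<^bsub>M\<^esub>)"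
      using that by simp
  qed (simp add: fun_eq_iff)
qed (use gmod.intro[OF assms] in \<open>simp_all add: gmod.sm_zero_r abelian_groupE(2,5)[OF assms[unfolded graded_module_def, THEN conjunct1]]\<close>)

lemma projective_zero:
  assumes "fg_gr_projective A M" shows "fg_gr_projective A (zero_gmodule M)"
  unfolding fg_gr_projective_def gr_projective_def
proof (intro conjI allI impI ballI)
  have M: "graded_module A M" using assms by (auto simp: fg_gr_projective_def gr_projective_def)
  interpret M: gmod A M by (rule gmod.intro) fact
  show Z: "graded_module A (zero_gmodule M)" by (rule graded_zero[OF M])
  interpret Z: gmod A "zero_gmodule M" by (rule gmod.intro) fact
  show "fin_gen (zero_gmodule M)"
    unfolding fin_gen_def by (rule exI[of _ "{}"]) simp
  fix N L :: "'a univ_gmodule" and g f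
  assume N: "graded_module A N" and L: "graded_module A L" and g: "g \<in> gr_hom N L" and f: "f \<in> gr_hom (zero_gmodule M) L"
  have h: "(\<lambda>v\<in>carrier (zero_gmodule M). \<zero>\<^bsub>N\<^esub>) \<in> gr_hom (zero_gmodule M) N" by (rule hom_const_zero[OF Z N])
  have "f \<zero>\<^bsub>M\<^esub> = \<zero>\<^bsub>L\<^esub>" using hom_zero[OF Z L f] by simp
  then have "\<forall>v\<in>carrier (zero_gmodule M). g ((\<lambda>v\<in>carrier (zero_gmodule M). \<zero>\<^bsub>N\<^esub>) v) = f v"
    using hom_zero[OF N L g] by simp
  then show "\<exists>h\<in>gr_hom (zero_gmodule M) N. \<forall>v\<in>carrier (zero_gmodule M). g (h v) = f v"
    by (rule bexI[OF _ h])
qed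

lemma obj_stalk: "obj (stalk M) i = (if i = 0 then M else zero_gmodule M)"
  and dif_stalk: "dif (stalk M) i = (\<lambda>v\<in>carrier (obj (stalk M) i). \<zero>\<^bsub>M\<^esub>)"
  by (simp_all add: stalk_def Let_def)

lemma zero_obj_stalk [simp]: "\<zero>\<^bsub>obj (stalk M) i\<^esub> = \<zero>\<^bsub>M\<^esub>"
  by (simp add: obj_stalk)

lemma stalk_per:
  assumes "fg_gr_projective A M" shows "stalk M \<in> per A"
proof -
  have M: "graded_module A M" using assms by (auto simp: fg_gr_projective_def gr_projective_def)
  have G: "graded_module A (obj (stalk M) i)" for i using M graded_zero[OF M] by (simp add: obj_stalk)
  have d: "dif (stalk M) i \<in> gr_hom (obj (stalk M) i) (obj (stalk M) (i + 1))" for i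
    using hom_const_zero[OF G[of i] G[of "i + 1"]] by (simp add: dif_stalk)
  have "is_complex (stalk M)"
    unfolding is_complex_def
  proof (intro allI conjI ballI)
    fix i v assume "v \<in> carrier (obj (stalk M) i)"
    then have "dif (stalk M) i v \<in> carrier (obj (stalk M) (i + 1))" by (rule hom_closed[OF d])
    then show "dif (stalk M) (i + 1) (dif (stalk M) i v) = \<zero>\<^bsub>obj (stalk M) (i + 2)\<^esub>"
      by (simp add: dif_stalk[of M "i + 1"])
  qed (rule d)
  moreover have "\<forall>i. 0 < \<bar>i\<bar> \<longrightarrow> carrier (obj (stalk M) i) = {\<zero>\<^bsub>obj (stalk M) i\<^esub>}" by (simp add: obj_stalk)
  ultimately show ?thesis using assms projective_zero[OF assms] unfolding per_def by (auto simp: obj_stalk)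
qed

lemma shift_stalk: "cpx_shift m (stalk M) = stalk (gr_shift m M)"
proof -
  have "gr_shift m (zero_gmodule M) = zero_gmodule (gr_shift m M)" by (simp add: gr_shift_def zero_gmodule_def)
  then show ?thesis by (simp add: cpx_shift_def stalk_def Let_def fun_eq_iff if_distrib cong: if_cong)
qed

context galg
begin

lemma per_translate: assumes "X \<in> per A" shows "translate k X \<in> per A"
proof -
  have "good (translate k X)" by (rule good_translate[OF per_good[OF assms]])
  then have "is_complex (translate k X)" "bounded_cpx (translate k X)" by (auto simp: good_def tame_def)
  then show ?thesis using assms by (simp add: per_def bounded_cpx_def)
qed

text \<open>Degreewise inverses commute with the differentials.\<close>

lemma chain_inv:
  assumes X: "good X" and Y: "good Y" and f: "f \<in> chain_maps X Y"
    and bij: "\<And>i. bij_betw (f i) (carrier (obj X i)) (carrier (obj Y i))"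
  obtains g where "g \<in> chain_maps Y X" "comp_map X g f = id_map X" "comp_map Y f g = id_map Y"
proof -
  define g where "g i = restrict (inv_into (carrier (obj X i)) (f i)) (carrier (obj Y i))" for i
  note I = hom_inv[OF good_gm[OF X] good_gm[OF Y] chain_mapsD1[OF f] bij, folded g_def]
  have gc: "g \<in> chain_maps Y X"
  proof (rule chain_mapsI)
    show "g i \<in> gr_hom (obj Y i) (obj X i)" for i by (rule I(1))
    fix i v assume v: "v \<in> carrier (obj Y i)"
    have gv: "g i v \<in> carrier (obj X i)" by (rule hom_closed[OF I(1) v])
    have "dif Y i v = f (i + 1) (dif X i (g i v))"
      unfolding chain_mapsD2[OF f gv refl] I(3)[OF v] ..
    then show "g (i + 1) (dif Y i v) = dif X i (g i v)"
      using I(2)[OF dif_closed[OF goodD(3)[OF X] gv refl]] by simp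
  qed
  have "comp_map X g f = id_map X"
    by (rule gmaps_eqI[OF chain_gmaps[OF comp_chain[OF X f gc]] chain_gmaps[OF id_chain[OF X]]])
      (simp add: comp_map_apply id_map_def I(2))
  moreover have "comp_map Y f g = id_map Y"
    by (rule gmaps_eqI[OF chain_gmaps[OF comp_chain[OF Y gc f]] chain_gmaps[OF id_chain[OF Y]]])
      (simp add: comp_map_apply id_map_def I(3))
  ultimately show thesis by (rule that[OF gc])
qed

lemma cone_in_chain:
  assumes X: "good X" and Y: "good Y" and u: "u \<in> chain_maps X Y"
  shows "cone_in X Y \<in> chain_maps Y (cone X Y u)"
proof (rule chain_mapsI)
  fix i
  interpret X1: gmod A "obj X (i + 1)" by (rule gmod.intro[OF good_gm[OF X]])
  interpret X2: gmod A "obj X (i + 2)" by (rule gmod.intro[OF good_gm[OF X]])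
  interpret Y0: gmod A "obj Y i" by (rule gmod.intro[OF good_gm[OF Y]])
  interpret Y1: gmod A "obj Y (i + 1)" by (rule gmod.intro[OF good_gm[OF Y]])
  have e: "i + 1 + 1 = i + 2" by simp
  show "cone_in X Y i \<in> gr_hom (obj Y i) (obj (cone X Y u) i)"
    unfolding cone_in_def obj_cone
  proof (rule gr_homI)
    show "(\<lambda>w\<in>carrier (obj Y i). (\<zero>\<^bsub>obj X (i + 1)\<^esub>, w)) v \<in> gr (dsum_gmodule (obj X (i + 1)) (obj Y i)) n" if "v \<in> gr (obj Y i) n" for n v
      using that Y0.gr_carrier[OF that] by simp
  qed auto
  fix w assume w: "w \<in> carrier (obj Y i)"
  have dw: "dif Y i w \<in> carrier (obj Y (i + 1))" by (rule dif_closed[OF goodD(3)[OF Y] w refl])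
  have "dif X (i + 1) \<zero>\<^bsub>obj X (i + 1)\<^esub> = \<zero>\<^bsub>obj X (i + 2)\<^esub>"
    by (rule hom_zero[OF good_gm[OF X] good_gm[OF X] dif_hom[OF goodD(3)[OF X]]]) simp
  moreover have "u (i + 1) \<zero>\<^bsub>obj X (i + 1)\<^esub> = \<zero>\<^bsub>obj Y (i + 1)\<^esub>"
    by (rule hom_zero[OF good_gm[OF X] good_gm[OF Y] chain_mapsD1[OF u]])
  ultimately show "cone_in X Y (i + 1) (dif Y i w) = dif (cone X Y u) i (cone_in X Y i w)"
    using w dw by (simp add: cone_in_def dif_cone e X2.a_inv_zero)
qed

lemma cone_out_chain:
  assumes X: "good X" and Y: "good Y" and u: "u \<in> chain_maps X Y"
  shows "cone_out X Y \<in> chain_maps (cone X Y u) (translate 1 X)"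
proof (rule chain_mapsI)
  fix i
  interpret X1: gmod A "obj X (i + 1)" by (rule gmod.intro[OF good_gm[OF X]])
  interpret Y0: gmod A "obj Y i" by (rule gmod.intro[OF good_gm[OF Y]])
  have e: "i + 1 + 1 = i + 2" by simp
  show "cone_out X Y i \<in> gr_hom (obj (cone X Y u) i) (obj (translate 1 X) i)"
    unfolding cone_out_def obj_cone obj_translate
  proof (rule gr_homI)
    show "(\<lambda>(v, w)\<in>carrier (dsum_gmodule (obj X (i + 1)) (obj Y i)). v) p \<in> gr (obj X (i + 1)) n"
      if "p \<in> gr (dsum_gmodule (obj X (i + 1)) (obj Y i)) n" for n p
      using that X1.gr_carrier Y0.gr_carrier by auto
  qed auto
  fix p assume "p \<in> carrier (obj (cone X Y u) i)"
  then obtain v w where p: "p = (v, w)" "v \<in> carrier (obj X (i + 1))" "w \<in> carrier (obj Y i)" by auto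
  have "dif (cone X Y u) i p \<in> carrier (obj (cone X Y u) (i + 1))"
    by (rule dif_closed[OF complex_cone[OF X Y u] _ refl]) (use p in simp)
  then show "cone_out X Y (i + 1) (dif (cone X Y u) i p) = dif (translate 1 X) i (cone_out X Y i p)"
    unfolding p(1) dif_cone[OF p(2,3)] using p(2,3) by (simp add: cone_out_def dif_translate e)
qed

text \<open>The isomorphism and its inverse transport the structure maps of the cone, so that all squares
  of the isomorphism of triangles commute strictly.\<close>

lemma cone_relation:
  assumes X: "X \<in> per A" and Y: "Y \<in> per A" and Z: "Z \<in> per A" and u: "u \<in> chain_maps X Y"
    and f: "f \<in> chain_maps Z (cone X Y u)" and bij: "\<And>i. bij_betw (f i) (carrier (obj Z i)) (carrier (obj (cone X Y u) i))"
  shows "cls Y - cls X - cls Z \<in> triangle_relations A"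
proof -
  note gX = per_good[OF X] and gY = per_good[OF Y] and gZ = per_good[OF Z]
  have gC: "good (cone X Y u)" by (rule good_cone[OF gX gY u])
  obtain g where g: "g \<in> chain_maps (cone X Y u) Z" "comp_map Z g f = id_map Z" "comp_map (cone X Y u) f g = id_map (cone X Y u)"
    by (rule chain_inv[OF gZ gC f bij])
  have eq_refl: "homotopy_equiv U U (id_map U)" if U: "good U" for U :: "'a univ_gcomplex"
    unfolding homotopy_equiv_def
    using id_chain[OF U] homotopic_refl[OF U U id_chain[OF U]] comp_id_left[OF U U id_chain[OF U]] by (intro conjI bexI[of _ "id_map U"]) simp_all
  have ef: "homotopy_equiv Z (cone X Y u) f"
    unfolding homotopy_equiv_def using f g homotopic_refl[OF gZ gZ id_chain[OF gZ]] homotopic_refl[OF gC gC id_chain[OF gC]]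
    by (intro conjI bexI[of _ g]) simp_all
  note ci = cone_in_chain[OF gX gY u] and co = cone_out_chain[OF gX gY u]
  note gT = good_translate[OF gX, of 1]
  have c1: "comp_map Y f (comp_map Y g (cone_in X Y)) = cone_in X Y"
    unfolding comp_comp[OF gY ci g(1) f gC, symmetric] g(3) by (rule comp_id_left[OF gY gC ci])
  have c2: "comp_map Z (translate_map 1 (id_map X)) (comp_map Z (cone_out X Y) f) = comp_map Z (cone_out X Y) f"
    unfolding id_translate[symmetric] by (rule comp_id_left[OF gZ gT comp_chain[OF gZ f co]])
  have h1: "homotopic X Y (comp_map X u (id_map X)) (comp_map X (id_map Y) u)"
    unfolding comp_id_left[OF gX gY u] comp_id_right[OF gX gY u] by (rule homotopic_refl[OF gX gY u])
  have h2: "homotopic Y (cone X Y u) (comp_map Y (cone_in X Y) (id_map Y)) (comp_map Y f (comp_map Y g (cone_in X Y)))"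
    unfolding c1 comp_id_right[OF gY gC ci] by (rule homotopic_refl[OF gY gC ci])
  have h3: "homotopic Z (translate 1 X) (comp_map Z (cone_out X Y) f) (comp_map Z (translate_map 1 (id_map X)) (comp_map Z (cone_out X Y) f))"
    unfolding c2 by (rule homotopic_refl[OF gZ gT comp_chain[OF gZ f co]])
  have "distinguished_triangle A X Y Z u (comp_map Y g (cone_in X Y)) (comp_map Z (cone_out X Y) f)"
    unfolding distinguished_triangle_def
    by (intro conjI, rule X, rule Y, rule Z, rule u, rule comp_chain[OF gY ci g(1)], rule comp_chain[OF gZ f co],
        rule bexI[OF _ X], rule bexI[OF _ Y], rule bexI[OF _ u], rule exI[of _ "id_map X"], rule exI[of _ "id_map Y"],
        rule exI[of _ f], intro conjI, rule eq_refl[OF gX], rule eq_refl[OF gY], rule ef, rule h1, rule h2, rule h3)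
  then show ?thesis by (rule relations_triangle)
qed

lemma dif_cone_untranslate:
  assumes W: "good W" and v: "v \<in> carrier (obj W i)" and w: "w \<in> carrier (obj Y i)"
  shows "dif (cone (translate (- 1) W) Y u) i (v, w) = (dif W i v, u (i + 1) v \<oplus>\<^bsub>obj Y (i + 1)\<^esub> dif Y i w)"
proof -
  have dv: "dif W i v \<in> carrier (obj W (i + 1))" by (rule dif_closed[OF goodD(3)[OF W] v refl])
  interpret W1: gmod A "obj W (i + 1)" by (rule gmod.intro[OF good_gm[OF W]])
  have e: "1 + i = i + 1" by simp
  show ?thesis using v w dv by (simp add: dif_cone dif_translate e)
qed

text \<open>A degreewise split short exact sequence \<open>0 \<rightarrow> Y \<rightarrow> Z \<rightarrow> W \<rightarrow> 0\<close>, given by the projections \<open>a\<close>, \<open>b\<close> to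
  its ends and its extension cocycle \<open>u\<close>: then \<open>Z\<close> is isomorphic to the cone of \<open>u : W[-1] \<rightarrow> Y\<close>.\<close>

lemma split_relation:
  assumes W: "W \<in> per A" and Y: "Y \<in> per A" and Z: "Z \<in> per A" and u: "u \<in> chain_maps (translate (- 1) W) Y"
    and a: "\<And>i. a i \<in> gr_hom (obj Z i) (obj W i)" and b: "\<And>i. b i \<in> gr_hom (obj Z i) (obj Y i)"
    and da: "\<And>i v. v \<in> carrier (obj Z i) \<Longrightarrow> a (i + 1) (dif Z i v) = dif W i (a i v)"
    and db: "\<And>i v. v \<in> carrier (obj Z i) \<Longrightarrow> b (i + 1) (dif Z i v) = u (i + 1) (a i v) \<oplus>\<^bsub>obj Y (i + 1)\<^esub> dif Y i (b i v)"
    and bij: "\<And>i. bij_betw (\<lambda>v. (a i v, b i v)) (carrier (obj Z i)) (carrier (obj W i) \<times> carrier (obj Y i))"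
  shows "cls Y - cls (translate (- 1) W) - cls Z \<in> triangle_relations A"
proof (rule cone_relation[OF per_translate[OF W] Y Z u])
  let ?f = "\<lambda>i. \<lambda>v\<in>carrier (obj Z i). (a i v, b i v)"
  note gW = per_good[OF W] and gZ = per_good[OF Z]
  show "?f \<in> chain_maps Z (cone (translate (- 1) W) Y u)"
  proof (rule chain_mapsI)
    show "?f i \<in> gr_hom (obj Z i) (obj (cone (translate (- 1) W) Y u) i)" for i
      using pair_hom[OF good_gm[OF gZ] a b] by simp
    fix i v assume v: "v \<in> carrier (obj Z i)"
    show "?f (i + 1) (dif Z i v) = dif (cone (translate (- 1) W) Y u) i (?f i v)"
      using v dif_closed[OF goodD(3)[OF gZ] v refl] da[OF v] db[OF v] hom_closed[OF a v] hom_closed[OF b v]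
      by (simp add: dif_cone_untranslate[OF gW])
  qed
  show "bij_betw (?f i) (carrier (obj Z i)) (carrier (obj (cone (translate (- 1) W) Y u) i))" for i
    using bij[of i] by (simp add: bij_betw_def inj_on_def)
qed

section \<open>Generation by the indecomposable projectives\<close>

abbreviation "L j \<equiv> left_ideal_gmodule A (e j)"

text \<open>Both sides consist of the functions supported at \<open>0\<close> with value in \<open>Ae\<^sub>j\<close>; the equality is literal,
  not merely an isomorphism.\<close>

lemma left_ideal_gfree:
  assumes j: "j \<in> {1..r}" shows "L j = gfree {0} (\<lambda>_. j) (\<lambda>_. 0)"
proof -
  have im: "univ_in ` {a * e j | a. a \<in> S} = {f :: nat \<Rightarrow> 'a. f 0 * e j = f 0 \<and> f 0 \<in> S \<and> (\<forall>k. k \<notin> {0} \<longrightarrow> f k = 0)}"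
    if "\<And>a. a \<in> S \<Longrightarrow> a * e j \<in> S" for S
  proof (rule equalityI; rule subsetI)
    fix f assume "f \<in> univ_in ` {a * e j | a. a \<in> S}"
    then obtain a where "f = univ_in (a * e j)" "a \<in> S" by auto
    then show "f \<in> {f. f 0 * e j = f 0 \<and> f 0 \<in> S \<and> (\<forall>k. k \<notin> {0} \<longrightarrow> f k = 0)}"
      using that e_idem[OF j] by (simp add: univ_in_def mult.assoc)
  next
    fix f :: "nat \<Rightarrow> 'a" assume f: "f \<in> {f. f 0 * e j = f 0 \<and> f 0 \<in> S \<and> (\<forall>k. k \<notin> {0} \<longrightarrow> f k = 0)}"
    then have "f = univ_in (f 0 * e j)" by (auto simp: univ_in_def fun_eq_iff)
    moreover have "f 0 * e j \<in> {a * e j | a. a \<in> S}" using f by (intro CollectI exI[of _ "f 0"]) simp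
    ultimately show "f \<in> univ_in ` {a * e j | a. a \<in> S}" by (rule image_eqI)
  qed
  have c: "univ_in ` {a * e j | a. True} = {f. (\<forall>k\<in>{0}. f k * e j = f k) \<and> (\<forall>k. k \<notin> {0} \<longrightarrow> f k = 0)}"
    using im[of UNIV] by simp
  have g: "(if 0 \<le> n then univ_in ` {a * e j | a. a \<in> A (nat n)} else {\<lambda>_. 0}) =
      {f. (\<forall>k\<in>{0}. f k * e j = f k \<and> f k \<in> AZ (n - 0)) \<and> (\<forall>k. k \<notin> {0} \<longrightarrow> f k = 0)}" for n
  proof (cases "0 \<le> n")
    case True
    have "a * e j \<in> A (nat n)" if "a \<in> A (nat n)" for a using multA[OF that eA[OF j]] by simp
    then show ?thesis using True im[of "A (nat n)"] by (simp add: AZ_def)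
  next
    case False
    then show ?thesis by (auto simp: AZ_def fun_eq_iff) (metis neq0_conv)
  qed
  show ?thesis unfolding left_ideal_gmodule_def gfree_def c g ..
qed

lemma gfree_shift: "gr_shift m (gfree I i d) = gfree I i (\<lambda>k. d k + m)"
  by (simp add: gr_shift_def gfree_def diff_diff_add add.commute)

lemma projective_L: "j \<in> {1..r} \<Longrightarrow> fg_gr_projective A (L j)"
  unfolding left_ideal_gfree by (rule projective_gfree) auto

lemma per_L: "j \<in> {1..r} \<Longrightarrow> stalk (L j) \<in> per A"
  by (rule stalk_per[OF projective_L])

abbreviation "T \<equiv> triangle_relations A"
abbreviation "comb c \<equiv> (\<Sum>i\<in>{1..r}. act (c i) (cls (stalk (L i))))"

text \<open>Membership of the class of \<open>g\<close> in the submodule generated by the \<open>[Ae\<^sub>i]\<close>, phrased in the free group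
  so that induction on complexes needs no passage to the quotient.\<close>

definition spanned :: "('a univ_gcomplex \<Rightarrow>\<^sub>0 int) \<Rightarrow> bool" where
  "spanned g \<longleftrightarrow> (\<exists>c. g - comb c \<in> T)"

lemma relations_diff: "g \<in> T \<Longrightarrow> h \<in> T \<Longrightarrow> g - h \<in> T"
  using relations_add[OF _ relations_neg, of g A h] by simp

lemma spanned_rel: "g \<in> T \<Longrightarrow> spanned g"
  unfolding spanned_def by (rule exI[of _ "\<lambda>_. 0"]) simp

lemma spanned_add: "spanned g \<Longrightarrow> spanned h \<Longrightarrow> spanned (g + h)"
proof -
  assume "spanned g" "spanned h"
  then obtain c c' where c: "g - comb c \<in> T" "h - comb c' \<in> T" by (auto simp: spanned_def)
  have "g + h - comb (\<lambda>i. c i + c' i) = (g - comb c) + (h - comb c')" by (simp add: act_simps sum.distrib)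
  then have "g + h - comb (\<lambda>i. c i + c' i) \<in> T" using relations_add[OF c] by (simp only:)
  then show ?thesis unfolding spanned_def by (rule exI[of _ "\<lambda>i. c i + c' i"])
qed

lemma comb_act: "act p (comb c) = comb (\<lambda>i. p * c i)"
  unfolding act_def act.bext_sum_right unfolding act_def[symmetric] by (simp add: act_mult)

lemma spanned_act: "spanned g \<Longrightarrow> spanned (act p g)"
proof -
  assume "spanned g"
  then obtain c where c: "g - comb c \<in> T" by (auto simp: spanned_def)
  have "act p g - comb (\<lambda>i. p * c i) = act p (g - comb c)" by (simp add: act_simps comb_act)
  then have "act p g - comb (\<lambda>i. p * c i) \<in> T" using relations_act[OF c, of p] by (simp only:)
  then show ?thesis unfolding spanned_def by (rule exI[of _ "\<lambda>i. p * c i"])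
qed

lemma spanned_minus: "spanned g \<Longrightarrow> spanned (- g)"
proof -
  assume "spanned g"
  then have "spanned (act (- 1) g)" by (rule spanned_act)
  moreover have "act (- 1) g = - g"
    using act_simps(1)[of "- 1" 1 g] by (simp add: act_one eq_neg_iff_add_eq_0)
  ultimately show ?thesis by simp
qed

lemma spanned_cong: "g - h \<in> T \<Longrightarrow> spanned h \<Longrightarrow> spanned g"
  using spanned_add[OF spanned_rel, of "g - h" h] by simp

lemma spanned_L: "j \<in> {1..r} \<Longrightarrow> spanned (cls (stalk (L j)))"
proof -
  assume j: "j \<in> {1..r}"
  have "comb (\<lambda>i. if i = j then 1 else 0) = (\<Sum>i\<in>{1..r}. if i = j then cls (stalk (L j)) else 0)"
    by (rule sum.cong) (simp_all add: act_one)
  also have "\<dots> = cls (stalk (L j))" using j by simp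
  finally show ?thesis unfolding spanned_def by (intro exI[of _ "\<lambda>i. if i = j then 1 else 0"]) (simp add: relations_zero)
qed

text \<open>A zero object, as a complex of zero modules.\<close>

definition zero_cpx :: "'a univ_gcomplex" where "zero_cpx = stalk (gfree {} (\<lambda>_. 0) (\<lambda>_. 0))"

lemma obj_zero_cpx [simp]: "obj zero_cpx i = gfree {} (\<lambda>_. 0) (\<lambda>_. 0)"
proof -
  have "{f :: nat \<Rightarrow> 'a. \<forall>k. f k = 0} = {\<lambda>_. 0}" by auto
  then have "zero_gmodule (gfree {} (\<lambda>_. 0) (\<lambda>_. 0)) = gfree {} (\<lambda>_. 0) (\<lambda>_. 0)"
    by (simp add: zero_gmodule_def gfree_def)
  then show ?thesis by (simp add: zero_cpx_def obj_stalk)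
qed

lemma carrier_zero_cpx [simp]: "carrier (gfree {} (\<lambda>_. 0) (\<lambda>_. 0)) = {\<lambda>_. 0}"
  by auto

lemma zero_cpx_per: "zero_cpx \<in> per A"
  unfolding zero_cpx_def by (rule stalk_per[OF projective_gfree]) auto

lemma translate_zero_cpx: "translate k zero_cpx = zero_cpx"
proof (rule gcomplex.equality)
  show "obj (translate k zero_cpx) = obj zero_cpx" by (rule ext) simp
  have z: "dif zero_cpx i = (\<lambda>v\<in>{\<lambda>_. 0}. (\<lambda>_. 0))" for i
    unfolding zero_cpx_def dif_stalk unfolding zero_cpx_def[symmetric] by (simp del: gfree_simps(1))
  interpret G: abelian_group "gfree {} (\<lambda>_. 0) (\<lambda>_. 0)" by (rule gfree_ab)
  have n: "\<ominus>\<^bsub>gfree {} (\<lambda>_. 0) (\<lambda>_. 0)\<^esub> (\<lambda>_. 0) = (\<lambda>_. 0)" using G.a_inv_zero by (simp only: gfree_simps(2))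
  show "dif (translate k zero_cpx) = dif zero_cpx"
    by (rule ext) (unfold dif_translate z obj_zero_cpx carrier_zero_cpx, rule restrict_ext, simp add: n del: gfree_simps(1))
qed simp

text \<open>An isomorphism \<open>X \<rightarrow> W\<close> is a split sequence with zero kernel.\<close>

lemma iso_relation:
  assumes W: "W \<in> per A" and X: "X \<in> per A" and a: "a \<in> chain_maps X W"
    and bij: "\<And>i. bij_betw (a i) (carrier (obj X i)) (carrier (obj W i))"
  shows "cls zero_cpx - cls (translate (- 1) W) - cls X \<in> T"
proof (rule split_relation[OF W zero_cpx_per X zero_map_chain[OF per_good[OF per_translate[OF W]] per_good[OF zero_cpx_per]], where a = a and b = "zero_map X zero_cpx"])
  note gX = per_good[OF X] and gz = per_good[OF zero_cpx_per] and gW = per_good[OF W]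
  show "a i \<in> gr_hom (obj X i) (obj W i)" for i by (rule chain_mapsD1[OF a])
  show "zero_map X zero_cpx i \<in> gr_hom (obj X i) (obj zero_cpx i)" for i by (rule chain_mapsD1[OF zero_map_chain[OF gX gz]])
  fix i
  have b: "zero_map X zero_cpx i v \<in> {\<lambda>_. 0}" if "v \<in> carrier (obj X i)" for i v
    using hom_closed[OF chain_mapsD1[OF zero_map_chain[OF gX gz]] that] by (simp del: gfree_simps)
  show "bij_betw (\<lambda>v. (a i v, zero_map X zero_cpx i v)) (carrier (obj X i)) (carrier (obj W i) \<times> carrier (obj zero_cpx i))"
    using bij[of i] b[of _ i] unfolding bij_betw_def inj_on_def obj_zero_cpx carrier_zero_cpx
    by (auto simp: image_iff)
  fix v assume v: "v \<in> carrier (obj X i)"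
  show "a (i + 1) (dif X i v) = dif W i (a i v)" by (rule chain_mapsD2[OF a v refl])
  have s1: "zero_map X zero_cpx (i + 1) (dif X i v) = (\<lambda>_. 0)" using b[OF dif_closed[OF goodD(3)[OF gX] v refl]] by simp
  have s2: "dif zero_cpx i (zero_map X zero_cpx i v) \<in> carrier (obj zero_cpx (i + 1))"
    by (rule dif_closed[OF goodD(3)[OF gz] hom_closed[OF chain_mapsD1[OF zero_map_chain[OF gX gz]] v] refl])
  have s3: "zero_map (translate (- 1) W) zero_cpx (i + 1) (a i v) \<in> carrier (obj zero_cpx (i + 1))"
    by (rule hom_closed[OF chain_mapsD1[OF zero_map_chain[OF good_translate[OF gW] gz]]]) (use hom_closed[OF chain_mapsD1[OF a] v] in simp)
  show "zero_map X zero_cpx (i + 1) (dif X i v) =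
      zero_map (translate (- 1) W) zero_cpx (i + 1) (a i v) \<oplus>\<^bsub>obj zero_cpx (i + 1)\<^esub> dif zero_cpx i (zero_map X zero_cpx i v)"
    using s1 s2 s3 unfolding obj_zero_cpx carrier_zero_cpx by simp
qed

lemma id_bij: "bij_betw (id_map X i) (carrier (obj X i)) (carrier (obj X i))"
  by (simp add: id_map_def bij_betw_def inj_on_def)

text \<open>The complex \<open>zero_cpx\<close> is literally equal to its translates, so the relation of its identity map
  says \<open>[zero_cpx] = [zero_cpx] + [zero_cpx]\<close>.\<close>

lemma zero_cpx_rel: "cls zero_cpx \<in> T"
proof -
  have "cls zero_cpx - cls zero_cpx - cls zero_cpx \<in> T"
    using iso_relation[OF zero_cpx_per zero_cpx_per id_chain[OF per_good[OF zero_cpx_per]] id_bij] unfolding translate_zero_cpx .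
  then have "- cls zero_cpx \<in> T" by simp
  then show ?thesis using relations_neg by fastforce
qed

text \<open>For the identity map of \<open>W\<close> this reads \<open>[W[-1]] = -[W]\<close>; comparison with that case shows that
  isomorphic complexes have the same class.\<close>

lemma translate_rel:
  assumes W: "W \<in> per A" and X: "X \<in> per A" and a: "a \<in> chain_maps X W"
    and bij: "\<And>i. bij_betw (a i) (carrier (obj X i)) (carrier (obj W i))"
  shows "cls (translate (- 1) W) + cls X \<in> T"
  using relations_diff[OF zero_cpx_rel iso_relation[OF assms]] by (simp add: add.commute)

lemma translate_neg: "W \<in> per A \<Longrightarrow> cls (translate (- 1) W) + cls W \<in> T"
  by (rule translate_rel[OF _ _ id_chain[OF per_good] id_bij])

lemma iso_rel:
  assumes "W \<in> per A" "X \<in> per A" "a \<in> chain_maps X W"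
    "\<And>i. bij_betw (a i) (carrier (obj X i)) (carrier (obj W i))"
  shows "cls X - cls W \<in> T"
  using relations_diff[OF translate_rel[OF assms] translate_neg[OF assms(1)]] by simp

text \<open>The translation in the relation of a split sequence is removed by \<open>[W[-1]] = -[W]\<close>.\<close>

lemma split_rel:
  assumes "cls Y - cls (translate (- 1) W) - cls Z \<in> T" "W \<in> per A"
  shows "cls Z - (cls Y + cls W) \<in> T"
proof -
  have "- ((cls Y - cls (translate (- 1) W) - cls Z) +
      (cls (translate (- 1) W) + cls W)) \<in> T"
    by (rule relations_neg[OF relations_add[OF assms(1) translate_neg[OF assms(2)]]])
  moreover have "- ((cls Y - cls (translate (- 1) W) - cls Z) +
      (cls (translate (- 1) W) + cls W)) =
      cls Z - (cls Y + cls W)" by (simp add: algebra_simps)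
  ultimately show ?thesis by (simp only:)
qed

lemma spanned_translate_minus: "W \<in> per A \<Longrightarrow> spanned (cls W) \<Longrightarrow> spanned (cls (translate (- 1) W))"
  by (rule spanned_cong[OF _ spanned_minus]) (simp_all add: translate_neg)

lemma spanned_translate_plus:
  assumes W: "W \<in> per A" and s: "spanned (cls W)"
  shows "spanned (cls (translate 1 W))"
proof (rule spanned_cong[OF _ spanned_minus[OF s]])
  note g = per_good[OF W]
  have "translate (- 1) (translate 1 W) = W"
    using translate_translate[OF goodD(2)[OF g] goodD(3)[OF g], of "- 1" 1] translate_0[OF goodD(3)[OF g]] by simp
  then show "cls (translate 1 W) - - cls W \<in> T"
    using translate_neg[OF per_translate[OF W, of 1]] by (simp add: add.commute)
qed

lemma spanned_translate:
  assumes W: "W \<in> per A" and s: "spanned (cls W)"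
  shows "spanned (cls (translate k W))"
proof -
  note g = per_good[OF W]
  note tt = translate_translate[OF goodD(2)[OF g] goodD(3)[OF g]]
  have "spanned (cls (translate (int n) W)) \<and> spanned (cls (translate (- int n) W))" for n
  proof (induction n)
    case 0 then show ?case using s translate_0[OF goodD(3)[OF g]] by simp
  next
    case (Suc n)
    have "spanned (cls (translate 1 (translate (int n) W)))"
      by (rule spanned_translate_plus[OF per_translate[OF W]]) (use Suc in simp)
    moreover have "spanned (cls (translate (- 1) (translate (- int n) W)))"
      by (rule spanned_translate_minus[OF per_translate[OF W]]) (use Suc in simp)
    moreover have "- 1 + - int n = - int (Suc n)" by simp
    ultimately show ?case unfolding tt by (simp add: add.commute)
  qed
  from this[of "nat \<bar>k\<bar>"] show ?thesis by (cases "0 \<le> k") auto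
qed

end

definition stalk_map :: "('a, 'm) gmodule \<Rightarrow> ('a, 'n) gmodule \<Rightarrow> ('m \<Rightarrow> 'n) \<Rightarrow> int \<Rightarrow> 'm \<Rightarrow> 'n" where
  "stalk_map M N \<phi> i = (if i = 0 then \<phi> else (\<lambda>v\<in>carrier (obj (stalk M) i). \<zero>\<^bsub>N\<^esub>))"

lemma fg_graded: "fg_gr_projective A M \<Longrightarrow> graded_module A M"
  by (simp add: fg_gr_projective_def gr_projective_def)

lemma graded_stalk: "graded_module A M \<Longrightarrow> graded_module A (obj (stalk M) i)"
  by (simp add: obj_stalk graded_zero)

lemma stalk_map_hom:
  assumes "graded_module A M" "graded_module A N" "\<phi> \<in> gr_hom M N"
  shows "stalk_map M N \<phi> i \<in> gr_hom (obj (stalk M) i) (obj (stalk N) i)"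
proof (cases "i = 0")
  case True then show ?thesis using assms(3) by (simp add: stalk_map_def obj_stalk)
next
  case False then show ?thesis
    using hom_const_zero[OF graded_stalk[OF assms(1), of i] graded_stalk[OF assms(2), of i]] by (simp add: stalk_map_def)
qed

lemma stalk_map_bij:
  assumes "bij_betw (\<lambda>v. (a v, b v)) (carrier M) (carrier W \<times> carrier Y)"
  shows "bij_betw (\<lambda>v. (stalk_map M W a i v, stalk_map M Y b i v)) (carrier (obj (stalk M) i))
    (carrier (obj (stalk W) i) \<times> carrier (obj (stalk Y) i))"
proof (cases "i = 0")
  case True then show ?thesis using assms by (simp add: stalk_map_def obj_stalk)
next
  case False then show ?thesis by (simp add: stalk_map_def obj_stalk bij_betw_def)
qed

lemma dif_translate_stalk:
  assumes "graded_module A M" "v \<in> carrier (obj (translate k (stalk M)) i)"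
  shows "dif (translate k (stalk M)) i v = \<zero>\<^bsub>M\<^esub>"
proof -
  interpret S: gmod A "obj (stalk M) (i + k + 1)" by (rule gmod.intro[OF graded_stalk[OF assms(1)]])
  show ?thesis using S.a_inv_zero assms(2) by (simp add: dif_translate dif_stalk)
qed

context galg
begin

text \<open>A direct sum decomposition, placed in degree zero; the extension cocycle vanishes.\<close>

lemma stalk_split:
  assumes M: "fg_gr_projective A M" and W: "fg_gr_projective A W" and Y: "fg_gr_projective A Y"
    and a: "a \<in> gr_hom M W" and b: "b \<in> gr_hom M Y"
    and bij: "bij_betw (\<lambda>v. (a v, b v)) (carrier M) (carrier W \<times> carrier Y)"
  shows "cls (stalk M) - (cls (stalk Y) + cls (stalk W)) \<in> T"
proof (rule split_rel[OF split_relation])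
  note pM = stalk_per[OF M] and pW = stalk_per[OF W] and pY = stalk_per[OF Y]
  note gM = fg_graded[OF M] and gW = fg_graded[OF W] and gY = fg_graded[OF Y]
  note sM = graded_stalk[OF gM] and sW = graded_stalk[OF gW] and sY = graded_stalk[OF gY]
  note ha = stalk_map_hom[OF gM gW a] and hb = stalk_map_hom[OF gM gY b]
  show "stalk W \<in> per A" "stalk W \<in> per A" "stalk Y \<in> per A" "stalk M \<in> per A" by (fact pW pY pM)+
  show "zero_map (translate (- 1) (stalk W)) (stalk Y) \<in> chain_maps (translate (- 1) (stalk W)) (stalk Y)"
    by (rule zero_map_chain[OF per_good[OF per_translate[OF pW]] per_good[OF pY]])
  fix i
  show "stalk_map M W a i \<in> gr_hom (obj (stalk M) i) (obj (stalk W) i)" by (rule ha)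
  show "stalk_map M Y b i \<in> gr_hom (obj (stalk M) i) (obj (stalk Y) i)" by (rule hb)
  show "bij_betw (\<lambda>v. (stalk_map M W a i v, stalk_map M Y b i v)) (carrier (obj (stalk M) i))
    (carrier (obj (stalk W) i) \<times> carrier (obj (stalk Y) i))" by (rule stalk_map_bij[OF bij])
  fix v assume v: "v \<in> carrier (obj (stalk M) i)"
  have av: "stalk_map M W a i v \<in> carrier (obj (stalk W) i)" by (rule hom_closed[OF ha v])
  have bv: "stalk_map M Y b i v \<in> carrier (obj (stalk Y) i)" by (rule hom_closed[OF hb v])
  show "stalk_map M W a (i + 1) (dif (stalk M) i v) = dif (stalk W) i (stalk_map M W a i v)"
    using hom_zero[OF sM sW ha, of "i + 1"] v av by (simp add: dif_stalk)
  interpret Y1: gmod A "obj (stalk Y) (i + 1)" by (rule gmod.intro[OF sY])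
  show "stalk_map M Y b (i + 1) (dif (stalk M) i v) =
    zero_map (translate (- 1) (stalk W)) (stalk Y) (i + 1) (stalk_map M W a i v) \<oplus>\<^bsub>obj (stalk Y) (i + 1)\<^esub>
      dif (stalk Y) i (stalk_map M Y b i v)"
    using hom_zero[OF sM sY hb, of "i + 1"] v av bv Y1.l_zero[OF Y1.zero_closed] by (simp add: dif_stalk zero_map_def)
qed

text \<open>Induction on the number of summands: project onto the coordinate \<open>k\<close> and its complement. The
  summand with generator in degree \<open>d k\<close> is a grading shift of \<open>Ae\<^bsub>i k\<^esub>\<close>, so its class is a power of
  \<open>x\<close> times a generator.\<close>

lemma spanned_gfree:
  assumes "finite I" "\<forall>k\<in>I. i k \<in> {1..r}"
  shows "spanned (cls (stalk (gfree I i d)))"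
  using assms
proof (induction I rule: finite_induct)
  case empty
  have "gfree {} i d = gfree {} (\<lambda>_. 0) (\<lambda>_. 0)" by (simp add: gfree_def)
  then show ?case using spanned_rel[OF zero_cpx_rel] by (simp add: zero_cpx_def)
next
  case (insert k I)
  have ik: "i k \<in> {1..r}" using insert by simp
  let ?M = "gfree (insert k I) i d" and ?W = "gr_shift (d k) (L (i k))" and ?Y = "gfree I i d"
  have W: "?W = gfree {0} (\<lambda>_. i k) (\<lambda>_. d k)" using left_ideal_gfree[OF ik] by (simp add: gfree_shift)
  have pM: "fg_gr_projective A ?M" and pW: "fg_gr_projective A ?W" and pY: "fg_gr_projective A ?Y"
    unfolding W by (rule projective_gfree; use insert in auto)+
  let ?a = "\<lambda>f\<in>carrier ?M. univ_in (f k)" and ?b = "\<lambda>f\<in>carrier ?M. f(k := 0)"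
  have Mc: "(\<lambda>n. v n + w n) \<in> carrier ?M" "(\<lambda>n. c * v n) \<in> carrier ?M" if "v \<in> carrier ?M" "w \<in> carrier ?M" for v w c
    using that by (auto simp: distrib_right mult.assoc)
  have "?a \<in> gr_hom ?M ?W" unfolding W
    by (rule gr_homI) (use Mc in \<open>auto simp del: gfree_simps(1) simp: gfree_simps(1)[of "{0}"] univ_in_def fun_eq_iff\<close>,
      auto)
  moreover have "?b \<in> gr_hom ?M ?Y"
    by (rule gr_homI) (use Mc insert(2) in \<open>auto simp del: gfree_simps(1) simp: gfree_simps(1)[of I] fun_eq_iff\<close>, auto)
  moreover have "bij_betw (\<lambda>v. (?a v, ?b v)) (carrier ?M) (carrier ?W \<times> carrier ?Y)"
  proof (rule bij_betw_byWitness[of _ "\<lambda>(f, g). g(k := f 0)"])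
    show "\<forall>v\<in>carrier ?M. (\<lambda>(f, g). g(k := f 0)) (?a v, ?b v) = v" by (simp add: univ_in_def fun_eq_iff)
    show "\<forall>p\<in>carrier ?W \<times> carrier ?Y. (?a ((\<lambda>(f, g). g(k := f 0)) p), ?b ((\<lambda>(f, g). g(k := f 0)) p)) = p"
      using insert(2) unfolding W by (auto simp: univ_in_def fun_eq_iff)
    show "(\<lambda>v. (?a v, ?b v)) ` carrier ?M \<subseteq> carrier ?W \<times> carrier ?Y"
      using insert(2) unfolding W by (auto simp: univ_in_def)
    show "(\<lambda>(f, g). g(k := f 0)) ` (carrier ?W \<times> carrier ?Y) \<subseteq> carrier ?M" unfolding W by auto
  qed
  ultimately have rel: "cls (stalk ?M) - (cls (stalk ?Y) + cls (stalk ?W)) \<in> T"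
    by (rule stalk_split[OF pM pW pY])
  have "spanned (cls (stalk ?W))"
    using spanned_act[OF spanned_L[OF ik], of "Poly_Mapping.single (d k) 1"] by (simp add: act_single shift_stalk)
  then show ?case using spanned_cong[OF rel] spanned_add insert by blast
qed

text \<open>Isomorphic modules have the same class: take the zero module as second summand.\<close>

lemma spanned_stalk:
  assumes P: "fg_gr_projective A P" shows "spanned (cls (stalk P))"
proof -
  obtain I i d \<phi> where I: "finite I" "\<forall>k\<in>I. i k \<in> {1..r}" "\<phi> \<in> gr_hom (gfree I i d) P"
    "bij_betw \<phi> (carrier (gfree I i d)) (carrier P)" by (rule projective_iso_gfree[OF P])
  let ?F = "gfree I i d"
  have F: "fg_gr_projective A ?F" by (rule projective_gfree) (use I in auto)
  let ?t = "zero_gmodule P"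
  have "bij_betw (\<lambda>v. (\<phi> v, (\<lambda>v\<in>carrier ?F. \<zero>\<^bsub>?t\<^esub>) v)) (carrier ?F) (carrier P \<times> carrier ?t)"
    using I(4) unfolding bij_betw_def inj_on_def by (auto simp: image_iff simp del: gfree_simps)
  then have rel: "cls (stalk ?F) - (cls (stalk ?t) + cls (stalk P)) \<in> T"
    by (rule stalk_split[OF F P projective_zero[OF P] I(3) hom_const_zero[OF fg_graded[OF F] fg_graded[OF projective_zero[OF P]]]])
  let ?z = "\<lambda>v\<in>carrier ?t. \<zero>\<^bsub>?t\<^esub>"
  note Z = projective_zero[OF P]
  have "cls (stalk ?t) - (cls (stalk ?t) + cls (stalk ?t)) \<in> T"
    by (rule stalk_split[OF Z Z Z, of ?z ?z]) (rule hom_const_zero[OF fg_graded[OF Z] fg_graded[OF Z]],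
        rule hom_const_zero[OF fg_graded[OF Z] fg_graded[OF Z]], simp add: bij_betw_def)
  then have z: "- cls (stalk ?t) \<in> T" by simp
  have "- ((cls (stalk ?F) - (cls (stalk ?t) + cls (stalk P)))
      + - (- cls (stalk ?t))) \<in> T"
    by (rule relations_neg[OF relations_add[OF rel relations_neg[OF z]]])
  then have "cls (stalk P) - cls (stalk ?F) \<in> T" by (simp add: algebra_simps)
  then show ?thesis by (rule spanned_cong[OF _ spanned_gfree[OF I(1,2)]])
qed

text \<open>Brutal truncation: the terms of degree \<open>N\<close> and above are replaced by zero.\<close>

definition below :: "int \<Rightarrow> 'a univ_gcomplex \<Rightarrow> 'a univ_gcomplex" where
  "below N X = \<lparr>obj = (\<lambda>i. if i < N then obj X i else zero_gmodule (obj X i)),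
     dif = (\<lambda>i. if i + 1 < N then dif X i
       else (\<lambda>v\<in>carrier (if i < N then obj X i else zero_gmodule (obj X i)). \<zero>\<^bsub>obj X (i + 1)\<^esub>))\<rparr>"

lemma obj_below: "obj (below N X) i = (if i < N then obj X i else zero_gmodule (obj X i))"
  by (simp add: below_def)

lemma zero_below [simp]: "\<zero>\<^bsub>obj (below N X) i\<^esub> = \<zero>\<^bsub>obj X i\<^esub>"
  by (simp add: obj_below)

lemma dif_below: "i + 1 < N \<Longrightarrow> dif (below N X) i = dif X i"
  "\<not> i + 1 < N \<Longrightarrow> dif (below N X) i = (\<lambda>v\<in>carrier (obj (below N X) i). \<zero>\<^bsub>obj X (i + 1)\<^esub>)"
  by (simp_all add: below_def)

lemma below_per: assumes X: "X \<in> per A" shows "below N X \<in> per A"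
proof -
  have fg: "fg_gr_projective A (obj (below N X) i)" for i
    using X by (simp add: obj_below per_def projective_zero)
  note g = per_good[OF X]
  have d: "dif (below N X) i \<in> gr_hom (obj (below N X) i) (obj (below N X) (i + 1))" for i
  proof (cases "i + 1 < N")
    case True then show ?thesis using dif_hom[OF goodD(3)[OF g] refl, of i] by (simp add: dif_below(1) obj_below)
  next
    case False then show ?thesis
      using hom_const_zero[OF fg_graded[OF fg[of i]] fg_graded[OF fg[of "i + 1"]]] by (simp add: dif_below(2))
  qed
  have "is_complex (below N X)"
    unfolding is_complex_def
  proof (intro allI conjI ballI)
    fix i v assume v: "v \<in> carrier (obj (below N X) i)"
    note dv = hom_closed[OF d v]
    show "dif (below N X) (i + 1) (dif (below N X) i v) = \<zero>\<^bsub>obj (below N X) (i + 2)\<^esub>"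
    proof (cases "i + 1 + 1 < N")
      case True
      then have "v \<in> carrier (obj X i)" using v by (simp add: obj_below)
      then show ?thesis using True X by (simp add: dif_below per_def is_complex_def)
    next
      case False
      have e: "i + 1 + 1 = i + 2" by simp
      show ?thesis using dv dif_below(2)[OF False, of X, unfolded e] by simp
    qed
  qed (rule d)
  moreover obtain K where "\<forall>i. K < \<bar>i\<bar> \<longrightarrow> carrier (obj X i) = {\<zero>\<^bsub>obj X i\<^esub>}" using X by (auto simp: per_def)
  then have "\<forall>i. K < \<bar>i\<bar> \<longrightarrow> carrier (obj (below N X) i) = {\<zero>\<^bsub>obj (below N X) i\<^esub>}" by (simp add: obj_below)
  ultimately show ?thesis using fg by (auto simp: per_def)
qed

text \<open>The term of highest degree is a subcomplex, the quotient is the truncation, and the extension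
  cocycle is the last nonzero differential.\<close>

lemma truncation:
  assumes X: "X \<in> per A" and top: "\<And>i. N < i \<Longrightarrow> carrier (obj X i) = {\<zero>\<^bsub>obj X i\<^esub>}"
  shows "cls X -
    (cls (translate (- N) (stalk (obj X N))) + cls (below N X)) \<in> T"
proof -
  note gX = per_good[OF X]
  have M: "fg_gr_projective A (obj X N)" using X by (simp add: per_def)
  let ?W = "below N X" and ?Y = "translate (- N) (stalk (obj X N))"
  have W: "?W \<in> per A" by (rule below_per[OF X])
  have Y: "?Y \<in> per A" by (rule per_translate[OF stalk_per[OF M]])
  note gW = per_good[OF W] and gY = per_good[OF Y]
  note mX = good_gm[OF gX] and mW = good_gm[OF gW] and mY = good_gm[OF gY]
  have oY: "obj ?Y i = (if i = N then obj X N else zero_gmodule (obj X N))" for i by (simp add: obj_stalk)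
  have zY: "\<zero>\<^bsub>obj ?Y i\<^esub> = \<zero>\<^bsub>obj X N\<^esub>" for i by simp
  have dY: "dif ?Y i v = \<zero>\<^bsub>obj X N\<^esub>" if "v \<in> carrier (obj ?Y i)" for i v
    by (rule dif_translate_stalk[OF mX that])
  define a where "a i = (if i < N then (\<lambda>v\<in>carrier (obj X i). v) else (\<lambda>v\<in>carrier (obj X i). \<zero>\<^bsub>obj ?W i\<^esub>))" for i
  define b where "b i = (if i = N then (\<lambda>v\<in>carrier (obj X i). v) else (\<lambda>v\<in>carrier (obj X i). \<zero>\<^bsub>obj ?Y i\<^esub>))" for i
  define u where "u i = (if i = N then dif X (N - 1) else (\<lambda>v\<in>carrier (obj ?W (i - 1)). \<zero>\<^bsub>obj ?Y i\<^esub>))" for i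
  have idh: "(\<lambda>v\<in>carrier (obj X i). v) \<in> gr_hom (obj X i) (obj X i)" for i
    using chain_mapsD1[OF id_chain[OF gX], of i] by (simp add: id_map_def)
  have ha: "a i \<in> gr_hom (obj X i) (obj ?W i)" for i
  proof (cases "i < N")
    case True then show ?thesis using idh[of i] by (simp add: a_def obj_below)
  next
    case False then show ?thesis using hom_const_zero[OF mX[of i] mW[of i]] by (simp add: a_def)
  qed
  have hb: "b i \<in> gr_hom (obj X i) (obj ?Y i)" for i
  proof (cases "i = N")
    case True then show ?thesis using idh[of i] oY[of i] by (simp add: b_def)
  next
    case False then show ?thesis using hom_const_zero[OF mX[of i] mY[of i]] by (simp add: b_def)
  qed
  have hu: "u i \<in> gr_hom (obj ?W (i - 1)) (obj ?Y i)" for i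
  proof (cases "i = N")
    case True
    have "dif X (N - 1) \<in> gr_hom (obj X (N - 1)) (obj X N)" by (rule dif_hom[OF goodD(3)[OF gX]]) simp
    then show ?thesis using True oY[of i] by (simp add: u_def obj_below)
  next
    case False then show ?thesis using hom_const_zero[OF mW[of "i - 1"] mY[of i]] by (simp add: u_def)
  qed
  have uc: "u \<in> chain_maps (translate (- 1) ?W) ?Y"
  proof (rule chain_mapsI)
    show "u i \<in> gr_hom (obj (translate (- 1) ?W) i) (obj ?Y i)" for i using hu by simp
    fix i v assume v: "v \<in> carrier (obj (translate (- 1) ?W) i)"
    then have v': "v \<in> carrier (obj ?W (i - 1))" by simp
    have dv: "dif ?W (i - 1) v \<in> carrier (obj ?W i)" by (rule dif_closed[OF goodD(3)[OF gW] v']) simp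
    interpret Wi: gmod A "obj ?W i" by (rule gmod.intro[OF mW])
    interpret Yi: gmod A "obj ?Y (i + 1)" by (rule gmod.intro[OF mY])
    have hu1: "u (i + 1) \<in> gr_hom (obj ?W i) (obj ?Y (i + 1))" using hu[of "i + 1"] by simp
    have "u (i + 1) (dif ?W (i - 1) v) = \<zero>\<^bsub>obj ?Y (i + 1)\<^esub>"
    proof (cases "i + 1 = N")
      case True
      have vX: "v \<in> carrier (obj X (i - 1))" using v' True by (simp add: obj_below)
      have "dif X i (dif X (i - 1) v) = \<zero>\<^bsub>obj X N\<^esub>"
        by (rule dif_dif[OF goodD(3)[OF gX] vX]) (use True in simp_all)
      moreover have "u (i + 1) = dif X i" using True by (auto simp: u_def)
      ultimately show ?thesis using True zY by (simp add: dif_below(1))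
    qed (use dv zY in \<open>simp add: u_def\<close>)
    moreover have "dif (translate (- 1) ?W) i v = \<ominus>\<^bsub>obj ?W i\<^esub> dif ?W (i - 1) v"
      using v by (simp add: dif_translate)
    moreover have "u (i + 1) (\<ominus>\<^bsub>obj ?W i\<^esub> dif ?W (i - 1) v) = \<ominus>\<^bsub>obj ?Y (i + 1)\<^esub> u (i + 1) (dif ?W (i - 1) v)"
      by (rule hom_neg[OF mW mY hu1 dv])
    moreover have "dif ?Y i (u i v) = \<zero>\<^bsub>obj ?Y (i + 1)\<^esub>" using dY[OF hom_closed[OF hu v']] zY by simp
    ultimately show "u (i + 1) (dif (translate (- 1) ?W) i v) = dif ?Y i (u i v)"
      using Yi.a_inv_zero by (simp only:)
  qed
  show ?thesis
  proof (rule split_rel[OF split_relation[OF W Y X uc ha hb] W])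
    fix i
    consider "i < N" | "i = N" | "N < i" by linarith
    then show "bij_betw (\<lambda>v. (a i v, b i v)) (carrier (obj X i)) (carrier (obj ?W i) \<times> carrier (obj ?Y i))"
    proof cases
      case 1 then show ?thesis unfolding bij_betw_def inj_on_def oY by (auto simp: a_def b_def obj_below zY)
    next
      case 2 then show ?thesis unfolding bij_betw_def inj_on_def oY by (auto simp: a_def b_def obj_below zY)
    next
      case 3 then show ?thesis using top[OF 3] unfolding bij_betw_def inj_on_def oY by (simp add: a_def b_def obj_below zY)
    qed
    fix v assume v: "v \<in> carrier (obj X i)"
    have dv: "dif X i v \<in> carrier (obj X (i + 1))" by (rule dif_closed[OF goodD(3)[OF gX] v refl])
    have av: "a i v \<in> carrier (obj ?W i)" by (rule hom_closed[OF ha v])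
    have bv: "b i v \<in> carrier (obj ?Y i)" by (rule hom_closed[OF hb v])
    show "a (i + 1) (dif X i v) = dif ?W i (a i v)"
      using dv v av by (cases "i + 1 < N") (simp_all add: a_def dif_below)
    interpret Yi: gmod A "obj ?Y (i + 1)" by (rule gmod.intro[OF mY])
    have uv: "u (i + 1) (a i v) \<in> carrier (obj ?Y (i + 1))" using hom_closed[OF hu[of "i + 1"]] av by simp
    have "u (i + 1) (a i v) = b (i + 1) (dif X i v)"
    proof (cases "i + 1 = N")
      case True
      then have "u (i + 1) = dif X i" "i < N" by (auto simp: u_def)
      then show ?thesis using v dv True by (simp add: a_def b_def)
    qed (use dv av in \<open>simp add: u_def b_def\<close>)
    then show "b (i + 1) (dif X i v) = u (i + 1) (a i v) \<oplus>\<^bsub>obj ?Y (i + 1)\<^esub> dif ?Y i (b i v)"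
      using Yi.r_zero[OF uv] dY[OF bv] zY[of "i + 1"] by simp
  qed
qed

text \<open>Induction on the length of the complex.\<close>

lemma spanned_bounded:
  assumes "X \<in> per A" "\<And>i. i \<notin> {m..<m + int n} \<Longrightarrow> carrier (obj X i) = {\<zero>\<^bsub>obj X i\<^esub>}"
  shows "spanned (cls X)"
  using assms
proof (induction n arbitrary: X)
  case 0
  have "cls X - cls zero_cpx \<in> T"
  proof (rule iso_rel[OF zero_cpx_per 0(1) zero_map_chain[OF per_good[OF 0(1)] per_good[OF zero_cpx_per]]])
    show "bij_betw (zero_map X zero_cpx i) (carrier (obj X i)) (carrier (obj zero_cpx i))" for i
      using 0(2)[of i] unfolding obj_zero_cpx carrier_zero_cpx by (simp add: zero_map_def bij_betw_def)
  qed
  then show ?case by (rule spanned_cong[OF _ spanned_rel[OF zero_cpx_rel]])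
next
  case (Suc n)
  let ?N = "m + int n"
  have M: "fg_gr_projective A (obj X ?N)" using Suc(2) by (simp add: per_def)
  have "spanned (cls (below ?N X))"
  proof (rule Suc(1)[OF below_per[OF Suc(2)]])
    fix i assume "i \<notin> {m..<?N}"
    then show "carrier (obj (below ?N X) i) = {\<zero>\<^bsub>obj (below ?N X) i\<^esub>}"
      using Suc(3)[of i] by (auto simp: obj_below)
  qed
  moreover have "spanned (cls (translate (- ?N) (stalk (obj X ?N))))"
    by (rule spanned_translate[OF stalk_per[OF M] spanned_stalk[OF M]])
  moreover have "cls X -
      (cls (translate (- ?N) (stalk (obj X ?N))) + cls (below ?N X)) \<in> T"
    by (rule truncation[OF Suc(2)]) (use Suc(3) in simp)
  ultimately show ?case using spanned_cong spanned_add by blast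
qed

lemma spanned_single: assumes X: "X \<in> per A" shows "spanned (Poly_Mapping.single X c)"
proof -
  obtain K where K: "\<forall>i. K < \<bar>i\<bar> \<longrightarrow> carrier (obj X i) = {\<zero>\<^bsub>obj X i\<^esub>}" using X by (auto simp: per_def)
  have "spanned (cls X)"
  proof (rule spanned_bounded[OF X, of "- K" "nat (2 * K + 1)"])
    fix i assume "i \<notin> {- K..<- K + int (nat (2 * K + 1))}"
    then have "K < \<bar>i\<bar>" by (cases "0 \<le> 2 * K + 1") auto
    then show "carrier (obj X i) = {\<zero>\<^bsub>obj X i\<^esub>}" using K by blast
  qed
  from spanned_act[OF this, of "Poly_Mapping.single 0 c"] show ?thesis by (simp add: act_single cpx_shift_0)
qed

lemma spanned_all: "Poly_Mapping.keys g \<subseteq> per A \<Longrightarrow> spanned g"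
  by (induction g rule: pm_induct) (simp_all add: spanned_single spanned_add spanned_rel[OF relations_zero])

end

section \<open>The pairing\<close>

lemma finite_bound: fixes g :: "'i \<Rightarrow> int" assumes "finite F" shows "\<exists>D. \<forall>x\<in>F. g x \<le> D"
  using bdd_above_finite[OF finite_imageI[OF assms, of g]] unfolding bdd_above_def by auto

lemma fls_sum_nth: "fls_nth (\<Sum>i\<in>I. f i) n = (\<Sum>i\<in>I. fls_nth (f i) n)"
  by (induction I rule: infinite_finite_induct) auto

context galg
begin

lemma pairing_dim_eq: "pairing_dim scl P Q n i = hdim P (translate i (cpx_shift (- n) Q))"
  by (simp add: pairing_dim_def hdim_def)

lemma pairing_coeff_eq: "pairing_coeff scl P Q n = euler P (cpx_shift (- n) Q)"
  by (simp add: pairing_coeff_def pairing_dim_eq euler_def euler_sign_def)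

lemma hdim_shift [simp]: "hdim (cpx_shift m X) (cpx_shift m Y) = hdim X Y"
  by (simp add: hdim_def Hom_per_def chain_map_space_def zero_map_def)

lemma euler_shift [simp]: "euler (cpx_shift m X) (cpx_shift m Y) = euler X Y"
  by (simp add: euler_def translate_shift)

lemma gdim_zero:
  assumes X: "good X" and Y: "good Y"
    and z: "\<And>f i v. f \<in> gmaps X Y \<Longrightarrow> v \<in> carrier (obj X i) \<Longrightarrow> f i v = \<zero>\<^bsub>obj Y i\<^esub>"
  shows "gdim X Y = 0"
  unfolding gdim_def
proof (rule has_dim_0_carrier[OF kspace_gmap[OF goodD(2)[OF X] goodD(2)[OF Y]]], rule subsetI)
  fix f assume "f \<in> carrier (gmap_space X Y)"
  then have f: "f \<in> gmaps X Y" by simp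
  have "f = zero_map X Y"
    by (rule gmaps_eqI[OF f chain_gmaps[OF zero_map_chain[OF X Y]]]) (simp add: z[OF f] zero_map_def)
  then show "f \<in> {\<zero>\<^bsub>gmap_space X Y\<^esub>}" by simp
qed

text \<open>The component of degree \<open>n\<close> of \<open>gfree I i d\<close> vanishes below the smallest \<open>d k\<close>.\<close>

lemma projective_lower:
  assumes P: "fg_gr_projective A P" shows "\<exists>E. \<forall>n<E. gr P n \<subseteq> {\<zero>\<^bsub>P\<^esub>}"
proof -
  obtain I i d \<phi> where I: "finite I" "\<forall>k\<in>I. i k \<in> {1..r}" "\<phi> \<in> gr_hom (gfree I i d) P"
    "bij_betw \<phi> (carrier (gfree I i d)) (carrier P)" by (rule projective_iso_gfree[OF P])
  have F: "graded_module A (gfree I i d)" by (rule fg_graded[OF projective_gfree]) (use I in auto)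
  note inv = hom_inv[OF F fg_graded[OF P] I(3,4)]
  interpret P: gmod A P by (rule gmod.intro[OF fg_graded[OF P]])
  obtain D where D: "\<forall>k\<in>I. - d k \<le> D" using finite_bound[OF I(1), of "\<lambda>k. - d k"] by blast
  have "v = \<zero>\<^bsub>P\<^esub>" if n: "n < - D" and v: "v \<in> gr P n" for n v
  proof -
    let ?w = "restrict (inv_into (carrier (gfree I i d)) \<phi>) (carrier P) v"
    have w: "?w \<in> gr (gfree I i d) n" by (rule hom_gr[OF inv(1) v])
    have "?w k = 0" for k
    proof (cases "k \<in> I")
      case True
      then have "n < d k" using D n by fastforce
      then show ?thesis using gfree_grD[OF w True] by (simp add: AZ_def)
    qed (use w in simp)
    then have "?w = \<zero>\<^bsub>gfree I i d\<^esub>" by (simp add: fun_eq_iff)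
    then have "\<phi> ?w = \<zero>\<^bsub>P\<^esub>" using hom_zero[OF F fg_graded[OF P] I(3)] by (simp only:)
    then show ?thesis using inv(3)[OF P.gr_carrier[OF v]] by simp
  qed
  then show ?thesis by blast
qed

text \<open>Let \<open>D\<close> bound the degrees of generators of all terms of \<open>P\<close>, and let the terms of \<open>Q\<close> vanish in
  degrees below \<open>-E\<close>. A map from a term of \<open>P\<close> to a term of \<open>Q\<langle>-n\<rangle>\<close> sends these generators to elements
  of \<open>Q\<close> of degree at most \<open>D + n\<close>, which are zero for \<open>n < - E - D\<close>.\<close>

lemma pairing_lower:
  assumes P: "P \<in> per A" and Q: "Q \<in> per A"
  shows "\<exists>N. \<forall>n<N. pairing_coeff scl P Q n = 0"
proof -
  note gP = per_good[OF P] and gQ = per_good[OF Q]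
  obtain K where K: "\<And>i. K < \<bar>i\<bar> \<Longrightarrow> carrier (obj P i) = {\<zero>\<^bsub>obj P i\<^esub>}" using P by (auto simp: per_def)
  obtain K' where K': "\<And>i. K' < \<bar>i\<bar> \<Longrightarrow> carrier (obj Q i) = {\<zero>\<^bsub>obj Q i\<^esub>}" using Q by (auto simp: per_def)
  have "\<forall>i. \<exists>S. hgen (obj P i) S" using goodD(1)[OF gP] by (simp add: tame_def)
  then obtain S where S: "\<And>i. hgen (obj P i) (S i)" by metis
  then have "\<forall>i s. \<exists>n. s \<in> S i \<longrightarrow> s \<in> gr (obj P i) n" unfolding hgen_def by blast
  then obtain dg where dg: "\<And>i s. s \<in> S i \<Longrightarrow> s \<in> gr (obj P i) (dg i s)" by metis
  have "finite (SIGMA i:{- K..K}. S i)" using S by (intro finite_SigmaI) (auto simp: hgen_def)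
  from finite_bound[OF this, of "\<lambda>(i, s). dg i s"]
  obtain D where D: "\<And>i s. i \<in> {- K..K} \<Longrightarrow> s \<in> S i \<Longrightarrow> dg i s \<le> D" by fastforce
  have "\<forall>i. \<exists>E. \<forall>n<E. gr (obj Q i) n \<subseteq> {\<zero>\<^bsub>obj Q i\<^esub>}" using Q projective_lower by (simp add: per_def)
  then obtain E where E: "\<And>i n. n < E i \<Longrightarrow> gr (obj Q i) n \<subseteq> {\<zero>\<^bsub>obj Q i\<^esub>}" by metis
  obtain E' where E': "\<And>i. i \<in> {- K'..K'} \<Longrightarrow> - E i \<le> E'" using finite_bound[of "{- K'..K'}" "\<lambda>i. - E i"] by blast
  have "pairing_coeff scl P Q n = 0" if n: "n < - E' - D" for n
  proof -
    have gS: "good (cpx_shift (- n) Q)" by (rule per_good[OF per_shift[OF Q]])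
    have z: "gdim P (translate i (cpx_shift (- n) Q)) = 0" for i
    proof (rule gdim_zero[OF gP good_translate[OF gS]])
      fix f p v assume f: "f \<in> gmaps P (translate i (cpx_shift (- n) Q))" and v: "v \<in> carrier (obj P p)"
      let ?Z = "obj (translate i (cpx_shift (- n) Q)) p"
      have fp: "f p \<in> gr_hom (obj P p) ?Z" by (rule gmapsD[OF f])
      have gmP: "graded_module A (obj P p)" and gmZ: "graded_module A ?Z"
        by (rule good_gm[OF gP], rule good_gm[OF good_translate[OF gS]])
      interpret M: gmod A "obj P p" by (rule gmod.intro[OF gmP])
      interpret Z: gmod A ?Z by (rule gmod.intro[OF gmZ])
      show "f p v = \<zero>\<^bsub>?Z\<^esub>"
      proof (cases "K < \<bar>p\<bar> \<or> K' < \<bar>p + i\<bar>")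
        case True
        then show ?thesis
        proof
          assume "K < \<bar>p\<bar>"
          then have "v = \<zero>\<^bsub>obj P p\<^esub>" using K v by simp
          then show ?thesis using hom_zero[OF gmP gmZ fp] by (simp only:)
        next
          assume "K' < \<bar>p + i\<bar>"
          then show ?thesis using K' hom_closed[OF fp v] by simp
        qed
      next
        case False
        then have p: "p \<in> {- K..K}" "p + i \<in> {- K'..K'}" by auto
        let ?U = "{w \<in> carrier (obj P p). f p w = \<zero>\<^bsub>?Z\<^esub>}"
        have "carrier (obj P p) \<subseteq> ?U"
        proof (rule hgen_induct[OF S])
          show "\<zero>\<^bsub>obj P p\<^esub> \<in> ?U" using hom_zero[OF gmP gmZ fp] by simp
          show "w \<oplus>\<^bsub>obj P p\<^esub> w' \<in> ?U" if "w \<in> ?U" "w' \<in> ?U" for w w'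
            using that hom_add[OF fp, of w w'] Z.l_zero[OF Z.zero_closed] by simp
          show "a \<odot>\<^bsub>obj P p\<^esub> w \<in> ?U" if "w \<in> ?U" for a w
            using that hom_sm[OF fp, of w a] M.sm_closed[of w a] Z.sm_zero_r[of a] by simp
          show "S p \<subseteq> ?U"
          proof
            fix s assume s: "s \<in> S p"
            have "f p s \<in> gr ?Z (dg p s)" by (rule hom_gr[OF fp dg[OF s]])
            then have "f p s \<in> gr (obj Q (p + i)) (dg p s + n)" by simp
            moreover have "dg p s + n < E (p + i)" using D[OF p(1) s] E'[OF p(2)] n by linarith
            ultimately have "f p s = \<zero>\<^bsub>obj Q (p + i)\<^esub>" using E by blast
            then show "s \<in> ?U" using M.gr_carrier[OF dg[OF s]] by simp
          qed
        qed
        then show ?thesis using v by blast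
      qed
    qed
    then show ?thesis unfolding pairing_coeff_eq
      using euler_eq(3)[OF gP gS, of "{}"] by simp
  qed
  then show ?thesis by blast
qed

lemma pairing_welldefined_per: "P \<in> per A \<Longrightarrow> Q \<in> per A \<Longrightarrow> pairing_welldefined scl P Q"
  unfolding pairing_welldefined_def pairing_dim_eq
  by (intro conjI allI hdim_ndim(1) euler_eq(2) pairing_lower per_good good_translate per_shift)

lemma pairing_nth: "P \<in> per A \<Longrightarrow> Q \<in> per A \<Longrightarrow> fls_nth (pairing scl P Q) n = euler P (cpx_shift (- n) Q)"
  unfolding pairing_def pairing_coeff_eq[symmetric]
  using pairing_lower[of P Q] by (meson nth_Abs_fls_lower_bound)

lemma pairing_triangle:
  assumes t: "distinguished_triangle A X Y Z f g h" and Q: "Q \<in> per A"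
  shows "pairing scl Y Q = pairing scl X Q + pairing scl Z Q" "pairing scl Q Y = pairing scl Q X + pairing scl Q Z"
proof -
  have per: "X \<in> per A" "Y \<in> per A" "Z \<in> per A" using t by (simp_all add: distinguished_triangle_def)
  show "pairing scl Y Q = pairing scl X Q + pairing scl Z Q"
    by (rule fls_eqI) (simp add: pairing_nth per Q euler_triangle(2)[OF t per_good[OF per_shift[OF Q]]])
  show "pairing scl Q Y = pairing scl Q X + pairing scl Q Z"
    by (rule fls_eqI) (simp add: pairing_nth per Q euler_triangle(1)[OF triangle_shift[OF t] per_good[OF Q]])
qed

lemma pairing_shift_right:
  assumes "P \<in> per A" "Q \<in> per A" shows "fls_nth (pairing scl P (cpx_shift m Q)) n = fls_nth (pairing scl P Q) (n - m)"
  using assms by (simp add: pairing_nth per_shift cpx_shift_shift add.commute)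

lemma pairing_shift_left:
  assumes "P \<in> per A" "Q \<in> per A" shows "fls_nth (pairing scl (cpx_shift m P) Q) n = fls_nth (pairing scl P Q) (n + m)"
proof -
  have "cpx_shift (- n) Q = cpx_shift m (cpx_shift (- n - m) Q)" by (simp add: cpx_shift_shift)
  then show ?thesis using assms by (simp add: pairing_nth per_shift)
qed

text \<open>The form on the free group, the coefficients acting as constant Laurent series.\<close>

definition pairing_ext :: "('a univ_gcomplex \<Rightarrow>\<^sub>0 int) \<Rightarrow> ('a univ_gcomplex \<Rightarrow>\<^sub>0 int) \<Rightarrow> int fls" where
  "pairing_ext = bext (\<lambda>P Q c. fls_const c * pairing scl P Q)"

lemma pairing_ext_biadd: "biadd (\<lambda>P Q c. fls_const c * pairing scl P Q)"
  by unfold_locales (simp add: fls_plus_const[symmetric] distrib_right)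

lemmas pairing_ext_simps = biadd.bext_add_left[OF pairing_ext_biadd, folded pairing_ext_def] biadd.bext_add_right[OF pairing_ext_biadd, folded pairing_ext_def]
  biadd.bext_diff_left[OF pairing_ext_biadd, folded pairing_ext_def] biadd.bext_diff_right[OF pairing_ext_biadd, folded pairing_ext_def]
  biadd.bext_minus_left[OF pairing_ext_biadd, folded pairing_ext_def] biadd.bext_minus_right[OF pairing_ext_biadd, folded pairing_ext_def]
  biadd.bext_zero_left[OF pairing_ext_biadd, folded pairing_ext_def] biadd.bext_zero_right[OF pairing_ext_biadd, folded pairing_ext_def]

lemmas pairing_ext_single = biadd.bext_single[OF pairing_ext_biadd, folded pairing_ext_def]
lemmas pairing_ext_sum_right = biadd.bext_sum_right[OF pairing_ext_biadd, folded pairing_ext_def]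

text \<open>By biadditivity it suffices to pair one triangle with one complex.\<close>

lemma pairing_ext_relations:
  assumes h: "Poly_Mapping.keys h \<subseteq> per A" and g: "g \<in> T"
  shows "pairing_ext g h = 0" "pairing_ext h g = 0"
proof -
  show "pairing_ext g h = 0" using h
  proof (induction h rule: pm_induct)
    case (single Q c)
    show ?case using g
    proof (induction g rule: relations_induct)
      case (gen X Y Z f u w)
      show ?case by (simp add: pairing_ext_simps pairing_ext_single pairing_triangle[OF gen single] algebra_simps)
    qed (simp_all add: pairing_ext_simps)
  qed (simp_all add: pairing_ext_simps)
  show "pairing_ext h g = 0" using h
  proof (induction h rule: pm_induct)
    case (single Q c)
    show ?case using g
    proof (induction g rule: relations_induct)
      case (gen X Y Z f u w)
      show ?case by (simp add: pairing_ext_simps pairing_ext_single pairing_triangle[OF gen single] algebra_simps)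
    qed (simp_all add: pairing_ext_simps)
  qed (simp_all add: pairing_ext_simps)
qed

lemma pairing_ext_x:
  assumes "Poly_Mapping.keys g \<subseteq> per A" "Poly_Mapping.keys h \<subseteq> per A"
  shows "pairing_ext (act laurent_x g) h = fls_X_inv * pairing_ext g h" "pairing_ext g (act laurent_x h) = fls_X * pairing_ext g h"
proof -
  have "pairing_ext (act laurent_x g) h = fls_X_inv * pairing_ext g h \<and> pairing_ext g (act laurent_x h) = fls_X * pairing_ext g h"
    using assms(1)
  proof (induction g rule: pm_induct)
    case (single P c)
    show ?case using assms(2)
    proof (induction h rule: pm_induct)
      case (single Q c')
      have "pairing scl (cpx_shift 1 P) Q = fls_X_inv * pairing scl P Q"
        by (rule fls_eqI) (simp add: pairing_shift_left \<open>P \<in> per A\<close> single fls_X_inv_times_conv_shift(1))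
      moreover have "pairing scl P (cpx_shift 1 Q) = fls_X * pairing scl P Q"
        by (rule fls_eqI) (simp add: pairing_shift_right \<open>P \<in> per A\<close> single fls_X_times_conv_shift(1))
      ultimately show ?case by (simp add: laurent_x_def act_single pairing_ext_single mult.left_commute)
    qed (simp_all add: pairing_ext_simps act_simps distrib_left)
  qed (simp_all add: pairing_ext_simps act_simps distrib_left)
  then show "pairing_ext (act laurent_x g) h = fls_X_inv * pairing_ext g h" "pairing_ext g (act laurent_x h) = fls_X * pairing_ext g h" by blast+
qed

text \<open>The form on classes. The choice of representatives is immaterial because \<open>pairing_ext\<close> vanishes on
  relations in both arguments.\<close>

definition form :: "('a univ_gcomplex \<Rightarrow>\<^sub>0 int) set \<Rightarrow> ('a univ_gcomplex \<Rightarrow>\<^sub>0 int) set \<Rightarrow> int fls" where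
  "form U V = (let rep = \<lambda>W. SOME g. g \<in> carrier (free_per A) \<and> K0_of A g = W in pairing_ext (rep U) (rep V))"

lemma form_K0_of:
  assumes g: "g \<in> carrier (free_per A)" and h: "h \<in> carrier (free_per A)"
  shows "form (K0_of A g) (K0_of A h) = pairing_ext g h"
proof -
  define rep where "rep W = (SOME g. g \<in> carrier (free_per A) \<and> K0_of A g = W)" for W
  have rep: "rep (K0_of A k) \<in> carrier (free_per A) \<and> rep (K0_of A k) - k \<in> T" if k: "k \<in> carrier (free_per A)" for k
  proof -
    have "rep (K0_of A k) \<in> carrier (free_per A) \<and> K0_of A (rep (K0_of A k)) = K0_of A k"
      unfolding rep_def by (rule someI[of _ k]) (use k in simp)
    then show ?thesis using K0_eq_iff[of "rep (K0_of A k)" A k] k by simp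
  qed
  have "pairing_ext (rep (K0_of A g) - g) (rep (K0_of A h)) = 0" by (rule pairing_ext_relations) (use rep[OF g] rep[OF h] in simp_all)
  moreover have "pairing_ext g (rep (K0_of A h) - h) = 0" by (rule pairing_ext_relations(2)) (use g rep[OF h] in simp_all)
  ultimately show ?thesis unfolding form_def rep_def[symmetric] Let_def by (simp add: pairing_ext_simps)
qed

lemma form_sesquilinear: "sesquilinear (K0 A) form"
  unfolding sesquilinear_def
proof (intro conjI ballI)
  fix u v assume "u \<in> carrier (K0 A)" "v \<in> carrier (K0 A)"
  then obtain g h where gh: "g \<in> carrier (free_per A)" "u = K0_of A g" "h \<in> carrier (free_per A)" "v = K0_of A h"
    unfolding K0_carrier by (elim imageE)
  have ac: "act laurent_x g \<in> carrier (free_per A)" "act laurent_x h \<in> carrier (free_per A)" using gh(1,3) by (simp_all add: act_closed)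
  show "form (laurent_x \<odot>\<^bsub>K0 A\<^esub> u) v = fls_X_inv * form u v" "form u (laurent_x \<odot>\<^bsub>K0 A\<^esub> v) = fls_X * form u v"
    unfolding gh K0_smult[OF gh(1)] K0_smult[OF gh(3)] form_K0_of[OF gh(1,3)] form_K0_of[OF ac(1) gh(3)] form_K0_of[OF gh(1) ac(2)]
    by (rule pairing_ext_x; use gh in simp)+
  fix w assume "w \<in> carrier (K0 A)"
  then obtain k where k: "k \<in> carrier (free_per A)" "w = K0_of A k" unfolding K0_carrier by (elim imageE)
  have pc: "g + h \<in> carrier (free_per A)" "h + k \<in> carrier (free_per A)" using gh(1,3) k(1) by (simp_all add: keys_add_sub)
  show "form (u \<oplus>\<^bsub>K0 A\<^esub> v) w = form u w + form v w"
    unfolding gh k K0_add[OF gh(1,3)] form_K0_of[OF gh(1) k(1)] form_K0_of[OF gh(3) k(1)] form_K0_of[OF pc(1) k(1)]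
    by (rule pairing_ext_simps)
  show "form u (v \<oplus>\<^bsub>K0 A\<^esub> w) = form u v + form u w"
    unfolding gh k K0_add[OF gh(3) k(1)] form_K0_of[OF gh(1) k(1)] form_K0_of[OF gh(1,3)] form_K0_of[OF gh(1) pc(2)]
    by (rule pairing_ext_simps)
qed

lemma form_class:
  assumes "P \<in> per A" "Q \<in> per A" shows "form (K0_class A P) (K0_class A Q) = pairing scl P Q"
  unfolding K0_class_def
  using form_K0_of[of "cls P" "cls Q"] assms by (simp add: pairing_ext_single)

section \<open>The Gram matrix\<close>

text \<open>A homomorphism from \<open>Ae\<^sub>i\<close> is given by the image \<open>x\<close> of \<open>e\<^sub>i\<close>, subject to \<open>e\<^sub>i x = x\<close>; in
  \<open>Ae\<^sub>j\<langle>-n\<rangle>\<close> the elements of degree zero are those of \<open>A\<^sub>n e\<^sub>j\<close>.\<close>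

lemma gdim_stalk:
  assumes i: "i \<in> {1..r}" and j: "j \<in> {1..r}"
  shows "int (gdim (stalk (L i)) (stalk (gr_shift (- n) (L j)))) = fls_nth (fps_to_fls (hilbert_matrix scl A e i j)) n"
proof -
  let ?S = "{x \<in> AZ n. e i * x = x \<and> x * e j = x}"
  let ?M = "gfree {0} (\<lambda>_. i) (\<lambda>_. 0)" and ?N = "gfree {0} (\<lambda>_. j) (\<lambda>_. - n)"
  have N: "gr_shift (- n) (L j) = ?N" using left_ideal_gfree[OF j] by (simp add: gfree_shift)
  have gM: "graded_module A ?M" and gN: "graded_module A ?N" by (rule fg_graded[OF projective_gfree]; use i j in simp)+
  have pM: "stalk ?M \<in> per A" and pN: "stalk ?N \<in> per A" by (rule stalk_per[OF projective_gfree]; use i j in simp)+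
  note goM = per_good[OF pM] and goN = per_good[OF pN]
  have S: "vs.subspace ?S"
    unfolding vs.subspace_def using AZ_add AZ_scale by (auto simp: distrib_left distrib_right scl_l[symmetric] scl_r[symmetric])
  have u: "gunit (\<lambda>_. i) 0 \<in> gr ?M 0" using gunit_gr[of 0 "{0}" "\<lambda>_. i" "\<lambda>_. 0"] i by simp
  have ue: "e i \<odot>\<^bsub>?M\<^esub> gunit (\<lambda>_. i) 0 = gunit (\<lambda>_. i) 0" using e_idem[OF i] by (simp add: gunit_def fun_eq_iff)
  have uc: "gunit (\<lambda>_. i) 0 \<in> carrier ?M" by (rule gmod.gr_carrier[OF gmod.intro[OF gM] u])
  let ?V = "gmap_space (stalk ?M) (stalk ?N)" and ?f = "\<lambda>f. f 0 (gunit (\<lambda>_. i) 0) 0"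
  have h0: "f 0 \<in> gr_hom ?M ?N" if "f \<in> gmaps (stalk ?M) (stalk ?N)" for f
    using gmapsD[OF that, of 0] by (simp add: obj_stalk)
  have fS: "?f f \<in> ?S" if f: "f \<in> gmaps (stalk ?M) (stalk ?N)" for f
  proof -
    have "f 0 (gunit (\<lambda>_. i) 0) \<in> gr ?N 0" by (rule hom_gr[OF h0[OF f] u])
    moreover have "f 0 (gunit (\<lambda>_. i) 0) = e i \<odot>\<^bsub>?N\<^esub> f 0 (gunit (\<lambda>_. i) 0)"
      using hom_sm[OF h0[OF f] uc, of "e i"] ue by simp
    then have "?f f = e i * ?f f" by (metis gfree_simps(4))
    ultimately show ?thesis by simp
  qed
  have lin: "lin ?V (sub_space scl ?S) ?f"
    by (rule linI) (use fS uc in \<open>auto simp: obj_stalk\<close>)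
  have bij: "bij_betw ?f (carrier ?V) (carrier (sub_space scl ?S))"
    unfolding bij_betw_def
  proof
    show "inj_on ?f (carrier ?V)"
    proof (rule inj_onI)
      fix f g assume "f \<in> carrier ?V" "g \<in> carrier ?V" and eq: "?f f = ?f g"
      then have f: "f \<in> gmaps (stalk ?M) (stalk ?N)" and g: "g \<in> gmaps (stalk ?M) (stalk ?N)" by simp_all
      have "f 0 (gunit (\<lambda>_. i) 0) k = g 0 (gunit (\<lambda>_. i) 0) k" for k
        using eq hom_closed[OF h0[OF f] uc] hom_closed[OF h0[OF g] uc] by (cases "k = 0") simp_all
      then have eq': "f 0 (gunit (\<lambda>_. i) 0) = g 0 (gunit (\<lambda>_. i) 0)" by (rule ext)
      show "f = g"
      proof (rule gmaps_eqI[OF f g])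
        fix p v assume v: "v \<in> carrier (obj (stalk ?M) p)"
        show "f p v = g p v"
        proof (cases "p = 0")
          case True
          then have v': "v \<in> carrier ?M" using v by (simp add: obj_stalk)
          interpret N: gmod A ?N by (rule gmod.intro[OF gN])
          have "f 0 v = (\<Oplus>\<^bsub>?N\<^esub>k\<in>{0}. v k \<odot>\<^bsub>?N\<^esub> f 0 (gunit (\<lambda>_. i) k))"
            by (rule hom_gfree[OF _ _ gN h0[OF f] v']) (use i in simp_all)
          also have "\<dots> = (\<Oplus>\<^bsub>?N\<^esub>k\<in>{0}. v k \<odot>\<^bsub>?N\<^esub> g 0 (gunit (\<lambda>_. i) k))"
            by (rule N.finsum_cong') (use eq' N.sm_closed[OF hom_closed[OF h0[OF g] uc]] in \<open>simp_all del: gfree_simps\<close>)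
          also have "\<dots> = g 0 v"
            by (rule hom_gfree[OF _ _ gN h0[OF g] v', symmetric]) (use i in simp_all)
          finally show ?thesis unfolding True .
        next
          case False
          then show ?thesis using gmaps_closed[OF f v] gmaps_closed[OF g v] by (simp add: obj_stalk)
        qed
      qed
    qed
    show "?f ` carrier ?V = carrier (sub_space scl ?S)"
    proof (rule equalityI; rule subsetI)
      fix x assume "x \<in> ?f ` carrier ?V" then show "x \<in> carrier (sub_space scl ?S)" using fS by auto
    next
      fix x assume "x \<in> carrier (sub_space scl ?S)"
      then have x: "x \<in> AZ n" "e i * x = x" "x * e j = x" by simp_all
      have xN: "univ_in x \<in> gr ?N 0" using x by (simp add: univ_in_def)
      let ?h = "ev {0} (\<lambda>_. i) (\<lambda>_. 0) ?N (\<lambda>_. univ_in x)"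
      have h: "?h \<in> gr_hom ?M ?N" by (rule ev_hom) (use gN xN i in simp_all)
      have "?h (gunit (\<lambda>_. i) 0) = univ_in x"
        by (rule ev_gunit) (use gN xN i x in \<open>simp_all add: univ_in_def fun_eq_iff\<close>)
      then have "?f (stalk_map ?M ?N ?h) = x" by (simp add: stalk_map_def univ_in_def)
      moreover have "stalk_map ?M ?N ?h \<in> carrier ?V" using stalk_map_hom[OF gM gN h] by (simp add: gmaps_def)
      ultimately show "x \<in> ?f ` carrier ?V" by (rule image_eqI[OF sym])
    qed
  qed
  obtain B where B: "finite B" "?S \<subseteq> vs.span B"
  proof (cases "0 \<le> n")
    case True
    obtain B where "finite B" "A (nat n) = vs.span B" using finA by blast
    then show ?thesis using that[of B] True by (auto simp: AZ_def)
  next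
    case False then show ?thesis using that[of "{}"] by (auto simp: AZ_def)
  qed
  have "has_dim ?V (vs.dim ?S)"
    by (rule has_dim_iso[OF kspace_gmap[OF goodD(2)[OF goM] goodD(2)[OF goN]] lin bij has_dim_sub_space[OF vs.vector_space_axioms S B]])
  then have d: "gdim (stalk ?M) (stalk ?N) = vs.dim ?S" unfolding gdim_def by (rule has_dim_kdim)
  have "int (vs.dim ?S) = fls_nth (fps_to_fls (hilbert_matrix scl A e i j)) n"
  proof (cases "0 \<le> n")
    case True
    have "?S = {e i * a * e j | a. a \<in> A (nat n)}"
    proof (rule equalityI; rule subsetI)
      fix x assume x: "x \<in> ?S"
      then have "x = e i * x * e j" "x \<in> A (nat n)" using True by (simp_all add: AZ_def)
      then show "x \<in> {e i * a * e j | a. a \<in> A (nat n)}" by blast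
    next
      fix x assume "x \<in> {e i * a * e j | a. a \<in> A (nat n)}"
      then obtain a where a: "x = e i * a * e j" "a \<in> A (nat n)" by blast
      have "e i * a * e j \<in> A (nat n)" using multA[OF multA[OF eA[OF i] a(2)] eA[OF j]] by simp
      moreover have "e i * (e i * a * e j) = e i * a * e j" by (metis e_idem[OF i] mult.assoc)
      moreover have "e i * a * e j * e j = e i * a * e j" by (metis e_idem[OF j] mult.assoc)
      ultimately show "x \<in> ?S" using a True by (simp add: AZ_def)
    qed
    then show ?thesis using True by (simp add: hilbert_matrix_def)
  next
    case False
    then have "?S = {0}" by (auto simp: AZ_def)
    then have "vs.dim ?S = 0" using vs.dim_le_card[of ?S "{}"] by simp
    then show ?thesis using False by simp
  qed
  then show ?thesis unfolding N left_ideal_gfree[OF i] d .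
qed

text \<open>All other translates of a stalk complex admit only zero maps, so the Euler characteristic has a
  single term.\<close>

lemma pairing_L:
  assumes i: "i \<in> {1..r}" and j: "j \<in> {1..r}"
  shows "pairing scl (stalk (L i)) (stalk (L j)) = fps_to_fls (hilbert_matrix scl A e i j)"
proof (rule fls_eqI)
  fix n
  let ?X = "stalk (L i)" and ?Y = "stalk (gr_shift (- n) (L j))"
  have Y: "?Y \<in> per A" using per_shift[OF per_L[OF j], of "- n"] by (simp add: shift_stalk)
  note gX = per_good[OF per_L[OF i]] and gY = per_good[OF Y]
  have z: "gdim ?X (translate k ?Y) = 0" if k: "k \<noteq> 0" for k
  proof (rule gdim_zero[OF gX good_translate[OF gY]])
    fix f p v assume f: "f \<in> gmaps ?X (translate k ?Y)" and v: "v \<in> carrier (obj ?X p)"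
    show "f p v = \<zero>\<^bsub>obj (translate k ?Y) p\<^esub>"
    proof (cases "p = 0")
      case True
      then show ?thesis using gmaps_closed[OF f v] k by (simp add: obj_stalk)
    next
      case False
      then have "v = \<zero>\<^bsub>obj ?X p\<^esub>" using v by (simp add: obj_stalk)
      then show ?thesis using hom_zero[OF good_gm[OF gX] good_gm[OF good_translate[OF gY]] gmapsD[OF f]] by (simp only:)
    qed
  qed
  have "euler ?X ?Y = (\<Sum>k\<in>{0}. euler_sign k * int (gdim ?X (translate k ?Y)))"
  proof (rule euler_eq(3)[OF gX gY])
    show "{k. gdim ?X (translate k ?Y) \<noteq> 0} \<subseteq> {0}"
    proof
      fix k assume "k \<in> {k. gdim ?X (translate k ?Y) \<noteq> 0}"
      then have "\<not> gdim ?X (translate k ?Y) = 0" by (rule CollectD)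
      then have "k = 0" by (rule contrapos_np) (rule z)
      then show "k \<in> {0}" by simp
    qed
  qed simp
  also have "\<dots> = int (gdim ?X ?Y)" using translate_0[OF goodD(3)[OF gY]] by (simp add: euler_sign_def)
  finally show "fls_nth (pairing scl ?X (stalk (L j))) n = fls_nth (fps_to_fls (hilbert_matrix scl A e i j)) n"
    using per_L[OF i] per_L[OF j] by (simp add: pairing_nth shift_stalk gdim_stalk[OF i j])
qed

text \<open>Since \<open>A\<^sub>0\<close> is spanned by the orthogonal idempotents, \<open>e\<^sub>iA\<^sub>0e\<^sub>j\<close> is the line of \<open>e\<^sub>i\<close> if \<open>i = j\<close> and
  zero otherwise.\<close>

lemma hilbert_0:
  assumes i: "i \<in> {1..r}" and j: "j \<in> {1..r}"
  shows "fps_nth (hilbert_matrix scl A e i j) 0 = (if i = j then 1 else 0)"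
proof (cases "i = j")
  case True
  have "{e i * a * e j | a. a \<in> A 0} = vs.span {e i}"
  proof (rule equalityI; rule subsetI)
    fix x assume "x \<in> {e i * a * e j | a. a \<in> A 0}"
    then obtain a where a: "a \<in> A 0" "x = e i * a * e j" by blast
    obtain c where "\<forall>i\<in>{1..r}. a * e i = scl (c i) (e i)" using A0_e[OF a(1)] by metis
    then have "x = scl (c i) (e i)" using a i True e_idem[OF i] by (simp add: mult.assoc scl_r[symmetric])
    then show "x \<in> vs.span {e i}" by (simp add: vs.span_scale vs.span_base)
  next
    fix x assume "x \<in> vs.span {e i}"
    then obtain c where c: "x = scl c (e i)" by (auto simp: vs.span_singleton)
    have "x = e i * x * e j" unfolding c using True e_idem[OF i] by (simp add: scl_l[symmetric] scl_r[symmetric])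
    moreover have "x \<in> A 0" unfolding c by (rule vs.subspace_scale[OF subA eA[OF i]])
    ultimately show "x \<in> {e i * a * e j | a. a \<in> A 0}" by blast
  qed
  moreover have "vs.dim {e i} = 1" using vs.dim_eq_card_independent[of "{e i}"] e_nz[OF i] by simp
  ultimately show ?thesis using True by (simp add: hilbert_matrix_def)
next
  case False
  have "{e i * a * e j | a. a \<in> A 0} \<subseteq> {0}"
  proof
    fix x assume "x \<in> {e i * a * e j | a. a \<in> A 0}"
    then obtain a where a: "a \<in> A 0" "x = e i * a * e j" by blast
    obtain c where "\<forall>i\<in>{1..r}. a * e i = scl (c i) (e i)" using A0_e[OF a(1)] by metis
    then show "x \<in> {0}" using a i j False e_orth[OF i j False] by (simp add: mult.assoc scl_r[symmetric])
  qed
  then have "vs.dim {e i * a * e j | a. a \<in> A 0} = 0" using vs.dim_le_card[of "{e i * a * e j | a. a \<in> A 0}" "{}"] by simp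
  then show ?thesis using False by (simp add: hilbert_matrix_def)
qed

section \<open>The basis\<close>

lemma pairing_ext_act_nth:
  assumes "j \<in> {1..r}" "i \<in> {1..r}"
  shows "fls_nth (pairing_ext (cls (stalk (L j))) (act p (cls (stalk (L i))))) n =
    (\<Sum>m\<in>Poly_Mapping.keys p. Poly_Mapping.lookup p m * fls_nth (fps_to_fls (hilbert_matrix scl A e j i)) (n - m))"
proof -
  let ?X = "stalk (L i)"
  have "act p (cls ?X) = (\<Sum>m\<in>Poly_Mapping.keys p. Poly_Mapping.single (cpx_shift m ?X) (Poly_Mapping.lookup p m))"
    by (simp add: act_def bext_def)
  then show ?thesis
    using assms by (simp add: pairing_ext_sum_right pairing_ext_single fls_sum_nth pairing_shift_right per_L pairing_L del: fps_to_fls_nth)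
qed

text \<open>Let \<open>n\<close> be the lowest exponent in the coefficients, occurring in \<open>c j\<close>. Pairing with \<open>[Ae\<^sub>j]\<close>, the
  coefficient of degree \<open>n\<close> involves only the constant term of the Gram matrix, hence equals that of
  \<open>c j\<close>; but the pairing vanishes on relations.\<close>

lemma comb_independent:
  assumes T: "comb c \<in> T" shows "\<forall>i\<in>{1..r}. c i = 0"
proof (rule ccontr)
  assume "\<not> ?thesis"
  then obtain i0 where i0: "i0 \<in> {1..r}" "c i0 \<noteq> 0" by blast
  let ?K = "\<Union>i\<in>{1..r}. Poly_Mapping.keys (c i)"
  have K: "finite ?K" "?K \<noteq> {}" using i0 by auto
  define n where "n = Min ?K"
  have "n \<in> ?K" unfolding n_def by (rule Min_in[OF K])
  then obtain j where j: "j \<in> {1..r}" "n \<in> Poly_Mapping.keys (c j)" by blast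
  have min: "n \<le> m" if "i \<in> {1..r}" "m \<in> Poly_Mapping.keys (c i)" for i m
    unfolding n_def by (rule Min_le[OF K(1)]) (use that in blast)
  let ?h = "\<lambda>i m. fls_nth (fps_to_fls (hilbert_matrix scl A e j i)) (n - m)"
  have h: "?h i m = (if m = n \<and> i = j then 1 else 0)" if "i \<in> {1..r}" "m \<in> Poly_Mapping.keys (c i)" for i m
    using min[OF that] hilbert_0[OF j(1) that(1)] by auto
  have "pairing_ext (cls (stalk (L j))) (comb c) = 0"
    by (rule pairing_ext_relations(2)[OF _ T]) (use per_L[OF j(1)] in simp)
  then have "0 = fls_nth (\<Sum>i\<in>{1..r}. pairing_ext (cls (stalk (L j))) (act (c i) (cls (stalk (L i))))) n"
    by (simp add: pairing_ext_sum_right)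
  also have "\<dots> = (\<Sum>i\<in>{1..r}. \<Sum>m\<in>Poly_Mapping.keys (c i). Poly_Mapping.lookup (c i) m * ?h i m)"
    unfolding fls_sum_nth by (rule sum.cong[OF refl]) (rule pairing_ext_act_nth[OF j(1)])
  also have "\<dots> = (\<Sum>i\<in>{1..r}. if i = j then Poly_Mapping.lookup (c j) n else 0)"
  proof (rule sum.cong[OF refl])
    fix i assume i: "i \<in> {1..r}"
    have "(\<Sum>m\<in>Poly_Mapping.keys (c i). Poly_Mapping.lookup (c i) m * ?h i m) =
        (\<Sum>m\<in>Poly_Mapping.keys (c i). if m = n then (if i = j then Poly_Mapping.lookup (c j) n else 0) else 0)"
      by (rule sum.cong[OF refl]) (simp add: h[OF i] del: fps_to_fls_nth)
    then show "(\<Sum>m\<in>Poly_Mapping.keys (c i). Poly_Mapping.lookup (c i) m * ?h i m) = (if i = j then Poly_Mapping.lookup (c j) n else 0)"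
      using j(2) by (simp del: fps_to_fls_nth)
  qed
  also have "\<dots> = Poly_Mapping.lookup (c j) n" using j(1) by simp
  finally show False using j(2) by (simp add: in_keys_iff)
qed

lemma K0_finsum:
  assumes "finite I" "\<And>i. i \<in> I \<Longrightarrow> g i \<in> carrier (free_per A)"
  shows "(\<Oplus>\<^bsub>K0 A\<^esub>i\<in>I. K0_of A (g i)) = K0_of A (\<Sum>i\<in>I. g i)" "(\<Sum>i\<in>I. g i) \<in> carrier (free_per A)"
proof -
  interpret K: Module.module laurent_ring "K0 A" by (rule K0_module)
  have "(\<Oplus>\<^bsub>K0 A\<^esub>i\<in>I. K0_of A (g i)) = K0_of A (\<Sum>i\<in>I. g i) \<and> (\<Sum>i\<in>I. g i) \<in> carrier (free_per A)"
    using assms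
  proof (induction I rule: finite_induct)
    case empty
    then show ?case by (simp add: K0_zero)
  next
    case (insert k I)
    have gk: "g k \<in> carrier (free_per A)" using insert by simp
    have s: "(\<Sum>i\<in>I. g i) \<in> carrier (free_per A)" and
      eq: "(\<Oplus>\<^bsub>K0 A\<^esub>i\<in>I. K0_of A (g i)) = K0_of A (\<Sum>i\<in>I. g i)" using insert by simp_all
    have c: "K0_of A (g i) \<in> carrier (K0 A)" if "i \<in> insert k I" for i
      unfolding K0_carrier by (rule imageI) (rule insert(4)[OF that])
    have "(\<Oplus>\<^bsub>K0 A\<^esub>i\<in>insert k I. K0_of A (g i)) = K0_of A (g k) \<oplus>\<^bsub>K0 A\<^esub> K0_of A (\<Sum>i\<in>I. g i)"
      unfolding eq[symmetric] by (rule K.finsum_insert[OF insert(1,2)]) (use c in auto)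
    also have "\<dots> = K0_of A (g k + (\<Sum>i\<in>I. g i))" by (rule K0_add[OF gk s])
    finally show ?case using insert(1,2) gk s keys_add_sub[of "g k" "per A" "\<Sum>i\<in>I. g i"] by simp
  qed
  then show "(\<Oplus>\<^bsub>K0 A\<^esub>i\<in>I. K0_of A (g i)) = K0_of A (\<Sum>i\<in>I. g i)" "(\<Sum>i\<in>I. g i) \<in> carrier (free_per A)" by simp_all
qed

lemma K0_combination:
  "(\<Oplus>\<^bsub>K0 A\<^esub>i\<in>{1..r}. c i \<odot>\<^bsub>K0 A\<^esub> K0_class A (stalk (L i))) = K0_of A (comb c)" "comb c \<in> carrier (free_per A)"
proof -
  have g: "act (c i) (cls (stalk (L i))) \<in> carrier (free_per A)" if "i \<in> {1..r}" for i
    using act_closed[of "cls (stalk (L i))" A "c i"] per_L[OF that] by simp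
  have eq: "c i \<odot>\<^bsub>K0 A\<^esub> K0_class A (stalk (L i)) = K0_of A (act (c i) (cls (stalk (L i))))" if "i \<in> {1..r}" for i
    unfolding K0_class_def by (rule K0_smult) (use per_L[OF that] in simp)
  interpret K: Module.module laurent_ring "K0 A" by (rule K0_module)
  have "(\<Oplus>\<^bsub>K0 A\<^esub>i\<in>{1..r}. c i \<odot>\<^bsub>K0 A\<^esub> K0_class A (stalk (L i))) =
      (\<Oplus>\<^bsub>K0 A\<^esub>i\<in>{1..r}. K0_of A (act (c i) (cls (stalk (L i)))))"
  proof (rule K.finsum_cong'[OF refl])
    show "(\<lambda>i. K0_of A (act (c i) (cls (stalk (L i))))) \<in> {1..r} \<rightarrow> carrier (K0 A)"
      unfolding K0_carrier using g by (intro funcsetI imageI)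
  qed (rule eq)
  then show "(\<Oplus>\<^bsub>K0 A\<^esub>i\<in>{1..r}. c i \<odot>\<^bsub>K0 A\<^esub> K0_class A (stalk (L i))) = K0_of A (comb c)" "comb c \<in> carrier (free_per A)"
    using K0_finsum[OF finite_atLeastAtMost g] by simp_all
qed

lemma K0_basis: "basis_on laurent_ring (K0 A) {1..r} (\<lambda>i. K0_class A (stalk (L i)))"
  unfolding basis_on_def
proof (intro conjI ballI)
  show "(\<lambda>i. K0_class A (stalk (L i))) \<in> {1..r} \<rightarrow> carrier (K0 A)"
    unfolding K0_carrier K0_class_def using per_L by (intro funcsetI imageI) simp
  fix v assume "v \<in> carrier (K0 A)"
  then obtain g where g: "g \<in> carrier (free_per A)" "v = K0_of A g" unfolding K0_carrier by (elim imageE)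
  obtain c where c: "g - comb c \<in> T" using spanned_all[of g] g(1) by (auto simp: spanned_def)
  have iff: "v = (\<Oplus>\<^bsub>K0 A\<^esub>i\<in>{1..r}. c' i \<odot>\<^bsub>K0 A\<^esub> K0_class A (stalk (L i))) \<longleftrightarrow> g - comb c' \<in> T" for c'
    unfolding K0_combination(1) g(2) by (rule K0_eq_iff[OF g(1) K0_combination(2)])
  show "\<exists>!c. c \<in> {1..r} \<rightarrow>\<^sub>E carrier laurent_ring \<and> v = (\<Oplus>\<^bsub>K0 A\<^esub>i\<in>{1..r}. c i \<odot>\<^bsub>K0 A\<^esub> K0_class A (stalk (L i)))"
    unfolding iff
  proof (rule ex1I[of _ "restrict c {1..r}"])
    have "comb (restrict c {1..r}) = comb c" by (rule sum.cong) simp_all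
    then show "restrict c {1..r} \<in> {1..r} \<rightarrow>\<^sub>E carrier laurent_ring \<and> g - comb (restrict c {1..r}) \<in> T"
      using c by (simp add: univ_ring_def)
    fix c' assume c': "c' \<in> {1..r} \<rightarrow>\<^sub>E carrier laurent_ring \<and> g - comb c' \<in> T"
    have "comb (\<lambda>i. c i - c' i) = (g - comb c') - (g - comb c)"
      by (simp add: act.bext_diff_left[folded act_def] sum_subtractf)
    then have "comb (\<lambda>i. c i - c' i) \<in> T" using relations_diff[OF c'[THEN conjunct2] c] by (simp only:)
    from comb_independent[OF this] show "c' = restrict c {1..r}"
      using c' by (intro PiE_ext[where k = "{1..r}" and s = "\<lambda>_. UNIV"]) (auto simp: univ_ring_def)
  qed
qed simp

end

theorem lemma6p3:
  fixes scl :: "'k::field \<Rightarrow> 'a \<Rightarrow> 'a::{ring,monoid_mult}"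
    and A :: "nat \<Rightarrow> 'a set" and r :: nat and e :: "nat \<Rightarrow> 'a"
  assumes "elementary_algebra scl A r e"
    and "\<forall>j\<in>{1..r}. FP_infinity A (vertex_simple A (e j))"
    and "\<forall>i\<in>{1..r}. \<forall>j\<in>{1..r}. rational_series (hilbert_matrix scl A e i j)"
  shows
    "(Module.module laurent_ring (K0 A) \<and>
      (\<forall>P\<in>per A. laurent_x \<odot>\<^bsub>K0 A\<^esub> K0_class A P = K0_class A (cpx_shift 1 P)) \<and>
      basis_on laurent_ring (K0 A) {1..r} (\<lambda>i. K0_class A (stalk (left_ideal_gmodule A (e i))))) \<and>
     (\<forall>P\<in>per A. \<forall>Q\<in>per A. pairing_welldefined scl P Q) \<and>
     (\<exists>B. sesquilinear (K0 A) B \<and>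
        (\<forall>P\<in>per A. \<forall>Q\<in>per A. B (K0_class A P) (K0_class A Q) = pairing scl P Q) \<and>
        (\<forall>i\<in>{1..r}. \<forall>j\<in>{1..r}.
           B (K0_class A (stalk (left_ideal_gmodule A (e i))))
             (K0_class A (stalk (left_ideal_gmodule A (e j)))) =
           fps_to_fls (hilbert_matrix scl A e i j)))"
proof -
  interpret galg scl A r e by (rule galg.intro) fact
  have "form (K0_class A (stalk (L i))) (K0_class A (stalk (L j))) = fps_to_fls (hilbert_matrix scl A e i j)"
    if "i \<in> {1..r}" "j \<in> {1..r}" for i j
    unfolding form_class[OF per_L[OF that(1)] per_L[OF that(2)]] by (rule pairing_L[OF that])
  then show ?thesis
    using K0_module K0_x K0_basis pairing_welldefined_per form_sesquilinear form_class by (intro conjI ballI exI[of _ form]) simp_all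
qed

end
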